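(* Let $\mathcal{U}$ be a free ultrafilter on $\mathbb{N}$ and let $\mathcal{Q} = \prod_{n \to \mathcal{U}} M_n(\mathbb{C})$. Let $\mathcal{A}$ be a separable tracial $\mathrm{W}^*$-algebra. Suppose that any two embeddings $\mathcal{A} \to \mathcal{Q}$ are conjugate by an automorphism of $\mathcal{Q}$. Then $h^{\mathcal{U}}(\mathcal{A}) \leq 0$.
   Context: **Basics.** A tracial $\mathrm{W}^*$-algebra $\mathcal{M}=(M,\tau)$ is a $\mathrm{W}^*$-algebra with a faithful normal tracial state; $L^\infty(\mathcal{M}):=M$, $\|x\|_2=\tau(x^*x)^{1/2}$, and $D_r^{\mathcal{M}}$ is the closed operator-norm ball of radius $r$. $M_n(\mathbb{C})$ carries the normalized trace. An embedding is a unital trace-preserving $*$-homomorphism; $\mathrm{W}^*(\mathbf{X})$ is the $\mathrm{W}^*$-subalgebra generated by $\mathbf{X}$. $\prod_{n\to\mathcal{U}}M_n(\mathbb{C})$ is the tracial ultraproduct. Two embeddings $\alpha,\beta:\mathcal{A}\to\mathcal{Q}$ are conjugate by an automorphism $\theta$ of $\mathcal{Q}$ if $\beta=\theta\circ\alpha$. Separable means separable in $\|\cdot\|_2$. Convention: $\log 0=-\infty$. **Orbital covering numbers.** For an index set $I$, $\Omega\subseteq M_n(\mathbb{C})^I$, finite $F\subseteq I$ and $\epsilon>0$, $K^{\mathrm{orb}}_{F,\epsilon}(\Omega)$ is the minimal cardinality of a set $\Omega'\subseteq M_n(\mathbb{C})^I$ such that for every $\mathbf{Y}\in\Omega$ there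 are a unitary $U\in M_n(\mathbb{C})$ and $\mathbf{X}\in\Omega'$ with $\|Y_i-UX_iU^*\|_2<\epsilon$ for all $i\in F$. **$1$-bounded entropy (Hayes).** Let $\mathbf{X}\in L^\infty(\mathcal{M})^I$, $\mathbf{Y}\in L^\infty(\mathcal{M})^J$ ($I,J$ arbitrary index sets), $\mathbf{r}\in(0,\infty)^I$, $\mathbf{r}'\in(0,\infty)^J$ with $\|X_i\|\le r_i$, $\|Y_j\|\le r_j'$. The non-commutative law of a tuple is the map $p\mapsto\tau(p(\text{tuple}))$ on non-commutative $*$-polynomials. Let $\Sigma_{\mathbf{r},\mathbf{r}'}$ be the set of laws of tuples in $\prod_{i\in I} D_{r_i}\times\prod_{j\in J} D_{r_j'}$ of tracial $\mathrm{W}^*$-algebras, with the topology of pointwise convergence on $*$-polynomials. For $\mathcal{O}\subseteq\Sigma_{\mathbf{r},\mathbf{r}'}$ let $\Gamma^{(n)}_{\mathbf{r},\mathbf{r}'}(\mathcal{O})$ be the set of tuples in $\prod_i D_{r_i}^{M_n(\mathbb{C})}\times\prod_j D_{r_j'}^{M_n(\mathbb{C})}$ whose law lies in $\mathcal{O}$, and let $p$ be the projection onto the $I$-coordinates. Put $$h^{\mathcal{U}}_{\mathbf{r},\mathbf{r}'}(\mathbf{X}:\mathbf{Y})=\sup_{\epsilon>0}\ \sup_{F\subseteq I\text{ finite}}\ \inf_{\mathcal{O}}\ \lim_{n\to\mathcal{U}}\frac1{n^2}\log K^{\mathrm{orb}}_{F,\epsilon}\big(p[\Gamma^{(n)}_{\mathbf{r},\mathbf{r}'}(\mathcal{O})]\big),$$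 with $\mathcal{O}$ ranging over neighborhoods of the law of $(\mathbf{X},\mathbf{Y})$. For $\mathcal{N}\subseteq\mathcal{M}$, $h^{\mathcal{U}}(\mathcal{N}:\mathcal{M}):=h^{\mathcal{U}}_{\mathbf{r},\mathbf{r}'}(\mathbf{X}:\mathbf{Y})$ for any $\mathbf{X},\mathbf{Y}$ with $\mathrm{W}^*(\mathbf{X})=\mathcal{N}$, $\mathrm{W}^*(\mathbf{X},\mathbf{Y})=\mathcal{M}$ (the value does not depend on the choices). $h^{\mathcal{U}}(\mathcal{M}):=h^{\mathcal{U}}(\mathcal{M}:\mathcal{M})$. *)

theory Defs
  imports
    "HOL-Analysis.Analysis"
    "HOL-Library.Extended_Nat"
    "HOL-Library.Poly_Mapping"
    "HOL-Algebra.Module"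
    "HOL-Algebra.QuotRing"
    "Jordan_Normal_Form.Schur_Decomposition"
begin

section \<open>W*-algebras\<close>

record 'a cstar_alg = "(complex, 'a) module" +
  star :: "'a \<Rightarrow> 'a"
  nrm :: "'a \<Rightarrow> real"

record 'a tracial_alg = "'a cstar_alg" +
  tr :: "'a \<Rightarrow> complex"

definition complex_ring :: "complex ring" where
  "complex_ring = \<lparr>carrier = UNIV, mult = (*), one = 1, zero = 0, add = (+)\<rparr>"

definition cstar_algebra :: "('a, 'm) cstar_alg_scheme \<Rightarrow> bool" where
  "cstar_algebra M \<longleftrightarrow>
     Ring.ring M \<and> Module.module complex_ring M \<and>
     (\<forall>c. \<forall>x\<in>carrier M. \<forall>y\<in>carrier M.
        c \<odot>\<^bsub>M\<^esub> (x \<otimes>\<^bsub>M\<^esub> y) = (c \<odot>\<^bsub>M\<^esub> x) \<otimes>\<^bsub>M\<^esub> y \<and>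
        c \<odot>\<^bsub>M\<^esub> (x \<otimes>\<^bsub>M\<^esub> y) = x \<otimes>\<^bsub>M\<^esub> (c \<odot>\<^bsub>M\<^esub> y)) \<and>
     (\<forall>x\<in>carrier M. star M x \<in> carrier M \<and> star M (star M x) = x) \<and>
     (\<forall>x\<in>carrier M. \<forall>y\<in>carrier M.
        star M (x \<oplus>\<^bsub>M\<^esub> y) = star M x \<oplus>\<^bsub>M\<^esub> star M y \<and>
        star M (x \<otimes>\<^bsub>M\<^esub> y) = star M y \<otimes>\<^bsub>M\<^esub> star M x) \<and>
     (\<forall>c. \<forall>x\<in>carrier M. star M (c \<odot>\<^bsub>M\<^esub> x) = cnj c \<odot>\<^bsub>M\<^esub> star M x) \<and>
     (\<forall>x\<in>carrier M. 0 \<le> nrm M x \<and> (nrm M x = 0 \<longleftrightarrow> x = \<zero>\<^bsub>M\<^esub>)) \<and>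
     (\<forall>c. \<forall>x\<in>carrier M. nrm M (c \<odot>\<^bsub>M\<^esub> x) = cmod c * nrm M x) \<and>
     (\<forall>x\<in>carrier M. \<forall>y\<in>carrier M.
        nrm M (x \<oplus>\<^bsub>M\<^esub> y) \<le> nrm M x + nrm M y \<and>
        nrm M (x \<otimes>\<^bsub>M\<^esub> y) \<le> nrm M x * nrm M y) \<and>
     (\<forall>x\<in>carrier M. nrm M (star M x \<otimes>\<^bsub>M\<^esub> x) = (nrm M x)\<^sup>2) \<and>
     (\<forall>s :: nat \<Rightarrow> 'a. (\<forall>k. s k \<in> carrier M) \<longrightarrow>
        (\<forall>e>0. \<exists>N. \<forall>k\<ge>N. \<forall>l\<ge>N. nrm M (s k \<ominus>\<^bsub>M\<^esub> s l) < e) \<longrightarrow>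
        (\<exists>x\<in>carrier M. (\<lambda>k. nrm M (s k \<ominus>\<^bsub>M\<^esub> x)) \<longlonglongrightarrow> 0))"

text \<open>The Banach space dual; functionals are normalized to be \<^const>\<open>undefined\<close>
  off the carrier, so that they are determined by their values on it.\<close>

definition bdd_functionals :: "('a, 'm) cstar_alg_scheme \<Rightarrow> ('a \<Rightarrow> complex) set" where
  "bdd_functionals M = {\<phi> \<in> extensional (carrier M).
     (\<forall>x\<in>carrier M. \<forall>y\<in>carrier M. \<phi> (x \<oplus>\<^bsub>M\<^esub> y) = \<phi> x + \<phi> y) \<and>
     (\<forall>c. \<forall>x\<in>carrier M. \<phi> (c \<odot>\<^bsub>M\<^esub> x) = c * \<phi> x) \<and>
     (\<exists>C. \<forall>x\<in>carrier M. cmod (\<phi> x) \<le> C * nrm M x)}"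

definition functional_norm :: "('a, 'm) cstar_alg_scheme \<Rightarrow> ('a \<Rightarrow> complex) \<Rightarrow> real" where
  "functional_norm M \<phi> = (SUP x\<in>{x \<in> carrier M. nrm M x \<le> 1}. cmod (\<phi> x))"

text \<open>Sakai's definition: a W*-algebra is a C*-algebra which is isometrically the dual of a
  Banach space. Any such Banach space embeds isometrically into the dual of \<open>M\<close>, so it is
  taken to be a norm-closed subspace \<open>P\<close> of that dual for which the canonical
  map from \<open>M\<close> to the dual of \<open>P\<close> is isometric (condition on \<^const>\<open>nrm\<close>) and onto
  (last condition).\<close>

definition is_predual :: "('a, 'm) cstar_alg_scheme \<Rightarrow> ('a \<Rightarrow> complex) set \<Rightarrow> bool" where
  "is_predual M P \<longleftrightarrow>
     P \<subseteq> bdd_functionals M \<and>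
     (\<lambda>x\<in>carrier M. 0) \<in> P \<and>
     (\<forall>\<phi>\<in>P. \<forall>\<psi>\<in>P. (\<lambda>x\<in>carrier M. \<phi> x + \<psi> x) \<in> P) \<and>
     (\<forall>c. \<forall>\<phi>\<in>P. (\<lambda>x\<in>carrier M. c * \<phi> x) \<in> P) \<and>
     (\<forall>\<phi>\<in>bdd_functionals M.
        (\<forall>e>0. \<exists>\<psi>\<in>P. functional_norm M (\<lambda>x\<in>carrier M. \<phi> x - \<psi> x) < e) \<longrightarrow> \<phi> \<in> P) \<and>
     (\<forall>x\<in>carrier M. nrm M x = (SUP \<phi>\<in>{\<phi> \<in> P. functional_norm M \<phi> \<le> 1}. cmod (\<phi> x))) \<and>
     (\<forall>\<Lambda> :: ('a \<Rightarrow> complex) \<Rightarrow> complex.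
        (\<forall>\<phi>\<in>P. \<forall>\<psi>\<in>P. \<Lambda> (\<lambda>x\<in>carrier M. \<phi> x + \<psi> x) = \<Lambda> \<phi> + \<Lambda> \<psi>) \<and>
        (\<forall>c. \<forall>\<phi>\<in>P. \<Lambda> (\<lambda>x\<in>carrier M. c * \<phi> x) = c * \<Lambda> \<phi>) \<and>
        (\<exists>C. \<forall>\<phi>\<in>P. cmod (\<Lambda> \<phi>) \<le> C * functional_norm M \<phi>) \<longrightarrow>
        (\<exists>x\<in>carrier M. \<forall>\<phi>\<in>P. \<Lambda> \<phi> = \<phi> x))"

definition wstar_algebra :: "('a, 'm) cstar_alg_scheme \<Rightarrow> bool" where
  "wstar_algebra M \<longleftrightarrow> cstar_algebra M \<and> (\<exists>P. is_predual M P)"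

text \<open>The predual is unique (Sakai), so the union below has only one member.\<close>

definition normal_functionals :: "('a, 'm) cstar_alg_scheme \<Rightarrow> ('a \<Rightarrow> complex) set" where
  "normal_functionals M = \<Union>{P. is_predual M P}"

definition tracial_wstar :: "('a, 'm) tracial_alg_scheme \<Rightarrow> bool" where
  "tracial_wstar M \<longleftrightarrow>
     wstar_algebra M \<and>
     restrict (tr M) (carrier M) \<in> normal_functionals M \<and>
     tr M \<one>\<^bsub>M\<^esub> = 1 \<and>
     (\<forall>x\<in>carrier M. 0 \<le> Re (tr M (star M x \<otimes>\<^bsub>M\<^esub> x)) \<and> Im (tr M (star M x \<otimes>\<^bsub>M\<^esub> x)) = 0) \<and>
     (\<forall>x\<in>carrier M. tr M (star M x \<otimes>\<^bsub>M\<^esub> x) = 0 \<longrightarrow> x = \<zero>\<^bsub>M\<^esub>) \<and>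
     (\<forall>x\<in>carrier M. \<forall>y\<in>carrier M. tr M (x \<otimes>\<^bsub>M\<^esub> y) = tr M (y \<otimes>\<^bsub>M\<^esub> x))"

definition norm2 :: "('a, 'm) tracial_alg_scheme \<Rightarrow> 'a \<Rightarrow> real" where
  "norm2 M x = sqrt (Re (tr M (star M x \<otimes>\<^bsub>M\<^esub> x)))"

definition separable_tracial :: "('a, 'm) tracial_alg_scheme \<Rightarrow> bool" where
  "separable_tracial M \<longleftrightarrow>
     (\<exists>D. countable D \<and> D \<subseteq> carrier M \<and>
        (\<forall>x\<in>carrier M. \<forall>e>0. \<exists>d\<in>D. norm2 M (x \<ominus>\<^bsub>M\<^esub> d) < e))"

definition weak_star_topology :: "('a, 'm) cstar_alg_scheme \<Rightarrow> 'a topology" where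
  "weak_star_topology M = topology_generated_by
     {{x \<in> carrier M. \<phi> x \<in> V} | \<phi> V. \<phi> \<in> normal_functionals M \<and> open V}"

definition wstar_subalgebra :: "('a, 'm) cstar_alg_scheme \<Rightarrow> 'a set \<Rightarrow> bool" where
  "wstar_subalgebra M N \<longleftrightarrow>
     N \<subseteq> carrier M \<and> \<one>\<^bsub>M\<^esub> \<in> N \<and>
     (\<forall>x\<in>N. \<forall>y\<in>N. x \<oplus>\<^bsub>M\<^esub> y \<in> N \<and> x \<otimes>\<^bsub>M\<^esub> y \<in> N) \<and>
     (\<forall>c. \<forall>x\<in>N. c \<odot>\<^bsub>M\<^esub> x \<in> N) \<and>
     (\<forall>x\<in>N. star M x \<in> N) \<and>
     closedin (weak_star_topology M) N"

definition wstar_generated :: "('a, 'm) cstar_alg_scheme \<Rightarrow> 'a set \<Rightarrow> 'a set" where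
  "wstar_generated M S = \<Inter>{N. wstar_subalgebra M N \<and> S \<subseteq> N}"

definition embedding ::
  "('a, 'm) tracial_alg_scheme \<Rightarrow> ('b, 'n) tracial_alg_scheme \<Rightarrow> ('a \<Rightarrow> 'b) \<Rightarrow> bool" where
  "embedding M N \<alpha> \<longleftrightarrow>
     \<alpha> \<in> Ring.ring_hom M N \<and>
     (\<forall>c. \<forall>x\<in>carrier M. \<alpha> (c \<odot>\<^bsub>M\<^esub> x) = c \<odot>\<^bsub>N\<^esub> \<alpha> x) \<and>
     (\<forall>x\<in>carrier M. \<alpha> (star M x) = star N (\<alpha> x)) \<and>
     (\<forall>x\<in>carrier M. tr N (\<alpha> x) = tr M x)"

text \<open>Automorphisms of the pair (algebra, trace).\<close>

definition automorphism :: "('a, 'm) tracial_alg_scheme \<Rightarrow> ('a \<Rightarrow> 'a) \<Rightarrow> bool" where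
  "automorphism M \<theta> \<longleftrightarrow> embedding M M \<theta> \<and> bij_betw \<theta> (carrier M) (carrier M)"

definition conjugate_embeddings ::
  "('a, 'm) tracial_alg_scheme \<Rightarrow> ('b, 'n) tracial_alg_scheme \<Rightarrow>
   ('a \<Rightarrow> 'b) \<Rightarrow> ('a \<Rightarrow> 'b) \<Rightarrow> bool" where
  "conjugate_embeddings M Q \<alpha> \<beta> \<longleftrightarrow>
     (\<exists>\<theta>. automorphism Q \<theta> \<and> (\<forall>x\<in>carrier M. \<beta> x = \<theta> (\<alpha> x)))"

section \<open>Matrix algebras\<close>

definition vec_norm2 :: "complex vec \<Rightarrow> real" where
  "vec_norm2 v = sqrt (Re (v \<bullet>c v))"

definition operator_norm :: "complex mat \<Rightarrow> real" where
  "operator_norm A =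
     (SUP v\<in>{v \<in> carrier_vec (dim_col A). vec_norm2 v \<le> 1}. vec_norm2 (A *\<^sub>v v))"

definition mat_alg :: "nat \<Rightarrow> complex mat tracial_alg" where
  "mat_alg n = \<lparr>carrier = carrier_mat n n, mult = (*), one = 1\<^sub>m n, zero = 0\<^sub>m n n, add = (+),
     smult = (\<cdot>\<^sub>m), star = mat_adjoint, nrm = operator_norm,
     tr = (\<lambda>A. (\<Sum>i<n. A $$ (i, i)) / of_nat n)\<rparr>"

definition unitary_mat :: "nat \<Rightarrow> complex mat \<Rightarrow> bool" where
  "unitary_mat n V \<longleftrightarrow>
     V \<in> carrier_mat n n \<and> V * mat_adjoint V = 1\<^sub>m n \<and> mat_adjoint V * V = 1\<^sub>m n"

section \<open>Tracial ultraproducts\<close>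

text \<open>An ultrafilter on the natural numbers is represented as a library filter;
  the set \<open>{n. P n}\<close> belongs to it iff \<open>eventually P U\<close>.\<close>

definition free_ultrafilter :: "nat filter \<Rightarrow> bool" where
  "free_ultrafilter U \<longleftrightarrow>
     U \<noteq> bot \<and>
     (\<forall>P. eventually P U \<or> eventually (\<lambda>n. \<not> P n) U) \<and>
     (\<forall>k. eventually (\<lambda>n. n \<noteq> k) U)"

definition bdd_sequences :: "(nat \<Rightarrow> 'a tracial_alg) \<Rightarrow> (nat \<Rightarrow> 'a) ring" where
  "bdd_sequences M = \<lparr>
     carrier = {x. (\<forall>n. x n \<in> carrier (M n)) \<and> bdd_above (range (\<lambda>n. nrm (M n) (x n)))},
     mult = (\<lambda>x y n. x n \<otimes>\<^bsub>M n\<^esub> y n),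
     one = (\<lambda>n. \<one>\<^bsub>M n\<^esub>),
     zero = (\<lambda>n. \<zero>\<^bsub>M n\<^esub>),
     add = (\<lambda>x y n. x n \<oplus>\<^bsub>M n\<^esub> y n)\<rparr>"

definition null_sequences :: "nat filter \<Rightarrow> (nat \<Rightarrow> 'a tracial_alg) \<Rightarrow> (nat \<Rightarrow> 'a) set" where
  "null_sequences U M =
     {x \<in> carrier (bdd_sequences M). ((\<lambda>n. norm2 (M n) (x n)) \<longlongrightarrow> 0) U}"

text \<open>The ring structure is that of the library quotient ring, whose elements are cosets;
  scalar multiplication and involution are defined on cosets in the same way as the
  multiplication of \<^const>\<open>FactRing\<close>, and the norm is the quotient norm.\<close>

definition ultraproduct ::
  "nat filter \<Rightarrow> (nat \<Rightarrow> 'a tracial_alg) \<Rightarrow> (nat \<Rightarrow> 'a) set tracial_alg" where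
  "ultraproduct U M =
     (let B = bdd_sequences M; I = null_sequences U M; Q = B Quot I in
      \<lparr>carrier = carrier Q, mult = mult Q, one = one Q, zero = zero Q, add = add Q,
       smult = (\<lambda>c A. \<Union>x\<in>A. I +>\<^bsub>B\<^esub> (\<lambda>n. c \<odot>\<^bsub>M n\<^esub> x n)),
       star = (\<lambda>A. \<Union>x\<in>A. I +>\<^bsub>B\<^esub> (\<lambda>n. star (M n) (x n))),
       nrm = (\<lambda>A. INF x\<in>A. SUP n. nrm (M n) (x n)),
       tr = (\<lambda>A. THE t. \<forall>x\<in>A. ((\<lambda>n. tr (M n) (x n)) \<longlongrightarrow> t) U)\<rparr>)"

text \<open>The index 0 is harmless: a free ultrafilter ignores every single coordinate.\<close>

abbreviation matrix_ultraproduct ::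
  "nat filter \<Rightarrow> (nat \<Rightarrow> complex mat) set tracial_alg" where
  "matrix_ultraproduct U \<equiv> ultraproduct U mat_alg"

section \<open>Non-commutative laws\<close>

text \<open>A word is a list of letters; \<open>(k, False)\<close> stands for the variable with index \<open>k\<close>,
  \<open>(k, True)\<close> for its adjoint. A non-commutative *-polynomial is a finitely supported
  family of coefficients indexed by words.\<close>

type_synonym 'k ncpoly = "('k \<times> bool) list \<Rightarrow>\<^sub>0 complex"

definition ncpolys :: "'k set \<Rightarrow> 'k ncpoly set" where
  "ncpolys K = {p. \<forall>w\<in>Poly_Mapping.keys p. fst ` set w \<subseteq> K}"

definition eval_word :: "('a, 'm) cstar_alg_scheme \<Rightarrow> ('k \<Rightarrow> 'a) \<Rightarrow> ('k \<times> bool) list \<Rightarrow> 'a" where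
  "eval_word M Z w =
     foldr (\<lambda>(k, s) a. (if s then star M (Z k) else Z k) \<otimes>\<^bsub>M\<^esub> a) w \<one>\<^bsub>M\<^esub>"

definition eval_poly :: "('a, 'm) cstar_alg_scheme \<Rightarrow> ('k \<Rightarrow> 'a) \<Rightarrow> 'k ncpoly \<Rightarrow> 'a" where
  "eval_poly M Z p =
     (\<Oplus>\<^bsub>M\<^esub>w\<in>Poly_Mapping.keys p. Poly_Mapping.lookup p w \<odot>\<^bsub>M\<^esub> eval_word M Z w)"

definition nc_law ::
  "('a, 'm) tracial_alg_scheme \<Rightarrow> 'k set \<Rightarrow> ('k \<Rightarrow> 'a) \<Rightarrow> ('k ncpoly \<Rightarrow> complex)" where
  "nc_law M K Z = (\<lambda>p\<in>ncpolys K. tr M (eval_poly M Z p))"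

definition law_topology :: "'k set \<Rightarrow> ('k ncpoly \<Rightarrow> complex) topology" where
  "law_topology K = product_topology (\<lambda>_. euclidean) (ncpolys K)"

text \<open>Neighbourhoods of a law are taken in the space of all complex functions on the
  *-polynomials, with pointwise convergence. The set of laws of tuples subject to given norm
  bounds, ranging over all tracial W*-algebras, carries the subspace topology, and
  neighbourhoods \<open>\<O>\<close> are used below only through the sets \<open>microstates n K R \<O>\<close>, which test
  membership in \<open>\<O>\<close> for laws of matrix tuples subject to those bounds. So intersecting \<open>\<O>\<close> with
  the set of laws changes nothing, and no type accommodating all tracial W*-algebras is
  needed.\<close>

definition law_neighbourhoods ::
  "'k set \<Rightarrow> ('k ncpoly \<Rightarrow> complex) \<Rightarrow> ('k ncpoly \<Rightarrow> complex) set set" where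
  "law_neighbourhoods K \<mu> =
     {\<O>. \<O> \<subseteq> topspace (law_topology K) \<and>
        (\<exists>V. openin (law_topology K) V \<and> \<mu> \<in> V \<and> V \<subseteq> \<O>)}"

section \<open>1-bounded entropy\<close>

definition microstates ::
  "nat \<Rightarrow> 'k set \<Rightarrow> ('k \<Rightarrow> real) \<Rightarrow> ('k ncpoly \<Rightarrow> complex) set \<Rightarrow> ('k \<Rightarrow> complex mat) set" where
  "microstates n K R \<O> =
     {Z \<in> (\<Pi>\<^sub>E k\<in>K. {A \<in> carrier_mat n n. operator_norm A \<le> R k}).
        nc_law (mat_alg n) K Z \<in> \<O>}"

definition orbital_cover ::
  "nat \<Rightarrow> 'i set \<Rightarrow> real \<Rightarrow> ('i \<Rightarrow> complex mat) set \<Rightarrow> ('i \<Rightarrow> complex mat) set \<Rightarrow> bool" where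
  "orbital_cover n F \<epsilon> \<Omega> \<Omega>' \<longleftrightarrow>
     (\<forall>Y\<in>\<Omega>. \<exists>V. unitary_mat n V \<and>
        (\<exists>X\<in>\<Omega>'. \<forall>i\<in>F. norm2 (mat_alg n) (Y i - V * X i * mat_adjoint V) < \<epsilon>))"

text \<open>The value is \<open>\<infinity>\<close> if there is no finite cover.\<close>

definition orbital_covering_number ::
  "nat \<Rightarrow> 'i set \<Rightarrow> 'i set \<Rightarrow> real \<Rightarrow> ('i \<Rightarrow> complex mat) set \<Rightarrow> enat" where
  "orbital_covering_number n I F \<epsilon> \<Omega> =
     (INF \<Omega>' \<in> {\<Omega>'. \<Omega>' \<subseteq> (\<Pi>\<^sub>E i\<in>I. carrier_mat n n) \<and> finite \<Omega>' \<and> orbital_cover n F \<epsilon> \<Omega> \<Omega>'}.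
        enat (card \<Omega>'))"

definition log_enat :: "enat \<Rightarrow> ereal" where
  "log_enat k = (case k of enat m \<Rightarrow> if m = 0 then - \<infinity> else ereal (ln (real m)) | \<infinity> \<Rightarrow> \<infinity>)"

text \<open>The tuple \<open>(X, Y)\<close> is indexed by the disjoint union of the index sets of \<open>X\<close> and \<open>Y\<close>.\<close>

definition one_bounded_entropy ::
  "nat filter \<Rightarrow> ('a, 'm) tracial_alg_scheme \<Rightarrow>
   'i set \<Rightarrow> ('i \<Rightarrow> 'a) \<Rightarrow> ('i \<Rightarrow> real) \<Rightarrow> 'j set \<Rightarrow> ('j \<Rightarrow> 'a) \<Rightarrow> ('j \<Rightarrow> real) \<Rightarrow> ereal" where
  "one_bounded_entropy U M I X r J Y r' =
     (SUP \<epsilon>\<in>{0<..}. SUP F\<in>{F. finite F \<and> F \<subseteq> I}.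
      INF \<O>\<in>law_neighbourhoods (I <+> J) (nc_law M (I <+> J) (case_sum X Y)).
        Lim U (\<lambda>n. ereal (1 / (real n)\<^sup>2) *
          log_enat (orbital_covering_number n I F \<epsilon>
            ((\<lambda>Z. \<lambda>i\<in>I. Z (Inl i)) ` microstates n (I <+> J) (case_sum r r') \<O>))))"

definition bounded_tuple ::
  "('a, 'm) cstar_alg_scheme \<Rightarrow> 'i set \<Rightarrow> ('i \<Rightarrow> 'a) \<Rightarrow> ('i \<Rightarrow> real) \<Rightarrow> bool" where
  "bounded_tuple M I X r \<longleftrightarrow> (\<forall>i\<in>I. X i \<in> carrier M \<and> 0 < r i \<and> nrm M (X i) \<le> r i)"

text \<open>The tuples and radii that may be used to compute the entropy of \<open>N\<close> in the presence of
  \<open>M\<close>; the value of \<^const>\<open>one_bounded_entropy\<close> is the same for all of them.\<close>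

definition generating_tuples ::
  "('a, 'm) cstar_alg_scheme \<Rightarrow> 'a set \<Rightarrow>
   'i set \<Rightarrow> ('i \<Rightarrow> 'a) \<Rightarrow> ('i \<Rightarrow> real) \<Rightarrow> 'j set \<Rightarrow> ('j \<Rightarrow> 'a) \<Rightarrow> ('j \<Rightarrow> real) \<Rightarrow> bool" where
  "generating_tuples M N I X r J Y r' \<longleftrightarrow>
     bounded_tuple M I X r \<and> bounded_tuple M J Y r' \<and>
     wstar_generated M (X ` I) = N \<and>
     wstar_generated M (X ` I \<union> Y ` J) = carrier M"

end

(* If the orbital covering numbers of the microstates of A grew like exp (delta n^2), then
   microstates whose entries, in some common eigenbasis, are concentrated on a small proportion of
   the n^2 positions could not exhaust them: such sparse tuples are covered by few orbits. So
   non-sparse microstates Z exist near the law of A, and their limit along U is an embedding of A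
   into Q. Another embedding is the limit of block-diagonal amplifications of microstates; it
   commutes with a self-adjoint operator T of Q whose spectral measure is uniform on k points. Both
   embeddings being conjugate, Z almost commutes with matrices S having nearly the spectrum of T.
   In an eigenbasis of S, Z is then concentrated on the entries joining nearly equal eigenvalues,
   which are a proportion 1/k of all, so that Z is sparse: a contradiction.

   To turn microstates into an embedding defined on all of A, elements are approximated by
   *-polynomials in the generators; their density in the 2-norm (for an abstract W*-algebra, and
   without the bicommutant theorem) and the truncation of self-adjoint matrices replace the
   Kaplansky density theorem. *)

theory Submission
  imports Defs
begin

text \<open>The conjugating automorphism of the ultraproduct is arbitrary: it need not come from
  unitaries acting in each coordinate, so nothing about individual matrices can be carried along it.
  Only what it visibly preserves is used, namely products, adjoints and the trace. Hence the
  operator T enters through its moments and its commutation relations, and pairs of eigenvalues are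
  counted by a polynomial test function instead of spectral projections. The eigenbasis in which a
  microstate is sparse depends on the microstate, and orbital covering numbers forgive exactly this
  choice.

  On the side of A the obstacle is that a predual yields weak* limits of bounded sequences which
  respect sums and norms, while their behaviour under products is unknown. Products are recovered
  from inequalities that survive in the limit: contractivity gives a Kadison type inequality for the
  trace, and its first variation shows that pairings with a fixed element pass to the limit. For
  density, best approximations of an element are not bounded in operator norm; their resolvents are,
  and the limit is taken of those.\<close>

section \<open>Traces on *-rings\<close>

text \<open>\<open>nr\<close> is a C*-seminorm and \<open>t\<close> a bounded positive trace, with
  neither faithfulness nor completeness. Thus the ring may consist of formal *-polynomials, with
  \<open>nr\<close> and \<open>t\<close> pulled back along an evaluation into an algebra that is
  given by a carrier. Scalars are central ring elements \<open>sc a\<close>, so that all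
  computations take place in a single ring type.\<close>

locale tracial_star_ring =
  fixes sc :: "complex \<Rightarrow> 'f::ring_1" and st :: "'f \<Rightarrow> 'f"
    and nr :: "'f \<Rightarrow> real" and t :: "'f \<Rightarrow> complex"
  assumes sc_add: "sc (a + b) = sc a + sc b"
    and sc_mult: "sc (a * b) = sc a * sc b"
    and sc_1: "sc 1 = 1"
    and sc_comm: "f * sc a = sc a * f"
    and st_add: "st (f + g) = st f + st g"
    and st_mult: "st (f * g) = st g * st f"
    and st_st: "st (st f) = f"
    and st_sc: "st (sc a) = sc (cnj a)"
    and nr_nonneg: "0 \<le> nr f"
    and nr_add: "nr (f + g) \<le> nr f + nr g"
    and nr_mult: "nr (f * g) \<le> nr f * nr g"
    and nr_sc: "nr (sc a * f) = cmod a * nr f"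
    and nr_cstar: "nr (st f * f) = (nr f)\<^sup>2"
    and t_add: "t (f + g) = t f + t g"
    and t_sc: "t (sc a * f) = a * t f"
    and t_comm: "t (f * g) = t (g * f)"
    and t_pos: "0 \<le> Re (t (st f * f))"
    and t_real: "Im (t (st f * f)) = 0"
    and t_bdd: "\<exists>C. \<forall>f. cmod (t f) \<le> C * nr f"
begin

definition n2 :: "'f \<Rightarrow> real" where "n2 f = sqrt (Re (t (st f * f)))"

lemma sc_0 [simp]: "sc 0 = 0"
  using sc_add[of 0 0] by simp

lemma sc_left: "f * (sc a * g) = sc a * (f * g)"
  by (metis mult.assoc sc_comm)

lemma sc_minus: "sc (- a) = - sc a"
  using sc_add[of a "- a"] by (simp add: eq_neg_iff_add_eq_0 add.commute)

lemma sc_minus1: "sc (- 1) = - 1"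
  by (simp add: sc_minus sc_1)

lemma st_0 [simp]: "st 0 = 0"
  using st_add[of 0 0] by simp

lemma st_1 [simp]: "st 1 = 1"
  using st_sc[of 1] by (simp add: sc_1)

lemma st_minus: "st (- f) = - st f"
  using st_add[of f "- f"] by (simp add: eq_neg_iff_add_eq_0 add.commute)

lemma st_diff: "st (f - g) = st f - st g"
  using st_add[of f "- g"] by (simp add: st_minus)

lemma st_scm: "st (sc a * f) = sc (cnj a) * st f"
  by (simp add: st_mult st_sc sc_comm)

lemma st_power: "st (f ^ n) = st f ^ n"
  by (induction n) (simp_all add: st_mult power_commutes)

lemma nr_0 [simp]: "nr 0 = 0"
  using nr_sc[of 0 0] by simp

lemma nr_minus [simp]: "nr (- f) = nr f"
  using nr_sc[of "- 1" f] by (simp add: sc_minus1)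

lemma nr_diff: "nr (f - g) \<le> nr f + nr g"
  using nr_add[of f "- g"] by simp

lemma nr_diff_commute: "nr (f - g) = nr (g - f)"
  using nr_minus[of "f - g"] by simp

lemma nr_1: "nr 1 \<le> 1"
  using nr_cstar[of 1] nr_nonneg[of 1] by (simp add: power2_eq_square) (smt (verit) mult_cancel_right1)

lemma nr_st [simp]: "nr (st f) = nr f"
proof -
  have "nr g \<le> nr (st g)" for g
  proof (cases "nr g = 0")
    case False
    have "(nr g)\<^sup>2 \<le> nr (st g) * nr g"
      using nr_mult[of "st g" g] by (simp add: nr_cstar)
    with False nr_nonneg[of g] show ?thesis by (simp add: power2_eq_square)
  qed (simp add: nr_nonneg)
  from this[of f] this[of "st f"] show ?thesis by (simp add: st_st)
qed

lemma nr_power: "nr (f ^ n) \<le> nr f ^ n"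
proof (induction n)
  case (Suc n)
  then show ?case using nr_mult[of f "f ^ n"] mult_left_mono[OF Suc nr_nonneg[of f]] by simp
qed (simp add: nr_1)

lemma t_0 [simp]: "t 0 = 0"
  using t_add[of 0 0] by simp

lemma t_minus: "t (- f) = - t f"
  using t_sc[of "- 1" f] by (simp add: sc_minus1)

lemma t_diff: "t (f - g) = t f - t g"
  using t_add[of f "- g"] by (simp add: t_minus)

text \<open>Polarisation: the number \<open>t (st (f + sc a) * (f + sc a))\<close> is real, hence so
  is its part \<open>a * t (st f) + cnj a * t f\<close>; the cases \<open>a = 1\<close> and
  \<open>a = \<i>\<close> compare imaginary and real parts.\<close>

lemma t_st: "t (st f) = cnj (t f)"
proof -
  have e: "t (st (f + sc a) * (f + sc a)) =
      t (st f * f) + a * t (st f) + cnj a * t f + t (sc (cnj a) * sc a)" for a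
    unfolding st_add st_sc distrib_left distrib_right sc_comm[of "st f" a] t_add t_sc by simp
  have r: "Im (t (sc (cnj a) * sc a)) = 0" for a
    using t_real[of "sc a"] by (simp add: st_sc)
  have "Im (a * t (st f) + cnj a * t f) = 0" for a
    using t_real[of "f + sc a"] t_real[of f] r[of a] unfolding e by simp
  from this[of 1] this[of \<i>] show ?thesis by (auto simp: complex_eq_iff)
qed

lemma n2_nonneg [simp]: "0 \<le> n2 f"
  by (simp add: n2_def t_pos)

lemma n2_sq: "(n2 f)\<^sup>2 = Re (t (st f * f))"
  by (simp add: n2_def t_pos)

lemma t_n2: "t (st f * f) = complex_of_real ((n2 f)\<^sup>2)"
  by (simp add: n2_sq complex_eq_iff t_real)

lemma n2_sc: "n2 (sc a * f) = cmod a * n2 f"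
proof -
  have "st (sc a * f) * (sc a * f) = sc (cnj a * a) * (st f * f)"
    by (simp add: st_scm sc_mult mult.assoc) (metis mult.assoc sc_comm)
  then have "(n2 (sc a * f))\<^sup>2 = (cmod a * n2 f)\<^sup>2"
    unfolding n2_sq power_mult_distrib cmod_power2
    by (simp add: t_sc t_real power2_eq_square)
  then show ?thesis by (simp add: power2_eq_iff_nonneg)
qed

lemma n2_minus [simp]: "n2 (- f) = n2 f"
  using n2_sc[of "- 1" f] by (simp add: sc_minus1)

lemma n2_st [simp]: "n2 (st f) = n2 f"
  by (simp add: n2_def st_st t_comm[of f])

lemma n2_0 [simp]: "n2 0 = 0"
  by (simp add: n2_def)

text \<open>The polarisation identity on which the variational arguments below rest.\<close>

lemma n2_add_sc: "(n2 (f + sc c * g))\<^sup>2 = (n2 f)\<^sup>2 + 2 * Re (c * t (st f * g)) + (cmod c)\<^sup>2 * (n2 g)\<^sup>2"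
proof -
  have 1: "st f * (sc c * g) = sc c * (st f * g)"
    by (rule sc_left)
  have 2: "(sc (cnj c) * st g) * (sc c * g) = sc (cnj c * c) * (st g * g)"
    using sc_left[of "st g" c g] by (simp add: mult.assoc sc_mult)
  have 3: "(sc (cnj c) * st g) * f = sc (cnj c) * (st g * f)" by (simp add: mult.assoc)
  have e: "st (f + sc c * g) * (f + sc c * g)
      = st f * f + sc c * (st f * g) + (sc (cnj c) * (st g * f) + sc (cnj c * c) * (st g * g))"
    unfolding st_add st_scm distrib_left distrib_right 1 2 3 by (simp add: add_ac)
  have h: "t (st g * f) = cnj (t (st f * g))"
    using t_st[of "st f * g"] by (simp add: st_mult st_st)
  have r: "Re (cnj c * c * complex_of_real ((n2 g)\<^sup>2)) = (cmod c)\<^sup>2 * (n2 g)\<^sup>2"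
  proof -
    have "cnj c * c = complex_of_real ((cmod c)\<^sup>2)" by (simp only: complex_norm_square mult.commute)
    then show ?thesis by (simp only: of_real_mult[symmetric] Re_complex_of_real)
  qed
  have k: "Re (cnj c * cnj (t (st f * g))) = Re (c * t (st f * g))"
    by simp
  have "t (st (f + sc c * g) * (f + sc c * g)) = t (st f * f) + c * t (st f * g)
      + (cnj c * cnj (t (st f * g)) + cnj c * c * complex_of_real ((n2 g)\<^sup>2))"
    unfolding e by (simp only: t_add t_sc t_n2[of g] h)
  then have "Re (t (st (f + sc c * g) * (f + sc c * g))) = Re (t (st f * f)) + Re (c * t (st f * g))
      + (Re (c * t (st f * g)) + (cmod c)\<^sup>2 * (n2 g)\<^sup>2)"
    by (simp only: plus_complex.sel r k)
  then show ?thesis unfolding n2_sq[symmetric] by simp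
qed

lemma Cauchy_Schwarz: "cmod (t (st f * g)) \<le> n2 f * n2 g"
proof -
  define b where "b = t (st f * g)"
  have main: "0 \<le> (n2 f)\<^sup>2 - 2 * s * (cmod b)\<^sup>2 + s\<^sup>2 * (cmod b)\<^sup>2 * (n2 g)\<^sup>2" for s :: real
  proof -
    \<comment> \<open>The factor \<open>cnj b\<close> makes the cross term real, and negative for
      positive \<open>s\<close>.\<close>
    have "0 \<le> (n2 (f + sc (- of_real s * cnj b) * g))\<^sup>2" by simp
    also have "Re ((- of_real s * cnj b) * b) = - s * (cmod b)\<^sup>2"
      unfolding cmod_power2 by (simp add: power2_eq_square algebra_simps)
    then have "(n2 (f + sc (- of_real s * cnj b) * g))\<^sup>2
        = (n2 f)\<^sup>2 - 2 * s * (cmod b)\<^sup>2 + s\<^sup>2 * (cmod b)\<^sup>2 * (n2 g)\<^sup>2"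
      unfolding n2_add_sc b_def[symmetric] by (simp add: norm_mult power_mult_distrib)
    finally show ?thesis .
  qed
  have "(cmod b)\<^sup>2 \<le> (n2 f * n2 g)\<^sup>2"
  proof (cases "n2 g = 0")
    case True
    have "b = 0"
    proof (rule ccontr)
      assume "b \<noteq> 0"
      then have "cmod b > 0" by simp
      \<comment> \<open>For \<open>n2 g = 0\<close> the right-hand side of \<open>main\<close> is
        affine in \<open>s\<close>; this \<open>s\<close> gives it the value
        \<open>- 1\<close>.\<close>
      with main[of "((n2 f)\<^sup>2 + 1) / (2 * (cmod b)\<^sup>2)"] True show False by (simp add: field_simps)
    qed
    then show ?thesis by simp
  next
    case False
    then have "n2 g > 0" by (simp add: less_le)
    with main[of "1 / (n2 g)\<^sup>2"] show ?thesis by (simp add: field_simps power2_eq_square)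
  qed
  then show ?thesis unfolding b_def by (rule power2_le_imp_le) simp
qed

lemma n2_add: "n2 (f + g) \<le> n2 f + n2 g"
proof -
  have "(n2 (f + g))\<^sup>2 = (n2 f)\<^sup>2 + 2 * Re (t (st f * g)) + (n2 g)\<^sup>2"
    using n2_add_sc[of f 1 g] by (simp add: sc_1)
  also have "\<dots> \<le> (n2 f)\<^sup>2 + 2 * (n2 f * n2 g) + (n2 g)\<^sup>2"
    using Cauchy_Schwarz[of f g] complex_Re_le_cmod[of "t (st f * g)"] by simp
  also have "\<dots> = (n2 f + n2 g)\<^sup>2" by (simp add: power2_sum)
  finally show ?thesis by (rule power2_le_imp_le) simp
qed

lemma n2_diff: "n2 (f - g) \<le> n2 f + n2 g"
  using n2_add[of f "- g"] by simp

lemma n2_diff_commute: "n2 (f - g) = n2 (g - f)"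
  using n2_minus[of "f - g"] by simp

lemma n2_triangle: "n2 (f - h) \<le> n2 (f - g) + n2 (g - h)"
  using n2_add[of "f - g" "g - h"] by simp

text \<open>Iterating the Cauchy-Schwarz inequality for the positive functional
  \<open>h \<mapsto> t (st g * h * g)\<close> yields \<open>\<omega>(h)\<^bsup>2^m\<^esup> \<le> \<omega>(1)\<^bsup>2^m - 1\<^esup> \<omega>(h\<^bsup>2^m\<^esup>)\<close>, and boundedness of \<open>t\<close>
  makes the unknown constant disappear in the limit; no order structure is needed.\<close>

lemma t_conj_le:
  assumes "st h = h"
  shows "Re (t (st g * h * g)) \<le> nr h * (n2 g)\<^sup>2"
proof -
  define \<omega> where "\<omega> h = cmod (t (st g * h * g))" for h
  define W where "W = (n2 g)\<^sup>2"
  obtain C where C: "\<And>f. cmod (t f) \<le> C * nr f" using t_bdd by blast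
  \<comment> \<open>Cauchy-Schwarz for \<open>g\<close> and \<open>k * g\<close>, the squaring step
    of the iteration.\<close>
  have sq: "(\<omega> k)\<^sup>2 \<le> W * \<omega> (k ^ 2)" if "st k = k" for k
  proof -
    have "(n2 (k * g))\<^sup>2 = Re (t (st g * k ^ 2 * g))"
      unfolding n2_sq using that by (simp add: st_mult power2_eq_square mult.assoc)
    also have "\<dots> \<le> \<omega> (k ^ 2)" unfolding \<omega>_def by (rule complex_Re_le_cmod)
    finally have a: "(n2 (k * g))\<^sup>2 \<le> \<omega> (k ^ 2)" .
    have "(\<omega> k)\<^sup>2 \<le> (n2 g * n2 (k * g))\<^sup>2"
      using Cauchy_Schwarz[of g "k * g"] unfolding \<omega>_def by (intro power_mono) (auto simp: mult.assoc)
    also have "\<dots> \<le> W * \<omega> (k ^ 2)"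
      unfolding power_mult_distrib W_def by (intro mult_left_mono a) auto
    finally show ?thesis .
  qed
  have W0: "0 \<le> W" by (simp add: W_def)
  \<comment> \<open>The extra factor \<open>W\<close> on the left accounts for the exponent
    \<open>2 ^ m - 1\<close> of \<open>W\<close> without a subtraction.\<close>
  have it: "\<omega> h ^ (2 ^ m) * W \<le> W ^ (2 ^ m) * \<omega> (h ^ (2 ^ m))" for m
  proof (induction m)
    case 0
    show ?case by (simp add: mult.commute)
  next
    case (Suc m)
    show ?case
    proof (cases "W = 0")
      case False
      with W0 have Wp: "W > 0" by simp
      let ?a = "\<omega> h ^ 2 ^ m" and ?b = "W ^ 2 ^ m" and ?k = "h ^ 2 ^ m"
      have [simp]: "0 \<le> ?a" "0 \<le> ?b" "0 \<le> \<omega> k" for k by (simp_all add: \<omega>_def W0)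
      have "(?a * W)\<^sup>2 \<le> (?b * \<omega> ?k)\<^sup>2"
        using Suc W0 by (intro power_mono) auto
      also have "\<dots> \<le> ?b\<^sup>2 * (W * \<omega> (?k ^ 2))"
        unfolding power_mult_distrib using sq[of ?k] assms
        by (intro mult_left_mono) (auto simp: st_power)
      finally have "?a\<^sup>2 * W * W \<le> ?b\<^sup>2 * \<omega> (?k ^ 2) * W"
        by (simp add: power_mult_distrib power2_eq_square mult_ac)
      then have "?a\<^sup>2 * W \<le> ?b\<^sup>2 * \<omega> (?k ^ 2)" using Wp by simp
      then show ?thesis by (simp add: power_mult[symmetric] mult.commute)
    qed (simp add: zero_power)
  qed
  have "\<omega> h \<le> nr h * W"
  proof (cases "W = 0")
    case True
    then have "(\<omega> h)\<^sup>2 \<le> 0" using sq[OF assms] by simp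
    then show ?thesis using True by simp
  next
    case False
    with W0 have Wp: "W > 0" by simp
    define D where "D = \<bar>C\<bar> * (nr g)\<^sup>2"
    have up: "\<omega> k \<le> D * nr k" for k
    proof -
      have "\<omega> k \<le> C * nr (st g * k * g)" unfolding \<omega>_def by (rule C)
      also have "\<dots> \<le> \<bar>C\<bar> * nr (st g * k * g)" by (intro mult_right_mono nr_nonneg) simp
      also have "nr (st g * k * g) \<le> nr (st g * k) * nr g" by (rule nr_mult)
      also have "nr (st g * k) \<le> nr (st g) * nr k" by (rule nr_mult)
      finally show ?thesis unfolding D_def
        by (simp add: power2_eq_square mult_ac mult_left_mono mult_right_mono nr_nonneg)
    qed
    have D0: "0 \<le> D" by (simp add: D_def)
    have step: "\<omega> h ^ (2 ^ m) * W \<le> (W * nr h) ^ (2 ^ m) * D" for m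
    proof -
      have "\<omega> h ^ (2 ^ m) * W \<le> W ^ (2 ^ m) * (D * nr (h ^ 2 ^ m))"
        using it[of m] up[of "h ^ 2 ^ m"] W0 by (smt (verit) mult_left_mono zero_le_power)
      also have "\<dots> \<le> W ^ (2 ^ m) * (D * nr h ^ 2 ^ m)"
        using W0 D0 by (intro mult_left_mono nr_power) auto
      finally show ?thesis by (simp add: power_mult_distrib mult_ac)
    qed
    show ?thesis
    proof (rule ccontr)
      assume "\<not> \<omega> h \<le> nr h * W"
      then have gt: "\<omega> h > W * nr h" by (simp add: mult.commute)
      have a0: "0 \<le> W * nr h" using W0 nr_nonneg by simp
      show False
      proof (cases "W * nr h = 0")
        case True
        then show False using step[of 0] gt Wp by simp (metis mult_le_0_iff not_less power_one_right)
      next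
        case False
        with a0 have ap: "W * nr h > 0" using False by linarith
        define q where "q = \<omega> h / (W * nr h)"
        have q: "q > 1" using gt ap by (simp add: q_def)
        have bd: "q ^ (2 ^ m) \<le> D / W" for m
        proof -
          have "0 < (W * nr h) ^ 2 ^ m" using ap by simp
          moreover have "\<omega> h ^ 2 ^ m \<le> D / W * (W * nr h) ^ 2 ^ m"
            using step[of m] Wp by (simp add: pos_le_divide_eq mult_ac)
          ultimately show ?thesis unfolding q_def power_divide by (simp only: pos_divide_le_eq)
        qed
        obtain N where N: "D / W < q ^ N" using real_arch_pow[OF q] by blast
        have "q ^ N \<le> q ^ (2 ^ N)" using q by (intro power_increasing) (auto simp: less_imp_le)
        with N bd[of N] show False by simp
      qed
    qed
  qed
  moreover have "Re (t (st g * h * g)) \<le> \<omega> h" unfolding \<omega>_def by (rule complex_Re_le_cmod)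
  ultimately show ?thesis unfolding W_def by simp
qed

text \<open>\<open>t_conj_le\<close> for \<open>h = st f * f\<close>, whose seminorm is
  \<open>(nr f)\<^sup>2\<close> by the C*-identity.\<close>

lemma n2_mult_left: "n2 (f * g) \<le> nr f * n2 g"
proof -
  have "(n2 (f * g))\<^sup>2 = Re (t (st g * (st f * f) * g))"
    unfolding n2_sq by (simp add: st_mult mult.assoc)
  also have "\<dots> \<le> nr (st f * f) * (n2 g)\<^sup>2"
    by (rule t_conj_le) (simp add: st_mult st_st)
  also have "\<dots> = (nr f * n2 g)\<^sup>2" by (simp add: nr_cstar power_mult_distrib)
  finally show ?thesis by (rule power2_le_imp_le) (simp add: nr_nonneg)
qed

lemma n2_mult_right: "n2 (f * g) \<le> n2 f * nr g"
  using n2_mult_left[of "st g" "st f"] n2_st[of "f * g"] by (simp add: st_mult mult.commute)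

lemma n2_1_le: "n2 f \<le> nr f * n2 1"
  using n2_mult_left[of f 1] by simp

lemma t_le_n2: "cmod (t f) \<le> n2 1 * n2 f"
  using Cauchy_Schwarz[of 1 f] by simp

lemma t_mult_le: "cmod (t (f * g)) \<le> n2 f * n2 g"
  using Cauchy_Schwarz[of "st f" g] by (simp add: st_st)

lemma real_imaginary_parts:
  obtains x y where "f = x + sc \<i> * y" "st x = x" "st y = y" "nr x \<le> nr f" "nr y \<le> nr f"
proof
  show "f = sc (1/2) * (f + st f) + sc \<i> * (sc (- \<i> / 2) * (f - st f))"
  proof -
    have "sc (1/2) * (f + st f) + sc \<i> * (sc (- \<i> / 2) * (f - st f)) = (sc (1/2) + sc (1/2)) * f"
      by (simp add: mult.assoc[symmetric] sc_mult[symmetric] algebra_simps)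
    also have "\<dots> = f" by (simp add: sc_add[symmetric] sc_1)
    finally show ?thesis by simp
  qed
  show "st (sc (1/2) * (f + st f)) = sc (1/2) * (f + st f)"
    by (simp add: st_scm st_add st_st add.commute)
  show "st (sc (- \<i> / 2) * (f - st f)) = sc (- \<i> / 2) * (f - st f)"
    by (simp add: st_scm st_diff st_st) (metis (no_types, opaque_lifting) minus_diff_eq mult_minus_left mult_minus_right sc_minus minus_divide_left)
  show "nr (sc (1/2) * (f + st f)) \<le> nr f"
    using nr_add[of f "st f"] by (simp add: nr_sc)
  show "nr (sc (- \<i> / 2) * (f - st f)) \<le> nr f"
    using nr_diff[of f "st f"] by (simp add: nr_sc norm_divide)
qed

end

context tracial_star_ring
begin

lemma st_sq: "st (f * f) = st f * st f"
  by (rule st_mult)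

lemma t_sc_right: "t (f * (sc a * g)) = a * t (f * g)"
  by (simp add: sc_left t_sc)

lemma sc_half: "sc (1/2) * f + sc (1/2) * f = f"
  by (simp add: distrib_right[symmetric] sc_add[symmetric] sc_1)

lemma Re_t_sq: "st f = f \<Longrightarrow> Re (t (f * f)) = (n2 f)\<^sup>2"
  by (simp add: n2_sq)

lemma nr_sc1: "nr (sc a) \<le> cmod a"
  using nr_sc[of a 1] mult_left_mono[OF nr_1, of "cmod a"] by simp

end

section \<open>Weak* limits along an ultrafilter\<close>

text \<open>\<open>L y x\<close> stands for weak* convergence of \<open>y\<close> to \<open>x\<close> along an ultrafilter \<open>U\<close>.\<close>

locale tracial_limits = tracial_star_ring sc st nr t
  for sc :: "complex \<Rightarrow> 'f::ring_1" and st nr t +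
  fixes U :: "nat filter" and L :: "(nat \<Rightarrow> 'f) \<Rightarrow> 'f \<Rightarrow> bool"
  assumes U_bot: "U \<noteq> bot"
    and U_conv: "\<And>f :: nat \<Rightarrow> complex. (\<And>k. cmod (f k) \<le> C) \<Longrightarrow> \<exists>l. (f \<longlongrightarrow> l) U"
    and L_ex: "(\<And>k. nr (y k) \<le> K) \<Longrightarrow> \<exists>x. L y x"
    and L_nr: "(\<And>k. nr (y k) \<le> K) \<Longrightarrow> L y x \<Longrightarrow> nr x \<le> K"
    and L_add: "L y x \<Longrightarrow> L y' x' \<Longrightarrow> L (\<lambda>k. y k + y' k) (x + x')"
    and L_sc: "L y x \<Longrightarrow> L (\<lambda>k. sc a * y k) (sc a * x)"
    and L_const: "L (\<lambda>k. x) x"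
    and L_t: "L y x \<Longrightarrow> ((\<lambda>k. t (y k)) \<longlongrightarrow> t x) U"
begin

text \<open>With \<open>w = 1 + i s g - s\<^sup>2/2 G\<close>, the weak* limit of \<open>1 + i s h - s\<^sup>2/2 h\<^sup>2\<close>, contractivity of
  the limit gives \<open>\<parallel>w\<parallel>\<^sup>2 \<le> 1 + O(s\<^sup>4)\<close>, while \<open>\<tau>(w\<^sup>*w) = 1 + s\<^sup>2 \<tau>(g\<^sup>2 - G) + O(s\<^sup>4)\<close>.\<close>

lemma Kadison_trace:
  assumes h: "\<And>k. st (h k) = h k" "\<And>k. nr (h k) \<le> K"
    and L1: "L h g1" and b: "((\<lambda>k. Re (t (h k * h k))) \<longlongrightarrow> b) U"
  shows "(n2 (sc (1/2) * (g1 + st g1)))\<^sup>2 \<le> b"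
proof -
  have K0: "0 \<le> K" using h(2)[of 0] nr_nonneg[of "h 0"] by linarith
  have bh: "nr (h k * h k) \<le> K * K" for k
    by (rule order_trans[OF nr_mult]) (intro mult_mono h nr_nonneg K0)
  then obtain G1 where L2: "L (\<lambda>k. h k * h k) G1" using L_ex[of "\<lambda>k. h k * h k" "K * K"] by blast
  \<comment> \<open>Nothing says that \<open>L\<close> respects \<open>st\<close>, so limits of
    self-adjoint sequences are symmetrised by hand.\<close>
  define g where "g = sc (1/2) * (g1 + st g1)"
  define G where "G = sc (1/2) * (G1 + st G1)"
  have sg: "st g = g" "st G = G"
    by (simp_all add: g_def G_def st_scm st_add st_st add.commute)
  have tG: "Re (t G) = b"
  proof -
    have "((\<lambda>k. Re (t (h k * h k))) \<longlongrightarrow> Re (t G1)) U" by (intro tendsto_intros L_t L2)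
    then have "Re (t G1) = b" using b tendsto_unique[OF U_bot] by blast
    then show ?thesis by (simp add: G_def t_sc t_add t_st)
  qed
  have tgG: "t (g * G) = t (G * g)" by (rule t_comm)
  have main: "(n2 g)\<^sup>2 - b \<le> s\<^sup>2 * (K ^ 4 * (n2 1)\<^sup>2 / 4)" if s: "s > 0" for s :: real
  proof -
    define c where "c = complex_of_real (- s\<^sup>2 / 2)"
    define y where "y r k = 1 + sc (\<i> * of_real r) * h k + sc c * (h k * h k)" for r :: real and k
    define w where "w = 1 + sc (\<i> * of_real s) * g + sc c * G"
    define B where "B = sqrt (1 + s ^ 4 * K ^ 4 / 4)"
    have yb: "nr (y r k) \<le> B" if r: "r\<^sup>2 = s\<^sup>2" for r k
    proof -
      let ?h = "h k" and ?a = "\<i> * complex_of_real r"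
      have "st (y r k) * y r k = (1 + sc (- ?a) * ?h + sc c * (?h * ?h)) * (1 + sc ?a * ?h + sc c * (?h * ?h))"
        by (simp add: y_def st_add st_scm h(1) st_sq c_def)
      also have "\<dots> = 1 + sc (2 * c - ?a * ?a) * (?h * ?h) + sc (c * c) * (?h * ?h * (?h * ?h))"
      proof -
        have 1: "(1 + sc (- ?a) * ?h + sc c * (?h * ?h)) * (1 + sc ?a * ?h + sc c * (?h * ?h))
          = 1 + (sc ?a + sc (- ?a)) * ?h + (sc c + sc c + sc (- ?a) * sc ?a) * (?h * ?h)
            + (sc (- ?a) * sc c + sc c * sc ?a) * (?h * ?h * ?h) + (sc c * sc c) * (?h * ?h * (?h * ?h))"
          by (simp add: distrib_left distrib_right mult.assoc sc_left[of "h k"] add_ac)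
        have 2: "sc ?a + sc (- ?a) = 0" "sc (- ?a) * sc c + sc c * sc ?a = 0"
          "sc c + sc c + sc (- ?a) * sc ?a = sc (2 * c - ?a * ?a)"
          by (simp_all add: sc_add[symmetric] sc_mult[symmetric])
        show ?thesis unfolding 1 2 by (simp add: sc_mult)
      qed
      also have "2 * c - ?a * ?a = 0"
        using r unfolding c_def by (auto simp: complex_eq_iff power2_eq_square)
      finally have e: "st (y r k) * y r k = 1 + sc (c * c) * (?h * ?h * (?h * ?h))" by simp
      have "(nr (y r k))\<^sup>2 \<le> nr 1 + nr (sc (c * c) * (?h * ?h * (?h * ?h)))"
        unfolding nr_cstar[symmetric] e by (rule nr_add)
      also have "\<dots> \<le> 1 + cmod (c * c) * ((K * K) * (K * K))"
        unfolding nr_sc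
        by (intro add_mono nr_1 mult_left_mono order_trans[OF nr_mult] mult_mono bh) (auto simp: nr_nonneg K0)
      also have "\<dots> = 1 + s ^ 4 * K ^ 4 / 4"
        by (simp add: c_def norm_mult norm_divide power2_eq_square power4_eq_xxxx mult_ac)
      finally show ?thesis unfolding B_def by (rule real_le_rsqrt)
    qed
    have Ly: "L (y r) (1 + sc (\<i> * of_real r) * g1 + sc c * G1)" for r
      unfolding y_def by (intro L_add L_sc L_const L1 L2)
    have z: "nr (1 + sc (\<i> * of_real s) * g1 + sc c * G1) \<le> B"
      by (rule L_nr[OF _ Ly]) (simp add: yb)
    \<comment> \<open>The adjoint of the limit for \<open>- s\<close> is the limit expression for
      \<open>s\<close> with \<open>g1\<close> and \<open>G1\<close> replaced by their adjoints. The
      average of this and the expression for \<open>s\<close> is \<open>w\<close>.\<close>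
    have "nr (1 + sc (\<i> * of_real (- s)) * g1 + sc c * G1) \<le> B"
      by (rule L_nr[OF _ Ly]) (simp add: yb)
    then have "nr (st (1 + sc (\<i> * of_real (- s)) * g1 + sc c * G1)) \<le> B" by simp
    then have z': "nr (1 + sc (\<i> * of_real s) * st g1 + sc c * st G1) \<le> B"
      by (simp add: st_add st_scm c_def)
    have weq: "w = sc (1/2) * (1 + sc (\<i> * of_real s) * g1 + sc c * G1)
        + sc (1/2) * (1 + sc (\<i> * of_real s) * st g1 + sc c * st G1)"
    proof -
      have "w = (sc (1/2) * 1 + sc (1/2) * 1) + sc (\<i> * of_real s) * g + sc c * G"
        by (simp add: w_def sc_half[of 1, simplified])
      then show ?thesis unfolding g_def G_def
        by (simp add: distrib_left sc_left[of "sc (\<i> * of_real s)"] sc_left[of "sc c"] add_ac)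
    qed
    have "nr w \<le> B"
      unfolding weq
      by (rule order_trans[OF nr_add]) (use z z' in \<open>simp add: nr_sc\<close>)
    then have "n2 w \<le> B * n2 1"
      using n2_1_le[of w] mult_right_mono[of "nr w" B "n2 1"] by simp
    then have "(n2 w)\<^sup>2 \<le> (B * n2 1)\<^sup>2" by (intro power_mono) auto
    also have "(B * n2 1)\<^sup>2 = (1 + s ^ 4 * K ^ 4 / 4) * (n2 1)\<^sup>2"
      by (simp add: B_def power_mult_distrib add_nonneg_nonneg K0)
    finally have up: "(n2 w)\<^sup>2 \<le> (1 + s ^ 4 * K ^ 4 / 4) * (n2 1)\<^sup>2" .
    have "(n2 w)\<^sup>2 = (n2 (1 + sc c * G))\<^sup>2 + 2 * Re (\<i> * of_real s * t (st (1 + sc c * G) * g)) + s\<^sup>2 * (n2 g)\<^sup>2"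
      using n2_add_sc[of "1 + sc c * G" "\<i> * of_real s" g]
      by (simp add: w_def norm_mult add_ac)
    also have "Re (\<i> * of_real s * t (st (1 + sc c * G) * g)) = 0"
    proof -
      have "cnj (t g) = t g" using t_st[of g] by (simp add: sg)
      moreover have "cnj (t (G * g)) = t (G * g)" using t_st[of "G * g"] by (simp add: st_mult sg tgG)
      ultimately have "Im (t (st (1 + sc c * G) * g)) = 0"
        by (simp add: st_add st_scm sg distrib_right t_add mult.assoc t_sc c_def complex_eq_iff)
      then show ?thesis by simp
    qed
    also have "(n2 (1 + sc c * G))\<^sup>2 = (n2 1)\<^sup>2 + 2 * Re (c * t G) + (cmod c)\<^sup>2 * (n2 G)\<^sup>2"
      using n2_add_sc[of 1 c G] by simp
    also have "Re (c * t G) = - s\<^sup>2 / 2 * b" by (simp add: c_def tG)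
    finally have "(n2 w)\<^sup>2 \<ge> (n2 1)\<^sup>2 - s\<^sup>2 * b + s\<^sup>2 * (n2 g)\<^sup>2" by simp
    with up have "s\<^sup>2 * ((n2 g)\<^sup>2 - b) \<le> s\<^sup>2 * (s\<^sup>2 * (K ^ 4 * (n2 1)\<^sup>2 / 4))"
      by (simp add: algebra_simps power2_eq_square power4_eq_xxxx)
    then show ?thesis by (rule mult_left_le_imp_le) (use s in simp)
  qed
  have "((\<lambda>s. s\<^sup>2 * (K ^ 4 * (n2 1)\<^sup>2 / 4)) \<longlongrightarrow> 0\<^sup>2 * (K ^ 4 * (n2 1)\<^sup>2 / 4)) (at_right 0)"
    by (intro tendsto_intros)
  moreover have "\<forall>\<^sub>F s in at_right 0. (n2 g)\<^sup>2 - b \<le> s\<^sup>2 * (K ^ 4 * (n2 1)\<^sup>2 / 4)"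
    using eventually_at_right_less[of "0::real"] by eventually_elim (rule main)
  ultimately have "(n2 g)\<^sup>2 - b \<le> 0\<^sup>2 * (K ^ 4 * (n2 1)\<^sup>2 / 4)"
    by (rule tendsto_lowerbound) simp
  then show ?thesis by (simp add: g_def)
qed

text \<open>First variation of \<open>Kadison_trace\<close>: applied to the sequence
  \<open>h k + sc (of_real s) * a\<close>, both sides are quadratic in \<open>s\<close> with the
  same leading term, so the difference is affine in \<open>s\<close> and bounded above for all real
  \<open>s\<close>. Its slope must vanish, and the slope compares \<open>t (g * a)\<close> with the
  limit of \<open>t (h k * a)\<close>.\<close>

lemma bounded_complete_sa:
  assumes h: "\<And>k. st (h k) = h k" "\<And>k. nr (h k) \<le> K"
  obtains x where "st x = x" "\<And>a. st a = a \<Longrightarrow> ((\<lambda>k. t (h k * a)) \<longlongrightarrow> t (x * a)) U"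
proof -
  obtain g1 where L1: "L h g1" using L_ex[of h K] h(2) by blast
  define g where "g = sc (1/2) * (g1 + st g1)"
  have sg: "st g = g" by (simp add: g_def st_scm st_add st_st add.commute)
  have K0: "0 \<le> K" using h(2)[of 0] nr_nonneg[of "h 0"] by linarith
  have im: "Im (t (x * a)) = 0" if "st x = x" "st a = a" for x a
    using t_st[of "x * a"] that by (simp add: st_mult t_comm[of a] complex_eq_iff)
  have bd: "\<exists>C. \<forall>k. cmod (t (h k * a)) \<le> C" for a
  proof (intro exI allI)
    fix k
    have "cmod (t (h k * a)) \<le> n2 (h k) * n2 a" by (rule t_mult_le)
    also have "\<dots> \<le> (K * n2 1) * n2 a"
      by (intro mult_right_mono order_trans[OF n2_1_le] h) auto
    finally show "cmod (t (h k * a)) \<le> (K * n2 1) * n2 a" .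
  qed
  have "((\<lambda>k. t (h k * a)) \<longlongrightarrow> t (g * a)) U" if sa: "st a = a" for a
  proof -
    obtain c where c: "((\<lambda>k. t (h k * a)) \<longlongrightarrow> c) U" using bd[of a] U_conv[of "\<lambda>k. t (h k * a)"] by blast
    have "\<exists>C. \<forall>k. cmod (t (h k * h k)) \<le> C"
    proof (intro exI allI)
      fix k
      have "cmod (t (h k * h k)) \<le> n2 (h k) * n2 (h k)" by (rule t_mult_le)
      also have "\<dots> \<le> (K * n2 1) * (K * n2 1)"
        by (intro mult_mono order_trans[OF n2_1_le] mult_right_mono h) (auto simp: K0)
      finally show "cmod (t (h k * h k)) \<le> (K * n2 1) * (K * n2 1)" .
    qed
    then obtain b where b: "((\<lambda>k. t (h k * h k)) \<longlongrightarrow> b) U"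
      using U_conv[of "\<lambda>k. t (h k * h k)"] by blast
    have Ric: "Im c = 0"
    proof -
      have "((\<lambda>k. Im (t (h k * a))) \<longlongrightarrow> Im c) U" by (intro tendsto_intros c)
      then have "((\<lambda>k. 0) \<longlongrightarrow> Im c) U" using im[OF h(1) sa] by simp
      from tendsto_unique[OF U_bot this tendsto_const] show ?thesis .
    qed
    have key: "(n2 g)\<^sup>2 - Re b + 2 * s * (Re (t (g * a)) - Re c) \<le> 0" for s :: real
    proof -
      define h' where "h' k = h k + sc (of_real s) * a" for k
      have sh: "st (h' k) = h' k" for k by (simp add: h'_def st_add st_scm h sa)
      have bh: "nr (h' k) \<le> K + nr (sc (of_real s) * a)" for k
        unfolding h'_def by (rule order_trans[OF nr_add]) (simp add: h)
      have L': "L h' (g1 + sc (of_real s) * a)"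
        unfolding h'_def by (intro L_add L1 L_const)
      have e: "Re (t (h' k * h' k)) = Re (t (h k * h k)) + 2 * s * Re (t (h k * a)) + s\<^sup>2 * (n2 a)\<^sup>2" for k
        using n2_add_sc[of "h k" "of_real s" a] Re_t_sq[OF sh[of k]] Re_t_sq[OF h(1)[of k]]
        by (simp add: h'_def h(1))
      have "((\<lambda>k. Re (t (h' k * h' k))) \<longlongrightarrow> Re b + 2 * s * Re c + s\<^sup>2 * (n2 a)\<^sup>2) U"
        unfolding e by (intro tendsto_intros b c)
      from Kadison_trace[OF sh bh L' this]
      have "(n2 (sc (1/2) * (g1 + sc (of_real s) * a + st (g1 + sc (of_real s) * a))))\<^sup>2
        \<le> Re b + 2 * s * Re c + s\<^sup>2 * (n2 a)\<^sup>2" .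
      also have "sc (1/2) * (g1 + sc (of_real s) * a + st (g1 + sc (of_real s) * a)) = g + sc (of_real s) * a"
        using sc_half[of "sc (of_real s) * a"] by (simp add: g_def st_add st_scm sa distrib_left add_ac)
      finally show ?thesis using n2_add_sc[of g "of_real s" a] by (simp add: sg algebra_simps)
    qed
    have "Re (t (g * a)) - Re c = 0"
    proof (rule ccontr)
      define d where "d = Re (t (g * a)) - Re c"
      assume "Re (t (g * a)) - Re c \<noteq> 0"
      then have "d \<noteq> 0" by (simp add: d_def)
      \<comment> \<open>For this value of \<open>s\<close> the left-hand side of \<open>key\<close>
        would be 1.\<close>
      then have "2 * ((1 - (n2 g)\<^sup>2 + Re b) / (2 * d)) * d = 1 - (n2 g)\<^sup>2 + Re b" by simp
      then show False using key[of "(1 - (n2 g)\<^sup>2 + Re b) / (2 * d)"] unfolding d_def[symmetric] by linarith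
    qed
    then have "t (g * a) = c" using im[OF sg sa] Ric by (simp add: complex_eq_iff)
    then show ?thesis using c by simp
  qed
  with sg show ?thesis using that by blast
qed

lemma bounded_complete:
  assumes "\<And>k. nr (y k) \<le> K"
  obtains x where "\<And>a. ((\<lambda>k. t (y k * a)) \<longlongrightarrow> t (x * a)) U"
proof -
  have "\<exists>p. y k = fst p + sc \<i> * snd p \<and> st (fst p) = fst p \<and> st (snd p) = snd p
      \<and> nr (fst p) \<le> nr (y k) \<and> nr (snd p) \<le> nr (y k)" for k
    using real_imaginary_parts[of "y k"] by (metis fst_conv snd_conv)
  then obtain p where p: "\<And>k. y k = fst (p k) + sc \<i> * snd (p k) \<and> st (fst (p k)) = fst (p k)
      \<and> st (snd (p k)) = snd (p k) \<and> nr (fst (p k)) \<le> nr (y k) \<and> nr (snd (p k)) \<le> nr (y k)"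
    by metis
  obtain x1 where x1: "\<And>a. st a = a \<Longrightarrow> ((\<lambda>k. t (fst (p k) * a)) \<longlongrightarrow> t (x1 * a)) U"
    using bounded_complete_sa[of "\<lambda>k. fst (p k)" K] p assms by (metis order_trans)
  obtain x2 where x2: "\<And>a. st a = a \<Longrightarrow> ((\<lambda>k. t (snd (p k) * a)) \<longlongrightarrow> t (x2 * a)) U"
    using bounded_complete_sa[of "\<lambda>k. snd (p k)" K] p assms by (metis order_trans)
  have sa: "((\<lambda>k. t (y k * a)) \<longlongrightarrow> t ((x1 + sc \<i> * x2) * a)) U" if "st a = a" for a
  proof -
    have "((\<lambda>k. t (fst (p k) * a) + \<i> * t (snd (p k) * a)) \<longlongrightarrow> t (x1 * a) + \<i> * t (x2 * a)) U"
      by (intro tendsto_intros x1 x2 that)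
    moreover have "t (y k * a) = t (fst (p k) * a) + \<i> * t (snd (p k) * a)" for k
      using p[of k] by (simp add: distrib_right t_add mult.assoc t_sc)
    ultimately show ?thesis by (simp add: distrib_right t_add mult.assoc t_sc)
  qed
  show ?thesis
  proof
    fix a
    obtain a1 a2 where a: "a = a1 + sc \<i> * a2" "st a1 = a1" "st a2 = a2"
      using real_imaginary_parts[of a] by metis
    have "((\<lambda>k. t (y k * a1) + \<i> * t (y k * a2))
        \<longlongrightarrow> t ((x1 + sc \<i> * x2) * a1) + \<i> * t ((x1 + sc \<i> * x2) * a2)) U"
      by (intro tendsto_intros sa a)
    then show "((\<lambda>k. t (y k * a)) \<longlongrightarrow> t ((x1 + sc \<i> * x2) * a)) U"
      unfolding a(1) by (simp add: distrib_left t_add t_sc_right)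
  qed
qed

text \<open>Completeness of operator-norm balls in the 2-norm. The weak limit \<open>x\<close> is
  also a limit in \<open>n2\<close>: tested against \<open>a = st (y i - x)\<close>, the square of
  \<open>n2 (y i - x)\<close> is the limit over \<open>j\<close> of
  \<open>t ((y i - y j) * a)\<close>, which is at most \<open>e * n2 (y i - x)\<close> by
  Cauchy-Schwarz.\<close>

lemma bounded_complete_n2:
  assumes b: "\<And>k. nr (y k) \<le> K"
    and c: "\<And>e. e > 0 \<Longrightarrow> \<exists>N. \<forall>i\<ge>N. \<forall>j\<ge>N. n2 (y i - y j) < e"
    and U: "\<And>N. eventually (\<lambda>n. n \<ge> N) U"
  obtains x where "(\<lambda>k. n2 (y k - x)) \<longlonglongrightarrow> 0"
proof -
  obtain x where x: "\<And>a. ((\<lambda>k. t (y k * a)) \<longlongrightarrow> t (x * a)) U"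
    using bounded_complete[of y K] b by blast
  have "\<exists>N. \<forall>i\<ge>N. n2 (y i - x) \<le> e" if e: "e > 0" for e
  proof -
    obtain N where N: "\<And>i j. i \<ge> N \<Longrightarrow> j \<ge> N \<Longrightarrow> n2 (y i - y j) < e" using c[OF e] by blast
    have "n2 (y i - x) \<le> e" if i: "i \<ge> N" for i
    proof -
      let ?a = "st (y i - x)"
      have "((\<lambda>j. cmod (t (y i * ?a) - t (y j * ?a))) \<longlongrightarrow> cmod (t (y i * ?a) - t (x * ?a))) U"
        by (intro tendsto_intros x)
      moreover have "\<forall>\<^sub>F j in U. cmod (t (y i * ?a) - t (y j * ?a)) \<le> e * n2 (y i - x)"
        using U[of N]
      proof eventually_elim
        case (elim j)
        have "cmod (t (y i * ?a) - t (y j * ?a)) = cmod (t ((y i - y j) * ?a))"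
          by (simp add: left_diff_distrib t_diff)
        also have "\<dots> \<le> n2 (y i - y j) * n2 ?a" by (rule t_mult_le)
        also have "\<dots> \<le> e * n2 (y i - x)"
          using N[OF i elim] unfolding n2_st by (intro mult_right_mono) auto
        finally show ?case .
      qed
      ultimately have "cmod (t (y i * ?a) - t (x * ?a)) \<le> e * n2 (y i - x)"
        using tendsto_upperbound U_bot by blast
      moreover have "t (y i * ?a) - t (x * ?a) = complex_of_real ((n2 (y i - x))\<^sup>2)"
        unfolding t_diff[symmetric] left_diff_distrib[symmetric] t_comm[of "y i - x"] by (rule t_n2)
      ultimately have "n2 (y i - x) * n2 (y i - x) \<le> e * n2 (y i - x)"
        by (simp only: norm_of_real) (simp add: power2_eq_square)
      then show ?thesis using n2_nonneg[of "y i - x"] e by (cases "n2 (y i - x) = 0") auto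
    qed
    then show ?thesis by blast
  qed
  then have "(\<lambda>k. n2 (y k - x)) \<longlonglongrightarrow> 0"
    unfolding lim_sequentially dist_real_def
    by (metis diff_zero abs_of_nonneg[OF n2_nonneg] field_sum_of_halves half_gt_zero less_add_same_cancel1 order_le_less_trans)
  then show ?thesis using that by blast
qed

end

text \<open>Evaluate at the minimiser \<open>s = 1 / C\<close>. \<open>B\<close> stands for the
  squared modulus of a pairing; it occurs twice because the variation is scaled by the conjugate of
  that pairing.\<close>

lemma quadratic_discriminant_bound:
  fixes A B C :: real
  assumes "\<And>s. 0 \<le> A - 2 * s * B + s\<^sup>2 * B * C" "0 \<le> C"
  shows "B \<le> A * C"
proof (cases "C = 0")
  case True
  show ?thesis
  proof (rule ccontr)
    assume "\<not> ?thesis"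
    then have "B > 0" using True by simp
    then show False using assms(1)[of "(A + 1) / (2 * B)"] True by (simp add: field_simps)
  qed
next
  case False
  then have C: "C > 0" using assms by simp
  have "0 \<le> A - 2 * (1 / C) * B + (1 / C)\<^sup>2 * B * C" by (rule assms)
  also have "\<dots> = A - B / C" using C by (simp add: power2_eq_square field_simps)
  finally show ?thesis using C by (simp add: field_simps)
qed

section \<open>Square roots, resolvents and best approximations\<close>

context tracial_star_ring
begin

lemma nr_limit_zero:
  assumes "\<And>k. nr f \<le> c * nr (g k)" "(\<lambda>k. nr (g k)) \<longlonglongrightarrow> 0"
  shows "nr f = 0"
proof -
  have "(\<lambda>k. c * nr (g k)) \<longlonglongrightarrow> c * 0" by (intro tendsto_intros assms)
  then have "nr f \<le> c * 0" using assms(1) by (intro LIMSEQ_le_const) auto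
  then show ?thesis using nr_nonneg[of f] by simp
qed

text \<open>The square root of \<open>1 - h\<^sup>2\<close> is \<open>1 - v\<close>, where \<open>v\<close> is the fixed point of
  \<open>v \<mapsto> (h\<^sup>2 + v\<^sup>2) / 2\<close>.\<close>

lemma unitary_average:
  assumes compl: "\<And>s. (\<And>e. e > 0 \<Longrightarrow> \<exists>N. \<forall>k\<ge>N. \<forall>l\<ge>N. nr (s k - s l) < e) \<Longrightarrow>
      \<exists>x. (\<lambda>k. nr (s k - x)) \<longlonglongrightarrow> 0"
    and h: "st h = h" "nr h \<le> 1/2"
  obtains u where "nr (st u * u - 1) = 0" "nr (u * st u - 1) = 0" "h = sc (1/2) * (u + st u)"
proof -
  define \<Phi> where "\<Phi> v = sc (1/2) * (h * h + v * v)" for v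
  define v where "v k = (\<Phi> ^^ k) 0" for k
  have v0: "v 0 = 0" and vS: "\<And>k. v (Suc k) = \<Phi> (v k)" by (simp_all add: v_def)
  have hh: "nr (h * h) \<le> 1/4"
    using nr_mult[of h h] mult_mono[OF h(2) h(2)] nr_nonneg[of h] by simp
  \<comment> \<open>All iterates stay in the ball of radius 1/4, because
    \<open>nr (h * h) \<le> 1/4\<close>; on this ball the estimate says that \<open>\<Phi>\<close>
    contracts by the factor 1/4.\<close>
  have diff: "nr (\<Phi> a - \<Phi> b) \<le> (nr a + nr b) / 2 * nr (a - b)" for a b
  proof -
    have "\<Phi> a - \<Phi> b = sc (1/2) * (a * (a - b) + (a - b) * b)"
      by (simp add: \<Phi>_def algebra_simps)
    then have "nr (\<Phi> a - \<Phi> b) = nr (a * (a - b) + (a - b) * b) / 2"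
      by (simp add: nr_sc)
    also have "\<dots> \<le> (nr a * nr (a - b) + nr (a - b) * nr b) / 2"
      using nr_add[of "a * (a - b)" "(a - b) * b"] nr_mult[of a "a - b"] nr_mult[of "a - b" b] by simp
    finally show ?thesis by (simp add: algebra_simps)
  qed
  have bd: "nr (v k) \<le> 1/4" for k
  proof (induction k)
    case (Suc k)
    have "nr (v k * v k) \<le> 1/4 * (1/4)"
      using nr_mult[of "v k" "v k"] mult_mono[OF Suc Suc] nr_nonneg[of "v k"] by simp
    then show ?case
      using nr_add[of "h * h" "v k * v k"] hh by (simp add: vS \<Phi>_def nr_sc)
  qed (simp add: v0)
  have step: "nr (v (k + m) - v k) \<le> (1/4) ^ k" for k m
  proof (induction k)
    case 0
    then show ?case using bd[of m] by (simp add: v0)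
  next
    case (Suc k)
    have "nr (v (Suc k + m) - v (Suc k)) \<le> (nr (v (k + m)) + nr (v k)) / 2 * nr (v (k + m) - v k)"
      using diff[of "v (k + m)" "v k"] by (simp add: vS)
    also have "\<dots> \<le> 1/4 * (1/4) ^ k"
      using bd[of "k + m"] bd[of k] Suc by (intro mult_mono) (auto simp: nr_nonneg)
    finally show ?case by simp
  qed
  have "\<exists>N. \<forall>k\<ge>N. \<forall>l\<ge>N. nr (v k - v l) < e" if e: "e > 0" for e
  proof -
    obtain N where N: "(1/4::real) ^ N < e / 2" using e real_arch_pow_inv[of "e / 2" "1/4"] by auto
    have "nr (v k - v l) < e" if "k \<ge> N" "l \<ge> N" for k l
    proof -
      have "nr (v k - v l) \<le> nr (v k - v N) + nr (v l - v N)"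
        using nr_diff[of "v k - v N" "v l - v N"] by simp
      then show ?thesis using step[of N "k - N"] step[of N "l - N"] that N by simp
    qed
    then show ?thesis by blast
  qed
  then obtain w where w: "(\<lambda>k. nr (v k - w)) \<longlonglongrightarrow> 0" using compl by blast
  have sv: "st (v k) = v k" for k
    by (induction k) (simp_all add: v0 vS \<Phi>_def st_scm st_add st_sq h(1))
  have cv: "v k * h = h * v k" for k
  proof (induction k)
    case (Suc k)
    have "v k * v k * h = h * (v k * v k)" by (simp add: mult.assoc Suc) (simp add: mult.assoc[symmetric] Suc)
    then show ?case by (simp add: vS \<Phi>_def mult.assoc distrib_left distrib_right sc_left[of h])
  qed (simp add: v0)
  define x where "x = sc (1/2) * (w + st w)"
  have sx: "st x = x" by (simp add: x_def st_scm st_add st_st add.commute)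
  have "nr (v k - x) \<le> nr (v k - w)" for k
  proof -
    have "v k - x = sc (1/2) * ((v k - w) + st (v k - w))"
      using sc_half[of "v k"] by (simp add: x_def st_diff sv algebra_simps)
    then show ?thesis using nr_add[of "v k - w" "st (v k - w)"] by (simp add: nr_sc)
  qed
  then have x: "(\<lambda>k. nr (v k - x)) \<longlonglongrightarrow> 0"
    using w by (rule_tac tendsto_sandwich[of "\<lambda>_. 0" _ _ "\<lambda>k. nr (v k - w)"]) (auto simp: nr_nonneg)
  have fp: "nr (x - \<Phi> x) = 0"
  proof -
    have "nr (x - \<Phi> x) \<le> nr (v (Suc k) - x) + (1/4 + nr x) / 2 * nr (v k - x)" for k
    proof -
      have "nr (x - \<Phi> x) \<le> nr (v (Suc k) - x) + nr (\<Phi> (v k) - \<Phi> x)"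
        using nr_diff[of "\<Phi> (v k) - \<Phi> x" "v (Suc k) - x"] by (simp add: vS)
      also have "nr (\<Phi> (v k) - \<Phi> x) \<le> (nr (v k) + nr x) / 2 * nr (v k - x)" by (rule diff)
      also have "\<dots> \<le> (1/4 + nr x) / 2 * nr (v k - x)"
        using bd[of k] by (intro mult_right_mono nr_nonneg) simp
      finally show ?thesis by simp
    qed
    moreover have "(\<lambda>k. nr (v (Suc k) - x) + (1/4 + nr x) / 2 * nr (v k - x)) \<longlonglongrightarrow> 0 + (1/4 + nr x) / 2 * 0"
      by (intro tendsto_intros x LIMSEQ_Suc)
    ultimately have "nr (x - \<Phi> x) \<le> 0 + (1/4 + nr x) / 2 * 0" by (intro LIMSEQ_le_const) auto
    then show ?thesis using nr_nonneg[of "x - \<Phi> x"] by simp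
  qed
  have cm: "nr (x * h - h * x) = 0"
  proof (rule nr_limit_zero[OF _ x])
    fix k
    have "x * h - h * x = h * (v k - x) - (v k - x) * h" by (simp add: algebra_simps cv)
    then have "nr (x * h - h * x) \<le> nr (h * (v k - x)) + nr ((v k - x) * h)" by (simp add: nr_diff)
    also have "\<dots> \<le> nr h * nr (v k - x) + nr (v k - x) * nr h" by (intro add_mono nr_mult)
    finally show "nr (x * h - h * x) \<le> (2 * nr h) * nr (v k - x)" by simp
  qed
  \<comment> \<open>The fixed point equation for \<open>x\<close> reads
    \<open>s * s = 1 - h * h\<close>, so \<open>h + sc \<i> * s\<close> is unitary as soon as
    \<open>h\<close> and \<open>s\<close> commute. Since \<open>nr\<close> is a seminorm, both
    relations hold up to elements of seminorm zero.\<close>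
  define s where "s = 1 - x"
  define u where "u = h + sc \<i> * s"
  have ss: "st s = s" by (simp add: s_def st_diff sx)
  have su: "st u = h - sc \<i> * s" by (simp add: u_def st_add st_scm h ss sc_minus)
  have ii: "sc \<i> * sc \<i> = - 1" by (simp add: sc_mult[symmetric] sc_minus1)
  have ii': "sc \<i> * (sc \<i> * f) = - f" for f by (simp add: mult.assoc[symmetric] ii)
  have sq: "s * s + h * h - 1 = (\<Phi> x - x) + (\<Phi> x - x)"
    using sc_half[of "h * h + x * x"] by (simp add: s_def \<Phi>_def algebra_simps)
  have n1: "nr (s * s + h * h - 1) = 0"
    using nr_add[of "\<Phi> x - x" "\<Phi> x - x"] fp nr_nonneg[of "s * s + h * h - 1"]
    unfolding sq nr_diff_commute[of "\<Phi> x"] by simp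
  have n2: "nr (h * s - s * h) = 0" using cm by (simp add: s_def algebra_simps)
  have e1: "st u * u - 1 = (s * s + h * h - 1) + sc \<i> * (h * s - s * h)"
    unfolding su by (simp add: u_def algebra_simps sc_left[of h] sc_left[of s] ii')
  have e2: "u * st u - 1 = (s * s + h * h - 1) - sc \<i> * (h * s - s * h)"
    unfolding su by (simp add: u_def algebra_simps sc_left[of h] sc_left[of s] ii')
  show ?thesis
  proof
    show "nr (st u * u - 1) = 0"
      unfolding e1 using nr_add[of "s * s + h * h - 1" "sc \<i> * (h * s - s * h)"] n1 n2 nr_nonneg
      by (metis add.right_neutral mult_zero_right nr_sc order_antisym)
    show "nr (u * st u - 1) = 0"
      unfolding e2 using nr_diff[of "s * s + h * h - 1" "sc \<i> * (h * s - s * h)"] n1 n2 nr_nonneg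
      by (metis add.right_neutral mult_zero_right nr_sc order_antisym)
    show "h = sc (1/2) * (u + st u)"
      using sc_half[of h] unfolding su by (simp add: u_def distrib_left)
  qed
qed

definition star_subalg :: "'f set \<Rightarrow> bool" where
  "star_subalg S \<longleftrightarrow> 1 \<in> S \<and> (\<forall>f\<in>S. \<forall>g\<in>S. f + g \<in> S \<and> f * g \<in> S) \<and> (\<forall>a. \<forall>f\<in>S. sc a * f \<in> S) \<and> (\<forall>f\<in>S. st f \<in> S)"

lemma star_subalgD:
  assumes "star_subalg S"
  shows "1 \<in> S" "f \<in> S \<Longrightarrow> g \<in> S \<Longrightarrow> f + g \<in> S" "f \<in> S \<Longrightarrow> g \<in> S \<Longrightarrow> f * g \<in> S"
    "f \<in> S \<Longrightarrow> sc a * f \<in> S" "f \<in> S \<Longrightarrow> st f \<in> S" "sc a \<in> S" "f \<in> S \<Longrightarrow> g \<in> S \<Longrightarrow> f - g \<in> S"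
    "f \<in> S \<Longrightarrow> f ^ n \<in> S"
proof -
  show 0: "1 \<in> S" and 1: "f \<in> S \<Longrightarrow> g \<in> S \<Longrightarrow> f + g \<in> S" and 2: "f \<in> S \<Longrightarrow> g \<in> S \<Longrightarrow> f * g \<in> S"
    and 3: "f \<in> S \<Longrightarrow> sc a * f \<in> S" and "f \<in> S \<Longrightarrow> st f \<in> S" for f g a
    using assms unfolding star_subalg_def by auto
  show "sc a \<in> S" using 3[OF 0, of a] by simp
  show "f \<in> S \<Longrightarrow> g \<in> S \<Longrightarrow> f - g \<in> S" using 1[of f "- g"] 3[of g "- 1"] by (simp add: sc_minus1)
  show "f \<in> S \<Longrightarrow> f ^ n \<in> S" by (induction n) (auto intro: 0 2)
qed

text \<open>A Neumann series around a far away point \<open>m\<close> of the positive real axis: with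
  \<open>q = (m - i p) / (1 + m)\<close> one has \<open>1 + i p = (1 + m) (1 - q)\<close>, and \<open>\<parallel>m - i p\<parallel>\<^sup>2 \<le> m\<^sup>2 + \<parallel>p\<parallel>\<^sup>2\<close>
  makes the bound on the inverse independent of \<open>p\<close>.\<close>

lemma approximate_resolvent:
  assumes S: "star_subalg S" and p: "p \<in> S" "st p = p" and e: "e > 0"
  obtains r where "r \<in> S" "nr r \<le> 2" "nr ((1 + sc \<i> * p) * r - 1) < e" "nr (r * (1 + sc \<i> * p) - 1) < e"
proof -
  \<comment> \<open>With this choice the norm of \<open>m - i p\<close> is at most
    \<open>sqrt (m\<^sup>2 + m) \<le> m + 1/2\<close>. The gap of at least 1/2 to
    \<open>1 + m\<close> gives both \<open>c < 1\<close> and the final bound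
    \<open>nr r \<le> 2\<close>.\<close>
  define m where "m = (nr p)\<^sup>2"
  define c where "c = sqrt (m\<^sup>2 + m) / (1 + m)"
  define \<mu> where "\<mu> = 1 + m"
  define \<kappa> where "\<kappa> = 1 / \<mu>"
  define q where "q = sc (of_real \<kappa>) * (sc (of_real m) - sc \<i> * p)"
  have m0: "0 \<le> m" by (simp add: m_def)
  then have m1: "0 < \<mu>" by (simp add: \<mu>_def)
  then have k0: "0 < \<kappa>" and km: "\<mu> * \<kappa> = 1" by (simp_all add: \<kappa>_def)
  have qS: "q \<in> S" unfolding q_def by (intro star_subalgD[OF S] p)
  have sm: "sqrt (m\<^sup>2 + m) \<le> m + 1/2"
    using m0 by (intro real_le_lsqrt) (auto simp: power2_eq_square algebra_simps)
  have c0: "0 \<le> c" using m0 by (simp add: c_def)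
  have c1: "c < 1" using m0 sm by (simp add: c_def)
  have ii: "sc \<i> * (sc \<i> * f) = - f" for f
    by (simp add: mult.assoc[symmetric] sc_mult[symmetric] sc_minus1)
  have "st (sc (of_real m) - sc \<i> * p) * (sc (of_real m) - sc \<i> * p) = sc (of_real m) * sc (of_real m) + p * p"
  proof -
    have "p * sc (of_real m) = sc (of_real m) * p" by (rule sc_comm)
    moreover have "sc (of_real m) * (sc \<i> * p) = sc \<i> * (sc (of_real m) * p)" by (rule sc_left)
    ultimately show ?thesis
      by (simp add: st_diff st_sc st_scm p sc_minus algebra_simps sc_left[of p] ii)
  qed
  then have "(nr (sc (of_real m) - sc \<i> * p))\<^sup>2 = nr (sc (of_real m) * sc (of_real m) + p * p)"
    by (simp only: nr_cstar[symmetric])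
  also have "\<dots> \<le> m * m + nr p * nr p"
    using nr_add[of "sc (of_real m) * sc (of_real m)" "p * p"] nr_mult[of p p] m0
      nr_sc1[of "of_real m * of_real m"] by (simp add: sc_mult norm_mult)
  finally have "nr (sc (of_real m) - sc \<i> * p) \<le> sqrt (m\<^sup>2 + m)"
    by (intro real_le_rsqrt) (simp add: m_def power2_eq_square)
  then have "\<kappa> * nr (sc (of_real m) - sc \<i> * p) \<le> \<kappa> * sqrt (m\<^sup>2 + m)"
    using k0 by simp
  moreover have "nr q = \<kappa> * nr (sc (of_real m) - sc \<i> * p)" using k0 by (simp add: q_def nr_sc)
  moreover have "\<kappa> * sqrt (m\<^sup>2 + m) = c" by (simp add: c_def \<kappa>_def \<mu>_def)
  ultimately have qc: "nr q \<le> c" by simp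
  define R where "R J = (\<Sum>j<J. q ^ j)" for J :: nat
  have R1: "(1 - q) * R J = 1 - q ^ J" for J
    unfolding R_def by (induction J) (simp_all add: distrib_left left_diff_distrib)
  have R2: "R J * (1 - q) = 1 - q ^ J" for J
    unfolding R_def by (induction J) (simp_all add: distrib_right right_diff_distrib power_commutes, simp add: algebra_simps)
  have RS: "R J \<in> S" for J
    unfolding R_def
  proof (induction J)
    case 0
    show ?case using star_subalgD(6)[OF S, of 0] by simp
  next
    case (Suc J)
    then show ?case using star_subalgD(2,8)[OF S] qS by simp
  qed
  have nq: "nr (q ^ J) \<le> c ^ J" for J
    by (rule order_trans[OF nr_power]) (intro power_mono qc nr_nonneg)
  have nR: "nr (R J) \<le> 1 / (1 - c)" for J
  proof -
    have "nr (R J) \<le> (\<Sum>j<J. c ^ j)"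
      unfolding R_def
    proof (induction J)
      case (Suc J)
      then show ?case using nr_add[of "\<Sum>j<J. q ^ j" "q ^ J"] nq[of J] by simp
    qed simp
    also have "\<dots> = (1 - c ^ J) / (1 - c)" using c1 by (simp add: sum_gp_strict)
    also have "\<dots> \<le> 1 / (1 - c)" using c0 c1 by (intro divide_right_mono) auto
    finally show ?thesis .
  qed
  have one: "sc (of_real \<mu>) * sc (of_real \<kappa>) = 1"
    by (simp only: sc_mult[symmetric] of_real_mult[symmetric] km of_real_1 sc_1)
  have eq: "1 + sc \<i> * p = sc (of_real \<mu>) * (1 - q)"
  proof -
    have "sc (of_real \<mu>) * q = sc (of_real m) - sc \<i> * p"
      unfolding q_def mult.assoc[symmetric] one by simp
    then show ?thesis by (simp add: right_diff_distrib \<mu>_def sc_add sc_1)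
  qed
  \<comment> \<open>\<open>S\<close> need not be closed, so the series is cut off: a finite partial
    sum stays in \<open>S\<close> and inverts up to \<open>e\<close>.\<close>
  obtain J where J: "c ^ J < e" using real_arch_pow_inv[OF e c1] by blast
  define r where "r = sc (of_real \<kappa>) * R J"
  have l: "(1 + sc \<i> * p) * r = 1 - q ^ J"
  proof -
    have "(1 + sc \<i> * p) * r = (sc (of_real \<mu>) * sc (of_real \<kappa>)) * ((1 - q) * R J)"
      unfolding eq r_def by (simp only: mult.assoc sc_left[of "1 - q"])
    then show ?thesis by (simp only: one R1 mult_1_left)
  qed
  have l': "r * (1 + sc \<i> * p) = 1 - q ^ J"
  proof -
    have "r * (1 + sc \<i> * p) = (sc (of_real \<mu>) * sc (of_real \<kappa>)) * (R J * (1 - q))"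
      unfolding eq r_def by (simp only: mult.assoc sc_left[of "R J"] sc_left[of "sc (of_real \<kappa>)"])
    then show ?thesis by (simp only: one R2 mult_1_left)
  qed
  show ?thesis
  proof
    show "r \<in> S" unfolding r_def by (intro star_subalgD[OF S] RS)
    have "nr r = \<kappa> * nr (R J)" using k0 by (simp add: r_def nr_sc)
    also have "\<dots> \<le> \<kappa> * (1 / (1 - c))" using k0 by (intro mult_left_mono nR) simp
    also have "\<dots> = 1 / (\<mu> * (1 - c))" by (simp add: \<kappa>_def)
    also have "\<mu> * (1 - c) = \<mu> - sqrt (m\<^sup>2 + m)"
      using m1 by (simp add: c_def \<mu>_def right_diff_distrib)
    also have "1 / (\<mu> - sqrt (m\<^sup>2 + m)) \<le> 1 / (1/2)"
      using sm by (intro divide_left_mono) (auto simp: \<mu>_def)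
    finally show "nr r \<le> 2" by simp
    show "nr ((1 + sc \<i> * p) * r - 1) < e" "nr (r * (1 + sc \<i> * p) - 1) < e"
      unfolding l l' using nq[of J] J by simp_all
  qed
qed

text \<open>As \<open>S\<close> need not be closed, the orthogonal projection of \<open>x\<close>
  onto it is replaced by a minimising sequence. If \<open>p k\<close> misses the infimum of the
  squared distances by at most \<open>(1 / Suc k)\<^sup>2\<close>, then moving \<open>p k\<close> in
  the direction of any \<open>a\<close> in \<open>S\<close> gains little, which by the discriminant
  bound is near orthogonality of \<open>x - p k\<close> to \<open>S\<close>. Applied to
  \<open>p j - p k\<close> this yields the Cauchy estimate. Averaging with the adjoint makes
  \<open>p k\<close> self-adjoint without increasing the distance to \<open>x\<close>.\<close>

lemma best_approximation:
  assumes S: "star_subalg S" and x: "st x = x"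
  obtains p where "\<And>k. p k \<in> S" "\<And>k. st (p k) = p k"
    "\<And>k a. a \<in> S \<Longrightarrow> cmod (t (a * (x - p k))) \<le> n2 a / real (Suc k)"
    "\<And>j k. n2 (p j - p k) \<le> 1 / real (Suc j) + 1 / real (Suc k)"
proof -
  define D where "D = (INF a\<in>S. (n2 (x - a))\<^sup>2)"
  have ne: "S \<noteq> {}" using star_subalgD(1)[OF S] by blast
  have bb: "bdd_below ((\<lambda>a. (n2 (x - a))\<^sup>2) ` S)" by (intro bdd_belowI2[of _ 0]) simp
  have D: "D \<le> (n2 (x - a))\<^sup>2" if "a \<in> S" for a
    unfolding D_def by (rule cINF_lower[OF bb that])
  have "\<exists>a\<in>S. (n2 (x - a))\<^sup>2 < D + (1 / real (Suc k))\<^sup>2" for k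
  proof (rule ccontr)
    assume "\<not> ?thesis"
    then have "D + (1 / real (Suc k))\<^sup>2 \<le> D"
      unfolding D_def by (intro cINF_greatest[OF ne]) (auto simp: not_less D_def)
    then show False by simp
  qed
  then obtain a where a: "\<And>k. a k \<in> S" "\<And>k. (n2 (x - a k))\<^sup>2 < D + (1 / real (Suc k))\<^sup>2" by metis
  define p where "p k = sc (1/2) * (a k + st (a k))" for k
  have pS: "p k \<in> S" for k unfolding p_def by (intro star_subalgD[OF S] a)
  have ps: "st (p k) = p k" for k by (simp add: p_def st_scm st_add st_st add.commute)
  have pn: "(n2 (x - p k))\<^sup>2 - D \<le> (1 / real (Suc k))\<^sup>2" for k
  proof -
    have "x - p k = sc (1/2) * ((x - a k) + st (x - a k))"
      using sc_half[of x] by (simp add: p_def st_diff x algebra_simps)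
    then have "n2 (x - p k) \<le> n2 (x - a k)"
      using n2_add[of "x - a k" "st (x - a k)"] by (simp add: n2_sc)
    then have "(n2 (x - p k))\<^sup>2 \<le> (n2 (x - a k))\<^sup>2" by (intro power_mono) auto
    then show ?thesis using a(2)[of k] by linarith
  qed
  have orth: "cmod (t (b * (x - p k))) \<le> n2 b / real (Suc k)" if b: "b \<in> S" for b k
  proof -
    define y where "y = x - p k"
    define q where "q = st b"
    define z where "z = t (st y * q)"
    have zz: "cmod (t (b * y)) = cmod z"
      using t_st[of "b * y"] by (simp add: z_def q_def st_mult)
    have "0 \<le> ((n2 y)\<^sup>2 - D) - 2 * s * (cmod z)\<^sup>2 + s\<^sup>2 * (cmod z)\<^sup>2 * (n2 q)\<^sup>2" for s :: real
    proof -
      define c where "c = - of_real s * cnj z"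
      have "p k + sc (- c) * q \<in> S" unfolding q_def by (intro star_subalgD[OF S] pS b)
      then have "D \<le> (n2 (x - (p k + sc (- c) * q)))\<^sup>2" by (rule D)
      also have "x - (p k + sc (- c) * q) = y + sc c * q" by (simp add: y_def sc_minus)
      also have "(n2 (y + sc c * q))\<^sup>2 = (n2 y)\<^sup>2 + 2 * Re (c * z) + (cmod c)\<^sup>2 * (n2 q)\<^sup>2"
        unfolding n2_add_sc z_def ..
      also have "Re (c * z) = - s * (cmod z)\<^sup>2"
        unfolding cmod_power2 c_def by (simp add: power2_eq_square algebra_simps)
      finally show ?thesis by (simp add: c_def norm_mult power_mult_distrib)
    qed
    then have "(cmod z)\<^sup>2 \<le> ((n2 y)\<^sup>2 - D) * (n2 q)\<^sup>2"
      by (rule quadratic_discriminant_bound) simp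
    also have "\<dots> \<le> (1 / real (Suc k))\<^sup>2 * (n2 q)\<^sup>2"
      unfolding y_def by (intro mult_right_mono pn) simp
    also have "\<dots> = (n2 b / real (Suc k))\<^sup>2" by (simp add: q_def power_divide)
    finally have "cmod z \<le> n2 b / real (Suc k)" by (rule power2_le_imp_le) simp
    then show ?thesis by (simp add: zz[unfolded y_def] y_def)
  qed
  have "n2 (p j - p k) \<le> 1 / real (Suc j) + 1 / real (Suc k)" for j k
  proof -
    define d where "d = p j - p k"
    have dS: "d \<in> S" unfolding d_def by (intro star_subalgD[OF S] pS)
    have "t (st d * d) = t (d * (x - p k)) - t (d * (x - p j))"
      unfolding t_diff[symmetric] by (simp add: d_def st_diff ps algebra_simps)
    then have "cmod (t (st d * d)) \<le> n2 d / real (Suc k) + n2 d / real (Suc j)"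
      using norm_triangle_ineq4[of "t (d * (x - p k))" "t (d * (x - p j))"]
        orth[OF dS, of k] orth[OF dS, of j] by simp
    then have "n2 d * n2 d \<le> n2 d * (1 / real (Suc j) + 1 / real (Suc k))"
      unfolding t_n2 by (simp add: power2_eq_square norm_mult distrib_left del: of_nat_Suc)
    then show ?thesis
      unfolding d_def[symmetric] using n2_nonneg[of d] by (cases "n2 d = 0") auto
  qed
  with pS ps orth show ?thesis using that by blast
qed

end

section \<open>Density in the 2-norm\<close>

context tracial_limits
begin

text \<open>The approximations \<open>p k\<close> are Cauchy in \<open>n2\<close> but not bounded in
  \<open>nr\<close>, so they may have no limit in the algebra. Their approximate resolvents
  \<open>r k\<close>, inverting \<open>1 + i s p k\<close>, are bounded by 2 and still Cauchy, hence
  converge to some \<open>R\<close>. As \<open>x - p k\<close> is almost orthogonal to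
  \<open>S\<close> and \<open>S\<close> is closed under products, \<open>(1 + i s x) R - 1\<close>
  is orthogonal to \<open>S\<close>, so \<open>orth\<close> makes it null: \<open>R\<close> is the
  resolvent of \<open>x\<close> itself. Finally \<open>(1 - R) / (i s)\<close> differs from
  \<open>x\<close> by a term of order \<open>s\<close>, and \<open>(1 - r k) / (i s)\<close> is an
  element of \<open>S\<close> close to it.\<close>

lemma density_sa:
  assumes S: "star_subalg S" and x: "st x = x" and e: "e > 0"
    and orth: "\<And>b. (\<And>a. a \<in> S \<Longrightarrow> t (a * b) = 0) \<Longrightarrow> n2 b = 0"
    and U: "\<And>N. eventually (\<lambda>n. n \<ge> N) U"
  shows "\<exists>a\<in>S. n2 (x - a) < e"
proof -
  obtain p where pS: "\<And>k. p k \<in> S" and ps: "\<And>k. st (p k) = p k"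
    and po: "\<And>k a. a \<in> S \<Longrightarrow> cmod (t (a * (x - p k))) \<le> n2 a / real (Suc k)"
    and pc: "\<And>j k. n2 (p j - p k) \<le> 1 / real (Suc j) + 1 / real (Suc k)"
    using best_approximation[OF S x] by blast
  \<comment> \<open>The final error is at most \<open>s * (nr x)\<^sup>2 * n2 R\<close> with
    \<open>n2 R \<le> 2 * n2 1\<close>; the cap at 1 lets \<open>s\<close> be dropped from the other
    estimates.\<close>
  define s where "s = min 1 (e / (2 * (2 * (nr x)\<^sup>2 * n2 1 + 1)))"
  have pos: "2 * (nr x)\<^sup>2 * n2 1 + 1 > 0" by (intro add_nonneg_pos mult_nonneg_nonneg) auto
  have s0: "s > 0" using e pos by (simp add: s_def)
  have se: "s * (2 * (nr x)\<^sup>2 * n2 1) \<le> e / 2"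
  proof -
    have "s * (2 * (nr x)\<^sup>2 * n2 1) \<le> s * (2 * (nr x)\<^sup>2 * n2 1 + 1)" using s0 by simp
    also have "\<dots> \<le> e / (2 * (2 * (nr x)\<^sup>2 * n2 1 + 1)) * (2 * (nr x)\<^sup>2 * n2 1 + 1)"
      using pos by (intro mult_right_mono) (auto simp: s_def)
    also have "\<dots> = e / 2" using pos by (simp add: field_simps)
    finally show ?thesis .
  qed
  let ?s = "sc (of_real s)"
  let ?R = "\<lambda>y. 1 + sc \<i> * (?s * y)"
  have "\<exists>r. r \<in> S \<and> nr r \<le> 2 \<and> nr (?R (p k) * r - 1) < 1 / real (Suc k) \<and> nr (r * ?R (p k) - 1) < 1 / real (Suc k)" for k
  proof -
    have "?s * p k \<in> S" "st (?s * p k) = ?s * p k"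
      using star_subalgD(4)[OF S pS] by (simp_all add: st_scm ps)
    from approximate_resolvent[OF S this, of "1 / real (Suc k)"] show ?thesis by auto
  qed
  then obtain r where rS: "\<And>k. r k \<in> S" and r2: "\<And>k. nr (r k) \<le> 2"
    and rl: "\<And>k. nr (?R (p k) * r k - 1) < 1 / real (Suc k)"
    and rr: "\<And>k. nr (r k * ?R (p k) - 1) < 1 / real (Suc k)" by metis
  have i0: "(\<lambda>k. 1 / real (Suc k)) \<longlonglongrightarrow> 0"
    using LIMSEQ_inverse_real_of_nat by (simp add: inverse_eq_divide)
  have s1: "s \<le> 1" by (simp add: s_def)
  have cauchy: "n2 (r j - r k) \<le> (4 + 2 * n2 1) * (1 / real (Suc j) + 1 / real (Suc k))" for j k
  proof -
    \<comment> \<open>The resolvent identity, corrected by the defects of the approximate inverses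
      \<open>r j\<close> and \<open>r k\<close>.\<close>
    have "r j - r k = r j * (sc \<i> * (?s * (p k - p j))) * r k - r j * (?R (p k) * r k - 1) + (r j * ?R (p j) - 1) * r k"
      by (simp add: algebra_simps)
    then have "n2 (r j - r k) \<le> n2 (r j * (sc \<i> * (?s * (p k - p j))) * r k)
        + n2 (r j * (?R (p k) * r k - 1)) + n2 ((r j * ?R (p j) - 1) * r k)"
      using n2_add[of "r j * (sc \<i> * (?s * (p k - p j))) * r k - r j * (?R (p k) * r k - 1)" "(r j * ?R (p j) - 1) * r k"]
        n2_diff[of "r j * (sc \<i> * (?s * (p k - p j))) * r k" "r j * (?R (p k) * r k - 1)"] by simp
    also have "n2 (r j * (sc \<i> * (?s * (p k - p j))) * r k) \<le> 4 * (1 / real (Suc j) + 1 / real (Suc k))"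
    proof -
      have "n2 (r j * (sc \<i> * (?s * (p k - p j))) * r k) \<le> n2 (r j * (sc \<i> * (?s * (p k - p j)))) * nr (r k)"
        by (rule n2_mult_right)
      also have "\<dots> \<le> (nr (r j) * (s * n2 (p k - p j))) * nr (r k)"
        using n2_mult_left[of "r j" "sc \<i> * (?s * (p k - p j))"] s0
        by (intro mult_right_mono nr_nonneg) (simp add: n2_sc)
      also have "\<dots> \<le> (2 * (1 * (1 / real (Suc j) + 1 / real (Suc k)))) * 2"
        using pc[of k j] s0 s1 r2 by (intro mult_mono) (auto simp: nr_nonneg add.commute)
      finally show ?thesis by simp
    qed
    also have "n2 (r j * (?R (p k) * r k - 1)) \<le> 2 * (1 / real (Suc k) * n2 1)"
      using rl[of k] r2
      by (intro order_trans[OF n2_mult_left] mult_mono order_trans[OF n2_1_le] mult_right_mono) (auto simp: nr_nonneg)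
    also have "n2 ((r j * ?R (p j) - 1) * r k) \<le> (1 / real (Suc j) * n2 1) * 2"
      using rr[of j] r2
      by (intro order_trans[OF n2_mult_right] mult_mono order_trans[OF n2_1_le] mult_right_mono) (auto simp: nr_nonneg)
    finally show ?thesis by (simp add: algebra_simps)
  qed
  have "\<exists>N. \<forall>i\<ge>N. \<forall>j\<ge>N. n2 (r i - r j) < d" if d: "d > 0" for d
  proof -
    have "(\<lambda>k. (4 + 2 * n2 1) * (1 / real (Suc k))) \<longlonglongrightarrow> (4 + 2 * n2 1) * 0"
      by (intro tendsto_intros i0)
    then have "eventually (\<lambda>k. (4 + 2 * n2 1) * (1 / real (Suc k)) < d / 2) sequentially"
      using d by (intro order_tendstoD) auto
    then obtain N where N: "\<And>k. k \<ge> N \<Longrightarrow> (4 + 2 * n2 1) * (1 / real (Suc k)) < d / 2"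
      unfolding eventually_sequentially by blast
    have "n2 (r i - r j) < d" if "i \<ge> N" "j \<ge> N" for i j
      using cauchy[of i j] N[OF that(1)] N[OF that(2)] unfolding distrib_left by linarith
    then show ?thesis by blast
  qed
  then obtain R where R: "(\<lambda>k. n2 (r k - R)) \<longlonglongrightarrow> 0"
    using bounded_complete_n2[of r 2, OF r2 _ U] by blast
  define \<nu> where "\<nu> = ?R x * R - 1"
  have nu: "n2 \<nu> = 0"
  proof (rule orth)
    fix b assume b: "b \<in> S"
    have "cmod (t (b * \<nu>)) \<le> n2 (b * ?R x) * n2 (r k - R) + (2 * n2 b + n2 b * n2 1) * (1 / real (Suc k))" for k
    proof -
      have "b * \<nu> = sc \<i> * (?s * (b * (x - p k) * r k)) + b * (?R (p k) * r k - 1) - (b * ?R x) * (r k - R)"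
        by (simp add: \<nu>_def algebra_simps sc_left[of b] sc_left[of x])
      then have "t (b * \<nu>) = \<i> * (of_real s * t (b * (x - p k) * r k)) + t (b * (?R (p k) * r k - 1)) - t ((b * ?R x) * (r k - R))"
        by (simp add: t_diff t_add t_sc)
      then have "cmod (t (b * \<nu>)) \<le> cmod (\<i> * (of_real s * t (b * (x - p k) * r k)))
          + cmod (t (b * (?R (p k) * r k - 1))) + cmod (t ((b * ?R x) * (r k - R)))"
        by (metis norm_triangle_ineq norm_triangle_ineq4 add_right_mono order_trans)
      also have "cmod (\<i> * (of_real s * t (b * (x - p k) * r k))) \<le> 1 * (2 * n2 b * (1 / real (Suc k)))"
      proof -
        \<comment> \<open>By the trace property the factor \<open>x - p k\<close> is paired with
          \<open>r k * b\<close>, an element of \<open>S\<close>, to which it is almost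
          orthogonal.\<close>
        have "t (b * (x - p k) * r k) = t ((r k * b) * (x - p k))"
          using t_comm[of "b * (x - p k)" "r k"] by (simp add: mult.assoc)
        then have "cmod (t (b * (x - p k) * r k)) \<le> n2 (r k * b) / real (Suc k)"
          using po[OF star_subalgD(3)[OF S rS b]] by simp
        also have "\<dots> \<le> (2 * n2 b) / real (Suc k)"
          using order_trans[OF n2_mult_left mult_right_mono[OF r2 n2_nonneg]] by (intro divide_right_mono) auto
        finally have "s * cmod (t (b * (x - p k) * r k)) \<le> 1 * (2 * n2 b / real (Suc k))"
          using s0 s1 by (intro mult_mono) auto
        then show ?thesis using s0 by (simp add: norm_mult)
      qed
      also have "cmod (t (b * (?R (p k) * r k - 1))) \<le> n2 b * (1 / real (Suc k) * n2 1)"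
        using rl[of k]
        by (intro order_trans[OF t_mult_le] mult_left_mono order_trans[OF n2_1_le] mult_right_mono) auto
      also have "cmod (t ((b * ?R x) * (r k - R))) \<le> n2 (b * ?R x) * n2 (r k - R)" by (rule t_mult_le)
      finally show ?thesis by (simp add: algebra_simps)
    qed
    moreover have "(\<lambda>k. n2 (b * ?R x) * n2 (r k - R) + (2 * n2 b + n2 b * n2 1) * (1 / real (Suc k)))
        \<longlonglongrightarrow> n2 (b * ?R x) * 0 + (2 * n2 b + n2 b * n2 1) * 0"
      by (intro tendsto_intros R i0)
    ultimately have "cmod (t (b * \<nu>)) \<le> n2 (b * ?R x) * 0 + (2 * n2 b + n2 b * n2 1) * 0"
      by (intro LIMSEQ_le_const) auto
    then show "t (b * \<nu>) = 0" by simp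
  qed
  have nR: "n2 R \<le> 2 * n2 1"
  proof -
    have "n2 R \<le> 2 * n2 1 + n2 (r k - R)" for k
      using n2_diff[of "r k" "r k - R"] n2_1_le[of "r k"] mult_right_mono[OF r2[of k] n2_nonneg[of 1]] by simp
    moreover have "(\<lambda>k. 2 * n2 1 + n2 (r k - R)) \<longlonglongrightarrow> 2 * n2 1 + 0" by (intro tendsto_intros R)
    ultimately have "n2 R \<le> 2 * n2 1 + 0" by (intro LIMSEQ_le_const) auto
    then show ?thesis by simp
  qed
  let ?c = "sc (1 / (\<i> * of_real s))"
  have cs: "?c * (sc \<i> * (?s * f)) = f" for f
    using s0 by (simp add: mult.assoc[symmetric] sc_mult[symmetric] sc_1)
  have id1: "1 - R = sc \<i> * (?s * (x * R)) - \<nu>" by (simp add: \<nu>_def distrib_right mult.assoc)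
  have "x - ?c * (1 - R) = x * (1 - R) + ?c * \<nu>"
    unfolding id1 right_diff_distrib[of ?c] cs by (simp add: id1[symmetric] algebra_simps)
  also have "x * (1 - R) = sc \<i> * (?s * (x * (x * R))) - x * \<nu>"
    unfolding id1 by (simp add: right_diff_distrib sc_left[of x])
  finally have "n2 (x - ?c * (1 - R)) \<le> n2 (sc \<i> * (?s * (x * (x * R)))) + n2 (x * \<nu>) + n2 (?c * \<nu>)"
    using n2_add[of "sc \<i> * (?s * (x * (x * R))) - x * \<nu>" "?c * \<nu>"] n2_diff[of "sc \<i> * (?s * (x * (x * R)))" "x * \<nu>"] by simp
  also have "n2 (x * \<nu>) = 0" using n2_mult_left[of x \<nu>] nu n2_nonneg[of "x * \<nu>"] by simp
  also have "n2 (?c * \<nu>) = 0" by (simp add: n2_sc nu)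
  also have "n2 (sc \<i> * (?s * (x * (x * R)))) \<le> s * (nr x * (nr x * (2 * n2 1)))"
    unfolding n2_sc using s0
    by (auto intro!: mult_left_mono order_trans[OF n2_mult_left] nR nr_nonneg)
  also have "s * (nr x * (nr x * (2 * n2 1))) \<le> e / 2" using se by (simp add: power2_eq_square mult_ac)
  finally have fin: "n2 (x - ?c * (1 - R)) \<le> e / 2" by simp
  have "(\<lambda>k. cmod (1 / (\<i> * of_real s)) * n2 (r k - R)) \<longlonglongrightarrow> cmod (1 / (\<i> * of_real s)) * 0"
    by (intro tendsto_intros R)
  then have "eventually (\<lambda>k. cmod (1 / (\<i> * of_real s)) * n2 (r k - R) < e / 2) sequentially"
    using e by (intro order_tendstoD) auto
  then obtain k where k: "cmod (1 / (\<i> * of_real s)) * n2 (r k - R) < e / 2"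
    unfolding eventually_sequentially by blast
  have "?c * (1 - R) - ?c * (1 - r k) = ?c * (r k - R)" by (simp add: algebra_simps)
  then have "n2 (x - ?c * (1 - r k)) \<le> n2 (x - ?c * (1 - R)) + n2 (?c * (r k - R))"
    using n2_triangle[of x "?c * (1 - r k)" "?c * (1 - R)"] by simp
  also have "\<dots> < e" using fin k by (simp add: n2_sc)
  finally have "n2 (x - ?c * (1 - r k)) < e" .
  moreover have "?c * (1 - r k) \<in> S" by (intro star_subalgD[OF S] rS)
  ultimately show ?thesis by blast
qed

lemma density:
  assumes S: "star_subalg S" and e: "e > 0"
    and orth: "\<And>b. (\<And>a. a \<in> S \<Longrightarrow> t (a * b) = 0) \<Longrightarrow> n2 b = 0"
    and U: "\<And>N. eventually (\<lambda>n. n \<ge> N) U"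
  shows "\<exists>a\<in>S. n2 (x - a) < e"
proof -
  obtain y z where x: "x = y + sc \<i> * z" "st y = y" "st z = z" using real_imaginary_parts[of x] by metis
  obtain a where a: "a \<in> S" "n2 (y - a) < e / 2" using density_sa[OF S x(2) _ orth U, of "e / 2"] e by auto
  obtain b where b: "b \<in> S" "n2 (z - b) < e / 2" using density_sa[OF S x(3) _ orth U, of "e / 2"] e by auto
  have e: "x - (a + sc \<i> * b) = (y - a) + sc \<i> * (z - b)" by (simp add: x(1) algebra_simps)
  have "n2 (x - (a + sc \<i> * b)) \<le> n2 (y - a) + n2 (z - b)"
    unfolding e using n2_add[of "y - a" "sc \<i> * (z - b)"] by (simp add: n2_sc)
  then have "n2 (x - (a + sc \<i> * b)) < e" using a b by simp
  moreover have "a + sc \<i> * b \<in> S" by (intro star_subalgD[OF S] a b)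
  ultimately show ?thesis by blast
qed

end

section \<open>Evaluation of *-polynomials\<close>

text \<open>The convolution product on finitely supported families wants an additively written
  monoid of exponents; with concatenation of words, \<open>ncpoly\<close> becomes the free
  *-algebra.\<close>

instantiation list :: (type) monoid_add
begin
definition zero_list :: "'a list" where "zero_list = []"
definition plus_list :: "'a list \<Rightarrow> 'a list \<Rightarrow> 'a list" where "plus_list = (@)"
instance by standard (simp_all add: zero_list_def plus_list_def)
end

lemma poly_mapping_add_induct [case_names zero single add]:
  assumes "P 0" "\<And>k c. P (Poly_Mapping.single k c)" "\<And>p q. P p \<Longrightarrow> P q \<Longrightarrow> P (p + q)"
  shows "P (p :: 'k \<Rightarrow>\<^sub>0 'c::comm_monoid_add)"
proof (induction p rule: update_induct)
  case const
  show ?case by (rule assms)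
next
  case (update f a b)
  have "Poly_Mapping.update a b f = f + Poly_Mapping.single a b"
    using update by (intro poly_mapping_eqI)
      (auto simp: lookup_add lookup_single lookup_update not_in_keys_iff_lookup_eq_zero when_def)
  then show ?case using assms update by simp
qed

definition word_star :: "('k \<times> bool) list \<Rightarrow> ('k \<times> bool) list" where
  "word_star w = rev (map (\<lambda>(k, s). (k, \<not> s)) w)"

lemma word_star_star [simp]: "word_star (word_star w) = w"
  by (simp add: word_star_def rev_map o_def case_prod_beta)

lemma word_star_append: "word_star (u @ v) = word_star v @ word_star u"
  by (simp add: word_star_def)

lemma word_star_eq_iff: "word_star u = v \<longleftrightarrow> u = word_star v"
  by auto

lemma letters_word_star: "fst ` set (word_star w) = fst ` set w"
  by (auto simp: word_star_def image_iff split: prod.splits) force+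

definition poly_star :: "'k ncpoly \<Rightarrow> 'k ncpoly" where
  "poly_star p = Abs_poly_mapping (\<lambda>w. cnj (Poly_Mapping.lookup p (word_star w)))"

lemma lookup_poly_star: "Poly_Mapping.lookup (poly_star p) w = cnj (Poly_Mapping.lookup p (word_star w))"
proof -
  have "{w. cnj (Poly_Mapping.lookup p (word_star w)) \<noteq> 0} \<subseteq> word_star ` Poly_Mapping.keys p"
  proof
    fix w assume "w \<in> {w. cnj (Poly_Mapping.lookup p (word_star w)) \<noteq> 0}"
    then show "w \<in> word_star ` Poly_Mapping.keys p"
      by (intro image_eqI[of _ _ "word_star w"]) (simp_all add: in_keys_iff)
  qed
  then have "finite {w. cnj (Poly_Mapping.lookup p (word_star w)) \<noteq> 0}"
    by (rule finite_subset) simp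
  then show ?thesis by (simp add: poly_star_def)
qed

lemma poly_star_zero [simp]: "poly_star 0 = 0"
  by (intro poly_mapping_eqI) (simp add: lookup_poly_star)

lemma poly_star_add: "poly_star (p + q) = poly_star p + poly_star q"
  by (intro poly_mapping_eqI) (simp add: lookup_poly_star lookup_add)

lemma poly_star_single: "poly_star (Poly_Mapping.single w c) = Poly_Mapping.single (word_star w) (cnj c)"
  by (intro poly_mapping_eqI) (auto simp: lookup_poly_star lookup_single when_def word_star_eq_iff)

lemma poly_star_star: "poly_star (poly_star p) = p"
  by (intro poly_mapping_eqI) (simp add: lookup_poly_star)

lemma poly_star_mult: "poly_star (p * q) = poly_star q * poly_star p"
proof (induction p rule: poly_mapping_add_induct)
  case (single u c)
  show ?case
  proof (induction q rule: poly_mapping_add_induct)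
    case (single v d)
    show ?case by (simp add: mult_single poly_star_single plus_list_def word_star_append mult.commute)
  qed (simp_all add: poly_star_add algebra_simps)
qed (simp_all add: poly_star_add algebra_simps)

abbreviation const_poly :: "complex \<Rightarrow> 'k ncpoly" where
  "const_poly c \<equiv> Poly_Mapping.single 0 c"

abbreviation var_poly :: "'k \<Rightarrow> 'k ncpoly" where
  "var_poly k \<equiv> Poly_Mapping.single [(k, False)] 1"

lemma const_poly_commute: "p * const_poly c = const_poly c * p"
  by (induction p rule: poly_mapping_add_induct) (simp_all add: mult_single algebra_simps)

lemma ncpolys_single [simp]: "fst ` set w \<subseteq> K \<Longrightarrow> Poly_Mapping.single w c \<in> ncpolys K"
  by (auto simp: ncpolys_def)

lemma ncpolys_zero [simp]: "0 \<in> ncpolys K"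
  by (simp add: ncpolys_def)

lemma ncpolys_one [simp]: "1 \<in> ncpolys K"
  using ncpolys_single[of "[]" K 1] by (simp flip: single_one add: zero_list_def)

lemma ncpolys_const [simp]: "const_poly c \<in> ncpolys K"
  by (simp add: zero_list_def)

lemma ncpolys_add: "p \<in> ncpolys K \<Longrightarrow> q \<in> ncpolys K \<Longrightarrow> p + q \<in> ncpolys K"
  using Poly_Mapping.keys_add[of p q] unfolding ncpolys_def by blast

lemma ncpolys_mult: "p \<in> ncpolys K \<Longrightarrow> q \<in> ncpolys K \<Longrightarrow> p * q \<in> ncpolys K"
  using keys_mult[of p q] unfolding ncpolys_def plus_list_def by fastforce

lemma ncpolys_star: "p \<in> ncpolys K \<Longrightarrow> poly_star p \<in> ncpolys K"
proof -
  assume p: "p \<in> ncpolys K"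
  have "fst ` set w \<subseteq> K" if "w \<in> Poly_Mapping.keys (poly_star p)" for w
  proof -
    have "word_star w \<in> Poly_Mapping.keys p" using that by (simp add: in_keys_iff lookup_poly_star)
    then have "fst ` set (word_star w) \<subseteq> K" using p by (auto simp: ncpolys_def)
    then show ?thesis by (simp only: letters_word_star)
  qed
  then show ?thesis by (simp add: ncpolys_def)
qed

lemma ncpolys_minus: "p \<in> ncpolys K \<Longrightarrow> - p \<in> ncpolys K"
  by (simp add: ncpolys_def)

lemma ncpolys_diff: "p \<in> ncpolys K \<Longrightarrow> q \<in> ncpolys K \<Longrightarrow> p - q \<in> ncpolys K"
  using ncpolys_add[of p K "- q"] ncpolys_minus[of q K] by simp

lemma ncpolys_power: "p \<in> ncpolys K \<Longrightarrow> p ^ n \<in> ncpolys K"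
  by (induction n) (auto intro: ncpolys_mult)

text \<open>The algebraic part of \<open>cstar_algebra\<close>, separated so that evaluation of
  *-polynomials is treated once for the abstract algebra and for matrices.\<close>

locale star_algebra =
  fixes M :: "('a, 'm) cstar_alg_scheme" (structure)
  assumes is_ring: "Ring.ring M" and is_module: "Module.module complex_ring M"
    and smult_left: "x \<in> carrier M \<Longrightarrow> y \<in> carrier M \<Longrightarrow> c \<odot>\<^bsub>M\<^esub> (x \<otimes> y) = (c \<odot>\<^bsub>M\<^esub> x) \<otimes> y"
    and smult_right: "x \<in> carrier M \<Longrightarrow> y \<in> carrier M \<Longrightarrow> c \<odot>\<^bsub>M\<^esub> (x \<otimes> y) = x \<otimes> (c \<odot>\<^bsub>M\<^esub> y)"
    and star_closed [simp, intro]: "x \<in> carrier M \<Longrightarrow> star M x \<in> carrier M"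
    and star_star [simp]: "x \<in> carrier M \<Longrightarrow> star M (star M x) = x"
    and star_add: "x \<in> carrier M \<Longrightarrow> y \<in> carrier M \<Longrightarrow> star M (x \<oplus> y) = star M x \<oplus> star M y"
    and star_mult: "x \<in> carrier M \<Longrightarrow> y \<in> carrier M \<Longrightarrow> star M (x \<otimes> y) = star M y \<otimes> star M x"
    and star_smult: "x \<in> carrier M \<Longrightarrow> star M (c \<odot>\<^bsub>M\<^esub> x) = cnj c \<odot>\<^bsub>M\<^esub> star M x"
begin

sublocale Ring.ring M by (rule is_ring)

sublocale Mod: Module.module complex_ring M by (rule is_module)

lemma sm_closed [simp, intro]: "x \<in> carrier M \<Longrightarrow> c \<odot>\<^bsub>M\<^esub> x \<in> carrier M"
  using Mod.smult_closed[of c x] by (simp add: complex_ring_def)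

lemma sm_add_left: "x \<in> carrier M \<Longrightarrow> (a + b) \<odot>\<^bsub>M\<^esub> x = a \<odot>\<^bsub>M\<^esub> x \<oplus> b \<odot>\<^bsub>M\<^esub> x"
  using Mod.smult_l_distr[of a b x] by (simp add: complex_ring_def)

lemma sm_add_right: "x \<in> carrier M \<Longrightarrow> y \<in> carrier M \<Longrightarrow> a \<odot>\<^bsub>M\<^esub> (x \<oplus> y) = a \<odot>\<^bsub>M\<^esub> x \<oplus> a \<odot>\<^bsub>M\<^esub> y"
  using Mod.smult_r_distr[of a x y] by (simp add: complex_ring_def)

lemma sm_assoc: "x \<in> carrier M \<Longrightarrow> (a * b) \<odot>\<^bsub>M\<^esub> x = a \<odot>\<^bsub>M\<^esub> (b \<odot>\<^bsub>M\<^esub> x)"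
  using Mod.smult_assoc1[of a b x] by (simp add: complex_ring_def)

lemma sm_one [simp]: "x \<in> carrier M \<Longrightarrow> 1 \<odot>\<^bsub>M\<^esub> x = x"
  using Mod.smult_one[of x] by (simp add: complex_ring_def)

lemma sm_zero [simp]: "x \<in> carrier M \<Longrightarrow> 0 \<odot>\<^bsub>M\<^esub> x = \<zero>"
  using Mod.smult_l_null[of x] by (simp add: complex_ring_def)

lemma star_one [simp]: "star M \<one> = \<one>"
proof -
  have "star M (star M \<one> \<otimes> \<one>) = star M \<one> \<otimes> star M (star M \<one>)"
    by (rule star_mult) simp_all
  then show ?thesis by simp
qed

lemma star_zero [simp]: "star M \<zero> = \<zero>"
  using star_smult[of "\<one>" 0] by simp

lemma eval_word_closed [simp, intro]: "(\<And>k. Z k \<in> carrier M) \<Longrightarrow> eval_word M Z w \<in> carrier M"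
  by (induction w) (auto simp: eval_word_def)

lemma eval_word_append:
  assumes Z: "\<And>k. Z k \<in> carrier M"
  shows "eval_word M Z (u @ v) = eval_word M Z u \<otimes> eval_word M Z v"
proof -
  have [simp]: "eval_word M Z w \<in> carrier M" "Z k \<in> carrier M" for w k using Z by auto
  show ?thesis
  proof (induction u)
    case Nil
    have "eval_word M Z [] = \<one>" by (simp add: eval_word_def)
    then show ?case by simp
  next
    case (Cons a u)
    have e: "eval_word M Z (a # w) = (if snd a then star M (Z (fst a)) else Z (fst a)) \<otimes> eval_word M Z w" for w
      by (simp add: eval_word_def case_prod_beta)
    show ?case by (simp add: e Cons m_assoc)
  qed
qed

lemma eval_word_single: "(\<And>k. Z k \<in> carrier M) \<Longrightarrow> eval_word M Z [(k, s)] = (if s then star M (Z k) else Z k)"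
  by (simp add: eval_word_def)

lemma eval_word_star:
  assumes Z: "\<And>k. Z k \<in> carrier M"
  shows "eval_word M Z (word_star w) = star M (eval_word M Z w)"
proof -
  have [simp]: "eval_word M Z w \<in> carrier M" "Z k \<in> carrier M" for w k using Z by auto
  show ?thesis
  proof (induction w)
    case Nil
    show ?case by (simp add: eval_word_def word_star_def)
  next
    case (Cons a w)
    have e: "eval_word M Z (a # w) = (if snd a then star M (Z (fst a)) else Z (fst a)) \<otimes> eval_word M Z w"
      by (simp add: eval_word_def case_prod_beta)
    have "word_star (a # w) = word_star w @ [(fst a, \<not> snd a)]"
      by (simp add: word_star_def case_prod_beta)
    then show ?case
      by (simp add: eval_word_append[OF Z] Cons e star_mult eval_word_single[OF Z])
  qed
qed

lemma eval_poly_superset: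
  assumes Z: "\<And>k. Z k \<in> carrier M" and S: "finite S" "Poly_Mapping.keys p \<subseteq> S"
  shows "eval_poly M Z p = (\<Oplus>w\<in>S. Poly_Mapping.lookup p w \<odot>\<^bsub>M\<^esub> eval_word M Z w)"
  unfolding eval_poly_def
proof (rule add.finprod_mono_neutral_cong_left)
  have [simp]: "eval_word M Z w \<in> carrier M" for w using Z by (rule eval_word_closed)
  show "Poly_Mapping.lookup p w \<odot>\<^bsub>M\<^esub> eval_word M Z w = \<zero>" if "w \<in> S - Poly_Mapping.keys p" for w
    using that by (simp add: in_keys_iff)
  show "(\<lambda>w. Poly_Mapping.lookup p w \<odot>\<^bsub>M\<^esub> eval_word M Z w) \<in> S \<rightarrow> carrier M"
    by simp
qed (use S in simp_all)

lemma eval_poly_closed [simp, intro]: "(\<And>k. Z k \<in> carrier M) \<Longrightarrow> eval_poly M Z p \<in> carrier M"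
  unfolding eval_poly_def by (intro finsum_closed) auto

lemma eval_poly_zero [simp]: "eval_poly M Z 0 = \<zero>"
  by (simp add: eval_poly_def)

lemma eval_poly_add:
  assumes Z: "\<And>k. Z k \<in> carrier M"
  shows "eval_poly M Z (p + q) = eval_poly M Z p \<oplus> eval_poly M Z q"
proof -
  let ?S = "Poly_Mapping.keys p \<union> Poly_Mapping.keys q"
  have "eval_poly M Z (p + q)
      = (\<Oplus>w\<in>?S. Poly_Mapping.lookup p w \<odot>\<^bsub>M\<^esub> eval_word M Z w \<oplus> Poly_Mapping.lookup q w \<odot>\<^bsub>M\<^esub> eval_word M Z w)"
    using Z Poly_Mapping.keys_add[of p q]
    by (subst eval_poly_superset[of Z ?S]) (auto simp: lookup_add sm_add_left)
  also have "\<dots> = eval_poly M Z p \<oplus> eval_poly M Z q"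
    using Z by (subst finsum_addf) (auto simp: eval_poly_superset[of Z ?S p] eval_poly_superset[of Z ?S q])
  finally show ?thesis .
qed

lemma eval_poly_single:
  assumes Z: "\<And>k. Z k \<in> carrier M"
  shows "eval_poly M Z (Poly_Mapping.single w c) = c \<odot>\<^bsub>M\<^esub> eval_word M Z w"
proof -
  have [simp]: "eval_word M Z w \<in> carrier M" for w using Z by (rule eval_word_closed)
  show ?thesis
    by (subst eval_poly_superset[OF Z, of "{w}"]) simp_all
qed

lemma eval_poly_mult:
  assumes Z: "\<And>k. Z k \<in> carrier M"
  shows "eval_poly M Z (p * q) = eval_poly M Z p \<otimes> eval_poly M Z q"
proof (induction p rule: poly_mapping_add_induct)
  case zero
  show ?case using Z by simp
next
  case (single u c)
  show ?case
  proof (induction q rule: poly_mapping_add_induct)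
    case zero
    show ?case using Z by simp
  next
    case (single v d)
    have [simp]: "eval_word M Z w \<in> carrier M" for w using Z by simp
    show ?case
      using Z by (simp add: mult_single eval_poly_single plus_list_def eval_word_append smult_left[symmetric] smult_right[symmetric] sm_assoc[symmetric] mult.commute)
  next
    case (add p q)
    have [simp]: "eval_poly M Z w \<in> carrier M" for w using Z by simp
    show ?case using Z add by (simp add: distrib_left eval_poly_add r_distr)
  qed
next
  case (add p1 p2)
  have [simp]: "eval_poly M Z w \<in> carrier M" for w using Z by simp
  show ?case using Z add by (simp add: distrib_right eval_poly_add l_distr)
qed

lemma eval_poly_star:
  assumes Z: "\<And>k. Z k \<in> carrier M"
  shows "eval_poly M Z (poly_star p) = star M (eval_poly M Z p)"
proof (induction p rule: poly_mapping_add_induct)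
  case (single w c)
  then show ?case using Z by (simp add: poly_star_single eval_poly_single eval_word_star star_smult)
qed (use Z in \<open>simp_all add: poly_star_add eval_poly_add star_add\<close>)

lemma eval_poly_const:
  assumes Z: "\<And>k. Z k \<in> carrier M"
  shows "eval_poly M Z (const_poly c) = c \<odot>\<^bsub>M\<^esub> \<one>"
proof -
  have "eval_word M Z [] = \<one>" by (simp add: eval_word_def)
  then show ?thesis unfolding zero_list_def eval_poly_single[where Z = Z, OF Z] by simp
qed

lemma eval_poly_one [simp]:
  assumes Z: "\<And>k. Z k \<in> carrier M"
  shows "eval_poly M Z 1 = \<one>"
  using eval_poly_const[where Z = Z, OF Z, where c = 1] unfolding single_one by simp

lemma eval_poly_scale:
  assumes Z: "\<And>k. Z k \<in> carrier M"
  shows "eval_poly M Z (const_poly c * p) = c \<odot>\<^bsub>M\<^esub> eval_poly M Z p"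
proof -
  have [simp]: "eval_poly M Z p \<in> carrier M" by (rule eval_poly_closed) (rule Z)
  show ?thesis
    unfolding eval_poly_mult[where Z = Z, OF Z] eval_poly_const[where Z = Z, OF Z]
    using smult_left[of "\<one>" "eval_poly M Z p" c] by simp
qed

lemma eval_poly_var:
  assumes Z: "\<And>k. Z k \<in> carrier M"
  shows "eval_poly M Z (var_poly k) = Z k"
  unfolding eval_poly_single[where Z = Z, OF Z] eval_word_single[where Z = Z, OF Z] using Z[of k] by simp

lemma eval_poly_minus:
  assumes Z: "\<And>k. Z k \<in> carrier M"
  shows "eval_poly M Z (p - q) = eval_poly M Z p \<ominus> eval_poly M Z q"
proof -
  have "eval_poly M Z (p - q) \<oplus> eval_poly M Z q = eval_poly M Z p"
    using eval_poly_add[of Z "p - q" q] Z by simp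
  then have "eval_poly M Z p \<ominus> eval_poly M Z q = eval_poly M Z (p - q) \<oplus> eval_poly M Z q \<ominus> eval_poly M Z q"
    by simp
  also have "\<dots> = eval_poly M Z (p - q)"
    using eval_poly_closed[of Z "p - q"] eval_poly_closed[of Z q] Z by (simp add: a_minus_def a_assoc r_neg)
  finally show ?thesis by simp
qed

end

lemma eval_word_cong:
  assumes "\<And>k. k \<in> fst ` set w \<Longrightarrow> Z k = Z' k"
  shows "eval_word M Z w = eval_word M Z' w"
  unfolding eval_word_def by (rule foldr_cong) (use assms in \<open>force split: prod.splits\<close>)+

lemma (in star_algebra) eval_poly_cong:
  assumes "\<And>k. k \<in> K \<Longrightarrow> Z k = Z' k" "p \<in> ncpolys K" "\<And>k. Z' k \<in> carrier M"
  shows "eval_poly M Z p = eval_poly M Z' p"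
proof -
  have "eval_word M Z w = eval_word M Z' w" if "w \<in> Poly_Mapping.keys p" for w
    using that assms by (intro eval_word_cong) (auto simp: ncpolys_def)
  then show ?thesis unfolding eval_poly_def
    by (intro finsum_cong') (use assms(3) in auto)
qed

section \<open>Limits along ultrafilters\<close>

lemma ultrafilter_compact_limit:
  fixes f :: "nat \<Rightarrow> 'b::topological_space"
  assumes U: "free_ultrafilter U" and S: "compact S" and f: "\<And>n. f n \<in> S"
  obtains l where "l \<in> S" "(f \<longlongrightarrow> l) U"
proof -
  have ne: "filtermap f U \<noteq> bot" using U by (simp add: free_ultrafilter_def filtermap_bot_iff)
  have "eventually (\<lambda>x. x \<in> S) (filtermap f U)" using f by (simp add: eventually_filtermap)
  then obtain l where l: "l \<in> S" "inf (nhds l) (filtermap f U) \<noteq> bot"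
    using S ne unfolding compact_filter by blast
  have "(f \<longlongrightarrow> l) U"
  proof (rule topological_tendstoI)
    fix V assume V: "open V" "l \<in> V"
    show "eventually (\<lambda>n. f n \<in> V) U"
    proof (rule ccontr)
      assume "\<not> ?thesis"
      then have "eventually (\<lambda>n. f n \<notin> V) U" using U unfolding free_ultrafilter_def by blast
      then have "eventually (\<lambda>x. x \<notin> V) (filtermap f U)" by (simp add: eventually_filtermap)
      moreover have "eventually (\<lambda>x. x \<in> V) (nhds l)" using V eventually_nhds by blast
      ultimately have "eventually (\<lambda>x. False) (inf (nhds l) (filtermap f U))"
        unfolding eventually_inf by blast
      with l show False by (simp add: trivial_limit_def)
    qed
  qed
  with l that show ?thesis by blast
qed

lemma ultrafilter_bounded_limit:
  fixes f :: "nat \<Rightarrow> complex"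
  assumes "free_ultrafilter U" "\<And>n. cmod (f n) \<le> C"
  shows "\<exists>l. (f \<longlongrightarrow> l) U"
  by (rule ultrafilter_compact_limit[OF assms(1) compact_cball[of 0 C], of f])
    (use assms(2) in \<open>auto simp: dist_norm\<close>)

lemma free_ultrafilter_ge: "free_ultrafilter U \<Longrightarrow> eventually (\<lambda>n. n \<ge> N) U"
proof (induction N)
  case (Suc N)
  then have "eventually (\<lambda>n. n \<ge> N) U" "eventually (\<lambda>n. n \<noteq> N) U"
    by (auto simp: free_ultrafilter_def)
  then show ?case by eventually_elim simp
qed (simp add: always_eventually)

lemma free_ultrafilter_bot: "free_ultrafilter U \<Longrightarrow> U \<noteq> bot"
  by (simp add: free_ultrafilter_def)

text \<open>The common ground of tracial W*-algebras and of all \<open>mat_alg n\<close>, including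
  \<open>n = 0\<close>, where the trace of the unit is 0. This is why \<open>norm2 M \<one>\<close>
  occurs in the estimates instead of 1.\<close>

locale pre_tracial = star_algebra M for M :: "('a, 'm) tracial_alg_scheme" (structure) +
  assumes nrm_nonneg: "x \<in> carrier M \<Longrightarrow> 0 \<le> nrm M x"
    and nrm_add: "x \<in> carrier M \<Longrightarrow> y \<in> carrier M \<Longrightarrow> nrm M (x \<oplus> y) \<le> nrm M x + nrm M y"
    and nrm_mult: "x \<in> carrier M \<Longrightarrow> y \<in> carrier M \<Longrightarrow> nrm M (x \<otimes> y) \<le> nrm M x * nrm M y"
    and nrm_smult: "x \<in> carrier M \<Longrightarrow> nrm M (c \<odot>\<^bsub>M\<^esub> x) = cmod c * nrm M x"
    and nrm_cstar: "x \<in> carrier M \<Longrightarrow> nrm M (star M x \<otimes> x) = (nrm M x)\<^sup>2"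
    and tr_add: "x \<in> carrier M \<Longrightarrow> y \<in> carrier M \<Longrightarrow> tr M (x \<oplus> y) = tr M x + tr M y"
    and tr_smult: "x \<in> carrier M \<Longrightarrow> tr M (c \<odot>\<^bsub>M\<^esub> x) = c * tr M x"
    and tr_comm: "x \<in> carrier M \<Longrightarrow> y \<in> carrier M \<Longrightarrow> tr M (x \<otimes> y) = tr M (y \<otimes> x)"
    and tr_pos: "x \<in> carrier M \<Longrightarrow> 0 \<le> Re (tr M (star M x \<otimes> x))"
    and tr_real: "x \<in> carrier M \<Longrightarrow> Im (tr M (star M x \<otimes> x)) = 0"
    and tr_bdd: "\<exists>C. \<forall>x\<in>carrier M. cmod (tr M x) \<le> C * nrm M x"
begin

text \<open>The carrier is presented as a quotient of the free *-algebra over its own elements, whose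
  multiplication is that of a type class.\<close>

definition ev :: "'a ncpoly \<Rightarrow> 'a" where
  "ev = eval_poly M (\<lambda>x. if x \<in> carrier M then x else \<zero>)"

abbreviation lv :: "'a \<Rightarrow> 'a ncpoly" where "lv x \<equiv> var_poly x"

lemma ev_closed [simp, intro]: "ev p \<in> carrier M"
  unfolding ev_def by (rule eval_poly_closed) simp

lemma ev_0 [simp]: "ev 0 = \<zero>"
  by (simp add: ev_def)

lemma ev_1 [simp]: "ev 1 = \<one>"
  unfolding ev_def by (rule eval_poly_one) simp

lemma ev_add [simp]: "ev (p + q) = ev p \<oplus> ev q"
  unfolding ev_def by (rule eval_poly_add) simp

lemma ev_minus [simp]: "ev (p - q) = ev p \<ominus> ev q"
  unfolding ev_def by (rule eval_poly_minus) simp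

lemma ev_mult [simp]: "ev (p * q) = ev p \<otimes> ev q"
  unfolding ev_def by (rule eval_poly_mult) simp

lemma ev_star [simp]: "ev (poly_star p) = star M (ev p)"
  unfolding ev_def by (rule eval_poly_star) simp

lemma ev_const [simp]: "ev (const_poly c) = c \<odot>\<^bsub>M\<^esub> \<one>"
  unfolding ev_def by (rule eval_poly_const) simp

lemmas [simp] = smult_left[symmetric] smult_right[symmetric]

lemma ev_lv [simp]: "x \<in> carrier M \<Longrightarrow> ev (lv x) = x"
  unfolding ev_def by (subst eval_poly_var) auto

sublocale F: tracial_star_ring const_poly poly_star "\<lambda>p. nrm M (ev p)" "\<lambda>p. tr M (ev p)"
proof
  show "const_poly (a + b) = const_poly a + (const_poly b :: 'a ncpoly)" for a b by (simp add: single_add)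
  show "const_poly (a * b) = const_poly a * (const_poly b :: 'a ncpoly)" for a b by (simp add: mult_single)
  show "const_poly 1 = (1 :: 'a ncpoly)" by simp
  show "f * const_poly a = const_poly a * (f :: 'a ncpoly)" for f a by (rule const_poly_commute)
  show "poly_star (f + g) = poly_star f + (poly_star g :: 'a ncpoly)" for f g by (rule poly_star_add)
  show "poly_star (f * g) = poly_star g * (poly_star f :: 'a ncpoly)" for f g by (rule poly_star_mult)
  show "poly_star (poly_star f) = (f :: 'a ncpoly)" for f by (rule poly_star_star)
  show "poly_star (const_poly a) = (const_poly (cnj a) :: 'a ncpoly)" for a
    by (simp add: poly_star_single word_star_def zero_list_def)
  show "\<exists>C. \<forall>f. cmod (tr M (ev f)) \<le> C * nrm M (ev f)" using tr_bdd ev_closed by blast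
qed (simp_all add: nrm_nonneg nrm_add nrm_mult nrm_smult nrm_cstar tr_add tr_smult tr_comm[of "ev _" "ev _"] tr_pos tr_real)

lemma n2_ev: "F.n2 p = norm2 M (ev p)"
  by (simp add: F.n2_def norm2_def)

lemma norm2_nonneg [simp]: "x \<in> carrier M \<Longrightarrow> 0 \<le> norm2 M x"
  using F.n2_nonneg[of "lv x"] by (simp add: n2_ev)

lemma norm2_sq: "x \<in> carrier M \<Longrightarrow> (norm2 M x)\<^sup>2 = Re (tr M (star M x \<otimes> x))"
  by (simp add: norm2_def tr_pos)

lemma norm2_add: "x \<in> carrier M \<Longrightarrow> y \<in> carrier M \<Longrightarrow> norm2 M (x \<oplus> y) \<le> norm2 M x + norm2 M y"
  using F.n2_add[of "lv x" "lv y"] by (simp add: n2_ev)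

lemma norm2_minus_commute: "x \<in> carrier M \<Longrightarrow> y \<in> carrier M \<Longrightarrow> norm2 M (x \<ominus> y) = norm2 M (y \<ominus> x)"
  using F.n2_diff_commute[of "lv x" "lv y"] by (simp add: n2_ev)

lemma norm2_triangle:
  "x \<in> carrier M \<Longrightarrow> y \<in> carrier M \<Longrightarrow> z \<in> carrier M \<Longrightarrow> norm2 M (x \<ominus> z) \<le> norm2 M (x \<ominus> y) + norm2 M (y \<ominus> z)"
  using F.n2_triangle[of "lv x" "lv z" "lv y"] by (simp add: n2_ev)

lemma norm2_mult_left: "x \<in> carrier M \<Longrightarrow> y \<in> carrier M \<Longrightarrow> norm2 M (x \<otimes> y) \<le> nrm M x * norm2 M y"
  using F.n2_mult_left[of "lv x" "lv y"] by (simp add: n2_ev)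

lemma norm2_mult_right: "x \<in> carrier M \<Longrightarrow> y \<in> carrier M \<Longrightarrow> norm2 M (x \<otimes> y) \<le> norm2 M x * nrm M y"
  using F.n2_mult_right[of "lv x" "lv y"] by (simp add: n2_ev)

lemma norm2_star: "x \<in> carrier M \<Longrightarrow> norm2 M (star M x) = norm2 M x"
  using F.n2_st[of "lv x"] by (simp add: n2_ev)

lemma norm2_smult: "x \<in> carrier M \<Longrightarrow> norm2 M (c \<odot>\<^bsub>M\<^esub> x) = cmod c * norm2 M x"
  using F.n2_sc[of c "lv x"] by (simp add: n2_ev)

lemma tr_le_norm2: "x \<in> carrier M \<Longrightarrow> cmod (tr M x) \<le> norm2 M \<one> * norm2 M x"
  using F.t_le_n2[of "lv x"] by (simp add: n2_ev)

lemma tr_mult_le: "x \<in> carrier M \<Longrightarrow> y \<in> carrier M \<Longrightarrow> cmod (tr M (x \<otimes> y)) \<le> norm2 M x * norm2 M y"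
  using F.t_mult_le[of "lv x" "lv y"] by (simp add: n2_ev)

lemma tr_star: "x \<in> carrier M \<Longrightarrow> tr M (star M x) = cnj (tr M x)"
  using F.t_st[of "lv x"] by simp

lemma tr_minus: "x \<in> carrier M \<Longrightarrow> y \<in> carrier M \<Longrightarrow> tr M (x \<ominus> y) = tr M x - tr M y"
  using F.t_diff[of "lv x" "lv y"] by simp

end

section \<open>Tracial W*-algebras and their preduals\<close>

lemma cstar_algebra_star_algebra:
  assumes "cstar_algebra M"
  shows "star_algebra M"
proof -
  have r: "Ring.ring M" and m: "Module.module complex_ring M"
    and a: "\<forall>c. \<forall>x\<in>carrier M. \<forall>y\<in>carrier M.
        c \<odot>\<^bsub>M\<^esub> (x \<otimes>\<^bsub>M\<^esub> y) = (c \<odot>\<^bsub>M\<^esub> x) \<otimes>\<^bsub>M\<^esub> y \<and>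
        c \<odot>\<^bsub>M\<^esub> (x \<otimes>\<^bsub>M\<^esub> y) = x \<otimes>\<^bsub>M\<^esub> (c \<odot>\<^bsub>M\<^esub> y)"
    and s: "\<forall>x\<in>carrier M. star M x \<in> carrier M \<and> star M (star M x) = x"
    and t: "\<forall>x\<in>carrier M. \<forall>y\<in>carrier M.
        star M (x \<oplus>\<^bsub>M\<^esub> y) = star M x \<oplus>\<^bsub>M\<^esub> star M y \<and>
        star M (x \<otimes>\<^bsub>M\<^esub> y) = star M y \<otimes>\<^bsub>M\<^esub> star M x"
    and c: "\<forall>c. \<forall>x\<in>carrier M. star M (c \<odot>\<^bsub>M\<^esub> x) = cnj c \<odot>\<^bsub>M\<^esub> star M x"
    using assms unfolding cstar_algebra_def by - (elim conjE, assumption)+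
  show ?thesis
    by (rule star_algebra.intro[OF r m]) (use a s t c in \<open>blast+\<close>)
qed

locale tracial_wstar_alg =
  fixes M :: "('a, 'm) tracial_alg_scheme" (structure)
  assumes tracial: "tracial_wstar M"

sublocale tracial_wstar_alg \<subseteq> pre_tracial
proof -
  have c: "cstar_algebra M" using tracial by (simp add: tracial_wstar_def wstar_algebra_def)
  interpret star_algebra M by (rule cstar_algebra_star_algebra[OF c])
  have "restrict (tr M) (carrier M) \<in> bdd_functionals M"
    using tracial by (auto simp: tracial_wstar_def normal_functionals_def is_predual_def)
  then have t1: "\<forall>x\<in>carrier M. \<forall>y\<in>carrier M. tr M (x \<oplus> y) = tr M x + tr M y"
    and t2: "\<forall>c. \<forall>x\<in>carrier M. tr M (c \<odot>\<^bsub>M\<^esub> x) = c * tr M x"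
    and t3: "\<exists>C. \<forall>x\<in>carrier M. cmod (tr M x) \<le> C * nrm M x"
    by (auto simp: bdd_functionals_def)
  have n1: "\<forall>x\<in>carrier M. 0 \<le> nrm M x \<and> (nrm M x = 0 \<longleftrightarrow> x = \<zero>)"
    and n2: "\<forall>c. \<forall>x\<in>carrier M. nrm M (c \<odot>\<^bsub>M\<^esub> x) = cmod c * nrm M x"
    and n3: "\<forall>x\<in>carrier M. \<forall>y\<in>carrier M. nrm M (x \<oplus> y) \<le> nrm M x + nrm M y \<and> nrm M (x \<otimes> y) \<le> nrm M x * nrm M y"
    and n4: "\<forall>x\<in>carrier M. nrm M (star M x \<otimes> x) = (nrm M x)\<^sup>2"
    using c unfolding cstar_algebra_def by - (elim conjE, assumption)+
  have p: "\<forall>x\<in>carrier M. 0 \<le> Re (tr M (star M x \<otimes> x)) \<and> Im (tr M (star M x \<otimes> x)) = 0"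
    and q: "\<forall>x\<in>carrier M. \<forall>y\<in>carrier M. tr M (x \<otimes> y) = tr M (y \<otimes> x)"
    using tracial unfolding tracial_wstar_def by - (elim conjE, assumption)+
  have "pre_tracial_axioms M"
    by (rule pre_tracial_axioms.intro) (use t1 t2 t3 n1 n2 n3 n4 p q in \<open>blast+\<close>)
  then show "pre_tracial M" by (rule pre_tracial.intro[OF star_algebra_axioms])
qed

context tracial_wstar_alg
begin

lemma nrm_eq_0: "x \<in> carrier M \<Longrightarrow> nrm M x = 0 \<longleftrightarrow> x = \<zero>"
  using tracial by (simp add: tracial_wstar_def wstar_algebra_def cstar_algebra_def)

lemma norm2_eq_0: "x \<in> carrier M \<Longrightarrow> norm2 M x = 0 \<longleftrightarrow> x = \<zero>"
proof
  assume x: "x \<in> carrier M" "norm2 M x = 0"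
  then have "tr M (star M x \<otimes> x) = 0" using norm2_sq[of x] tr_real[of x] by (simp add: complex_eq_iff)
  then show "x = \<zero>" using x tracial by (simp add: tracial_wstar_def)
qed (simp add: norm2_def tr_smult[of \<zero> 0, simplified])

lemma nrm_complete:
  fixes s :: "nat \<Rightarrow> 'a"
  assumes "\<And>k. s k \<in> carrier M" "\<And>e. e > 0 \<Longrightarrow> \<exists>N. \<forall>k\<ge>N. \<forall>l\<ge>N. nrm M (s k \<ominus> s l) < e"
  shows "\<exists>x\<in>carrier M. (\<lambda>k. nrm M (s k \<ominus> x)) \<longlonglongrightarrow> 0"
  using tracial assms by (simp add: tracial_wstar_def wstar_algebra_def cstar_algebra_def)

lemma cmod_le_functional_norm:
  assumes \<phi>: "\<phi> \<in> bdd_functionals M" and x: "x \<in> carrier M"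
  shows "cmod (\<phi> x) \<le> functional_norm M \<phi> * nrm M x"
proof -
  obtain C where C: "\<And>x. x \<in> carrier M \<Longrightarrow> cmod (\<phi> x) \<le> C * nrm M x"
    using \<phi> unfolding bdd_functionals_def by blast
  have bdd: "bdd_above ((\<lambda>x. cmod (\<phi> x)) ` {x \<in> carrier M. nrm M x \<le> 1})"
  proof (rule bdd_aboveI2)
    fix x assume x: "x \<in> {x \<in> carrier M. nrm M x \<le> 1}"
    then have "cmod (\<phi> x) \<le> C * nrm M x" by (intro C) simp
    also have "\<dots> \<le> \<bar>C\<bar> * nrm M x" using x by (intro mult_right_mono nrm_nonneg) auto
    also have "\<dots> \<le> \<bar>C\<bar> * 1" using x by (intro mult_left_mono) auto
    finally show "cmod (\<phi> x) \<le> \<bar>C\<bar>" by simp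
  qed
  show ?thesis
  proof (cases "nrm M x = 0")
    case True
    then show ?thesis using C[OF x] by simp
  next
    case False
    then have p: "nrm M x > 0" using nrm_nonneg[OF x] by simp
    let ?y = "complex_of_real (1 / nrm M x) \<odot>\<^bsub>M\<^esub> x"
    have y: "?y \<in> carrier M" "nrm M ?y \<le> 1" using x p by (simp_all add: nrm_smult norm_divide)
    have "cmod (\<phi> ?y) \<le> functional_norm M \<phi>"
      unfolding functional_norm_def using y by (intro cSUP_upper[OF _ bdd]) simp
    moreover have "\<phi> ?y = complex_of_real (1 / nrm M x) * \<phi> x"
      using \<phi> x by (simp add: bdd_functionals_def)
    ultimately have "cmod (\<phi> x) / nrm M x \<le> functional_norm M \<phi>"
      using p by (simp add: norm_mult norm_divide)
    then show ?thesis using p by (simp add: pos_divide_le_eq)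
  qed
qed

lemma bdd_functional_linear:
  assumes "\<phi> \<in> bdd_functionals M" "x \<in> carrier M" "y \<in> carrier M"
  shows "\<phi> (x \<oplus> y) = \<phi> x + \<phi> y" "\<phi> (c \<odot>\<^bsub>M\<^esub> x) = c * \<phi> x"
  using assms by (auto simp: bdd_functionals_def)

text \<open>The Banach-Alaoglu theorem along an ultrafilter: the limits of
  \<open>\<phi> (ev (y k))\<close> form a bounded linear functional of \<open>\<phi>\<close> in
  \<open>P\<close>, which by duality is evaluation at an element of the carrier. That the limit does
  not increase the norm follows from the formula for the norm as a supremum over the unit ball of
  \<open>P\<close>.\<close>

lemma tracial_limits_predual:
  assumes U: "free_ultrafilter U" and P: "is_predual M P" and trP: "restrict (tr M) (carrier M) \<in> P"
  shows "tracial_limits const_poly poly_star (\<lambda>p. nrm M (ev p)) (\<lambda>p. tr M (ev p)) U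
    (\<lambda>y x. \<forall>\<phi>\<in>P. ((\<lambda>k. \<phi> (ev (y k))) \<longlongrightarrow> \<phi> (ev x)) U)"
proof -
  have bd: "\<phi> \<in> bdd_functionals M" if "\<phi> \<in> P" for \<phi> using P that by (auto simp: is_predual_def)
  have Ub: "U \<noteq> bot" by (rule free_ultrafilter_bot[OF U])
  show ?thesis
  proof (unfold_locales, goal_cases)
    case 1
    show ?case by (rule Ub)
  next
    case (2 C f)
    then show ?case using ultrafilter_bounded_limit[OF U] by blast
  next
    case (3 y K)
    define \<Lambda> where "\<Lambda> \<phi> = (THE l. ((\<lambda>k. \<phi> (ev (y k))) \<longlongrightarrow> l) U)" for \<phi> :: "'a \<Rightarrow> complex"
    have \<Lambda>: "((\<lambda>k. \<phi> (ev (y k))) \<longlongrightarrow> \<Lambda> \<phi>) U" if "\<phi> \<in> P" for \<phi>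
    proof -
      have "cmod (\<phi> (ev (y k))) \<le> \<bar>functional_norm M \<phi>\<bar> * K" for k
      proof -
        have "cmod (\<phi> (ev (y k))) \<le> functional_norm M \<phi> * nrm M (ev (y k))"
          by (rule cmod_le_functional_norm[OF bd[OF that]]) simp
        also have "\<dots> \<le> \<bar>functional_norm M \<phi>\<bar> * K"
          using 3[of k] by (intro mult_mono) (auto simp: nrm_nonneg)
        finally show ?thesis .
      qed
      then obtain l where l: "((\<lambda>k. \<phi> (ev (y k))) \<longlongrightarrow> l) U"
        using ultrafilter_bounded_limit[OF U, of "\<lambda>k. \<phi> (ev (y k))"] by blast
      moreover have "\<Lambda> \<phi> = l"
        unfolding \<Lambda>_def using l tendsto_unique[OF Ub _ l] by blast
      ultimately show ?thesis by simp
    qed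
    have "\<exists>x\<in>carrier M. \<forall>\<phi>\<in>P. \<Lambda> \<phi> = \<phi> x"
    proof -
      have "\<Lambda> (\<lambda>x\<in>carrier M. \<phi> x + \<psi> x) = \<Lambda> \<phi> + \<Lambda> \<psi>" if "\<phi> \<in> P" "\<psi> \<in> P" for \<phi> \<psi>
      proof -
        have "(\<lambda>x\<in>carrier M. \<phi> x + \<psi> x) \<in> P" using P that by (simp add: is_predual_def)
        from \<Lambda>[OF this] have "((\<lambda>k. \<phi> (ev (y k)) + \<psi> (ev (y k))) \<longlongrightarrow> \<Lambda> (\<lambda>x\<in>carrier M. \<phi> x + \<psi> x)) U" by simp
        from tendsto_unique[OF Ub this tendsto_add[OF \<Lambda>[OF that(1)] \<Lambda>[OF that(2)]]] show ?thesis .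
      qed
      moreover have "\<Lambda> (\<lambda>x\<in>carrier M. c * \<phi> x) = c * \<Lambda> \<phi>" if "\<phi> \<in> P" for \<phi> c
      proof -
        have "(\<lambda>x\<in>carrier M. c * \<phi> x) \<in> P" using P that by (simp add: is_predual_def)
        from \<Lambda>[OF this] have "((\<lambda>k. c * \<phi> (ev (y k))) \<longlongrightarrow> \<Lambda> (\<lambda>x\<in>carrier M. c * \<phi> x)) U" by simp
        from tendsto_unique[OF Ub this tendsto_mult_left[OF \<Lambda>[OF that]]] show ?thesis .
      qed
      moreover have "\<exists>C. \<forall>\<phi>\<in>P. cmod (\<Lambda> \<phi>) \<le> C * functional_norm M \<phi>"
      proof (intro exI ballI)
        fix \<phi> assume p: "\<phi> \<in> P"
        have f0: "0 \<le> functional_norm M \<phi>"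
        proof -
          have "cmod (\<phi> \<one>) \<le> functional_norm M \<phi> * nrm M \<one>" by (rule cmod_le_functional_norm[OF bd[OF p]]) simp
          moreover have "nrm M \<one> > 0"
          proof -
            have "tr M \<one> = 1" using tracial by (simp add: tracial_wstar_def)
            moreover have "tr M \<zero> = 0" using tr_smult[of \<zero> 0] by simp
            ultimately have "\<one> \<noteq> \<zero>" by auto
            then show ?thesis using nrm_eq_0[of \<one>] nrm_nonneg[of \<one>] by simp
          qed
          ultimately show ?thesis by (smt (verit) norm_ge_zero zero_le_mult_iff)
        qed
        have "\<forall>\<^sub>F k in U. cmod (\<phi> (ev (y k))) \<le> K * functional_norm M \<phi>"
        proof (rule always_eventually, rule allI)
          fix k
          have "cmod (\<phi> (ev (y k))) \<le> functional_norm M \<phi> * nrm M (ev (y k))"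
            by (rule cmod_le_functional_norm[OF bd[OF p]]) simp
          also have "\<dots> \<le> functional_norm M \<phi> * K" using 3[of k] f0 by (intro mult_left_mono)
          finally show "cmod (\<phi> (ev (y k))) \<le> K * functional_norm M \<phi>" by (simp add: mult.commute)
        qed
        then show "cmod (\<Lambda> \<phi>) \<le> K * functional_norm M \<phi>"
          using tendsto_upperbound[OF tendsto_norm[OF \<Lambda>[OF p]] _ Ub] by blast
      qed
      ultimately show ?thesis using P unfolding is_predual_def by blast
    qed
    then obtain x where x: "x \<in> carrier M" "\<And>\<phi>. \<phi> \<in> P \<Longrightarrow> \<Lambda> \<phi> = \<phi> x" by blast
    show ?case
      by (rule exI[of _ "lv x"]) (use \<Lambda> x in auto)
  next
    case (4 y K x)
    have "nrm M (ev x) = (SUP \<phi>\<in>{\<phi> \<in> P. functional_norm M \<phi> \<le> 1}. cmod (\<phi> (ev x)))"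
      using P ev_closed[of x] unfolding is_predual_def by blast
    also have "\<dots> \<le> K"
    proof (rule cSUP_least)
      have "functional_norm M (\<lambda>x\<in>carrier M. 0) \<le> 1"
        unfolding functional_norm_def
        by (rule cSUP_least) (use nrm_eq_0[of \<zero>] in \<open>auto intro!: exI[of _ \<zero>]\<close>)
      then show "{\<phi> \<in> P. functional_norm M \<phi> \<le> 1} \<noteq> {}" using P by (auto simp: is_predual_def)
      fix \<phi> assume p: "\<phi> \<in> {\<phi> \<in> P. functional_norm M \<phi> \<le> 1}"
      then have "((\<lambda>k. cmod (\<phi> (ev (y k)))) \<longlongrightarrow> cmod (\<phi> (ev x))) U" using 4(2) by (intro tendsto_intros) auto
      moreover have "cmod (\<phi> (ev (y k))) \<le> K" for k
      proof -
        have "cmod (\<phi> (ev (y k))) \<le> functional_norm M \<phi> * nrm M (ev (y k))"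
          using p by (intro cmod_le_functional_norm bd) auto
        also have "\<dots> \<le> 1 * nrm M (ev (y k))" using p by (intro mult_right_mono nrm_nonneg) auto
        finally show ?thesis using 4(1)[of k] by simp
      qed
      ultimately show "cmod (\<phi> (ev x)) \<le> K" using tendsto_upperbound[OF _ _ Ub] always_eventually by blast
    qed
    finally show ?case .
  next
    case (5 y x y' x')
    then show ?case using bd by (auto simp: bdd_functional_linear intro!: tendsto_add)
  next
    case (6 y x a)
    then show ?case using bd by (auto simp: bdd_functional_linear(2)[OF _ ev_closed ev_closed] intro!: tendsto_mult_left)
  next
    case (7 x)
    show ?case by simp
  next
    case (8 y x)
    then show ?case using trP by fastforce
  qed
qed

end

section \<open>Density of generating *-subalgebras\<close>

context tracial_wstar_alg
begin

lemma nrm_isometry: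
  assumes u: "u \<in> carrier M" "star M u \<otimes> u = \<one>" and x: "x \<in> carrier M"
  shows "nrm M (u \<otimes> x) = nrm M x"
proof -
  have "star M (u \<otimes> x) \<otimes> (u \<otimes> x) = star M x \<otimes> (star M u \<otimes> u) \<otimes> x"
    using u(1) x by (simp add: star_mult m_assoc)
  also have "\<dots> = star M x \<otimes> x" using u x by simp
  finally have "(nrm M (u \<otimes> x))\<^sup>2 = (nrm M x)\<^sup>2"
    using nrm_cstar[of "u \<otimes> x"] nrm_cstar[of x] u x by simp
  then show ?thesis using nrm_nonneg u x by (simp add: power2_eq_iff_nonneg)
qed

text \<open>A unitary \<open>u\<close> acts isometrically, so it carries preduals to preduals. As
  \<^const>\<open>normal_functionals\<close> is the union of all preduals, this makes \<open>x \<mapsto> \<tau>(u x)\<close> normal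
  without uniqueness of the predual.\<close>

lemma is_predual_shift:
  assumes P: "is_predual M P" and u: "u \<in> carrier M" "star M u \<otimes> u = \<one>" "u \<otimes> star M u = \<one>"
  shows "is_predual M ((\<lambda>\<phi>. \<lambda>x\<in>carrier M. \<phi> (u \<otimes> x)) ` P)"
proof -
  define S where "S v \<phi> = (\<lambda>x\<in>carrier M. \<phi> (v \<otimes> x))" for v and \<phi> :: "'a \<Rightarrow> complex"
  let ?v = "star M u"
  have v: "?v \<in> carrier M" using u by simp
  have uv: "u \<otimes> (?v \<otimes> x) = x" "?v \<otimes> (u \<otimes> x) = x" if "x \<in> carrier M" for x
    using u v that by (simp_all add: m_assoc[symmetric])
  have nu: "nrm M (u \<otimes> x) = nrm M x" "nrm M (?v \<otimes> x) = nrm M x" if "x \<in> carrier M" for x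
    using nrm_isometry[of u x] nrm_isometry[of ?v x] u that by simp_all
  have Sval: "S w \<phi> x = \<phi> (w \<otimes> x)" if "x \<in> carrier M" for w \<phi> x using that by (simp add: S_def)
  have SS: "S u (S ?v \<phi>) = \<phi>" if "\<phi> \<in> extensional (carrier M)" for \<phi>
  proof
    fix x show "S u (S ?v \<phi>) x = \<phi> x"
      using that u v uv by (cases "x \<in> carrier M") (auto simp: S_def extensional_def)
  qed
  have Sb: "S w \<phi> \<in> bdd_functionals M" if \<phi>: "\<phi> \<in> bdd_functionals M" and w: "w \<in> carrier M" for w \<phi>
  proof -
    obtain C where C: "\<And>x. x \<in> carrier M \<Longrightarrow> cmod (\<phi> x) \<le> C * nrm M x"
      using \<phi> unfolding bdd_functionals_def by blast
    have "cmod (S w \<phi> x) \<le> (\<bar>C\<bar> * nrm M w) * nrm M x" if x: "x \<in> carrier M" for x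
    proof -
      have "cmod (S w \<phi> x) \<le> C * nrm M (w \<otimes> x)" using C x w by (simp add: Sval)
      also have "\<dots> \<le> \<bar>C\<bar> * (nrm M w * nrm M x)"
        using x w by (intro mult_mono nrm_mult) (auto simp: nrm_nonneg)
      finally show ?thesis by simp
    qed
    then show ?thesis
      using w bdd_functional_linear[OF \<phi>]
      unfolding bdd_functionals_def by (auto simp: S_def r_distr smult_right[symmetric] simp del: smult_left)
  qed
  have ball: "(\<lambda>x. w \<otimes> x) ` {x \<in> carrier M. nrm M x \<le> 1} = {x \<in> carrier M. nrm M x \<le> 1}"
    if "w = u \<or> w = ?v" for w
  proof (intro equalityI subsetI)
    fix x assume "x \<in> (\<lambda>x. w \<otimes> x) ` {x \<in> carrier M. nrm M x \<le> 1}"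
    then show "x \<in> {x \<in> carrier M. nrm M x \<le> 1}" using that u v nu by auto
  next
    fix x assume x: "x \<in> {x \<in> carrier M. nrm M x \<le> 1}"
    then show "x \<in> (\<lambda>x. w \<otimes> x) ` {x \<in> carrier M. nrm M x \<le> 1}"
      using that u v nu uv by (intro image_eqI[of _ _ "(if w = u then ?v else u) \<otimes> x"]) auto
  qed
  have fn: "functional_norm M (S w \<phi>) = functional_norm M \<phi>" if "w = u \<or> w = ?v" for w \<phi>
  proof -
    have "(\<lambda>x. cmod (S w \<phi> x)) ` {x \<in> carrier M. nrm M x \<le> 1}
      = (\<lambda>x. cmod (\<phi> x)) ` (\<lambda>x. w \<otimes> x) ` {x \<in> carrier M. nrm M x \<le> 1}"
      unfolding image_image by (intro image_cong) (auto simp: Sval)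
    then show ?thesis unfolding functional_norm_def ball[OF that] by simp
  qed
  have Pb: "P \<subseteq> bdd_functionals M"
    and P0: "(\<lambda>x\<in>carrier M. 0) \<in> P"
    and Pa: "\<forall>\<phi>\<in>P. \<forall>\<psi>\<in>P. (\<lambda>x\<in>carrier M. \<phi> x + \<psi> x) \<in> P"
    and Ps: "\<forall>c. \<forall>\<phi>\<in>P. (\<lambda>x\<in>carrier M. c * \<phi> x) \<in> P"
    and Pc: "\<forall>\<phi>\<in>bdd_functionals M.
        (\<forall>e>0. \<exists>\<psi>\<in>P. functional_norm M (\<lambda>x\<in>carrier M. \<phi> x - \<psi> x) < e) \<longrightarrow> \<phi> \<in> P"
    and Pn: "\<forall>x\<in>carrier M. nrm M x = (SUP \<phi>\<in>{\<phi> \<in> P. functional_norm M \<phi> \<le> 1}. cmod (\<phi> x))"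
    and Pd: "\<forall>\<Lambda> :: ('a \<Rightarrow> complex) \<Rightarrow> complex.
        (\<forall>\<phi>\<in>P. \<forall>\<psi>\<in>P. \<Lambda> (\<lambda>x\<in>carrier M. \<phi> x + \<psi> x) = \<Lambda> \<phi> + \<Lambda> \<psi>) \<and>
        (\<forall>c. \<forall>\<phi>\<in>P. \<Lambda> (\<lambda>x\<in>carrier M. c * \<phi> x) = c * \<Lambda> \<phi>) \<and>
        (\<exists>C. \<forall>\<phi>\<in>P. cmod (\<Lambda> \<phi>) \<le> C * functional_norm M \<phi>) \<longrightarrow>
        (\<exists>x\<in>carrier M. \<forall>\<phi>\<in>P. \<Lambda> \<phi> = \<phi> x)"
    using P unfolding is_predual_def by - (elim conjE, assumption)+
  have Sadd: "(\<lambda>x\<in>carrier M. S w \<phi> x + S w \<psi> x) = S w (\<lambda>x\<in>carrier M. \<phi> x + \<psi> x)"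
    and Sdiff: "(\<lambda>x\<in>carrier M. S w \<phi> x - S w \<psi> x) = S w (\<lambda>x\<in>carrier M. \<phi> x - \<psi> x)"
    and Ssc: "(\<lambda>x\<in>carrier M. c * S w \<phi> x) = S w (\<lambda>x\<in>carrier M. c * \<phi> x)"
    if "w \<in> carrier M" for w \<phi> \<psi> c
    using that by (auto simp: S_def fun_eq_iff restrict_def)
  have "is_predual M (S u ` P)"
    unfolding is_predual_def
  proof (intro conjI ballI allI impI)
    show "S u ` P \<subseteq> bdd_functionals M" using Pb Sb u by blast
    have "S u (\<lambda>x\<in>carrier M. 0) = (\<lambda>x\<in>carrier M. 0)" using u by (auto simp: S_def fun_eq_iff restrict_def)
    then show "(\<lambda>x\<in>carrier M. 0) \<in> S u ` P" using P0 by (metis image_eqI)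
  next
    fix \<phi> \<psi> assume "\<phi> \<in> S u ` P" "\<psi> \<in> S u ` P"
    then show "(\<lambda>x\<in>carrier M. \<phi> x + \<psi> x) \<in> S u ` P" using Pa Sadd[OF u(1)] by auto
  next
    fix c \<phi> assume "\<phi> \<in> S u ` P"
    then show "(\<lambda>x\<in>carrier M. c * \<phi> x) \<in> S u ` P" using Ps Ssc[OF u(1)] by auto
  next
    fix \<phi> assume \<phi>: "\<phi> \<in> bdd_functionals M"
      and ap: "\<forall>e>0. \<exists>\<psi>\<in>S u ` P. functional_norm M (\<lambda>x\<in>carrier M. \<phi> x - \<psi> x) < e"
    have ext: "\<phi> \<in> extensional (carrier M)" using \<phi> by (simp add: bdd_functionals_def)
    have "\<exists>\<psi>\<in>P. functional_norm M (\<lambda>x\<in>carrier M. S ?v \<phi> x - \<psi> x) < e" if "e > 0" for e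
    proof -
      obtain \<psi> where \<psi>: "\<psi> \<in> P" "functional_norm M (\<lambda>x\<in>carrier M. \<phi> x - S u \<psi> x) < e"
        using ap \<open>e > 0\<close> by blast
      have "(\<lambda>x\<in>carrier M. \<phi> x - S u \<psi> x) = S u (\<lambda>x\<in>carrier M. S ?v \<phi> x - \<psi> x)"
        unfolding Sdiff[OF u(1), symmetric] SS[OF ext] ..
      then show ?thesis using \<psi> fn[of u] by auto
    qed
    then have "S ?v \<phi> \<in> P" using Pc Sb[OF \<phi> v] by blast
    then show "\<phi> \<in> S u ` P" using SS[OF ext] by (metis image_eqI)
  next
    fix x assume x: "x \<in> carrier M"
    have "{\<phi> \<in> S u ` P. functional_norm M \<phi> \<le> 1} = S u ` {\<phi> \<in> P. functional_norm M \<phi> \<le> 1}"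
      using fn[of u] by auto
    then have "(SUP \<phi>\<in>{\<phi> \<in> S u ` P. functional_norm M \<phi> \<le> 1}. cmod (\<phi> x))
      = (SUP \<phi>\<in>{\<phi> \<in> P. functional_norm M \<phi> \<le> 1}. cmod (\<phi> (u \<otimes> x)))"
      using x by (simp add: image_image Sval)
    also have "\<dots> = nrm M (u \<otimes> x)" using Pn u x by simp
    finally show "nrm M x = (SUP \<phi>\<in>{\<phi> \<in> S u ` P. functional_norm M \<phi> \<le> 1}. cmod (\<phi> x))"
      using nu x by simp
  next
    fix \<Lambda> :: "('a \<Rightarrow> complex) \<Rightarrow> complex"
    assume L: "(\<forall>\<phi>\<in>S u ` P. \<forall>\<psi>\<in>S u ` P. \<Lambda> (\<lambda>x\<in>carrier M. \<phi> x + \<psi> x) = \<Lambda> \<phi> + \<Lambda> \<psi>) \<and>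
        (\<forall>c. \<forall>\<phi>\<in>S u ` P. \<Lambda> (\<lambda>x\<in>carrier M. c * \<phi> x) = c * \<Lambda> \<phi>) \<and>
        (\<exists>C. \<forall>\<phi>\<in>S u ` P. cmod (\<Lambda> \<phi>) \<le> C * functional_norm M \<phi>)"
    define \<Lambda>' where "\<Lambda>' \<phi> = \<Lambda> (S u \<phi>)" for \<phi>
    have 1: "\<forall>\<phi>\<in>P. \<forall>\<psi>\<in>P. \<Lambda>' (\<lambda>x\<in>carrier M. \<phi> x + \<psi> x) = \<Lambda>' \<phi> + \<Lambda>' \<psi>"
      using L unfolding \<Lambda>'_def Sadd[OF u(1), symmetric] by blast
    have 2: "\<forall>c. \<forall>\<phi>\<in>P. \<Lambda>' (\<lambda>x\<in>carrier M. c * \<phi> x) = c * \<Lambda>' \<phi>"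
      using L unfolding \<Lambda>'_def Ssc[OF u(1), symmetric] by blast
    have 3: "\<exists>C. \<forall>\<phi>\<in>P. cmod (\<Lambda>' \<phi>) \<le> C * functional_norm M \<phi>"
    proof -
      obtain C where "\<forall>\<phi>\<in>S u ` P. cmod (\<Lambda> \<phi>) \<le> C * functional_norm M \<phi>" using L by blast
      then have "\<forall>\<phi>\<in>P. cmod (\<Lambda>' \<phi>) \<le> C * functional_norm M \<phi>"
        using fn[of u] by (simp add: \<Lambda>'_def)
      then show ?thesis ..
    qed
    obtain x where x: "x \<in> carrier M" "\<forall>\<phi>\<in>P. \<Lambda>' \<phi> = \<phi> x"
      using Pd[THEN spec, of \<Lambda>'] 1 2 3 by blast
    show "\<exists>x\<in>carrier M. \<forall>\<phi>\<in>S u ` P. \<Lambda> \<phi> = \<phi> x"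
      by (rule bexI[of _ "?v \<otimes> x"]) (use x u v uv in \<open>auto simp: \<Lambda>'_def Sval\<close>)
  qed
  moreover have "S u = (\<lambda>\<phi>. \<lambda>x\<in>carrier M. \<phi> (u \<otimes> x))" by (rule ext) (simp add: S_def)
  ultimately show ?thesis by simp
qed

lemma topspace_weak_star [simp]: "topspace (weak_star_topology M) = carrier M"
proof -
  have "restrict (tr M) (carrier M) \<in> normal_functionals M" using tracial by (simp add: tracial_wstar_def)
  then have "carrier M \<in> {{x \<in> carrier M. \<phi> x \<in> V} | \<phi> V. \<phi> \<in> normal_functionals M \<and> open V}"
    by (intro CollectI exI[of _ "restrict (tr M) (carrier M)"] exI[of _ UNIV]) auto
  then show ?thesis unfolding weak_star_topology_def by auto
qed

lemma continuous_map_normal: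
  assumes "\<phi> \<in> normal_functionals M"
  shows "continuous_map (weak_star_topology M) euclidean \<phi>"
  unfolding continuous_map_def
proof (intro conjI allI impI)
  fix V :: "complex set" assume "openin euclidean V"
  then have "{x \<in> carrier M. \<phi> x \<in> V} \<in> {{x \<in> carrier M. \<phi> x \<in> V} | \<phi> V. \<phi> \<in> normal_functionals M \<and> open V}"
    using assms by auto
  then show "openin (weak_star_topology M) {x \<in> topspace (weak_star_topology M). \<phi> x \<in> V}"
    unfolding topspace_weak_star unfolding weak_star_topology_def by (rule topology_generated_by_Basis)
qed simp

lemma continuous_map_tr_unitary:
  assumes u: "u \<in> carrier M" "star M u \<otimes> u = \<one>" "u \<otimes> star M u = \<one>"
  shows "continuous_map (weak_star_topology M) euclidean (\<lambda>x. tr M (u \<otimes> x))"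
proof -
  obtain P where P: "is_predual M P" "restrict (tr M) (carrier M) \<in> P"
    using tracial by (auto simp: tracial_wstar_def normal_functionals_def)
  let ?\<phi> = "\<lambda>x\<in>carrier M. restrict (tr M) (carrier M) (u \<otimes> x)"
  have "?\<phi> \<in> (\<lambda>\<phi>. \<lambda>x\<in>carrier M. \<phi> (u \<otimes> x)) ` P" using P(2) by blast
  then have "?\<phi> \<in> normal_functionals M"
    using is_predual_shift[OF P(1) u] unfolding normal_functionals_def by blast
  from continuous_map_normal[OF this] show ?thesis
    by (rule continuous_map_eq) (use u in auto)
qed

lemma nr_complete:
  assumes "\<And>e. e > 0 \<Longrightarrow> \<exists>N. \<forall>k\<ge>N. \<forall>l\<ge>N. nrm M (ev (s k - s l)) < e"
  shows "\<exists>x. (\<lambda>k. nrm M (ev (s k - x))) \<longlonglongrightarrow> 0"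
proof -
  have "\<exists>x\<in>carrier M. (\<lambda>k. nrm M (ev (s k) \<ominus> x)) \<longlonglongrightarrow> 0"
    by (rule nrm_complete) (use assms in auto)
  then obtain x where "x \<in> carrier M" "(\<lambda>k. nrm M (ev (s k) \<ominus> x)) \<longlonglongrightarrow> 0" by blast
  then show ?thesis by (intro exI[of _ "lv x"]) simp
qed

lemma minus_eq_zero_iff: "x \<in> carrier M \<Longrightarrow> y \<in> carrier M \<Longrightarrow> x \<ominus> y = \<zero> \<longleftrightarrow> x = y"
proof
  assume xy: "x \<in> carrier M" "y \<in> carrier M" and 0: "x \<ominus> y = \<zero>"
  have "(x \<ominus> y) \<oplus> y = x" using xy by (simp add: a_minus_def a_assoc l_neg)
  then show "x = y" using xy 0 by simp
qed (simp add: a_minus_def r_neg)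

text \<open>A self-adjoint element of norm at most 1/2 is the average of a unitary and its adjoint,
  so a rescaled \<open>b\<close> reduces to the case of unitaries.\<close>

lemma continuous_map_tr_sa:
  assumes b: "b \<in> carrier M" "star M b = b"
  shows "continuous_map (weak_star_topology M) euclidean (\<lambda>x. tr M (b \<otimes> x))"
proof -
  \<comment> \<open>The rescaled element has norm at most 1/2; the summand 1 keeps \<open>m\<close>
    positive when \<open>b\<close> is zero.\<close>
  define m where "m = 2 * (nrm M b + 1)"
  have m: "m > 0" using nrm_nonneg[OF b(1)] by (simp add: m_def)
  \<comment> \<open>A formal variable is not fixed by \<open>poly_star\<close>, even if its value is
    self-adjoint; the symmetrised polynomial is fixed and has the same value.\<close>
  define h where "h = const_poly (1/2) * (const_poly (complex_of_real (1 / m)) * (lv b + poly_star (lv b)))"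
  have eh: "ev h = complex_of_real (1 / m) \<odot>\<^bsub>M\<^esub> b"
  proof -
    have "ev h = (1/2) \<odot>\<^bsub>M\<^esub> (complex_of_real (1 / m) \<odot>\<^bsub>M\<^esub> (b \<oplus> b))"
      using b by (simp add: h_def sm_assoc[symmetric] mult.commute)
    also have "\<dots> = (1/2 * complex_of_real (1 / m) + 1/2 * complex_of_real (1 / m)) \<odot>\<^bsub>M\<^esub> b"
      using b by (simp only: sm_add_right sm_assoc sm_add_left sm_closed)
    also have "1/2 * complex_of_real (1 / m) + 1/2 * complex_of_real (1 / m) = complex_of_real (1 / m)" by simp
    finally show ?thesis .
  qed
  have h: "poly_star h = h" "nrm M (ev h) \<le> 1/2"
  proof -
    show "poly_star h = h" by (simp add: h_def F.st_scm F.st_add poly_star_star add.commute)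
    show "nrm M (ev h) \<le> 1/2" unfolding eh using m b nrm_nonneg[OF b(1)]
      by (simp add: nrm_smult norm_divide) (simp add: m_def field_simps)
  qed
  obtain u where u: "nrm M (ev (poly_star u * u - 1)) = 0" "nrm M (ev (u * poly_star u - 1)) = 0"
    and hu: "h = const_poly (1/2) * (u + poly_star u)"
    using F.unitary_average[OF nr_complete h] by blast
  have U: "star M (ev u) \<otimes> ev u = \<one>" "ev u \<otimes> star M (ev u) = \<one>"
    using u by (simp_all add: nrm_eq_0 minus_eq_zero_iff)
  have eq: "tr M (b \<otimes> x) = complex_of_real (m / 2) * (tr M (ev u \<otimes> x) + tr M (star M (ev u) \<otimes> x))"
    if x: "x \<in> carrier M" for x
  proof -
    have "complex_of_real m * complex_of_real (1 / m) = 1" using m by simp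
    then have "b = complex_of_real m \<odot>\<^bsub>M\<^esub> (complex_of_real (1 / m) \<odot>\<^bsub>M\<^esub> b)"
      using b sm_assoc[of b "complex_of_real m" "complex_of_real (1 / m)"] by simp
    also have "complex_of_real (1 / m) \<odot>\<^bsub>M\<^esub> b = (1/2) \<odot>\<^bsub>M\<^esub> (ev u \<oplus> star M (ev u))"
      unfolding eh[symmetric] hu by simp
    finally have "b \<otimes> x = (complex_of_real m \<odot>\<^bsub>M\<^esub> ((1/2) \<odot>\<^bsub>M\<^esub> (ev u \<oplus> star M (ev u)))) \<otimes> x" by simp
    then have "tr M (b \<otimes> x) = complex_of_real m * (1/2 * (tr M (ev u \<otimes> x) + tr M (star M (ev u) \<otimes> x)))"
      using x by (simp add: l_distr tr_smult tr_add)
    then show ?thesis by simp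
  qed
  have "continuous_map (weak_star_topology M) euclidean
      (\<lambda>x. complex_of_real (m / 2) * (tr M (ev u \<otimes> x) + tr M (star M (ev u) \<otimes> x)))"
  proof -
    have c: "continuous_map (weak_star_topology M) euclidean (\<lambda>x. tr M (ev u \<otimes> x) + tr M (star M (ev u) \<otimes> x))"
      by (intro continuous_map_add continuous_map_tr_unitary) (use U in auto)
    have "continuous_map euclidean euclidean (\<lambda>z. complex_of_real (m / 2) * z)"
      unfolding continuous_map_iff_continuous2 by (intro continuous_intros)
    from continuous_map_compose[OF c this] show ?thesis by (simp add: o_def)
  qed
  then show ?thesis by (rule continuous_map_eq) (use eq in auto)
qed

lemma continuous_map_tr_mult:
  assumes b: "b \<in> carrier M"
  shows "continuous_map (weak_star_topology M) euclidean (\<lambda>x. tr M (b \<otimes> x))"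
proof -
  obtain y z where yz: "lv b = y + const_poly \<i> * z" "poly_star y = y" "poly_star z = z"
    using F.real_imaginary_parts[of "lv b"] by metis
  have eb: "b = ev y \<oplus> \<i> \<odot>\<^bsub>M\<^esub> ev z" using b yz(1) ev_lv[of b] by simp
  have sa: "star M (ev y) = ev y" "star M (ev z) = ev z" using yz by (metis ev_star)+
  have c1: "continuous_map (weak_star_topology M) euclidean (\<lambda>x. tr M (ev y \<otimes> x))"
    and c2: "continuous_map (weak_star_topology M) euclidean (\<lambda>x. tr M (ev z \<otimes> x))"
    using sa by (auto intro: continuous_map_tr_sa)
  have "continuous_map euclidean euclidean (\<lambda>z. \<i> * z)"
    unfolding continuous_map_iff_continuous2 by (intro continuous_intros)
  from continuous_map_compose[OF c2 this] 
  have c3: "continuous_map (weak_star_topology M) euclidean (\<lambda>x. \<i> * tr M (ev z \<otimes> x))" by (simp add: o_def)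
  have eq: "tr M (ev y \<otimes> x) + \<i> * tr M (ev z \<otimes> x) = tr M (b \<otimes> x)" if "x \<in> carrier M" for x
    unfolding eb using that by (simp add: l_distr tr_add tr_smult)
  show ?thesis
    by (rule continuous_map_eq[OF continuous_map_add[OF c1 c3]]) (use eq in auto)
qed

definition carrier_star_subalgebra :: "'a set \<Rightarrow> bool" where
  "carrier_star_subalgebra S \<longleftrightarrow> S \<subseteq> carrier M \<and> \<one> \<in> S \<and>
     (\<forall>x\<in>S. \<forall>y\<in>S. x \<oplus> y \<in> S \<and> x \<otimes> y \<in> S) \<and> (\<forall>c. \<forall>x\<in>S. c \<odot>\<^bsub>M\<^esub> x \<in> S) \<and> (\<forall>x\<in>S. star M x \<in> S)"

text \<open>The double annihilator of \<open>S\<close> with respect to the trace pairing is a weak* closed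
  *-subalgebra.\<close>

lemma generating_annihilator_trivial:
  assumes S: "carrier_star_subalgebra S" and gen: "wstar_generated M G = carrier M" "G \<subseteq> S"
    and b: "b \<in> carrier M" and orth: "\<And>a. a \<in> S \<Longrightarrow> tr M (a \<otimes> b) = 0"
  shows "b = \<zero>"
proof -
  define B where "B = {b \<in> carrier M. \<forall>a\<in>S. tr M (b \<otimes> a) = 0}"
  define N where "N = {x \<in> carrier M. \<forall>b\<in>B. tr M (b \<otimes> x) = 0}"
  have Sc: "x \<in> S \<Longrightarrow> x \<in> carrier M" for x using S by (auto simp: carrier_star_subalgebra_def)
  have B0: "\<zero> \<in> B" using Sc tr_smult[of \<zero> 0] by (simp add: B_def)
  have Bc: "x \<in> B \<Longrightarrow> x \<in> carrier M" for x by (simp add: B_def)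
  \<comment> \<open>Left multiplication by \<open>S\<close> preserves \<open>B\<close>; by the trace
    property right multiplication by \<open>N\<close> then preserves \<open>B\<close> as well, and
    this is what makes \<open>N\<close> closed under products.\<close>
  have BSl: "a \<otimes> x \<in> B" if "x \<in> B" "a \<in> S" for x a
  proof -
    have "tr M ((a \<otimes> x) \<otimes> c) = 0" if c: "c \<in> S" for c
    proof -
      have "tr M ((a \<otimes> x) \<otimes> c) = tr M (x \<otimes> (c \<otimes> a))"
        using tr_comm[of a "x \<otimes> c"] Sc[OF c] Sc[OF \<open>a \<in> S\<close>] Bc[OF \<open>x \<in> B\<close>] by (simp add: m_assoc)
      also have "c \<otimes> a \<in> S" using \<open>a \<in> S\<close> c S by (simp add: carrier_star_subalgebra_def)
      then have "tr M (x \<otimes> (c \<otimes> a)) = 0" using \<open>x \<in> B\<close> by (simp add: B_def)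
      finally show ?thesis .
    qed
    then show ?thesis using Sc[OF that(2)] Bc[OF that(1)] by (simp add: B_def)
  qed
  have Bst: "star M x \<in> B" if "x \<in> B" for x
  proof -
    have "tr M (star M x \<otimes> a) = 0" if a: "a \<in> S" for a
    proof -
      have "tr M (star M x \<otimes> a) = cnj (tr M (star M a \<otimes> x))"
        using tr_star[of "star M a \<otimes> x"] Sc[OF a] Bc[OF \<open>x \<in> B\<close>] by (simp add: star_mult)
      also have "tr M (star M a \<otimes> x) = tr M (x \<otimes> star M a)" using tr_comm Sc[OF a] Bc[OF \<open>x \<in> B\<close>] by simp
      also have "\<dots> = 0" using \<open>x \<in> B\<close> a S by (simp add: B_def carrier_star_subalgebra_def)
      finally show ?thesis by simp
    qed
    then show ?thesis using Bc[OF that] by (simp add: B_def)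
  qed
  have SN: "S \<subseteq> N"
  proof
    fix x assume x: "x \<in> S"
    then have "\<forall>b\<in>B. tr M (b \<otimes> x) = 0" by (simp add: B_def)
    then show "x \<in> N" using Sc[OF x] by (simp add: N_def)
  qed
  have Nc: "x \<in> N \<Longrightarrow> x \<in> carrier M" for x by (simp add: N_def)
  have BN: "x \<otimes> y \<in> B" if "x \<in> B" "y \<in> N" for x y
  proof -
    have "tr M ((x \<otimes> y) \<otimes> a) = 0" if a: "a \<in> S" for a
    proof -
      have "tr M ((x \<otimes> y) \<otimes> a) = tr M ((a \<otimes> x) \<otimes> y)"
        using tr_comm[of "x \<otimes> y" a] Sc[OF a] Bc[OF \<open>x \<in> B\<close>] Nc[OF \<open>y \<in> N\<close>] by (simp add: m_assoc)
      also have "\<dots> = 0" using \<open>y \<in> N\<close> BSl[OF \<open>x \<in> B\<close> a] by (simp add: N_def)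
      finally show ?thesis .
    qed
    then show ?thesis using Bc[OF that(1)] Nc[OF that(2)] by (simp add: B_def)
  qed
  have "wstar_subalgebra M N"
    unfolding wstar_subalgebra_def
  proof (intro conjI ballI allI)
    show "N \<subseteq> carrier M" using Nc by blast
    show "\<one> \<in> N" using SN S by (auto simp: carrier_star_subalgebra_def)
    have cl: "closedin (weak_star_topology M) {x \<in> topspace (weak_star_topology M). tr M (b \<otimes> x) \<in> {0}}"
      if "b \<in> B" for b
      by (rule closedin_continuous_map_preimage[OF continuous_map_tr_mult[OF Bc[OF that]]]) simp
    have "N = (\<Inter>b\<in>B. {x \<in> topspace (weak_star_topology M). tr M (b \<otimes> x) \<in> {0}})"
      using B0 by (auto simp: N_def)
    also have "closedin (weak_star_topology M) \<dots>"
      using B0 cl by (intro closedin_Inter) blast+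
    finally show "closedin (weak_star_topology M) N" .
  next
    fix x y assume xy: "x \<in> N" "y \<in> N"
    have "tr M (c \<otimes> (x \<oplus> y)) = 0" if "c \<in> B" for c
      using Bc[OF that] Nc[OF xy(1)] Nc[OF xy(2)] xy that by (simp add: N_def r_distr tr_add)
    then show "x \<oplus> y \<in> N" using Nc[OF xy(1)] Nc[OF xy(2)] by (simp add: N_def)
    have "tr M (c \<otimes> (x \<otimes> y)) = 0" if "c \<in> B" for c
    proof -
      have "tr M (c \<otimes> (x \<otimes> y)) = tr M ((c \<otimes> x) \<otimes> y)" using Bc[OF that] Nc[OF xy(1)] Nc[OF xy(2)] by (simp add: m_assoc)
      then show ?thesis using BN[OF that xy(1)] xy(2) by (simp add: N_def)
    qed
    then show "x \<otimes> y \<in> N" using Nc[OF xy(1)] Nc[OF xy(2)] by (simp add: N_def)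
  next
    fix c x assume x: "x \<in> N"
    have "tr M (d \<otimes> (c \<odot>\<^bsub>M\<^esub> x)) = 0" if "d \<in> B" for d
      using Bc[OF that] Nc[OF x] x that by (simp add: N_def tr_smult)
    then show "c \<odot>\<^bsub>M\<^esub> x \<in> N" using Nc[OF x] by (simp add: N_def)
  next
    fix x assume x: "x \<in> N"
    have "tr M (c \<otimes> star M x) = 0" if c: "c \<in> B" for c
    proof -
      have "tr M (c \<otimes> star M x) = cnj (tr M (x \<otimes> star M c))"
        using tr_star[of "x \<otimes> star M c"] Bc[OF c] Nc[OF x] by (simp add: star_mult)
      also have "tr M (x \<otimes> star M c) = tr M (star M c \<otimes> x)" using tr_comm Bc[OF c] Nc[OF x] by simp
      also have "\<dots> = 0" using x Bst[OF c] by (simp add: N_def)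
      finally show ?thesis by simp
    qed
    then show "star M x \<in> N" using x by (simp add: N_def)
  qed
  then have "carrier M \<subseteq> N" using gen SN unfolding wstar_generated_def by blast
  then have "star M b \<in> N" using b by blast
  moreover have "b \<in> B"
  proof -
    have "tr M (b \<otimes> a) = 0" if "a \<in> S" for a using tr_comm[OF b Sc[OF that]] orth[OF that] by simp
    then show ?thesis using b by (simp add: B_def)
  qed
  ultimately have "tr M (b \<otimes> star M b) = 0" by (simp add: N_def)
  then have "norm2 M (star M b) = 0" using b by (simp add: norm2_def)
  then have "star M b = \<zero>" using norm2_eq_0[of "star M b"] b by simp
  then have "star M (star M b) = star M \<zero>" by (rule arg_cong)
  then show ?thesis using b by simp
qed

text \<open>\<open>density\<close> for the polynomials that evaluate into \<open>S\<close>; its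
  hypothesis \<open>orth\<close> is the triviality of the annihilator of \<open>S\<close>. The
  ultrafilter is the device that produces the weak* limits.\<close>

theorem norm2_density:
  assumes U: "free_ultrafilter U"
    and S: "carrier_star_subalgebra S" and gen: "wstar_generated M G = carrier M" "G \<subseteq> S"
    and x: "x \<in> carrier M" and e: "e > 0"
  shows "\<exists>a\<in>S. norm2 M (x \<ominus> a) < e"
proof -
  obtain P where P: "is_predual M P" "restrict (tr M) (carrier M) \<in> P"
    using tracial by (auto simp: tracial_wstar_def normal_functionals_def)
  interpret L: tracial_limits const_poly poly_star "\<lambda>p. nrm M (ev p)" "\<lambda>p. tr M (ev p)" U
    "\<lambda>y x. \<forall>\<phi>\<in>P. ((\<lambda>k. \<phi> (ev (y k))) \<longlongrightarrow> \<phi> (ev x)) U"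
    by (rule tracial_limits_predual[OF U P])
  define T where "T = {p. ev p \<in> S}"
  have "F.star_subalg T"
    using S unfolding F.star_subalg_def T_def carrier_star_subalgebra_def by (auto simp: subset_iff)
  moreover have "F.n2 b = 0" if "\<And>a. a \<in> T \<Longrightarrow> tr M (ev (a * b)) = 0" for b
  proof -
    have "ev b = \<zero>"
    proof (rule generating_annihilator_trivial[OF S gen])
      fix a assume a: "a \<in> S"
      then have "a \<in> carrier M" using S by (auto simp: carrier_star_subalgebra_def)
      then show "tr M (a \<otimes> ev b) = 0" using that[of "lv a"] a by (simp add: T_def)
    qed simp
    then show ?thesis by (simp add: n2_ev norm2_eq_0)
  qed
  ultimately have "\<exists>a\<in>T. F.n2 (lv x - a) < e"
    using L.density[OF _ e _ free_ultrafilter_ge[OF U]] by blast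
  then show ?thesis using x by (auto simp: T_def n2_ev)
qed

end

section \<open>Matrix algebras\<close>

lemma dim_mat_adjoint [simp]: "dim_row (mat_adjoint A) = dim_col A" "dim_col (mat_adjoint A) = dim_row A"
  by (simp_all add: mat_adjoint_def)

lemma mat_adjoint_carrier [simp, intro]: "A \<in> carrier_mat m n \<Longrightarrow> mat_adjoint A \<in> carrier_mat n m"
  by (rule carrier_matI) simp_all

lemma index_mat_adjoint [simp]:
  "i < dim_col A \<Longrightarrow> j < dim_row A \<Longrightarrow> mat_adjoint A $$ (i, j) = conjugate (A $$ (j, i))"
  by (simp add: mat_adjoint_def mat_of_rows_index)

lemma mat_adjoint_adjoint [simp]: "mat_adjoint (mat_adjoint A) = (A :: complex mat)"
  by (rule eq_matI) auto

lemma mat_adjoint_add: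
  "A \<in> carrier_mat m n \<Longrightarrow> B \<in> carrier_mat m n \<Longrightarrow> mat_adjoint (A + B) = mat_adjoint A + (mat_adjoint B :: complex mat)"
  by (rule eq_matI) auto

lemma mat_adjoint_smult: "mat_adjoint (c \<cdot>\<^sub>m A) = cnj c \<cdot>\<^sub>m (mat_adjoint A :: complex mat)"
  by (rule eq_matI) auto

lemma mat_adjoint_one [simp]: "mat_adjoint (1\<^sub>m n) = (1\<^sub>m n :: complex mat)"
  by (rule eq_matI) auto

lemma mat_adjoint_mult:
  fixes A B :: "complex mat"
  assumes "A \<in> carrier_mat l m" "B \<in> carrier_mat m n"
  shows "mat_adjoint (A * B) = mat_adjoint B * mat_adjoint A"
proof (rule eq_matI)
  fix i j assume "i < dim_row (mat_adjoint B * mat_adjoint A)" "j < dim_col (mat_adjoint B * mat_adjoint A)"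
  then have ij: "i < n" "j < l" using assms by auto
  have "mat_adjoint (A * B) $$ (i, j) = cnj (\<Sum>k\<in>{0..<m}. A $$ (j, k) * B $$ (k, i))"
    using assms ij by (simp add: scalar_prod_def)
  also have "\<dots> = (\<Sum>k\<in>{0..<m}. cnj (B $$ (k, i)) * cnj (A $$ (j, k)))"
    by (simp add: mult.commute)
  also have "\<dots> = (mat_adjoint B * mat_adjoint A) $$ (i, j)"
    using assms ij by (simp add: scalar_prod_def)
  finally show "mat_adjoint (A * B) $$ (i, j) = (mat_adjoint B * mat_adjoint A) $$ (i, j)" .
qed (use assms in auto)

lemma mult_cnj_eq: "z * cnj z = (complex_of_real (cmod z))\<^sup>2"
  by (metis complex_norm_square of_real_power)

lemma vec_norm2_L2: "vec_norm2 v = L2_set (\<lambda>i. cmod (v $ i)) {0..<dim_vec v}"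
proof -
  have "Re (v \<bullet>c v) = (\<Sum>i\<in>{0..<dim_vec v}. (cmod (v $ i))\<^sup>2)"
    unfolding scalar_prod_def Re_sum by (intro sum.cong) (auto simp: mult_cnj_eq simp flip: of_real_power simp del: times_complex.sel)
  then show ?thesis by (simp add: vec_norm2_def L2_set_def)
qed

lemma vec_norm2_nonneg [simp]: "0 \<le> vec_norm2 v"
  by (simp add: vec_norm2_L2)

lemma vec_norm2_sq: "v \<bullet>c v = complex_of_real ((vec_norm2 v)\<^sup>2)"
proof -
  have "v \<bullet>c v = complex_of_real (\<Sum>i\<in>{0..<dim_vec v}. (cmod (v $ i))\<^sup>2)"
    unfolding scalar_prod_def of_real_sum by (intro sum.cong) (auto simp: mult_cnj_eq)
  also have "(\<Sum>i\<in>{0..<dim_vec v}. (cmod (v $ i))\<^sup>2) = (vec_norm2 v)\<^sup>2"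
    by (simp add: vec_norm2_L2 L2_set_def sum_nonneg)
  finally show ?thesis .
qed

lemma vec_norm2_eq_0: "v \<in> carrier_vec n \<Longrightarrow> vec_norm2 v = 0 \<longleftrightarrow> v = 0\<^sub>v n"
  by (auto simp: vec_norm2_L2 L2_set_eq_0_iff intro!: eq_vecI)

lemma vec_norm2_add:
  assumes "v \<in> carrier_vec n" "w \<in> carrier_vec n"
  shows "vec_norm2 (v + w) \<le> vec_norm2 v + vec_norm2 w"
proof -
  have "vec_norm2 (v + w) = L2_set (\<lambda>i. cmod (v $ i + w $ i)) {0..<n}"
    using assms unfolding vec_norm2_L2 by (intro L2_set_cong) auto
  also have "\<dots> \<le> L2_set (\<lambda>i. cmod (v $ i) + cmod (w $ i)) {0..<n}"
    by (intro L2_set_mono norm_triangle_ineq) auto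
  also have "\<dots> \<le> L2_set (\<lambda>i. cmod (v $ i)) {0..<n} + L2_set (\<lambda>i. cmod (w $ i)) {0..<n}"
    by (rule L2_set_triangle_ineq)
  finally show ?thesis using assms by (simp add: vec_norm2_L2)
qed

lemma vec_norm2_smult: "vec_norm2 (c \<cdot>\<^sub>v v) = cmod c * vec_norm2 v"
proof -
  have "vec_norm2 (c \<cdot>\<^sub>v v) = L2_set (\<lambda>i. cmod c * cmod (v $ i)) {0..<dim_vec v}"
    unfolding vec_norm2_L2 by (intro L2_set_cong) (auto simp: norm_mult)
  then show ?thesis by (simp add: vec_norm2_L2 L2_set_right_distrib)
qed

lemma vec_Cauchy_Schwarz:
  fixes v w :: "complex vec"
  assumes "v \<in> carrier_vec n" "w \<in> carrier_vec n"
  shows "cmod (v \<bullet>c w) \<le> vec_norm2 v * vec_norm2 w"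
proof -
  have "v \<bullet>c w = (\<Sum>i\<in>{0..<n}. v $ i * cnj (w $ i))" using assms by (simp add: scalar_prod_def)
  then have "cmod (v \<bullet>c w) \<le> (\<Sum>i\<in>{0..<n}. \<bar>cmod (v $ i)\<bar> * \<bar>cmod (w $ i)\<bar>)"
    by (simp only:) (rule sum_norm_le, simp add: norm_mult)
  also have "\<dots> \<le> L2_set (\<lambda>i. cmod (v $ i)) {0..<n} * L2_set (\<lambda>i. cmod (w $ i)) {0..<n}"
    by (rule L2_set_mult_ineq)
  finally show ?thesis using assms by (simp add: vec_norm2_L2)
qed

lemma adjoint_cscalar_prod:
  fixes A :: "complex mat"
  assumes A: "A \<in> carrier_mat m n" and v: "v \<in> carrier_vec n" and w: "w \<in> carrier_vec m"
  shows "(A *\<^sub>v v) \<bullet>c w = v \<bullet>c (mat_adjoint A *\<^sub>v w)"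
proof -
  have "(A *\<^sub>v v) \<bullet>c w = (\<Sum>i\<in>{0..<m}. \<Sum>j\<in>{0..<n}. A $$ (i, j) * v $ j * cnj (w $ i))"
    using assms by (auto simp: scalar_prod_def sum_distrib_right intro!: sum.cong)
  also have "\<dots> = (\<Sum>j\<in>{0..<n}. \<Sum>i\<in>{0..<m}. A $$ (i, j) * v $ j * cnj (w $ i))"
    by (rule sum.swap)
  also have "\<dots> = v \<bullet>c (mat_adjoint A *\<^sub>v w)"
    using assms by (auto simp: scalar_prod_def sum_distrib_left mult_ac intro!: sum.cong)
  finally show ?thesis .
qed

lemma operator_norm_bdd:
  fixes A :: "complex mat"
  assumes A: "A \<in> carrier_mat m n"
  shows "bdd_above ((\<lambda>v. vec_norm2 (A *\<^sub>v v)) ` {v \<in> carrier_vec (dim_col A). vec_norm2 v \<le> 1})"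
proof (rule bdd_aboveI2)
  fix v assume "v \<in> {v \<in> carrier_vec (dim_col A). vec_norm2 v \<le> 1}"
  then have v: "v \<in> carrier_vec n" "vec_norm2 v \<le> 1" using A by auto
  have vj: "cmod (v $ j) \<le> 1" if "j < n" for j
  proof -
    have "cmod (v $ j) \<le> vec_norm2 v"
      using that v member_le_L2_set[of "{0..<n}" j "\<lambda>i. cmod (v $ i)"] by (simp add: vec_norm2_L2)
    then show ?thesis using v by simp
  qed
  have "vec_norm2 (A *\<^sub>v v) \<le> (\<Sum>i\<in>{0..<m}. cmod ((A *\<^sub>v v) $ i))"
  proof -
    have d: "dim_vec (A *\<^sub>v v) = m" using A by simp
    show ?thesis unfolding vec_norm2_L2 d by (rule L2_set_le_sum) simp
  qed
  also have "\<dots> \<le> (\<Sum>i\<in>{0..<m}. \<Sum>j\<in>{0..<n}. cmod (A $$ (i, j)))"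
  proof (rule sum_mono)
    fix i assume "i \<in> {0..<m}"
    then have "cmod ((A *\<^sub>v v) $ i) = cmod (\<Sum>j\<in>{0..<n}. A $$ (i, j) * v $ j)"
      using A v by (simp add: scalar_prod_def)
    also have "\<dots> \<le> (\<Sum>j\<in>{0..<n}. cmod (A $$ (i, j)))"
      using vj by (intro sum_norm_le) (auto simp: norm_mult intro!: mult_left_le)
    finally show "cmod ((A *\<^sub>v v) $ i) \<le> (\<Sum>j\<in>{0..<n}. cmod (A $$ (i, j)))" .
  qed
  finally show "vec_norm2 (A *\<^sub>v v) \<le> (\<Sum>i\<in>{0..<m}. \<Sum>j\<in>{0..<n}. cmod (A $$ (i, j)))" .
qed

lemma vec_norm2_zero [simp]: "vec_norm2 (0\<^sub>v n) = 0"
  by (simp add: vec_norm2_eq_0[of _ n])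

lemma operator_norm_nonneg: "A \<in> carrier_mat m n \<Longrightarrow> 0 \<le> operator_norm A"
  unfolding operator_norm_def
  by (rule cSUP_upper2[OF operator_norm_bdd, of A m n "0\<^sub>v (dim_col A)"]) auto

lemma operator_norm_bound:
  fixes A :: "complex mat"
  assumes A: "A \<in> carrier_mat m n" and v: "v \<in> carrier_vec n"
  shows "vec_norm2 (A *\<^sub>v v) \<le> operator_norm A * vec_norm2 v"
proof (cases "vec_norm2 v = 0")
  case True
  then have "v = 0\<^sub>v n" using v vec_norm2_eq_0 by blast
  then have "A *\<^sub>v v = 0\<^sub>v m" using A by (intro eq_vecI) (auto simp: scalar_prod_def)
  then show ?thesis using True by simp
next
  case False
  then have p: "vec_norm2 v > 0" by (simp add: less_le)
  let ?c = "complex_of_real (1 / vec_norm2 v)"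
  have "?c \<cdot>\<^sub>v v \<in> {v \<in> carrier_vec (dim_col A). vec_norm2 v \<le> 1}"
    using A v p by (simp add: vec_norm2_smult norm_divide)
  then have "vec_norm2 (A *\<^sub>v (?c \<cdot>\<^sub>v v)) \<le> operator_norm A"
    unfolding operator_norm_def by (rule cSUP_upper[OF _ operator_norm_bdd[OF A]])
  also have "A *\<^sub>v (?c \<cdot>\<^sub>v v) = ?c \<cdot>\<^sub>v (A *\<^sub>v v)" using A v by (intro mult_mat_vec)
  finally have "vec_norm2 (A *\<^sub>v v) / vec_norm2 v \<le> operator_norm A"
    using p by (simp add: vec_norm2_smult norm_divide)
  then show ?thesis using p by (simp add: pos_divide_le_eq)
qed

lemma operator_norm_le:
  assumes A: "A \<in> carrier_mat m n" and K: "0 \<le> K"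
    and le: "\<And>v. v \<in> carrier_vec n \<Longrightarrow> vec_norm2 (A *\<^sub>v v) \<le> K * vec_norm2 v"
  shows "operator_norm A \<le> K"
  unfolding operator_norm_def
proof (rule cSUP_least)
  show "{v \<in> carrier_vec (dim_col A). vec_norm2 v \<le> 1} \<noteq> {}"
    by (auto intro!: exI[of _ "0\<^sub>v (dim_col A)"])
  fix v assume "v \<in> {v \<in> carrier_vec (dim_col A). vec_norm2 v \<le> 1}"
  then have v: "v \<in> carrier_vec n" "vec_norm2 v \<le> 1" using A by auto
  have "vec_norm2 (A *\<^sub>v v) \<le> K * vec_norm2 v" by (rule le[OF v(1)])
  also have "\<dots> \<le> K * 1" using v K by (intro mult_left_mono) auto
  finally show "vec_norm2 (A *\<^sub>v v) \<le> K" by simp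
qed

lemma operator_norm_add:
  assumes A: "A \<in> carrier_mat m n" and B: "B \<in> carrier_mat m n"
  shows "operator_norm (A + B) \<le> operator_norm A + operator_norm B"
proof (rule operator_norm_le[of _ m n])
  fix v :: "complex vec" assume v: "v \<in> carrier_vec n"
  have "(A + B) *\<^sub>v v = A *\<^sub>v v + B *\<^sub>v v" using A B v by (rule add_mult_distrib_mat_vec)
  then have "vec_norm2 ((A + B) *\<^sub>v v) \<le> vec_norm2 (A *\<^sub>v v) + vec_norm2 (B *\<^sub>v v)"
    using A B v vec_norm2_add[of "A *\<^sub>v v" m "B *\<^sub>v v"] by simp
  also have "\<dots> \<le> operator_norm A * vec_norm2 v + operator_norm B * vec_norm2 v"
    by (rule add_mono[OF operator_norm_bound[OF A v] operator_norm_bound[OF B v]])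
  finally show "vec_norm2 ((A + B) *\<^sub>v v) \<le> (operator_norm A + operator_norm B) * vec_norm2 v"
    by (simp add: distrib_right)
qed (use A B operator_norm_nonneg in auto)

lemma operator_norm_mult:
  assumes A: "A \<in> carrier_mat l m" and B: "B \<in> carrier_mat m n"
  shows "operator_norm (A * B) \<le> operator_norm A * operator_norm B"
proof (rule operator_norm_le[of _ l n])
  fix v :: "complex vec" assume v: "v \<in> carrier_vec n"
  have "(A * B) *\<^sub>v v = A *\<^sub>v (B *\<^sub>v v)" using A B v by (rule assoc_mult_mat_vec)
  then have "vec_norm2 ((A * B) *\<^sub>v v) \<le> operator_norm A * vec_norm2 (B *\<^sub>v v)"
    using operator_norm_bound[OF A, of "B *\<^sub>v v"] B v by simp
  also have "\<dots> \<le> operator_norm A * (operator_norm B * vec_norm2 v)"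
    by (rule mult_left_mono[OF operator_norm_bound[OF B v] operator_norm_nonneg[OF A]])
  finally show "vec_norm2 ((A * B) *\<^sub>v v) \<le> operator_norm A * operator_norm B * vec_norm2 v" by simp
qed (use A B operator_norm_nonneg[OF A] operator_norm_nonneg[OF B] in auto)

lemma operator_norm_smult:
  assumes A: "A \<in> carrier_mat m n"
  shows "operator_norm (c \<cdot>\<^sub>m A) = cmod c * operator_norm A"
proof -
  have le: "operator_norm (c \<cdot>\<^sub>m A) \<le> cmod c * operator_norm A" if A: "A \<in> carrier_mat m n" for c A
  proof (rule operator_norm_le[of _ m n])
    fix v :: "complex vec" assume v: "v \<in> carrier_vec n"
    have "(c \<cdot>\<^sub>m A) *\<^sub>v v = c \<cdot>\<^sub>v (A *\<^sub>v v)" using A v by (intro eq_vecI) (auto simp: scalar_prod_def sum_distrib_left mult.assoc)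
    then show "vec_norm2 ((c \<cdot>\<^sub>m A) *\<^sub>v v) \<le> cmod c * operator_norm A * vec_norm2 v"
      using operator_norm_bound[OF A v] by (simp add: vec_norm2_smult mult.assoc mult_left_mono)
  qed (use A operator_norm_nonneg[OF A] in auto)
  show ?thesis
  proof (cases "c = 0")
    case True
    then show ?thesis using le[OF A, of c] operator_norm_nonneg[of "c \<cdot>\<^sub>m A" m n] A by simp
  next
    case False
    have "inverse c \<cdot>\<^sub>m (c \<cdot>\<^sub>m A) = A" using False by (intro eq_matI) auto
    then have "operator_norm A \<le> cmod (inverse c) * operator_norm (c \<cdot>\<^sub>m A)"
      using le[of "c \<cdot>\<^sub>m A" "inverse c"] A by simp
    then have "cmod c * operator_norm A \<le> cmod c * (cmod (inverse c) * operator_norm (c \<cdot>\<^sub>m A))"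
      by (intro mult_left_mono) auto
    also have "\<dots> = operator_norm (c \<cdot>\<^sub>m A)"
      using False by (simp add: norm_mult[symmetric] mult.assoc[symmetric])
    finally show ?thesis using le[OF A, of c] by simp
  qed
qed

lemma operator_norm_adjoint_le:
  assumes A: "A \<in> carrier_mat m n"
  shows "operator_norm (mat_adjoint A) \<le> operator_norm A"
proof (rule operator_norm_le[of _ n m])
  fix v :: "complex vec" assume v: "v \<in> carrier_vec m"
  let ?w = "mat_adjoint A *\<^sub>v v"
  have w: "?w \<in> carrier_vec n" by (rule mult_mat_vec_carrier[of _ n m]) (use A v in auto)
  have "complex_of_real ((vec_norm2 ?w)\<^sup>2) = (A *\<^sub>v ?w) \<bullet>c v"
    using adjoint_cscalar_prod[OF A w v] vec_norm2_sq[of ?w] by simp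
  then have "(vec_norm2 ?w)\<^sup>2 = cmod ((A *\<^sub>v ?w) \<bullet>c v)"
    by (metis abs_of_nonneg norm_of_real zero_le_power2)
  also have "\<dots> \<le> vec_norm2 (A *\<^sub>v ?w) * vec_norm2 v" using A v w by (intro vec_Cauchy_Schwarz) auto
  also have "\<dots> \<le> operator_norm A * vec_norm2 ?w * vec_norm2 v"
    by (intro mult_right_mono operator_norm_bound[OF A w]) auto
  finally have "vec_norm2 ?w * vec_norm2 ?w \<le> operator_norm A * vec_norm2 v * vec_norm2 ?w"
    by (simp add: power2_eq_square mult_ac)
  then show "vec_norm2 ?w \<le> operator_norm A * vec_norm2 v"
    using vec_norm2_nonneg[of ?w] operator_norm_nonneg[OF A] by (cases "vec_norm2 ?w = 0") auto
qed (use A operator_norm_nonneg[OF A] in auto)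

lemma operator_norm_adjoint: "A \<in> carrier_mat m n \<Longrightarrow> operator_norm (mat_adjoint A) = operator_norm A"
  using operator_norm_adjoint_le[of A m n] operator_norm_adjoint_le[of "mat_adjoint A" n m] by auto

lemma operator_norm_cstar:
  assumes A: "A \<in> carrier_mat m n"
  shows "operator_norm (mat_adjoint A * A) = (operator_norm A)\<^sup>2"
proof (rule antisym)
  show "operator_norm (mat_adjoint A * A) \<le> (operator_norm A)\<^sup>2"
    using operator_norm_mult[of "mat_adjoint A" n m A n] A by (simp add: operator_norm_adjoint power2_eq_square)
  let ?B = "mat_adjoint A * A"
  have B: "?B \<in> carrier_mat n n" using A by auto
  have "operator_norm A \<le> sqrt (operator_norm ?B)"
  proof (rule operator_norm_le[OF A])
    fix v :: "complex vec" assume v: "v \<in> carrier_vec n"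
    have "complex_of_real ((vec_norm2 (A *\<^sub>v v))\<^sup>2) = v \<bullet>c (?B *\<^sub>v v)"
      using adjoint_cscalar_prod[OF A v, of "A *\<^sub>v v"] A v vec_norm2_sq[of "A *\<^sub>v v"]
        assoc_mult_mat_vec[of "mat_adjoint A" n m A n v] by simp
    then have "(vec_norm2 (A *\<^sub>v v))\<^sup>2 = cmod (v \<bullet>c (?B *\<^sub>v v))"
      by (metis abs_of_nonneg norm_of_real zero_le_power2)
    also have "\<dots> \<le> vec_norm2 v * vec_norm2 (?B *\<^sub>v v)" using B v by (intro vec_Cauchy_Schwarz) auto
    also have "\<dots> \<le> vec_norm2 v * (operator_norm ?B * vec_norm2 v)"
      by (intro mult_left_mono operator_norm_bound[OF B v]) auto
    also have "\<dots> = (sqrt (operator_norm ?B) * vec_norm2 v)\<^sup>2"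
      using operator_norm_nonneg[OF B] by (simp add: power_mult_distrib power2_eq_square)
    finally show "vec_norm2 (A *\<^sub>v v) \<le> sqrt (operator_norm ?B) * vec_norm2 v"
      by (rule power2_le_imp_le) (simp add: operator_norm_nonneg[OF B])
  qed (simp add: operator_norm_nonneg[OF B])
  then have "(operator_norm A)\<^sup>2 \<le> (sqrt (operator_norm ?B))\<^sup>2"
    using operator_norm_nonneg[OF A] by (intro power_mono) auto
  then show "(operator_norm A)\<^sup>2 \<le> operator_norm ?B" using operator_norm_nonneg[OF B] by simp
qed

lemma cring_complex_ring: "cring complex_ring"
  by (rule cringI, rule abelian_groupI, goal_cases)
    (auto simp: complex_ring_def comm_monoid_def monoid_def comm_monoid_axioms_def algebra_simps
      intro: exI[of _ "- _"])

lemma mat_alg_sel [simp]: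
  "carrier (mat_alg n) = carrier_mat n n" "mult (mat_alg n) = (*)" "one (mat_alg n) = 1\<^sub>m n"
  "zero (mat_alg n) = 0\<^sub>m n n" "add (mat_alg n) = (+)" "smult (mat_alg n) = (\<cdot>\<^sub>m)"
  "star (mat_alg n) = mat_adjoint" "nrm (mat_alg n) = operator_norm"
  "tr (mat_alg n) A = (\<Sum>i<n. A $$ (i, i)) / of_nat n"
  by (simp_all add: mat_alg_def)

lemma abelian_group_mat_alg: "abelian_group (mat_alg n)"
proof (rule abelian_groupI)
  fix x assume "x \<in> carrier (mat_alg n)"
  then show "\<exists>y\<in>carrier (mat_alg n). y \<oplus>\<^bsub>mat_alg n\<^esub> x = \<zero>\<^bsub>mat_alg n\<^esub>"
    by (intro bexI[of _ "- x"]) auto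
qed (auto simp: comm_add_mat intro: assoc_add_mat)

lemma ring_mat_alg: "Ring.ring (mat_alg n)"
proof (rule ringI)
  show "abelian_group (mat_alg n)" by (rule abelian_group_mat_alg)
  show "Group.monoid (mat_alg n)" by (rule monoidI) auto
qed (auto simp: add_mult_distrib_mat mult_add_distrib_mat)

lemma module_mat_alg: "Module.module complex_ring (mat_alg n)"
  by (rule moduleI[OF cring_complex_ring abelian_group_mat_alg])
    (auto simp: complex_ring_def add_smult_distrib_left_mat add_smult_distrib_right_mat intro!: eq_matI)

lemma star_algebra_mat_alg: "star_algebra (mat_alg n)"
  by (rule star_algebra.intro[OF ring_mat_alg module_mat_alg])
    (auto simp: mat_adjoint_add mat_adjoint_mult mat_adjoint_smult)

definition frob :: "nat \<Rightarrow> complex mat \<Rightarrow> real" where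
  "frob n A = (\<Sum>i<n. \<Sum>j<n. (cmod (A $$ (i, j)))\<^sup>2)"

lemma tr_adjoint_mult:
  assumes "A \<in> carrier_mat n n"
  shows "tr (mat_alg n) (mat_adjoint A * A) = complex_of_real (frob n A / real n)"
proof -
  have "(\<Sum>i<n. (mat_adjoint A * A) $$ (i, i)) = (\<Sum>i<n. \<Sum>k<n. complex_of_real ((cmod (A $$ (k, i)))\<^sup>2))"
    using assms by (auto simp: scalar_prod_def mult_cnj_eq mult.commute[of "cnj _"] atLeast0LessThan intro!: sum.cong)
  also have "\<dots> = complex_of_real (frob n A)"
    unfolding frob_def of_real_sum by (rule sum.swap)
  finally show ?thesis by simp
qed

lemma pre_tracial_mat_alg: "pre_tracial (mat_alg n)"
proof (rule pre_tracial.intro[OF star_algebra_mat_alg], rule pre_tracial_axioms.intro, goal_cases)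
  case (6 x y)
  then show ?case by (simp add: sum.distrib add_divide_distrib)
next
  case (7 x c)
  then show ?case by (simp add: sum_distrib_left)
next
  case (8 x y)
  have "(\<Sum>i<n. (x * y) $$ (i, i)) = (\<Sum>i<n. \<Sum>k<n. x $$ (i, k) * y $$ (k, i))"
    using 8 by (auto simp: scalar_prod_def atLeast0LessThan intro!: sum.cong)
  also have "\<dots> = (\<Sum>k<n. \<Sum>i<n. y $$ (k, i) * x $$ (i, k))"
    by (subst sum.swap) (simp add: mult.commute)
  also have "\<dots> = (\<Sum>k<n. (y * x) $$ (k, k))"
    using 8 by (auto simp: scalar_prod_def atLeast0LessThan intro!: sum.cong)
  finally show ?case by simp
next
  case 11
  have "cmod (tr (mat_alg n) A) \<le> 1 * nrm (mat_alg n) A" if A: "A \<in> carrier (mat_alg n)" for A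
  proof -
    have A': "A \<in> carrier_mat n n" using A by simp
    have "cmod (A $$ (i, i)) \<le> operator_norm A" if i: "i < n" for i
    proof -
      have "cmod (A $$ (i, i)) = cmod ((A *\<^sub>v unit_vec n i) $ i)" using A' i by (simp add: scalar_prod_right_unit)
      also have "\<dots> \<le> vec_norm2 (A *\<^sub>v unit_vec n i)"
        using A' i member_le_L2_set[of "{0..<n}" i "\<lambda>j. cmod ((A *\<^sub>v unit_vec n i) $ j)"] by (simp add: vec_norm2_L2)
      also have "\<dots> \<le> operator_norm A * vec_norm2 (unit_vec n i)" by (rule operator_norm_bound[OF A']) simp
      also have "vec_norm2 (unit_vec n i :: complex vec) = 1"
        using i by (simp add: vec_norm2_def)
      finally show ?thesis by simp
    qed
    then have "cmod (\<Sum>i<n. A $$ (i, i)) \<le> (\<Sum>i<n. operator_norm A)" by (intro sum_norm_le) auto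
    then show ?thesis using operator_norm_nonneg[OF A'] by (cases "n = 0") (auto simp: norm_divide divide_le_eq mult.commute)
  qed
  then show ?case by blast
next
  case (9 x)
  then show ?case using tr_adjoint_mult[of x n] by (simp add: frob_def sum_nonneg del: mat_alg_sel(9))
next
  case (10 x)
  then show ?case using tr_adjoint_mult[of x n] by (simp del: mat_alg_sel(9))
qed (auto simp: operator_norm_add operator_norm_mult operator_norm_smult operator_norm_cstar operator_norm_nonneg)

interpretation MA: pre_tracial "mat_alg n" for n
  by (rule pre_tracial_mat_alg)

lemma norm2_frob: "A \<in> carrier_mat n n \<Longrightarrow> norm2 (mat_alg n) A = sqrt (frob n A / real n)"
  unfolding norm2_def using tr_adjoint_mult[of A n] by (simp del: mat_alg_sel(9))

lemma norm2_one_le: "norm2 (mat_alg n) (1\<^sub>m n) \<le> 1"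
proof (cases "n = 0")
  case False
  have "frob n (1\<^sub>m n) = (\<Sum>i<n. \<Sum>j<n. if i = j then 1 else 0)"
    unfolding frob_def by (intro sum.cong) auto
  then show ?thesis using False by (simp add: norm2_frob)
qed (simp add: norm2_frob frob_def)

lemma norm2_le_operator_norm:
  assumes "A \<in> carrier_mat n n"
  shows "norm2 (mat_alg n) A \<le> operator_norm A"
proof -
  have "norm2 (mat_alg n) A \<le> operator_norm A * norm2 (mat_alg n) (1\<^sub>m n)"
    using MA.norm2_mult_left[of A n "1\<^sub>m n"] assms by simp
  also have "\<dots> \<le> operator_norm A * 1"
    by (intro mult_left_mono norm2_one_le operator_norm_nonneg[OF assms])
  finally show ?thesis by simp
qed

lemma mat_alg_minus:
  assumes A: "A \<in> carrier_mat n n" and B: "B \<in> carrier_mat n n"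
  shows "A \<ominus>\<^bsub>mat_alg n\<^esub> B = A - B"
proof -
  define C where "C = A \<ominus>\<^bsub>mat_alg n\<^esub> B"
  have C: "C \<in> carrier_mat n n" using MA.minus_closed[of A n B] A B by (simp add: C_def)
  have CB: "C + B = A"
  proof -
      have "(A \<ominus>\<^bsub>mat_alg n\<^esub> B) \<oplus>\<^bsub>mat_alg n\<^esub> B = A \<oplus>\<^bsub>mat_alg n\<^esub> (\<ominus>\<^bsub>mat_alg n\<^esub> B \<oplus>\<^bsub>mat_alg n\<^esub> B)"
        unfolding a_minus_def by (rule MA.a_assoc) (use A B MA.a_inv_closed[of B n] in auto)
      also have "\<ominus>\<^bsub>mat_alg n\<^esub> B \<oplus>\<^bsub>mat_alg n\<^esub> B = \<zero>\<^bsub>mat_alg n\<^esub>" by (rule MA.l_neg) (use B in simp)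
      finally show ?thesis using A by (simp add: C_def)
  qed
  have "A - B = C" unfolding CB[symmetric] using B C by (intro eq_matI) auto
  then show ?thesis by (simp only: C_def)
qed

section \<open>Diagonalisation of self-adjoint matrices\<close>

definition diag_real :: "nat \<Rightarrow> (nat \<Rightarrow> real) \<Rightarrow> complex mat" where
  "diag_real n d = mat n n (\<lambda>(i, j). if i = j then complex_of_real (d i) else 0)"

lemma diag_real_carrier [simp, intro]: "diag_real n d \<in> carrier_mat n n"
  by (simp add: diag_real_def)

lemma unitary_mat_mult:
  assumes "unitary_mat n V" "unitary_mat n W"
  shows "unitary_mat n (V * W)"
proof -
  have c: "V \<in> carrier_mat n n" "W \<in> carrier_mat n n"
    and v: "V * mat_adjoint V = 1\<^sub>m n" "mat_adjoint V * V = 1\<^sub>m n"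
    and w: "W * mat_adjoint W = 1\<^sub>m n" "mat_adjoint W * W = 1\<^sub>m n"
    using assms by (auto simp: unitary_mat_def)
  note [simp] = right_mult_one_mat[OF c(1)] right_mult_one_mat[OF mat_adjoint_carrier[OF c(2)]]
    c mat_adjoint_carrier[OF c(1)] mat_adjoint_carrier[OF c(2)]
  have adj: "mat_adjoint (V * W) = mat_adjoint W * mat_adjoint V" by (rule mat_adjoint_mult) (rule c)+
  have "V * W * (mat_adjoint W * mat_adjoint V) = V * (W * mat_adjoint W) * mat_adjoint V"
    by (simp add: assoc_mult_mat[of _ n n _ n _ n] mult_carrier_mat[of _ n n _ n])
  then have 1: "V * W * mat_adjoint (V * W) = 1\<^sub>m n" by (simp add: adj v w)
  have "mat_adjoint W * mat_adjoint V * (V * W) = mat_adjoint W * (mat_adjoint V * V) * W"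
    by (simp add: assoc_mult_mat[of _ n n _ n _ n] mult_carrier_mat[of _ n n _ n])
  then have "mat_adjoint (V * W) * (V * W) = 1\<^sub>m n" by (simp add: adj v w)
  with 1 show ?thesis using mult_carrier_mat[OF c] by (simp add: unitary_mat_def)
qed

lemma four_block_mat_adjoint:
  assumes "A \<in> carrier_mat n1 n1" "D \<in> carrier_mat n2 n2"
  shows "mat_adjoint (four_block_mat A (0\<^sub>m n1 n2) (0\<^sub>m n2 n1) D)
    = four_block_mat (mat_adjoint A) (0\<^sub>m n1 n2) (0\<^sub>m n2 n1) (mat_adjoint D :: complex mat)"
proof -
  have d: "dim_row A = n1" "dim_col A = n1" "dim_row D = n2" "dim_col D = n2" using assms by auto
  show ?thesis by (rule eq_matI) (simp_all add: d not_less)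
qed

lemma four_block_diag_mult:
  fixes A A' D D' :: "complex mat"
  assumes "A \<in> carrier_mat n1 n1" "D \<in> carrier_mat n2 n2" "A' \<in> carrier_mat n1 n1" "D' \<in> carrier_mat n2 n2"
  shows "four_block_mat A (0\<^sub>m n1 n2) (0\<^sub>m n2 n1) D * four_block_mat A' (0\<^sub>m n1 n2) (0\<^sub>m n2 n1) D'
    = four_block_mat (A * A') (0\<^sub>m n1 n2) (0\<^sub>m n2 n1) (D * D')"
proof -
  note z = mult_carrier_mat[OF assms(1,3)] mult_carrier_mat[OF assms(2,4)]
  have 1: "0\<^sub>m n1 n2 * 0\<^sub>m n2 n1 = (0\<^sub>m n1 n1 :: complex mat)" "0\<^sub>m n2 n1 * 0\<^sub>m n1 n2 = (0\<^sub>m n2 n2 :: complex mat)"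
    "A * 0\<^sub>m n1 n2 = 0\<^sub>m n1 n2" "0\<^sub>m n1 n2 * D' = 0\<^sub>m n1 n2" "0\<^sub>m n2 n1 * A' = 0\<^sub>m n2 n1" "D * 0\<^sub>m n2 n1 = 0\<^sub>m n2 n1"
    using assms by auto
  have 2: "A * A' + 0\<^sub>m n1 n1 = A * A'" "0\<^sub>m n2 n2 + D * D' = D * D'" using z by auto
  have 3: "0\<^sub>m a b + 0\<^sub>m a b = (0\<^sub>m a b :: complex mat)" for a b by (rule eq_matI) auto
  show ?thesis
    unfolding mult_four_block_mat[OF assms(1) zero_carrier_mat zero_carrier_mat assms(2) assms(3) zero_carrier_mat zero_carrier_mat assms(4)]
    by (simp only: 1 2 3)
qed

lemma four_block_diag_one:
  "four_block_mat (1\<^sub>m n1) (0\<^sub>m n1 n2) (0\<^sub>m n2 n1) (1\<^sub>m n2) = (1\<^sub>m (n1 + n2) :: complex mat)"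
  by (intro eq_matI) auto

text \<open>The reflection exchanging the unit vector \<open>x\<close> and the first basis vector; the condition
  \<open>x\<^sub>0 \<le> 0\<close> keeps the two apart.\<close>

lemma Householder:
  fixes x :: "nat \<Rightarrow> complex"
  assumes n: "0 < n" and x1: "(\<Sum>i<n. (cmod (x i))\<^sup>2) = 1" and x0: "Im (x 0) = 0" "Re (x 0) \<le> 0"
  obtains H where "unitary_mat n H" "mat_adjoint H = H" "\<And>i. i < n \<Longrightarrow> H $$ (i, 0) = x i"
proof -
  \<comment> \<open>\<open>w\<close> is \<open>x\<close> minus the first basis vector and has
    squared norm \<open>2 * \<kappa>\<close>, so \<open>1 - w w* / \<kappa>\<close> is the
    reflection along \<open>w\<close>. The sign condition on \<open>x 0\<close> gives
    \<open>\<kappa> \<ge> 1\<close>.\<close>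
  define \<kappa> where "\<kappa> = 1 - Re (x 0)"
  define w where "w i = x i - (if i = 0 then 1 else 0)" for i
  have k1: "1 \<le> \<kappa>" using x0 by (simp add: \<kappa>_def)
  have w0: "w 0 = - complex_of_real \<kappa>" using x0 by (simp add: w_def \<kappa>_def complex_eq_iff)
  have wsum: "(\<Sum>i<n. cnj (w i) * w i) = complex_of_real (2 * \<kappa>)"
  proof -
    have "(cmod (w i))\<^sup>2 = (cmod (x i))\<^sup>2 + (if i = 0 then 1 - 2 * Re (x 0) else 0)" for i
      unfolding w_def cmod_power2 by (simp add: power2_eq_square algebra_simps)
    then have "(\<Sum>i<n. (cmod (w i))\<^sup>2) = 1 + (1 - 2 * Re (x 0))"
      using n x1 by (simp add: sum.distrib)
    moreover have "cnj (w i) * w i = complex_of_real ((cmod (w i))\<^sup>2)" for i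
      by (simp add: mult_cnj_eq mult.commute[of "cnj _"])
    ultimately show ?thesis by (simp add: \<kappa>_def flip: of_real_sum of_real_power)
  qed
  define H where "H = mat n n (\<lambda>(i, j). (if i = j then 1 else 0) - w i * cnj (w j) / complex_of_real \<kappa>)"
  have Hc: "H \<in> carrier_mat n n" by (simp add: H_def)
  have Ha: "mat_adjoint H = H" by (rule eq_matI) (auto simp: H_def)
  have HH: "H * H = 1\<^sub>m n"
  proof (rule eq_matI)
    fix i j assume "i < dim_row (1\<^sub>m n :: complex mat)" "j < dim_col (1\<^sub>m n :: complex mat)"
    then have ij: "i < n" "j < n" by auto
    let ?k = "complex_of_real \<kappa>"
    define u where "u = w i * cnj (w j) / (?k * ?k)"
    have s4: "(\<Sum>k<n. u * (cnj (w k) * w k)) = u * complex_of_real (2 * \<kappa>)"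
      by (simp only: sum_distrib_left[symmetric] wsum)
    have k0: "?k \<noteq> 0" using k1 by auto
    have "(H * H) $$ (i, j) = (\<Sum>k<n. ((if i = k then 1 else 0) - w i * cnj (w k) / ?k) * ((if k = j then 1 else 0) - w k * cnj (w j) / ?k))"
      using ij Hc by (simp add: scalar_prod_def H_def atLeast0LessThan)
    also have "\<dots> = (\<Sum>k<n. (if i = k then (if i = j then 1 else 0) else 0) - (if i = k then w i * cnj (w j) / ?k else 0)
        - (if k = j then w i * cnj (w j) / ?k else 0) + u * (cnj (w k) * w k))"
      unfolding u_def by (rule sum.cong) (auto simp: algebra_simps)
    also have "\<dots> = (if i = j then 1 else 0) - w i * cnj (w j) / ?k - w i * cnj (w j) / ?k + u * complex_of_real (2 * \<kappa>)"
      unfolding sum.distrib sum_subtractf s4 using ij by simp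
    also have "\<dots> = (if i = j then 1 else 0)" using k0 by (simp add: u_def field_simps)
    finally show "(H * H) $$ (i, j) = 1\<^sub>m n $$ (i, j)" using ij by simp
  qed (use Hc in auto)
  have "H $$ (i, 0) = x i" if "i < n" for i
  proof -
    have "H $$ (i, 0) = (if i = 0 then 1 else 0) - w i * cnj (w 0) / complex_of_real \<kappa>"
      using that n by (simp add: H_def)
    also have "\<dots> = (if i = 0 then 1 else 0) + w i" using k1 by (simp add: w0)
    also have "\<dots> = x i" by (simp add: w_def)
    finally show ?thesis .
  qed
  with Hc Ha HH that show ?thesis by (simp add: unitary_mat_def)
qed

lemma unit_eigenvector:
  assumes A: "A \<in> carrier_mat n n" and n: "0 < n"
  obtains e v where "v \<in> carrier_vec n" "A *\<^sub>v v = e \<cdot>\<^sub>v v" "(\<Sum>i<n. (cmod (vec_index v i))\<^sup>2) = 1"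
    "Im (vec_index v 0) = 0" "Re (vec_index v 0) \<le> 0"
proof -
  have "degree (char_poly A) = n" using degree_monic_char_poly[OF A] by simp
  then have "\<not> constant (poly (char_poly A))" using n by (simp add: constant_degree)
  then obtain e where "poly (char_poly A) e = 0" using fundamental_theorem_of_algebra by blast
  then have "eigenvalue A e" using eigenvalue_root_char_poly[OF A] by simp
  then obtain v where v: "v \<in> carrier_vec n" "v \<noteq> 0\<^sub>v n" "A *\<^sub>v v = e \<cdot>\<^sub>v v"
    using A by (auto simp: eigenvalue_def eigenvector_def)
  have p: "vec_norm2 v > 0" using v vec_norm2_eq_0[of v n] vec_norm2_nonneg[of v] by (simp add: less_le)
  \<comment> \<open>A phase that turns the first coordinate into a nonpositive real number, as
    \<open>Householder\<close> requires.\<close>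
  define \<theta> where "\<theta> = (if v $ 0 = 0 then 1 else - cnj (v $ 0) / complex_of_real (cmod (v $ 0)))"
  have \<theta>1: "cmod \<theta> = 1" by (simp add: \<theta>_def norm_divide)
  have \<theta>v: "\<theta> * v $ 0 = - complex_of_real (cmod (v $ 0))"
  proof (cases "v $ 0 = 0")
    case False
    then have "\<theta> * v $ 0 = - (v $ 0 * cnj (v $ 0)) / complex_of_real (cmod (v $ 0))" by (simp add: \<theta>_def)
    also have "\<dots> = - complex_of_real (cmod (v $ 0))"
      unfolding mult_cnj_eq using False by (simp add: power2_eq_square)
    finally show ?thesis .
  qed simp
  define c where "c = \<theta> / complex_of_real (vec_norm2 v)"
  define u where "u = c \<cdot>\<^sub>v v"
  have u: "u \<in> carrier_vec n" using v by (simp add: u_def)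
  have "A *\<^sub>v u = c \<cdot>\<^sub>v (A *\<^sub>v v)" unfolding u_def by (rule mult_mat_vec[OF A v(1)])
  also have "\<dots> = e \<cdot>\<^sub>v u" unfolding v(3) u_def by (simp add: smult_smult_assoc mult.commute)
  finally have eu: "A *\<^sub>v u = e \<cdot>\<^sub>v u" .
  have "vec_norm2 u = 1" using p \<theta>1 by (simp add: u_def vec_norm2_smult c_def norm_divide)
  then have "L2_set (\<lambda>i. cmod (u $ i)) {0..<n} = 1" using u by (simp add: vec_norm2_L2)
  then have s: "(\<Sum>i<n. (cmod (u $ i))\<^sup>2) = 1" by (simp add: L2_set_def atLeast0LessThan)
  have "u $ 0 = complex_of_real (- (cmod (v $ 0) / vec_norm2 v))"
    using v n \<theta>v by (simp add: u_def c_def)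
  then have "Im (u $ 0) = 0" "Re (u $ 0) \<le> 0" using p by (simp_all only: Im_complex_of_real Re_complex_of_real) simp
  with u eu s show ?thesis using that by blast
qed

text \<open>Deflation: a reflection \<open>H\<close> whose first column is a unit eigenvector
  conjugates \<open>A\<close> to a matrix whose first column is a multiple of the first basis
  vector. Being self-adjoint, that matrix is block diagonal, and induction treats the lower
  block.\<close>

theorem hermitian_diagonalization:
  assumes "A \<in> carrier_mat n n" "mat_adjoint A = A"
  shows "\<exists>V d. unitary_mat n V \<and> A = V * diag_real n d * mat_adjoint V"
  using assms
proof (induction n arbitrary: A)
  case 0
  then show ?case by (intro exI[of _ "1\<^sub>m 0"]) (auto simp: unitary_mat_def intro!: eq_matI)
next
  case (Suc m)
  let ?n = "Suc m"
  note A = Suc.prems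
  obtain e v where v: "v \<in> carrier_vec ?n" "A *\<^sub>v v = e \<cdot>\<^sub>v v" "(\<Sum>i<?n. (cmod (vec_index v i))\<^sup>2) = 1"
    "Im (vec_index v 0) = 0" "Re (vec_index v 0) \<le> 0"
    using unit_eigenvector[OF A(1)] by blast
  obtain H where H: "unitary_mat ?n H" "mat_adjoint H = H" "\<And>i. i < ?n \<Longrightarrow> H $$ (i, 0) = vec_index v i"
    using Householder[of ?n "\<lambda>i. vec_index v i"] v by blast
  have Hc: "H \<in> carrier_mat ?n ?n" and HH: "H * H = 1\<^sub>m ?n" using H(1,2) by (auto simp: unitary_mat_def)
  define B where "B = H * A * H"
  have Bc: "B \<in> carrier_mat ?n ?n" using Hc A by (simp add: B_def)
  have Ba: "mat_adjoint B = B"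
  proof -
    have "mat_adjoint B = mat_adjoint H * mat_adjoint (H * A)" unfolding B_def
      by (rule mat_adjoint_mult[of _ ?n ?n _ ?n]) (use Hc A in auto)
    also have "mat_adjoint (H * A) = A * H" using mat_adjoint_mult[OF Hc A(1)] A H by simp
    finally show ?thesis using Hc A H by (simp add: B_def assoc_mult_mat[of _ ?n ?n _ ?n _ ?n] mult_carrier_mat[of _ ?n ?n _ ?n])
  qed
  have B0: "B $$ (i, 0) = (if i = 0 then e else 0)" if i: "i < ?n" for i
  proof -
    have c0: "col H 0 = v" using H(3) Hc v by (intro eq_vecI) auto
    have "B $$ (i, 0) = col (H * (A * H)) 0 $ i"
      using i Bc Hc A by (simp add: B_def assoc_mult_mat[of _ ?n ?n _ ?n _ ?n] mult_carrier_mat[of _ ?n ?n _ ?n])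
    also have "col (H * (A * H)) 0 = H *\<^sub>v col (A * H) 0"
      by (rule col_mult2[of _ ?n ?n _ ?n]) (use Hc A in auto)
    also have "col (A * H) 0 = A *\<^sub>v col H 0"
      by (rule col_mult2[of _ ?n ?n _ ?n]) (use Hc A in auto)
    also have "H *\<^sub>v (A *\<^sub>v col H 0) = e \<cdot>\<^sub>v (H *\<^sub>v col H 0)" unfolding c0 v(2) by (rule mult_mat_vec[OF Hc v(1)])
    also have "H *\<^sub>v col H 0 = col (H * H) 0"
      by (rule col_mult2[symmetric, of _ ?n ?n _ ?n]) (use Hc in auto)
    finally show ?thesis using i by (simp add: HH)
  qed
  have Bsym: "B $$ (i, j) = cnj (B $$ (j, i))" if "i < ?n" "j < ?n" for i j
  proof -
    have "B $$ (i, j) = mat_adjoint B $$ (i, j)" by (simp add: Ba)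
    then show ?thesis using that Bc by simp
  qed
  have e: "cnj e = e" using Bsym[of 0 0] B0[of 0] by simp
  then have e': "complex_of_real (Re e) = e" by (simp add: complex_eq_iff)
  define B' where "B' = mat m m (\<lambda>(i, j). B $$ (Suc i, Suc j))"
  have B'c: "B' \<in> carrier_mat m m" by (simp add: B'_def)
  have "mat_adjoint B' = B'"
  proof (rule eq_matI)
    fix i j assume "i < dim_row B'" "j < dim_col B'"
    then have ij: "i < m" "j < m" by (auto simp: B'_def)
    then show "mat_adjoint B' $$ (i, j) = B' $$ (i, j)"
      using Bsym[of "Suc i" "Suc j"] by (simp add: B'_def)
  qed (simp_all add: B'_def)
  from Suc.IH[OF B'c this] obtain V' d where V': "unitary_mat m V'" "B' = V' * diag_real m d * mat_adjoint V'" by blast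
  have V'c: "V' \<in> carrier_mat m m" using V' by (simp add: unitary_mat_def)
  define E where "E = diag_real 1 (\<lambda>_. Re e)"
  define V1 where "V1 = four_block_mat (1\<^sub>m 1) (0\<^sub>m 1 m) (0\<^sub>m m 1) V'"
  define d' where "d' i = (if i = 0 then Re e else d (i - 1))" for i
  have B4: "B = four_block_mat E (0\<^sub>m 1 m) (0\<^sub>m m 1) B'"
  proof (rule eq_matI)
    fix i j assume "i < dim_row (four_block_mat E (0\<^sub>m 1 m) (0\<^sub>m m 1) B')" "j < dim_col (four_block_mat E (0\<^sub>m 1 m) (0\<^sub>m m 1) B')"
    then have ij: "i < ?n" "j < ?n" by (auto simp: E_def diag_real_def B'_def)
    show "B $$ (i, j) = four_block_mat E (0\<^sub>m 1 m) (0\<^sub>m m 1) B' $$ (i, j)"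
    proof (cases "j = 0")
      case True
      then show ?thesis using ij B0[of i] e' by (auto simp: E_def diag_real_def B'_def)
    next
      case j: False
      show ?thesis
      proof (cases "i = 0")
        case True
        then show ?thesis using ij j B0[of j] Bsym[of 0 j] by (auto simp: E_def diag_real_def B'_def)
      next
        case False
        then show ?thesis using ij j by (auto simp: E_def diag_real_def B'_def)
      qed
    qed
  qed (use Bc in \<open>auto simp: E_def diag_real_def B'_def\<close>)
  have D4: "diag_real ?n d' = four_block_mat E (0\<^sub>m 1 m) (0\<^sub>m m 1) (diag_real m d)"
    by (rule eq_matI) (auto simp: E_def diag_real_def d'_def)
  have V1a: "mat_adjoint V1 = four_block_mat (1\<^sub>m 1) (0\<^sub>m 1 m) (0\<^sub>m m 1) (mat_adjoint V')"
    unfolding V1_def by (subst four_block_mat_adjoint[OF _ V'c]) auto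
  have Ec: "E \<in> carrier_mat 1 1" by (simp add: E_def)
  have U1: "unitary_mat ?n V1"
    unfolding unitary_mat_def
  proof (intro conjI)
    have "V1 \<in> carrier_mat (1 + m) (1 + m)"
      unfolding V1_def by (rule four_block_carrier_mat[OF one_carrier_mat V'c])
    then show "V1 \<in> carrier_mat ?n ?n" by simp
    have "V1 * mat_adjoint V1 = four_block_mat (1\<^sub>m 1 * 1\<^sub>m 1) (0\<^sub>m 1 m) (0\<^sub>m m 1) (V' * mat_adjoint V')"
      unfolding V1a unfolding V1_def by (rule four_block_diag_mult) (use V'c in auto)
    then show "V1 * mat_adjoint V1 = 1\<^sub>m ?n"
      using V' four_block_diag_one[of 1 m] by (simp add: unitary_mat_def)
    have "mat_adjoint V1 * V1 = four_block_mat (1\<^sub>m 1 * 1\<^sub>m 1) (0\<^sub>m 1 m) (0\<^sub>m m 1) (mat_adjoint V' * V')"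
      unfolding V1a unfolding V1_def by (rule four_block_diag_mult) (use V'c in auto)
    then show "mat_adjoint V1 * V1 = 1\<^sub>m ?n"
      using V' four_block_diag_one[of 1 m] by (simp add: unitary_mat_def)
  qed
  have V1c: "V1 \<in> carrier_mat ?n ?n" using U1 by (simp add: unitary_mat_def)
  have "V1 * diag_real ?n d' = four_block_mat (1\<^sub>m 1 * E) (0\<^sub>m 1 m) (0\<^sub>m m 1) (V' * diag_real m d)"
    unfolding D4 V1_def by (rule four_block_diag_mult) (use V'c Ec in auto)
  then have "V1 * diag_real ?n d' * mat_adjoint V1
      = four_block_mat (1\<^sub>m 1 * E * 1\<^sub>m 1) (0\<^sub>m 1 m) (0\<^sub>m m 1) (V' * diag_real m d * mat_adjoint V')"
    unfolding V1a by (simp only:) (rule four_block_diag_mult, use V'c Ec in auto)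
  also have "\<dots> = B" using Ec by (simp add: B4 V'(2))
  finally have BV: "V1 * diag_real ?n d' * mat_adjoint V1 = B" .
  have "A = H * B * H"
  proof -
    have "H * B * H = (H * H) * A * (H * H)"
      using Hc A by (simp add: B_def assoc_mult_mat[of _ ?n ?n _ ?n _ ?n] mult_carrier_mat[of _ ?n ?n _ ?n])
    then show ?thesis using A by (simp add: HH)
  qed
  also have "\<dots> = (H * V1) * diag_real ?n d' * (mat_adjoint V1 * H)"
    unfolding BV[symmetric] using Hc V1c mat_adjoint_carrier[OF V1c] diag_real_carrier[of ?n d']
    by (simp add: assoc_mult_mat[of _ ?n ?n _ ?n _ ?n] mult_carrier_mat[of _ ?n ?n _ ?n])
  also have "mat_adjoint V1 * H = mat_adjoint (H * V1)"
    using mat_adjoint_mult[OF Hc V1c] H by simp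
  finally show ?case using unitary_mat_mult[OF H(1) U1] by blast
qed

section \<open>Sparse tuples have few orbits\<close>

text \<open>Rounding towards zero sends the interval from -1 to 1 to 0, so that the modulus of the
  rounded number is at most the square of the original. Thus the sum of the moduli of a rounded
  vector is controlled by its squared Euclidean norm.\<close>

definition trunc_int :: "real \<Rightarrow> int" where
  "trunc_int x = (if 0 \<le> x then \<lfloor>x\<rfloor> else \<lceil>x\<rceil>)"

lemma trunc_int_close: "\<bar>x - of_int (trunc_int x)\<bar> \<le> 1"
  unfolding trunc_int_def by (auto simp: abs_le_iff) linarith+

lemma trunc_int_square: "real_of_int \<bar>trunc_int x\<bar> \<le> x\<^sup>2"
proof (cases "\<bar>x\<bar> < 1")
  case True
  have "trunc_int x = 0"
  proof (cases "0 \<le> x")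
    case True
    with \<open>\<bar>x\<bar> < 1\<close> have "\<lfloor>x\<rfloor> = 0" by (intro floor_unique) auto
    with True show ?thesis by (simp add: trunc_int_def)
  next
    case False
    with \<open>\<bar>x\<bar> < 1\<close> have "\<lceil>x\<rceil> = 0" by (intro ceiling_unique) auto
    with False show ?thesis by (simp add: trunc_int_def)
  qed
  then show ?thesis by simp
next
  case False
  have "real_of_int \<bar>trunc_int x\<bar> \<le> \<bar>x\<bar>"
  proof (cases "0 \<le> x")
    case True
    then have "0 \<le> \<lfloor>x\<rfloor>" by simp
    then show ?thesis using True by (simp add: trunc_int_def)
  next
    case False
    then have "\<lceil>x\<rceil> \<le> 0" by simp
    then have "\<bar>\<lceil>x\<rceil>\<bar> = - \<lceil>x\<rceil>" by simp
    then show ?thesis using False by (simp add: trunc_int_def)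
  qed
  also have "\<dots> \<le> \<bar>x\<bar> * \<bar>x\<bar>" using False by (intro mult_le_cancel_left1[THEN iffD2]) auto
  finally show ?thesis by (simp add: power2_eq_square)
qed

text \<open>Chebyshev's counting trick: every vector in question has weight at least
  \<open>\<kappa>\<^bsup>s\<^esup> 2\<^bsup>-T\<^esup>\<close> for the product weight \<open>w(0) = 1\<close>, \<open>w(z) = \<kappa> 2\<^bsup>-|z|\<^esup>\<close>, whose total mass is
  at most \<open>(1 + 2 \<kappa>)\<^bsup>|E|\<^esup>\<close>.\<close>

lemma sparse_integer_vectors:
  fixes E :: "'e set" and \<kappa> s T :: real
  assumes E: "finite E" and \<kappa>: "0 < \<kappa>" "\<kappa> \<le> 1"
  defines "Z \<equiv> {z \<in> E \<rightarrow>\<^sub>E (UNIV :: int set). real (card {e\<in>E. z e \<noteq> 0}) \<le> s \<and> (\<Sum>e\<in>E. real_of_int \<bar>z e\<bar>) \<le> T}"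
  shows "finite Z" "real (card Z) \<le> (1 + 2 * \<kappa>) ^ card E * (1 / \<kappa>) powr s * 2 powr T"
proof -
  \<comment> \<open>No entry of a vector in \<open>Z\<close> exceeds \<open>M\<close> in modulus, so
    the total weight is taken over a finite box, where the sum of products is a product of
    sums.\<close>
  define M where "M = nat \<lceil>T\<rceil>"
  define B where "B = E \<rightarrow>\<^sub>E {- int M..int M}"
  define w where "w z = (if z = 0 then 1 else \<kappa> * (1/2) ^ nat \<bar>z\<bar>)" for z :: int
  have w0: "0 < w z" for z using \<kappa> by (simp add: w_def)
  have sub: "Z \<subseteq> B"
  proof
    fix z assume z: "z \<in> Z"
    have "z e \<in> {- int M..int M}" if e: "e \<in> E" for e
    proof -
      have "real_of_int \<bar>z e\<bar> \<le> (\<Sum>e\<in>E. real_of_int \<bar>z e\<bar>)" using e E by (intro member_le_sum) auto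
      also have "\<dots> \<le> T" using z by (simp add: Z_def)
      finally have "\<bar>z e\<bar> \<le> int M" unfolding M_def by linarith
      then show ?thesis by auto
    qed
    then show "z \<in> B" using z by (auto simp: B_def Z_def PiE_iff)
  qed
  have fB: "finite B" unfolding B_def using E by (intro finite_PiE) auto
  show fZ: "finite Z" by (rule finite_subset[OF sub fB])
  have low: "\<kappa> powr s * 2 powr (- T) \<le> (\<Prod>e\<in>E. w (z e))" if z: "z \<in> Z" for z
  proof -
    let ?S = "{e\<in>E. z e \<noteq> 0}"
    have "(\<Prod>e\<in>E. w (z e)) = (\<Prod>e\<in>E. (if z e \<noteq> 0 then \<kappa> else 1) * 2 powr (- real_of_int \<bar>z e\<bar>))"
    proof (rule prod.cong)
      fix e assume "e \<in> E"
      have "(1/2::real) ^ nat \<bar>z e\<bar> = 2 powr (- real_of_int \<bar>z e\<bar>)"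
        by (simp add: powr_minus powr_realpow[symmetric] power_one_over inverse_eq_divide)
      then show "w (z e) = (if z e \<noteq> 0 then \<kappa> else 1) * 2 powr (- real_of_int \<bar>z e\<bar>)"
        by (simp add: w_def)
    qed simp
    also have "\<dots> = \<kappa> ^ card ?S * 2 powr (- (\<Sum>e\<in>E. real_of_int \<bar>z e\<bar>))"
    proof -
      have "(\<Prod>e\<in>E. if z e \<noteq> 0 then \<kappa> else 1) = \<kappa> ^ card ?S"
        using E by (simp add: prod.If_cases Collect_conj_eq[symmetric] Int_def)
      moreover have "(\<Prod>e\<in>E. 2 powr (- real_of_int \<bar>z e\<bar>)) = 2 powr (- (\<Sum>e\<in>E. real_of_int \<bar>z e\<bar>))"
        using E by (simp add: powr_sum[symmetric] sum_negf)
      ultimately show ?thesis by (simp add: prod.distrib)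
    qed
    also have "\<kappa> ^ card ?S = \<kappa> powr real (card ?S)" using \<kappa> by (simp add: powr_realpow)
    finally have e: "(\<Prod>e\<in>E. w (z e)) = \<kappa> powr real (card ?S) * 2 powr (- (\<Sum>e\<in>E. real_of_int \<bar>z e\<bar>))" .
    show ?thesis unfolding e
    proof (rule mult_mono)
      show "\<kappa> powr s \<le> \<kappa> powr real (card ?S)" using z \<kappa> by (intro powr_mono') (auto simp: Z_def)
      show "2 powr (- T) \<le> 2 powr (- (\<Sum>e\<in>E. real_of_int \<bar>z e\<bar>))" using z by (intro powr_mono) (auto simp: Z_def)
    qed auto
  qed
  have geo: "(\<Sum>j=1..K. (1/2::real) ^ j) \<le> 1" for K
  proof -
    have "(\<Sum>j=1..K. (1/2::real) ^ j) = 1 - (1/2) ^ K" by (induction K) auto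
    then show ?thesis by simp
  qed
  have wsum: "(\<Sum>z\<in>{- int M..int M}. w z) \<le> 1 + 2 * \<kappa>"
  proof -
    have set: "{- int M..int M} = {0} \<union> (int ` {1..M} \<union> (\<lambda>j. - int j) ` {1..M})"
    proof (intro equalityI subsetI)
      fix z assume z: "z \<in> {- int M..int M}"
      show "z \<in> {0} \<union> (int ` {1..M} \<union> (\<lambda>j. - int j) ` {1..M})"
      proof (cases z "0::int" rule: linorder_cases)
        case less
        then have "z = - int (nat (- z))" "nat (- z) \<in> {1..M}" using z by auto
        then show ?thesis by blast
      next
        case greater
        then have "z = int (nat z)" "nat z \<in> {1..M}" using z by auto
        then show ?thesis by blast
      qed simp
    qed auto
    have "(\<Sum>z\<in>{- int M..int M}. w z) = w 0 + ((\<Sum>z\<in>int ` {1..M}. w z) + (\<Sum>z\<in>(\<lambda>j. - int j) ` {1..M}. w z))"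
    proof -
      have "int ` {1..M} \<inter> (\<lambda>j. - int j) ` {1..M} = {}" by auto
      then have "sum w (int ` {1..M} \<union> (\<lambda>j. - int j) ` {1..M}) = sum w (int ` {1..M}) + sum w ((\<lambda>j. - int j) ` {1..M})"
        by (intro sum.union_disjoint) auto
      moreover have "sum w ({0} \<union> (int ` {1..M} \<union> (\<lambda>j. - int j) ` {1..M})) = sum w {0} + sum w (int ` {1..M} \<union> (\<lambda>j. - int j) ` {1..M})"
        by (intro sum.union_disjoint) auto
      ultimately show ?thesis using set by simp
    qed
    also have "(\<Sum>z\<in>int ` {1..M}. w z) = (\<Sum>j=1..M. \<kappa> * (1/2) ^ j)"
      by (subst sum.reindex) (auto simp: w_def intro!: sum.cong)
    also have "(\<Sum>z\<in>(\<lambda>j. - int j) ` {1..M}. w z) = (\<Sum>j=1..M. \<kappa> * (1/2) ^ j)"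
      by (subst sum.reindex) (auto simp: w_def inj_on_def intro!: sum.cong)
    also have "(\<Sum>j=1..M. \<kappa> * (1/2) ^ j) = \<kappa> * (\<Sum>j=1..M. (1/2) ^ j)" by (simp add: sum_distrib_left)
    also have "w 0 + (\<kappa> * (\<Sum>j=1..M. (1/2) ^ j) + \<kappa> * (\<Sum>j=1..M. (1/2) ^ j)) \<le> 1 + (\<kappa> * 1 + \<kappa> * 1)"
      using geo[of M] \<kappa> by (intro add_mono mult_left_mono) (auto simp: w_def)
    finally show ?thesis by simp
  qed
  have "real (card Z) * (\<kappa> powr s * 2 powr (- T)) \<le> (\<Sum>z\<in>Z. \<Prod>e\<in>E. w (z e))"
    using sum_mono[of Z "\<lambda>_. \<kappa> powr s * 2 powr (- T)" "\<lambda>z. \<Prod>e\<in>E. w (z e)"] low by simp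
  also have "\<dots> \<le> (\<Sum>z\<in>B. \<Prod>e\<in>E. w (z e))"
    by (rule sum_mono2[OF fB sub]) (auto intro!: prod_nonneg less_imp_le[OF w0])
  also have "\<dots> = (\<Prod>e\<in>E. \<Sum>z\<in>{- int M..int M}. w z)"
    unfolding B_def by (rule prod_sum_PiE[symmetric]) (use E in auto)
  also have "\<dots> \<le> (\<Prod>e\<in>E. 1 + 2 * \<kappa>)"
    using wsum sum_nonneg[of "{- int M..int M}" w, OF less_imp_le[OF w0]] by (intro prod_mono) auto
  finally have "real (card Z) * (\<kappa> powr s * 2 powr (- T)) \<le> (1 + 2 * \<kappa>) ^ card E" by simp
  then show "real (card Z) \<le> (1 + 2 * \<kappa>) ^ card E * (1 / \<kappa>) powr s * 2 powr T"
    using \<kappa> by (simp add: powr_minus powr_divide field_simps)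
qed

text \<open>A tuple is sparse if a common unitary conjugation makes it, up to \<open>\<epsilon>\<close> in \<open>\<parallel>\<cdot>\<parallel>\<^sub>2\<close>, supported on
  a proportion \<open>c\<close> of the matrix entries.\<close>

definition sparse_tuple :: "nat \<Rightarrow> 'i set \<Rightarrow> real \<Rightarrow> real \<Rightarrow> ('i \<Rightarrow> complex mat) \<Rightarrow> bool" where
  "sparse_tuple n F c \<epsilon> Z \<longleftrightarrow> (\<exists>V. unitary_mat n V \<and> (\<forall>i\<in>F. \<exists>S \<subseteq> {..<n} \<times> {..<n}.
     real (card S) \<le> c * (real n)\<^sup>2 \<and>
     (\<Sum>p\<in>{..<n} \<times> {..<n} - S. (cmod ((mat_adjoint V * Z i * V) $$ p))\<^sup>2) \<le> \<epsilon>\<^sup>2 * real n))"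

lemma frob_pairs: "frob n A = (\<Sum>p\<in>{..<n} \<times> {..<n}. (cmod (A $$ p))\<^sup>2)"
  unfolding frob_def by (simp add: sum.cartesian_product)

lemma (in pre_tracial) norm2_unitary_left:
  assumes "u \<in> carrier M" "star M u \<otimes> u = \<one>" "x \<in> carrier M"
  shows "norm2 M (u \<otimes> x) = norm2 M x"
proof -
  have "star M (u \<otimes> x) \<otimes> (u \<otimes> x) = star M x \<otimes> (star M u \<otimes> u) \<otimes> x"
    using assms(1,3) by (simp add: star_mult m_assoc)
  then show ?thesis using assms by (simp add: norm2_def)
qed

lemma (in pre_tracial) norm2_unitary_conj:
  assumes u: "u \<in> carrier M" "star M u \<otimes> u = \<one>" and x: "x \<in> carrier M"
  shows "norm2 M (u \<otimes> x \<otimes> star M u) = norm2 M x"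
proof -
  have "norm2 M (u \<otimes> x \<otimes> star M u) = norm2 M (star M (u \<otimes> x \<otimes> star M u))"
    using u x by (simp add: norm2_star)
  also have "star M (u \<otimes> x \<otimes> star M u) = u \<otimes> star M (u \<otimes> x)" using u x by (simp add: star_mult)
  also have "norm2 M (u \<otimes> star M (u \<otimes> x)) = norm2 M (star M (u \<otimes> x))" using u x by (intro norm2_unitary_left) auto
  also have "\<dots> = norm2 M x" using u x by (simp add: norm2_star norm2_unitary_left)
  finally show ?thesis .
qed

lemma unitary_matD:
  assumes "unitary_mat n V"
  shows "V \<in> carrier_mat n n" "mat_adjoint V \<in> carrier_mat n n" "V * mat_adjoint V = 1\<^sub>m n" "mat_adjoint V * V = 1\<^sub>m n"
  using assms by (auto simp: unitary_mat_def)

lemma unitary_conj_conj: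
  assumes V: "unitary_mat n V" and A: "A \<in> carrier_mat n n"
  shows "V * (mat_adjoint V * A * V) * mat_adjoint V = A"
proof -
  note v = unitary_matD[OF V]
  have "V * (mat_adjoint V * A * V) * mat_adjoint V = (V * mat_adjoint V) * A * (V * mat_adjoint V)"
    using v(1,2) A by (simp add: assoc_mult_mat[of _ n n _ n _ n] mult_carrier_mat[of _ n n _ n])
  then show ?thesis using A by (simp add: v)
qed

lemma norm2_conj_diff:
  assumes V: "unitary_mat n V" and A: "A \<in> carrier_mat n n" and B: "B \<in> carrier_mat n n"
  shows "norm2 (mat_alg n) (A - V * B * mat_adjoint V) = norm2 (mat_alg n) (mat_adjoint V * A * V - B)"
proof -
  note v = unitary_matD[OF V]
  let ?C = "mat_adjoint V * A * V"
  have C: "?C \<in> carrier_mat n n" using v A by (simp add: mult_carrier_mat[of _ n n _ n])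
  have "A - V * B * mat_adjoint V = V * ?C * mat_adjoint V - V * B * mat_adjoint V"
    by (simp only: unitary_conj_conj[OF V A])
  also have "\<dots> = V * (?C - B) * mat_adjoint V"
    using v(1,2) B C by (simp add: mult_minus_distrib_mat[of _ n n _ n] minus_mult_distrib_mat[of _ n n _ _ n] mult_carrier_mat[of _ n n _ n])
  also have "norm2 (mat_alg n) (V * (?C - B) * mat_adjoint V) = norm2 (mat_alg n) (?C - B)"
    using MA.norm2_unitary_conj[of V n "?C - B"] v minus_carrier_mat[OF B, of ?C] by (simp only: mat_alg_sel)
  finally show ?thesis .
qed

text \<open>The three summands are the logarithms, per matrix and per \<open>n\<^sup>2\<close>, of
  the three factors in the count of sparse integer vectors. With \<open>c = q\<^sup>2\<close> each
  is at most a multiple of \<open>q\<close>, since \<open>ln (1 / q) \<le> 1 / q\<close>.\<close>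

lemma sparse_parameter:
  fixes f K \<delta> :: real
  assumes "0 \<le> f" "0 \<le> K" "0 < \<delta>"
  obtains c where "0 < c" "c \<le> 1" "f * (4 * c + 2 * c * ln (1 / c) + K * c) \<le> \<delta>"
proof -
  define q where "q = min 1 (\<delta> / (f * (8 + K) + 1))"
  have d: "0 < f * (8 + K) + 1" using assms by (intro add_nonneg_pos mult_nonneg_nonneg) auto
  have q: "0 < q" "q \<le> 1" using assms d by (auto simp: q_def)
  define c where "c = q\<^sup>2"
  have c: "0 < c" "c \<le> 1" "c \<le> q" using q by (auto simp: c_def power2_eq_square mult_le_one)
  have "ln (1 / c) = 2 * ln (1 / q)" using q by (simp add: c_def ln_div ln_mult power2_eq_square)
  also have "\<dots> \<le> 2 * (1 / q)" using ln_le_minus_one[of "1 / q"] q by (intro mult_left_mono) auto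
  finally have "c * ln (1 / c) \<le> c * (2 * (1 / q))" using c by (intro mult_left_mono) auto
  also have "\<dots> = 2 * q" using q by (simp add: c_def power2_eq_square)
  finally have l: "c * ln (1 / c) \<le> 2 * q" .
  have "K * c \<le> K * q" using c assms by (intro mult_left_mono) auto
  then have "4 * c + 2 * c * ln (1 / c) + K * c \<le> (8 + K) * q" using l c by (simp add: distrib_right)
  then have "f * (4 * c + 2 * c * ln (1 / c) + K * c) \<le> f * ((8 + K) * q)" using assms by (intro mult_left_mono) auto
  also have "\<dots> \<le> (f * (8 + K) + 1) * q" using q by (simp add: algebra_simps)
  also have "\<dots> \<le> (f * (8 + K) + 1) * (\<delta> / (f * (8 + K) + 1))" using d by (intro mult_left_mono) (auto simp: q_def)
  also have "\<dots> = \<delta>" using d by simp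
  finally show ?thesis using c that by blast
qed

text \<open>The unitary that exhibits sparsity is absorbed by the orbit, so only the conjugated
  tuples are to be approximated. Entries outside the supports are replaced by 0, the others are
  rounded towards zero to multiples of \<open>s\<close>. The supports are not recorded separately: a
  code is an integer vector with few nonzero entries, and the count of such vectors already pays for
  their positions.\<close>

theorem sparse_covering:
  fixes F :: "'i set" and r :: "'i \<Rightarrow> real"
  assumes F: "finite F" "F \<subseteq> I" and \<epsilon>: "0 < \<epsilon>" and \<delta>: "0 < \<delta>"
  obtains c where "0 < c"
    "\<And>n \<Omega>. 0 < n \<Longrightarrow> (\<And>Z i. Z \<in> \<Omega> \<Longrightarrow> i \<in> F \<Longrightarrow> Z i \<in> carrier_mat n n \<and> operator_norm (Z i) \<le> r i) \<Longrightarrow>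
      (\<And>Z. Z \<in> \<Omega> \<Longrightarrow> sparse_tuple n F c (\<epsilon> / 2) Z) \<Longrightarrow>
      \<exists>\<Omega>'. \<Omega>' \<subseteq> (\<Pi>\<^sub>E i\<in>I. carrier_mat n n) \<and> finite \<Omega>' \<and> orbital_cover n F \<epsilon> \<Omega> \<Omega>' \<and>
        real (card \<Omega>') \<le> exp (\<delta> * (real n)\<^sup>2)"
proof -
  define R where "R = Max (insert 0 (r ` F))"
  have R0: "0 \<le> R" and Rr: "\<And>i. i \<in> F \<Longrightarrow> r i \<le> R" using F by (auto simp: R_def)
  define f where "f = real (card F)"
  \<comment> \<open>Squared Euclidean norms of the conjugated matrices are at most
    \<open>R\<^sup>2 * n\<close>; in units of \<open>s\<^sup>2\<close> this is
    \<open>L * c * n\<^sup>2\<close>, the bound per matrix on the sum of the moduli of a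
    code.\<close>
  define L where "L = 4 * R\<^sup>2 / \<epsilon>\<^sup>2"
  have L0: "0 \<le> L" by (simp add: L_def)
  obtain c where c: "0 < c" "c \<le> 1" "f * (4 * c + 2 * c * ln (1 / c) + L * c) \<le> \<delta>"
    using sparse_parameter[of f L \<delta>] \<delta> L0 by (auto simp: f_def)
  show ?thesis
  proof (rule that[OF c(1)])
    fix n :: nat and \<Omega> :: "('i \<Rightarrow> complex mat) set"
    assume n: "0 < n" and \<Omega>: "\<And>Z i. Z \<in> \<Omega> \<Longrightarrow> i \<in> F \<Longrightarrow> Z i \<in> carrier_mat n n \<and> operator_norm (Z i) \<le> r i"
      and sp: "\<And>Z. Z \<in> \<Omega> \<Longrightarrow> sparse_tuple n F c (\<epsilon> / 2) Z"
    define N where "N = {..<n} \<times> {..<n}"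
    \<comment> \<open>The Boolean separates real parts (\<open>False\<close>) from imaginary parts
      (\<open>True\<close>).\<close>
    define E where "E = F \<times> (N \<times> (UNIV :: bool set))"
    have fN: "finite N" and cN: "real (card N) = (real n)\<^sup>2" by (auto simp: N_def power2_eq_square)
    have fE: "finite E" using F fN by (simp add: E_def)
    have cE: "real (card E) = f * ((real n)\<^sup>2 * 2)"
      by (simp add: E_def card_cartesian_product f_def cN)
    \<comment> \<open>Rounding costs at most \<open>2 * s\<^sup>2\<close> on each of
      \<open>c * n\<^sup>2\<close> positions, that is \<open>\<epsilon>\<^sup>2 * n / 2\<close>.
      With the discarded entries, \<open>\<epsilon>\<^sup>2 * n / 4\<close>, the total remains
      strictly below \<open>\<epsilon>\<^sup>2 * n\<close>.\<close>
    define s where "s = \<epsilon> / (2 * sqrt (c * real n))"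
    have cn: "0 < c * real n" using c n by simp
    have s0: "0 < s" using \<epsilon> cn by (simp add: s_def)
    have s2: "s\<^sup>2 = \<epsilon>\<^sup>2 / (4 * c * real n)" using cn by (simp add: s_def power_divide power_mult_distrib)
    define dec where "dec z = (\<lambda>i\<in>I. if i \<in> F then mat n n (\<lambda>p. Complex (s * of_int (z (i, p, False))) (s * of_int (z (i, p, True)))) else 0\<^sub>m n n)"
      for z :: "'i \<times> (nat \<times> nat) \<times> bool \<Rightarrow> int"
    define Zs where "Zs = {z \<in> E \<rightarrow>\<^sub>E (UNIV :: int set). real (card {e\<in>E. z e \<noteq> 0}) \<le> 2 * f * c * (real n)\<^sup>2
        \<and> (\<Sum>e\<in>E. real_of_int \<bar>z e\<bar>) \<le> f * L * c * (real n)\<^sup>2}"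
    have fZ: "finite Zs" and cZ: "real (card Zs) \<le> (1 + 2 * c) ^ card E * (1 / c) powr (2 * f * c * (real n)\<^sup>2) * 2 powr (f * L * c * (real n)\<^sup>2)"
      unfolding Zs_def by (rule sparse_integer_vectors[OF fE c(1,2)])+
    have card: "real (card (dec ` Zs)) \<le> exp (\<delta> * (real n)\<^sup>2)"
    proof -
      have "real (card (dec ` Zs)) \<le> real (card Zs)" using fZ by (simp add: card_image_le)
      also note cZ
      also have "(1 + 2 * c) ^ card E \<le> exp (2 * c) ^ card E"
        using c exp_ge_add_one_self[of "2 * c"] by (intro power_mono) auto
      also have "exp (2 * c) ^ card E = exp (4 * f * c * (real n)\<^sup>2)"
        by (simp add: exp_of_nat_mult[symmetric] cE mult_ac)
      also have "(1 / c) powr (2 * f * c * (real n)\<^sup>2) = exp (f * (2 * c * ln (1 / c)) * (real n)\<^sup>2)"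
        using c by (simp add: powr_def mult_ac)
      also have "(2::real) powr (f * L * c * (real n)\<^sup>2) \<le> exp (f * L * c * (real n)\<^sup>2)"
      proof -
        have "f * L * c * (real n)\<^sup>2 * ln 2 \<le> f * L * c * (real n)\<^sup>2 * 1"
          using ln_2_less_1 c L0 by (intro mult_left_mono mult_nonneg_nonneg) (auto simp: f_def)
        then show ?thesis by (simp add: powr_def mult_ac)
      qed
      finally have "real (card (dec ` Zs)) \<le> exp (4 * f * c * (real n)\<^sup>2) * exp (f * (2 * c * ln (1 / c)) * (real n)\<^sup>2) * exp (f * L * c * (real n)\<^sup>2)"
        by (simp add: mult_left_mono mult_right_mono)
      also have "\<dots> = exp (f * (4 * c + 2 * c * ln (1 / c) + L * c) * (real n)\<^sup>2)"
        by (simp add: exp_add[symmetric] algebra_simps)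
      also have "\<dots> \<le> exp (\<delta> * (real n)\<^sup>2)" using c(3) by (simp add: mult_right_mono)
      finally show ?thesis .
    qed
    have "orbital_cover n F \<epsilon> \<Omega> (dec ` Zs)"
      unfolding orbital_cover_def
    proof
      fix Y assume Y: "Y \<in> \<Omega>"
      obtain V where V: "unitary_mat n V" and S: "\<forall>i\<in>F. \<exists>S \<subseteq> N. real (card S) \<le> c * (real n)\<^sup>2 \<and>
          (\<Sum>p\<in>N - S. (cmod ((mat_adjoint V * Y i * V) $$ p))\<^sup>2) \<le> (\<epsilon> / 2)\<^sup>2 * real n"
        using sp[OF Y] unfolding sparse_tuple_def N_def by blast
      then obtain S where S: "\<And>i. i \<in> F \<Longrightarrow> S i \<subseteq> N" "\<And>i. i \<in> F \<Longrightarrow> real (card (S i)) \<le> c * (real n)\<^sup>2"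
          "\<And>i. i \<in> F \<Longrightarrow> (\<Sum>p\<in>N - S i. (cmod ((mat_adjoint V * Y i * V) $$ p))\<^sup>2) \<le> (\<epsilon> / 2)\<^sup>2 * real n"
        by metis
      define W where "W i = mat_adjoint V * Y i * V" for i
      note v = unitary_matD[OF V]
      have Yc: "Y i \<in> carrier_mat n n" "operator_norm (Y i) \<le> R" if "i \<in> F" for i
        using \<Omega>[OF Y that] Rr[OF that] by auto
      have Wc: "W i \<in> carrier_mat n n" if "i \<in> F" for i
        using Yc[OF that] v by (simp add: W_def mult_carrier_mat[of _ n n _ n])
      have Wf: "(\<Sum>p\<in>N. (cmod (W i $$ p))\<^sup>2) \<le> R\<^sup>2 * real n" if i: "i \<in> F" for i
      proof -
        have "norm2 (mat_alg n) (W i) = norm2 (mat_alg n) (Y i)"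
        proof -
          have "V * 0\<^sub>m n n * mat_adjoint V = 0\<^sub>m n n" using v by simp
          moreover have "Y i - 0\<^sub>m n n = Y i" using Yc[OF i] by (intro eq_matI) auto
          moreover have "W i - 0\<^sub>m n n = W i" using Wc[OF i] by (intro eq_matI) auto
          ultimately show ?thesis
            using norm2_conj_diff[OF V Yc(1)[OF i], of "0\<^sub>m n n"] by (simp add: W_def[symmetric])
        qed
        also have "\<dots> \<le> R" using norm2_le_operator_norm[OF Yc(1)[OF i]] Yc(2)[OF i] by simp
        finally have "sqrt (frob n (W i) / real n) \<le> R" using Wc[OF i] by (simp add: norm2_frob)
        then have "frob n (W i) / real n \<le> R\<^sup>2" by (metis R0 real_sqrt_le_iff real_sqrt_unique)
        then show ?thesis using n by (simp add: frob_pairs N_def divide_le_eq)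
      qed
      define z where "z = (\<lambda>(i, p, b)\<in>E. if p \<in> S i then trunc_int ((if b then Im (W i $$ p) else Re (W i $$ p)) / s) else 0)"
      have zE: "z (i, p, b) = (if p \<in> S i then trunc_int ((if b then Im (W i $$ p) else Re (W i $$ p)) / s) else 0)"
        if "i \<in> F" "p \<in> N" for i p b using that by (simp add: z_def E_def)
      have "z \<in> Zs"
        unfolding Zs_def
      proof (intro CollectI conjI)
        show "z \<in> E \<rightarrow>\<^sub>E UNIV" by (simp add: z_def)
        have "{e\<in>E. z e \<noteq> 0} \<subseteq> (\<Union>i\<in>F. {i} \<times> (S i \<times> UNIV))"
          by (auto simp: E_def zE split: if_splits)
        then have "card {e\<in>E. z e \<noteq> 0} \<le> card (\<Union>i\<in>F. {i} \<times> (S i \<times> (UNIV :: bool set)))"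
          using F finite_subset[OF S(1) fN] by (intro card_mono finite_UN_I finite_cartesian_product) auto
        also have "\<dots> \<le> (\<Sum>i\<in>F. card ({i} \<times> (S i \<times> (UNIV :: bool set))))" by (rule card_UN_le[OF F(1)])
        also have "\<dots> = (\<Sum>i\<in>F. card (S i) * 2)" by (simp add: card_cartesian_product)
        finally have "real (card {e\<in>E. z e \<noteq> 0}) \<le> (\<Sum>i\<in>F. real (card (S i)) * 2)"
          by (metis (mono_tags, lifting) of_nat_le_iff of_nat_mult of_nat_numeral of_nat_sum sum.cong)
        also have "\<dots> \<le> (\<Sum>i\<in>F. (c * (real n)\<^sup>2) * 2)" by (intro sum_mono mult_right_mono S) auto
        finally show "real (card {e\<in>E. z e \<noteq> 0}) \<le> 2 * f * c * (real n)\<^sup>2" by (simp add: f_def mult_ac)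
        have "(\<Sum>e\<in>E. real_of_int \<bar>z e\<bar>) = (\<Sum>i\<in>F. \<Sum>p\<in>N. \<Sum>b\<in>UNIV. real_of_int \<bar>z (i, p, b)\<bar>)"
          unfolding E_def sum.cartesian_product by (rule sum.cong) auto
        also have "\<dots> \<le> (\<Sum>i\<in>F. \<Sum>p\<in>N. (cmod (W i $$ p))\<^sup>2 / s\<^sup>2)"
        proof (intro sum_mono)
          fix i p assume ip: "i \<in> F" "p \<in> N"
          have "(\<Sum>b\<in>UNIV. real_of_int \<bar>z (i, p, b)\<bar>) \<le> (Re (W i $$ p) / s)\<^sup>2 + (Im (W i $$ p) / s)\<^sup>2"
            using trunc_int_square[of "Re (W i $$ p) / s"] trunc_int_square[of "Im (W i $$ p) / s"]
            by (simp add: UNIV_bool zE[OF ip])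
          then show "(\<Sum>b\<in>UNIV. real_of_int \<bar>z (i, p, b)\<bar>) \<le> (cmod (W i $$ p))\<^sup>2 / s\<^sup>2"
            by (simp add: cmod_power2 power_divide add_divide_distrib)
        qed
        also have "\<dots> \<le> (\<Sum>i\<in>F. R\<^sup>2 * real n / s\<^sup>2)"
          unfolding sum_divide_distrib[symmetric] by (intro sum_mono divide_right_mono Wf) auto
        also have "\<dots> = f * L * c * (real n)\<^sup>2"
          unfolding s2 L_def using \<epsilon> cn by (simp add: f_def power2_eq_square)
        finally show "(\<Sum>e\<in>E. real_of_int \<bar>z e\<bar>) \<le> f * L * c * (real n)\<^sup>2" .
      qed
      moreover have "norm2 (mat_alg n) (Y i - V * dec z i * mat_adjoint V) < \<epsilon>" if i: "i \<in> F" for i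
      proof -
        have iI: "i \<in> I" using i F by blast
        have dc: "dec z i \<in> carrier_mat n n" using i iI by (simp add: dec_def)
        have d: "(cmod ((W i - dec z i) $$ p))\<^sup>2 \<le> (if p \<in> S i then 2 * s\<^sup>2 else (cmod (W i $$ p))\<^sup>2)" if p: "p \<in> N" for p
        proof -
          obtain a b where ab: "p = (a, b)" "a < n" "b < n" using p by (auto simp: N_def)
          have e: "(W i - dec z i) $$ p = W i $$ p - Complex (s * of_int (z (i, p, False))) (s * of_int (z (i, p, True)))"
            using ab i iI Wc[OF i] by (simp add: dec_def)
          have t: "(x - s * of_int (trunc_int (x / s)))\<^sup>2 \<le> s\<^sup>2" for x
          proof -
            have "x - s * of_int (trunc_int (x / s)) = s * (x / s - of_int (trunc_int (x / s)))"
              using s0 by (simp add: right_diff_distrib)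
            moreover have "(x / s - of_int (trunc_int (x / s)))\<^sup>2 \<le> 1"
              using trunc_int_close[of "x / s"] by (simp add: abs_square_le_1)
            ultimately show ?thesis by (simp add: power_mult_distrib mult_left_le)
          qed
          show ?thesis
            unfolding e using t[of "Re (W i $$ p)"] t[of "Im (W i $$ p)"]
            by (simp add: zE[OF i p] cmod_power2)
        qed
        have "frob n (W i - dec z i) \<le> (\<Sum>p\<in>N. if p \<in> S i then 2 * s\<^sup>2 else (cmod (W i $$ p))\<^sup>2)"
          unfolding frob_pairs N_def[symmetric] by (intro sum_mono d)
        also have "\<dots> = (\<Sum>p\<in>S i. 2 * s\<^sup>2) + (\<Sum>p\<in>N - S i. (cmod (W i $$ p))\<^sup>2)"
        proof -
          have "N \<inter> {p. p \<in> S i} = S i" "N \<inter> - {p. p \<in> S i} = N - S i" using S(1)[OF i] by auto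
          then show ?thesis using fN by (simp add: sum.If_cases)
        qed
        also have "\<dots> \<le> c * (real n)\<^sup>2 * (2 * s\<^sup>2) + (\<epsilon> / 2)\<^sup>2 * real n"
          using S(2,3)[OF i] by (intro add_mono) (auto simp: W_def mult_right_mono)
        also have "\<dots> = (3/4) * \<epsilon>\<^sup>2 * real n"
          unfolding s2 using cn c n by (simp add: power2_eq_square field_simps)
        also have "\<dots> < \<epsilon>\<^sup>2 * real n" using \<epsilon> n by simp
        finally have "frob n (W i - dec z i) / real n < \<epsilon>\<^sup>2" using n by (simp add: divide_less_eq)
        then have "sqrt (frob n (W i - dec z i) / real n) < \<epsilon>" using \<epsilon> by (intro real_less_lsqrt) (auto simp: frob_def intro!: sum_nonneg divide_nonneg_nonneg)
        then have "norm2 (mat_alg n) (W i - dec z i) < \<epsilon>"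
          using norm2_frob[of "W i - dec z i" n] dc by (simp add: minus_carrier_mat)
        then show ?thesis using norm2_conj_diff[OF V Yc(1)[OF i] dc] by (simp add: W_def)
      qed
      ultimately show "\<exists>V. unitary_mat n V \<and> (\<exists>X\<in>dec ` Zs. \<forall>i\<in>F. norm2 (mat_alg n) (Y i - V * X i * mat_adjoint V) < \<epsilon>)"
        using V by blast
    qed
    moreover have "dec ` Zs \<subseteq> (\<Pi>\<^sub>E i\<in>I. carrier_mat n n)" by (auto simp: dec_def)
    moreover have "finite (dec ` Zs)" using fZ by simp
    ultimately show "\<exists>\<Omega>'. \<Omega>' \<subseteq> (\<Pi>\<^sub>E i\<in>I. carrier_mat n n) \<and> finite \<Omega>' \<and> orbital_cover n F \<epsilon> \<Omega> \<Omega>' \<and>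
        real (card \<Omega>') \<le> exp (\<delta> * (real n)\<^sup>2)"
      using card by blast
  qed
qed

section \<open>Functional calculus in a fixed eigenbasis\<close>

definition fcal :: "nat \<Rightarrow> complex mat \<Rightarrow> (nat \<Rightarrow> real) \<Rightarrow> (real \<Rightarrow> real) \<Rightarrow> complex mat" where
  "fcal n V d f = V * diag_real n (\<lambda>i. f (d i)) * mat_adjoint V"

lemma index_diag_mult_left:
  assumes "E \<in> carrier_mat n n" "i < n" "j < n"
  shows "(diag_real n d * E) $$ (i, j) = complex_of_real (d i) * E $$ (i, j)"
proof -
  have "(diag_real n d * E) $$ (i, j) = (\<Sum>k\<in>{0..<n}. diag_real n d $$ (i, k) * E $$ (k, j))"
    using assms by (auto simp: diag_real_def scalar_prod_def)
  also have "\<dots> = (\<Sum>k\<in>{0..<n}. if i = k then complex_of_real (d i) * E $$ (i, j) else 0)"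
    using assms by (intro sum.cong) (auto simp: diag_real_def)
  finally show ?thesis using assms by simp
qed

lemma index_diag_mult_right:
  assumes "E \<in> carrier_mat n n" "i < n" "j < n"
  shows "(E * diag_real n d) $$ (i, j) = complex_of_real (d j) * E $$ (i, j)"
proof -
  have "(E * diag_real n d) $$ (i, j) = (\<Sum>k\<in>{0..<n}. E $$ (i, k) * diag_real n d $$ (k, j))"
    using assms by (auto simp: diag_real_def scalar_prod_def)
  also have "\<dots> = (\<Sum>k\<in>{0..<n}. if j = k then complex_of_real (d j) * E $$ (i, j) else 0)"
    using assms by (intro sum.cong) (auto simp: diag_real_def)
  finally show ?thesis using assms by simp
qed

lemma diag_real_mult: "diag_real n d * diag_real n e = diag_real n (\<lambda>i. d i * e i)"
proof (rule eq_matI)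
  fix i j assume "i < dim_row (diag_real n (\<lambda>i. d i * e i))" "j < dim_col (diag_real n (\<lambda>i. d i * e i))"
  then have ij: "i < n" "j < n" by (auto simp: diag_real_def)
  show "(diag_real n d * diag_real n e) $$ (i, j) = diag_real n (\<lambda>i. d i * e i) $$ (i, j)"
    using ij by (simp only: index_diag_mult_left[OF diag_real_carrier ij]) (simp add: diag_real_def)
qed (auto simp: diag_real_def)

lemma diag_real_add: "diag_real n d + diag_real n e = diag_real n (\<lambda>i. d i + e i)"
  by (rule eq_matI) (auto simp: diag_real_def)

lemma diag_real_smult: "complex_of_real c \<cdot>\<^sub>m diag_real n d = diag_real n (\<lambda>i. c * d i)"
  by (rule eq_matI) (auto simp: diag_real_def)

lemma diag_real_one: "diag_real n (\<lambda>i. 1) = 1\<^sub>m n"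
  by (rule eq_matI) (auto simp: diag_real_def)

lemma diag_real_adjoint: "mat_adjoint (diag_real n d) = diag_real n d"
  by (rule eq_matI) (auto simp: diag_real_def)

lemma tr_diag_real: "tr (mat_alg n) (diag_real n d) = complex_of_real ((\<Sum>i<n. d i) / real n)"
  by (simp add: diag_real_def)

lemma frob_diag_real: "frob n (diag_real n d) = (\<Sum>i<n. (d i)\<^sup>2)"
proof -
  have "(\<Sum>j<n. (cmod (diag_real n d $$ (i, j)))\<^sup>2) = (d i)\<^sup>2" if "i < n" for i
  proof -
    have "(\<Sum>j<n. (cmod (diag_real n d $$ (i, j)))\<^sup>2) = (\<Sum>j<n. if i = j then (d i)\<^sup>2 else 0)"
      using that by (intro sum.cong) (auto simp: diag_real_def)
    then show ?thesis using that by simp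
  qed
  then show ?thesis by (simp add: frob_def)
qed

lemma operator_norm_one: "operator_norm (1\<^sub>m n) \<le> 1"
  by (rule operator_norm_le[of _ n n]) auto

lemma operator_norm_unitary: "unitary_mat n V \<Longrightarrow> operator_norm V \<le> 1"
proof -
  assume V: "unitary_mat n V"
  have "(operator_norm V)\<^sup>2 \<le> 1\<^sup>2"
    using operator_norm_cstar[OF unitary_matD(1)[OF V]] unitary_matD(4)[OF V] operator_norm_one[of n] by simp
  then show ?thesis by (rule power2_le_imp_le) simp
qed

lemma operator_norm_conj_le:
  assumes V: "unitary_mat n V" and A: "A \<in> carrier_mat n n"
  shows "operator_norm (V * A * mat_adjoint V) \<le> operator_norm A"
proof -
  note v = unitary_matD[OF V]
  have V1: "operator_norm V \<le> 1" "operator_norm (mat_adjoint V) \<le> 1"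
    using operator_norm_unitary[OF V] operator_norm_adjoint[OF v(1)] by auto
  have "operator_norm (V * A * mat_adjoint V) \<le> operator_norm (V * A) * operator_norm (mat_adjoint V)"
    by (rule operator_norm_mult[of _ n n _ n]) (use v A in auto)
  also have "\<dots> \<le> (operator_norm V * operator_norm A) * operator_norm (mat_adjoint V)"
    by (intro mult_right_mono operator_norm_mult[of _ n n _ n]) (use v A operator_norm_nonneg[OF v(2)] in auto)
  also have "\<dots> \<le> (1 * operator_norm A) * 1"
    using V1 operator_norm_nonneg[OF A] operator_norm_nonneg[OF v(1)] operator_norm_nonneg[OF v(2)]
    by (intro mult_mono mult_right_mono) auto
  finally show ?thesis by simp
qed

lemma unitary_adjoint: "unitary_mat n V \<Longrightarrow> unitary_mat n (mat_adjoint V)"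
  unfolding unitary_mat_def by auto

lemma diag_entry_le:
  assumes A: "A \<in> carrier_mat n n" and i: "i < n"
  shows "cmod (A $$ (i, i)) \<le> operator_norm A"
proof -
  have "cmod (A $$ (i, i)) = cmod (vec_index (A *\<^sub>v unit_vec n i) i)" using A i by (simp add: scalar_prod_right_unit)
  also have "\<dots> \<le> vec_norm2 (A *\<^sub>v unit_vec n i)"
    using A i member_le_L2_set[of "{0..<n}" i "\<lambda>j. cmod (vec_index (A *\<^sub>v unit_vec n i) j)"] by (simp add: vec_norm2_L2)
  also have "\<dots> \<le> operator_norm A * vec_norm2 (unit_vec n i)" by (rule operator_norm_bound[OF A]) simp
  also have "vec_norm2 (unit_vec n i :: complex vec) = 1" using i by (simp add: vec_norm2_def)
  finally show ?thesis by simp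
qed

lemma operator_norm_diag_real:
  assumes "\<And>i. i < n \<Longrightarrow> \<bar>d i\<bar> \<le> K" "0 \<le> K"
  shows "operator_norm (diag_real n d) \<le> K"
proof (rule operator_norm_le[of _ n n])
  fix v :: "complex vec" assume v: "v \<in> carrier_vec n"
  have e: "vec_index (diag_real n d *\<^sub>v v) i = complex_of_real (d i) * vec_index v i" if i: "i < n" for i
  proof -
    have "vec_index (diag_real n d *\<^sub>v v) i = (\<Sum>k\<in>{0..<n}. if i = k then complex_of_real (d i) * vec_index v i else 0)"
    proof -
      have "vec_index (diag_real n d *\<^sub>v v) i = (\<Sum>k\<in>{0..<n}. diag_real n d $$ (i, k) * vec_index v k)"
        using i v by (auto simp: diag_real_def scalar_prod_def)
      also have "\<dots> = (\<Sum>k\<in>{0..<n}. if i = k then complex_of_real (d i) * vec_index v i else 0)"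
        using i by (intro sum.cong) (auto simp: diag_real_def)
      finally show ?thesis .
    qed
    then show ?thesis using i by simp
  qed
  have d: "dim_vec (diag_real n d *\<^sub>v v) = n" "dim_vec v = n" using v by (auto simp: diag_real_def)
  have "vec_norm2 (diag_real n d *\<^sub>v v) \<le> L2_set (\<lambda>i. K * cmod (vec_index v i)) {0..<n}"
    unfolding vec_norm2_L2 d by (rule L2_set_mono) (auto simp: e norm_mult assms mult_right_mono)
  also have "\<dots> = K * vec_norm2 v" using assms by (simp add: L2_set_right_distrib vec_norm2_L2 d)
  finally show "vec_norm2 (diag_real n d *\<^sub>v v) \<le> K * vec_norm2 v" .
qed (use assms in auto)

context
  fixes n :: nat and V :: "complex mat" and d :: "nat \<Rightarrow> real"
  assumes V: "unitary_mat n V"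
begin

lemma fcal_carrier [simp, intro]: "fcal n V d f \<in> carrier_mat n n"
  unfolding fcal_def using unitary_matD(1,2)[OF V] by (simp add: mult_carrier_mat[of _ n n _ n])

lemma fcal_mult: "fcal n V d f * fcal n V d g = fcal n V d (\<lambda>x. f x * g x)"
proof -
  note v = unitary_matD[OF V]
  let ?D = "diag_real n (\<lambda>i. f (d i))" and ?E = "diag_real n (\<lambda>i. g (d i))"
  have "fcal n V d f * fcal n V d g = V * (?D * ((mat_adjoint V * V) * ?E)) * mat_adjoint V"
    unfolding fcal_def using v(1,2) by (simp add: assoc_mult_mat[of _ n n _ n _ n] mult_carrier_mat[of _ n n _ n])
  also have "(mat_adjoint V * V) * ?E = ?E" unfolding v by (rule left_mult_one_mat[OF diag_real_carrier])
  finally show ?thesis by (simp add: fcal_def diag_real_mult)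
qed

lemma fcal_add: "fcal n V d f + fcal n V d g = fcal n V d (\<lambda>x. f x + g x)"
proof -
  note v = unitary_matD[OF V]
  show ?thesis unfolding fcal_def diag_real_add[symmetric] using v(1,2)
    by (simp add: mult_add_distrib_mat[of _ n n _ n] add_mult_distrib_mat[of _ n n _ _ n] mult_carrier_mat[of _ n n _ n])
qed

lemma fcal_smult: "complex_of_real c \<cdot>\<^sub>m fcal n V d f = fcal n V d (\<lambda>x. c * f x)"
proof -
  note v = unitary_matD[OF V]
  let ?D = "diag_real n (\<lambda>i. f (d i))"
  have "V * (complex_of_real c \<cdot>\<^sub>m ?D) * mat_adjoint V = complex_of_real c \<cdot>\<^sub>m (V * ?D * mat_adjoint V)"
    using mult_smult_distrib[OF v(1) diag_real_carrier[of n "\<lambda>i. f (d i)"], of "complex_of_real c"]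
      mult_smult_assoc_mat[OF mult_carrier_mat[OF v(1) diag_real_carrier[of n "\<lambda>i. f (d i)"]] v(2), of "complex_of_real c"] by simp
  then show ?thesis unfolding fcal_def diag_real_smult[symmetric] by simp
qed

lemma fcal_one: "fcal n V d (\<lambda>x. 1) = 1\<^sub>m n"
  unfolding fcal_def diag_real_one using unitary_matD[OF V] by simp

lemma tr_fcal: "tr (mat_alg n) (fcal n V d f) = complex_of_real ((\<Sum>i<n. f (d i)) / real n)"
proof -
  note v = unitary_matD[OF V]
  let ?D = "diag_real n (\<lambda>i. f (d i))"
  have "tr (mat_alg n) (fcal n V d f) = tr (mat_alg n) (mat_adjoint V * (V * ?D))"
    unfolding fcal_def using MA.tr_comm[of "V * ?D" n "mat_adjoint V"] v(1,2)
    by (simp del: mat_alg_sel(9) add: mult_carrier_mat[of _ n n _ n])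
  also have "mat_adjoint V * (V * ?D) = (mat_adjoint V * V) * ?D"
    using v(1,2) by (simp add: assoc_mult_mat[of _ n n _ n _ n])
  also have "\<dots> = ?D" unfolding v by (rule left_mult_one_mat[OF diag_real_carrier])
  finally show ?thesis unfolding tr_diag_real .
qed

lemma norm2_fcal: "norm2 (mat_alg n) (fcal n V d f) = sqrt ((\<Sum>i<n. (f (d i))\<^sup>2) / real n)"
proof -
  note v = unitary_matD[OF V]
  have "norm2 (mat_alg n) (fcal n V d f) = norm2 (mat_alg n) (diag_real n (\<lambda>i. f (d i)))"
    unfolding fcal_def using MA.norm2_unitary_conj[of V n "diag_real n (\<lambda>i. f (d i))"] v by simp
  then show ?thesis by (simp add: norm2_frob frob_diag_real)
qed

lemma operator_norm_fcal:
  assumes "\<And>i. i < n \<Longrightarrow> \<bar>f (d i)\<bar> \<le> K" "0 \<le> K"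
  shows "operator_norm (fcal n V d f) \<le> K"
  unfolding fcal_def
  by (rule order_trans[OF operator_norm_conj_le[OF V]]) (auto intro!: operator_norm_diag_real assms)

lemma fcal_eigenvalue_le:
  assumes i: "i < n"
  shows "\<bar>f (d i)\<bar> \<le> operator_norm (fcal n V d f)"
proof -
  note v = unitary_matD[OF V]
  let ?D = "diag_real n (\<lambda>i. f (d i))"
  have "mat_adjoint V * fcal n V d f * mat_adjoint (mat_adjoint V) = ?D"
    using unitary_conj_conj[OF unitary_adjoint[OF V], of ?D] by (simp add: fcal_def)
  then have "operator_norm ?D \<le> operator_norm (fcal n V d f)"
    using operator_norm_conj_le[OF unitary_adjoint[OF V] fcal_carrier[of f]] by simp
  moreover have "\<bar>f (d i)\<bar> = cmod (?D $$ (i, i))" using i by (simp add: diag_real_def)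
  ultimately show ?thesis using diag_entry_le[of ?D n i] i by simp
qed

text \<open>In the eigenbasis, commuting with a diagonal matrix multiplies the entry at a position
  by the difference of the two eigenvalues.\<close>

lemma commutator_norm2:
  assumes Z: "Z \<in> carrier_mat n n"
  shows "norm2 (mat_alg n) (fcal n V d (\<lambda>x. x) * Z - Z * fcal n V d (\<lambda>x. x))
    = sqrt ((\<Sum>p\<in>{..<n} \<times> {..<n}. (d (fst p) - d (snd p))\<^sup>2 * (cmod ((mat_adjoint V * Z * V) $$ p))\<^sup>2) / real n)"
proof -
  note v = unitary_matD[OF V]
  let ?D = "diag_real n d" and ?Y = "mat_adjoint V * Z * V"
  have Y: "?Y \<in> carrier_mat n n" using v Z by (simp add: mult_carrier_mat[of _ n n _ n])
  have D: "?D \<in> carrier_mat n n" by simp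
  have "fcal n V d (\<lambda>x. x) * Z = (V * ?D * mat_adjoint V) * (V * ?Y * mat_adjoint V)"
    by (simp only: fcal_def unitary_conj_conj[OF V Z])
  also have "\<dots> = V * (?D * ((mat_adjoint V * V) * ?Y)) * mat_adjoint V"
    using v(1,2) Y by (simp add: assoc_mult_mat[of _ n n _ n _ n] mult_carrier_mat[of _ n n _ n] del: assoc_mult_mat)
  also have "(mat_adjoint V * V) * ?Y = ?Y" unfolding v by (rule left_mult_one_mat[OF Y])
  finally have 1: "fcal n V d (\<lambda>x. x) * Z = V * (?D * ?Y) * mat_adjoint V" .
  have "Z * fcal n V d (\<lambda>x. x) = (V * ?Y * mat_adjoint V) * (V * ?D * mat_adjoint V)"
    by (simp only: fcal_def unitary_conj_conj[OF V Z])
  also have "\<dots> = V * (?Y * ((mat_adjoint V * V) * ?D)) * mat_adjoint V"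
    using v(1,2) Y by (simp add: assoc_mult_mat[of _ n n _ n _ n] mult_carrier_mat[of _ n n _ n] del: assoc_mult_mat)
  also have "(mat_adjoint V * V) * ?D = ?D" unfolding v by (rule left_mult_one_mat[OF D])
  finally have 2: "Z * fcal n V d (\<lambda>x. x) = V * (?Y * ?D) * mat_adjoint V" .
  have DY: "?D * ?Y \<in> carrier_mat n n" "?Y * ?D \<in> carrier_mat n n" using mult_carrier_mat[OF D Y] mult_carrier_mat[OF Y D] by auto
  have "fcal n V d (\<lambda>x. x) * Z - Z * fcal n V d (\<lambda>x. x) = V * (?D * ?Y - ?Y * ?D) * mat_adjoint V"
    unfolding 1 2
    using mult_minus_distrib_mat[OF v(1) DY] minus_mult_distrib_mat[OF mult_carrier_mat[OF v(1) DY(1)] mult_carrier_mat[OF v(1) DY(2)] v(2)]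
    by simp
  then have "norm2 (mat_alg n) (fcal n V d (\<lambda>x. x) * Z - Z * fcal n V d (\<lambda>x. x)) = norm2 (mat_alg n) (?D * ?Y - ?Y * ?D)"
    using MA.norm2_unitary_conj[of V n "?D * ?Y - ?Y * ?D"] v minus_carrier_mat[OF DY(2), of "?D * ?Y"] by (simp only: mat_alg_sel)
  also have "\<dots> = sqrt (frob n (?D * ?Y - ?Y * ?D) / real n)"
    by (rule norm2_frob[OF minus_carrier_mat[OF DY(2)]])
  also have "frob n (?D * ?Y - ?Y * ?D) = (\<Sum>p\<in>{..<n} \<times> {..<n}. (d (fst p) - d (snd p))\<^sup>2 * (cmod (?Y $$ p))\<^sup>2)"
    unfolding frob_pairs
  proof (rule sum.cong)
    fix p assume "p \<in> {..<n} \<times> {..<n}"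
    then obtain a b where p: "p = (a, b)" "a < n" "b < n" by auto
    note e1 = index_diag_mult_left[OF Y p(2,3), of d] and e2 = index_diag_mult_right[OF Y p(2,3), of d]
    have "(?D * ?Y - ?Y * ?D) $$ p = complex_of_real (d a - d b) * ?Y $$ (a, b)"
      using p DY e1 e2 by (simp add: left_diff_distrib del: index_mult_mat)
    then show "(cmod ((?D * ?Y - ?Y * ?D) $$ p))\<^sup>2 = (d (fst p) - d (snd p))\<^sup>2 * (cmod (?Y $$ p))\<^sup>2"
      by (simp add: norm_mult power_mult_distrib p del: of_real_diff)
  qed simp
  finally show ?thesis .
qed

end

text \<open>Countable saturation of ultraproducts: at coordinate \<open>n\<close> take a witness for
  the strongest condition \<open>t \<le> n\<close> that has one. The cutoff at \<open>n\<close>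
  makes the maximum exist, and it is harmless because a free ultrafilter contains every set of all
  \<open>n \<ge> t\<close>.\<close>

lemma ultrafilter_diagonal:
  fixes G :: "nat \<Rightarrow> nat \<Rightarrow> 'z \<Rightarrow> bool"
  assumes U: "free_ultrafilter U"
    and ex: "\<And>t. eventually (\<lambda>n. \<exists>z. G t n z) U"
    and mono: "\<And>t t' n z. t \<le> t' \<Longrightarrow> G t' n z \<Longrightarrow> G t n z"
  obtains z where "\<And>t. eventually (\<lambda>n. G t n (z n)) U"
proof -
  define T where "T n = {t. t \<le> n \<and> (\<exists>z. G t n z)}" for n
  define z where "z n = (SOME z. G (Max (T n)) n z)" for n
  have "eventually (\<lambda>n. G t n (z n)) U" for t
    using free_ultrafilter_ge[OF U, of t] ex[of t]
  proof eventually_elim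
    case (elim n)
    have f: "finite (T n)" unfolding T_def by simp
    have t: "t \<in> T n" using elim by (simp add: T_def)
    then have "Max (T n) \<in> T n" using f by (intro Max_in) auto
    then have "\<exists>z. G (Max (T n)) n z" by (simp add: T_def)
    then have "G (Max (T n)) n (z n)" unfolding z_def by (rule someI_ex)
    moreover have "t \<le> Max (T n)" using f t by (rule Max_ge)
    ultimately show ?case by (rule mono[rotated])
  qed
  then show ?thesis using that by blast
qed

section \<open>The matrix ultraproduct\<close>

abbreviation BS :: "(nat \<Rightarrow> complex mat) ring" where "BS \<equiv> bdd_sequences mat_alg"

abbreviation mn2 :: "nat \<Rightarrow> complex mat \<Rightarrow> real" where "mn2 n \<equiv> norm2 (mat_alg n)"

lemma mn2_nonneg: "A \<in> carrier_mat n n \<Longrightarrow> 0 \<le> mn2 n A"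
  using MA.norm2_nonneg[of A n] by simp

lemma mn2_add: "A \<in> carrier_mat n n \<Longrightarrow> B \<in> carrier_mat n n \<Longrightarrow> mn2 n (A + B) \<le> mn2 n A + mn2 n B"
  using MA.norm2_add[of A n B] by simp

lemma mn2_triangle:
  assumes "A \<in> carrier_mat n n" "B \<in> carrier_mat n n" "C \<in> carrier_mat n n"
  shows "mn2 n (A - C) \<le> mn2 n (A - B) + mn2 n (B - C)"
  using MA.norm2_triangle[of A n B C] assms by (simp add: mat_alg_minus)

lemma mn2_minus_commute: "A \<in> carrier_mat n n \<Longrightarrow> B \<in> carrier_mat n n \<Longrightarrow> mn2 n (A - B) = mn2 n (B - A)"
  using MA.norm2_minus_commute[of A n B] by (simp add: mat_alg_minus)

lemma mn2_mult_left: "A \<in> carrier_mat n n \<Longrightarrow> B \<in> carrier_mat n n \<Longrightarrow> mn2 n (A * B) \<le> operator_norm A * mn2 n B"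
  using MA.norm2_mult_left[of A n B] by simp

lemma mn2_mult_right: "A \<in> carrier_mat n n \<Longrightarrow> B \<in> carrier_mat n n \<Longrightarrow> mn2 n (A * B) \<le> mn2 n A * operator_norm B"
  using MA.norm2_mult_right[of A n B] by simp

lemma mn2_smult: "A \<in> carrier_mat n n \<Longrightarrow> mn2 n (c \<cdot>\<^sub>m A) = cmod c * mn2 n A"
  using MA.norm2_smult[of A n c] by simp

lemma mn2_adjoint: "A \<in> carrier_mat n n \<Longrightarrow> mn2 n (mat_adjoint A) = mn2 n A"
  using MA.norm2_star[of A n] by simp

lemma tr_mat_le: "A \<in> carrier_mat n n \<Longrightarrow> cmod (tr (mat_alg n) A) \<le> mn2 n A"
proof -
  assume A: "A \<in> carrier_mat n n"
  have "cmod (tr (mat_alg n) A) \<le> mn2 n (1\<^sub>m n) * mn2 n A" using MA.tr_le_norm2[of A n] A by (simp del: mat_alg_sel(9))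
  also have "\<dots> \<le> 1 * mn2 n A" by (intro mult_right_mono norm2_one_le mn2_nonneg A)
  finally show ?thesis by simp
qed

lemma tr_mat_minus:
  "A \<in> carrier_mat n n \<Longrightarrow> B \<in> carrier_mat n n \<Longrightarrow> tr (mat_alg n) (A - B) = tr (mat_alg n) A - tr (mat_alg n) B"
  using MA.tr_minus[of A n B] by (simp add: mat_alg_minus del: mat_alg_sel(9))

lemma tr_mat_bounded: "A \<in> carrier_mat n n \<Longrightarrow> cmod (tr (mat_alg n) A) \<le> operator_norm A"
  using tr_mat_le norm2_le_operator_norm order_trans by blast

lemma BS_carrierI:
  assumes "\<And>n. z n \<in> carrier_mat n n" "\<And>n. operator_norm (z n) \<le> C"
  shows "z \<in> carrier BS"
  using assms by (auto simp: bdd_sequences_def intro!: bdd_aboveI)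

lemma BS_carrierD:
  assumes "z \<in> carrier BS"
  shows "z n \<in> carrier_mat n n" "\<exists>C\<ge>0. \<forall>n. operator_norm (z n) \<le> C"
proof -
  show 1: "z n \<in> carrier_mat n n" for n using assms by (simp add: bdd_sequences_def)
  obtain C where C: "\<And>n. operator_norm (z n) \<le> C"
    using assms by (auto simp: bdd_sequences_def bdd_above_def)
  have "0 \<le> C" using C[of 0] operator_norm_nonneg[OF 1[of 0]] by simp
  then show "\<exists>C\<ge>0. \<forall>n. operator_norm (z n) \<le> C" using C by blast
qed

lemma BS_sel [simp]:
  "mult BS = (\<lambda>x y n. x n * y n)" "one BS = (\<lambda>n. 1\<^sub>m n)" "zero BS = (\<lambda>n. 0\<^sub>m n n)" "add BS = (\<lambda>x y n. x n + y n)"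
  by (simp_all add: bdd_sequences_def)

lemma BS_add:
  assumes "x \<in> carrier BS" "y \<in> carrier BS"
  shows "(\<lambda>n. x n + y n) \<in> carrier BS"
proof -
  obtain C D where C: "\<And>n. operator_norm (x n) \<le> C" and D: "\<And>n. operator_norm (y n) \<le> D"
    using BS_carrierD(2) assms by meson
  note c = BS_carrierD(1)[OF assms(1)] BS_carrierD(1)[OF assms(2)]
  show ?thesis
    by (rule BS_carrierI, rule add_carrier_mat[OF c(2)], rule order_trans[OF operator_norm_add[OF c] add_mono[OF C D]])
qed

lemma BS_mult:
  assumes "x \<in> carrier BS" "y \<in> carrier BS"
  shows "(\<lambda>n. x n * y n) \<in> carrier BS"
proof -
  obtain C D where C: "0 \<le> C" "\<And>n. operator_norm (x n) \<le> C" and D: "\<And>n. operator_norm (y n) \<le> D"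
    using BS_carrierD(2) assms by meson
  have "operator_norm (x n * y n) \<le> C * D" for n
  proof -
    have "operator_norm (x n * y n) \<le> operator_norm (x n) * operator_norm (y n)"
      by (rule operator_norm_mult[OF BS_carrierD(1)[OF assms(1)] BS_carrierD(1)[OF assms(2)]])
    also have "\<dots> \<le> C * D" using C D operator_norm_nonneg[OF BS_carrierD(1)[OF assms(2)], of n] by (intro mult_mono) auto
    finally show ?thesis .
  qed
  then show ?thesis
    by (rule BS_carrierI[rotated]) (rule mult_carrier_mat[OF BS_carrierD(1)[OF assms(1)] BS_carrierD(1)[OF assms(2)]])
qed

lemma BS_smult:
  assumes "x \<in> carrier BS"
  shows "(\<lambda>n. c \<cdot>\<^sub>m x n) \<in> carrier BS"
proof -
  obtain C where C: "\<And>n. operator_norm (x n) \<le> C" using BS_carrierD(2)[OF assms] by blast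
  show ?thesis
    by (rule BS_carrierI[of _ "cmod c * C"])
      (use BS_carrierD(1)[OF assms] C in \<open>auto simp: operator_norm_smult[OF BS_carrierD(1)[OF assms]] mult_left_mono\<close>)
qed

lemma BS_adjoint:
  assumes "x \<in> carrier BS"
  shows "(\<lambda>n. mat_adjoint (x n)) \<in> carrier BS"
proof -
  obtain C where C: "\<And>n. operator_norm (x n) \<le> C" using BS_carrierD(2)[OF assms] by blast
  show ?thesis
    by (rule BS_carrierI[of _ C])
      (use BS_carrierD(1)[OF assms] C in \<open>auto simp: operator_norm_adjoint[OF BS_carrierD(1)[OF assms]]\<close>)
qed

lemma BS_one: "(\<lambda>n. 1\<^sub>m n) \<in> carrier BS"
  by (rule BS_carrierI[of _ 1]) (auto simp: operator_norm_one)

lemma BS_zero: "(\<lambda>n. 0\<^sub>m n n) \<in> carrier BS"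
proof (rule BS_carrierI)
  fix n
  show "operator_norm (0\<^sub>m n n) \<le> 0"
  proof (rule operator_norm_le[OF zero_carrier_mat])
    fix v :: "complex vec" assume v: "v \<in> carrier_vec n"
    have "0\<^sub>m n n *\<^sub>v v = 0\<^sub>v n" using v by (intro eq_vecI) (auto simp: scalar_prod_def)
    then show "vec_norm2 (0\<^sub>m n n *\<^sub>v v) \<le> 0 * vec_norm2 v" by simp
  qed simp
qed simp

lemma neg_add_mat: "(A :: complex mat) \<in> carrier_mat n m \<Longrightarrow> (- 1) \<cdot>\<^sub>m A + A = 0\<^sub>m n m"
  by (rule eq_matI) auto

lemma ring_BS: "Ring.ring BS"
proof (rule ringI)
  show "abelian_group BS"
  proof (rule abelian_groupI)
    fix x assume x: "x \<in> carrier BS"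
    show "\<exists>y\<in>carrier BS. y \<oplus>\<^bsub>BS\<^esub> x = \<zero>\<^bsub>BS\<^esub>"
      by (rule bexI[OF _ BS_smult[OF x, of "- 1"]]) (simp add: neg_add_mat[OF BS_carrierD(1)[OF x]])
  next
    fix x y z assume "x \<in> carrier BS" "y \<in> carrier BS" "z \<in> carrier BS"
    note c = this[THEN BS_carrierD(1)]
    show "x \<oplus>\<^bsub>BS\<^esub> y \<oplus>\<^bsub>BS\<^esub> z = x \<oplus>\<^bsub>BS\<^esub> (y \<oplus>\<^bsub>BS\<^esub> z)"
      unfolding BS_sel by (rule ext, rule assoc_add_mat[OF c])
  next
    fix x y assume "x \<in> carrier BS" "y \<in> carrier BS"
    note c = this[THEN BS_carrierD(1)]
    show "x \<oplus>\<^bsub>BS\<^esub> y = y \<oplus>\<^bsub>BS\<^esub> x" unfolding BS_sel by (rule ext, rule comm_add_mat[OF c])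
  next
    fix x assume "x \<in> carrier BS"
    note c = this[THEN BS_carrierD(1)]
    show "\<zero>\<^bsub>BS\<^esub> \<oplus>\<^bsub>BS\<^esub> x = x" unfolding BS_sel by (rule ext, rule left_add_zero_mat[OF c])
  qed (simp_all add: BS_add BS_zero)
  show "Group.monoid BS"
  proof (rule monoidI)
    fix x y z assume "x \<in> carrier BS" "y \<in> carrier BS" "z \<in> carrier BS"
    note c = this[THEN BS_carrierD(1)]
    show "x \<otimes>\<^bsub>BS\<^esub> y \<otimes>\<^bsub>BS\<^esub> z = x \<otimes>\<^bsub>BS\<^esub> (y \<otimes>\<^bsub>BS\<^esub> z)"
      unfolding BS_sel by (rule ext, rule assoc_mult_mat[OF c])
  next
    fix x assume "x \<in> carrier BS"
    note c = this[THEN BS_carrierD(1)]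
    show "\<one>\<^bsub>BS\<^esub> \<otimes>\<^bsub>BS\<^esub> x = x" unfolding BS_sel by (rule ext, rule left_mult_one_mat[OF c])
    show "x \<otimes>\<^bsub>BS\<^esub> \<one>\<^bsub>BS\<^esub> = x" unfolding BS_sel by (rule ext, rule right_mult_one_mat[OF c])
  qed (simp_all add: BS_mult BS_one)
next
  fix x y z assume "x \<in> carrier BS" "y \<in> carrier BS" "z \<in> carrier BS"
  note c = this[THEN BS_carrierD(1)]
  show "(x \<oplus>\<^bsub>BS\<^esub> y) \<otimes>\<^bsub>BS\<^esub> z = x \<otimes>\<^bsub>BS\<^esub> z \<oplus>\<^bsub>BS\<^esub> y \<otimes>\<^bsub>BS\<^esub> z"
    unfolding BS_sel by (rule ext, rule add_mult_distrib_mat[OF c])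
  show "z \<otimes>\<^bsub>BS\<^esub> (x \<oplus>\<^bsub>BS\<^esub> y) = z \<otimes>\<^bsub>BS\<^esub> x \<oplus>\<^bsub>BS\<^esub> z \<otimes>\<^bsub>BS\<^esub> y"
    unfolding BS_sel by (rule ext, rule mult_add_distrib_mat[OF c(3,1,2)])
qed

interpretation BS: Ring.ring BS by (rule ring_BS)

lemma BS_a_inv: "x \<in> carrier BS \<Longrightarrow> \<ominus>\<^bsub>BS\<^esub> x = (\<lambda>n. (- 1) \<cdot>\<^sub>m x n)"
  by (rule BS.minus_equality) (auto simp: BS_smult neg_add_mat[OF BS_carrierD(1)])

lemma tendsto_null_le:
  fixes f g :: "nat \<Rightarrow> real"
  assumes "(g \<longlongrightarrow> 0) U" "\<And>n. 0 \<le> f n" "\<And>n. f n \<le> g n"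
  shows "(f \<longlongrightarrow> 0) U"
  by (rule tendsto_sandwich[OF _ _ tendsto_const assms(1)]) (use assms in auto)

lemma null_sequencesD:
  assumes "x \<in> null_sequences U mat_alg"
  shows "x \<in> carrier BS" "((\<lambda>n. mn2 n (x n)) \<longlongrightarrow> 0) U"
  using assms by (auto simp: null_sequences_def)

lemma null_ideal: "ideal (null_sequences U mat_alg) BS"
proof (rule idealI[OF ring_BS])
  let ?I = "null_sequences U mat_alg"
  show "subgroup ?I (add_monoid BS)"
  proof (rule BS.add.subgroupI)
    show "?I \<subseteq> carrier BS" using null_sequencesD by blast
    have "mn2 n (0\<^sub>m n n) = 0" for n by (simp add: norm2_frob frob_def)
    then have "(\<lambda>n. 0\<^sub>m n n) \<in> ?I" by (simp add: null_sequences_def BS_zero)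
    then show "?I \<noteq> {}" by blast
    fix x assume x: "x \<in> ?I"
    note x' = null_sequencesD[OF x]
    show "\<ominus>\<^bsub>BS\<^esub> x \<in> ?I"
      using x' by (simp add: BS_a_inv null_sequences_def BS_smult mn2_smult[OF BS_carrierD(1)])
    fix y assume y: "y \<in> ?I"
    note y' = null_sequencesD[OF y]
    have "((\<lambda>n. mn2 n (x n) + mn2 n (y n)) \<longlongrightarrow> 0 + 0) U" by (intro tendsto_add x' y')
    then have lim: "((\<lambda>n. mn2 n (x n) + mn2 n (y n)) \<longlongrightarrow> 0) U" by simp
    note c = BS_carrierD(1)[OF x'(1)] BS_carrierD(1)[OF y'(1)]
    have "((\<lambda>n. mn2 n (x n + y n)) \<longlongrightarrow> 0) U"
      by (rule tendsto_null_le[OF lim], rule mn2_nonneg[OF add_carrier_mat[OF c(2)]], rule mn2_add[OF c])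
    then show "x \<oplus>\<^bsub>BS\<^esub> y \<in> ?I" using BS_add[OF x'(1) y'(1)] by (simp add: null_sequences_def)
  qed
  fix a x assume a: "a \<in> ?I" and x: "x \<in> carrier BS"
  note a' = null_sequencesD[OF a]
  obtain C where C: "C \<ge> 0" "\<And>n. operator_norm (x n) \<le> C" using BS_carrierD(2)[OF x] by blast
  note xc = BS_carrierD(1)[OF x] and ac = BS_carrierD(1)[OF a'(1)]
  have lim: "((\<lambda>n. C * mn2 n (a n)) \<longlongrightarrow> 0) U" using tendsto_mult_left[OF a'(2), of C] by simp
  have "((\<lambda>n. mn2 n (x n * a n)) \<longlongrightarrow> 0) U"
    by (rule tendsto_null_le[OF lim], rule mn2_nonneg[OF mult_carrier_mat[OF xc ac]],
        rule order_trans[OF mn2_mult_left[OF xc ac] mult_right_mono[OF C(2) mn2_nonneg[OF ac]]])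
  then show "x \<otimes>\<^bsub>BS\<^esub> a \<in> ?I" using BS_mult[OF x a'(1)] by (simp add: null_sequences_def)
  have "((\<lambda>n. mn2 n (a n * x n)) \<longlongrightarrow> 0) U"
  proof (rule tendsto_null_le[OF lim])
    fix n
    show "0 \<le> mn2 n (a n * x n)" by (intro mn2_nonneg mult_carrier_mat[OF ac xc])
    have "mn2 n (a n * x n) \<le> mn2 n (a n) * operator_norm (x n)" by (rule mn2_mult_right[OF ac xc])
    also have "\<dots> \<le> mn2 n (a n) * C" by (intro mult_left_mono C mn2_nonneg ac)
    finally show "mn2 n (a n * x n) \<le> C * mn2 n (a n)" by (simp add: mult.commute)
  qed
  then show "a \<otimes>\<^bsub>BS\<^esub> x \<in> ?I" using BS_mult[OF a'(1) x] by (simp add: null_sequences_def)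
qed

definition cls :: "nat filter \<Rightarrow> (nat \<Rightarrow> complex mat) \<Rightarrow> (nat \<Rightarrow> complex mat) set" where
  "cls U z = null_sequences U mat_alg +>\<^bsub>BS\<^esub> z"

lemma mem_cls_iff:
  assumes z: "z \<in> carrier BS"
  shows "w \<in> cls U z \<longleftrightarrow> w \<in> carrier BS \<and> ((\<lambda>n. mn2 n (w n - z n)) \<longlongrightarrow> 0) U"
proof
  note zc = BS_carrierD(1)[OF z]
  assume "w \<in> cls U z"
  then obtain i where i: "i \<in> null_sequences U mat_alg" "w = (\<lambda>n. i n + z n)"
    by (auto simp: cls_def a_r_coset_def')
  note i' = null_sequencesD[OF i(1)]
  have "w n - z n = i n" for n unfolding i(2) using zc[of n] BS_carrierD(1)[OF i'(1), of n] by (intro eq_matI) auto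
  then show "w \<in> carrier BS \<and> ((\<lambda>n. mn2 n (w n - z n)) \<longlongrightarrow> 0) U"
    using i' BS_add[OF i'(1) z] i(2) by simp
next
  note zc = BS_carrierD(1)[OF z]
  assume w: "w \<in> carrier BS \<and> ((\<lambda>n. mn2 n (w n - z n)) \<longlongrightarrow> 0) U"
  then have wc: "w n \<in> carrier_mat n n" for n using BS_carrierD(1) by blast
  have e: "w n - z n = w n + (- 1) \<cdot>\<^sub>m z n" for n using zc[of n] wc[of n] by (intro eq_matI) auto
  have "(\<lambda>n. w n - z n) \<in> carrier BS" unfolding e using BS_add[OF _ BS_smult[OF z]] w by blast
  then have "(\<lambda>n. w n - z n) \<in> null_sequences U mat_alg" using w by (simp add: null_sequences_def)
  moreover have "w = (\<lambda>n. (w n - z n) + z n)"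
  proof
    fix n show "w n = (w n - z n) + z n" using zc[of n] wc[of n] by (intro eq_matI) auto
  qed
  ultimately show "w \<in> cls U z" unfolding cls_def a_r_coset_def' by auto
qed

lemma cls_eq_iff:
  assumes z: "z \<in> carrier BS" and w: "w \<in> carrier BS"
  shows "cls U w = cls U z \<longleftrightarrow> ((\<lambda>n. mn2 n (w n - z n)) \<longlongrightarrow> 0) U"
proof
  have "mn2 n (w n - w n) = 0" for n
  proof -
    have "w n - w n = 0\<^sub>m n n" using BS_carrierD(1)[OF w, of n] by (intro eq_matI) auto
    then show ?thesis by (simp add: norm2_frob frob_def)
  qed
  then have "w \<in> cls U w" using w by (simp add: mem_cls_iff)
  moreover assume "cls U w = cls U z"
  ultimately show "((\<lambda>n. mn2 n (w n - z n)) \<longlongrightarrow> 0) U" using mem_cls_iff[OF z] by blast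
next
  assume "((\<lambda>n. mn2 n (w n - z n)) \<longlongrightarrow> 0) U"
  then have "w \<in> cls U z" using w mem_cls_iff[OF z] by blast
  then have "w \<in> null_sequences U mat_alg +>\<^bsub>BS\<^esub> z" by (simp only: cls_def)
  from BS.a_repr_independence[OF this z additive_subgroup.a_subgroup[OF ideal.axioms(1)[OF null_ideal]]]
  show "cls U w = cls U z" by (simp only: cls_def)
qed

abbreviation QQ :: "nat filter \<Rightarrow> (nat \<Rightarrow> complex mat) set tracial_alg" where "QQ U \<equiv> matrix_ultraproduct U"

lemma QQ_ops:
  "carrier (QQ U) = carrier (BS Quot null_sequences U mat_alg)" "mult (QQ U) = mult (BS Quot null_sequences U mat_alg)"
  "add (QQ U) = add (BS Quot null_sequences U mat_alg)" "one (QQ U) = one (BS Quot null_sequences U mat_alg)"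
  by (simp_all add: ultraproduct_def Let_def)

lemma cls_hom: "cls U \<in> Ring.ring_hom BS (BS Quot null_sequences U mat_alg)"
proof -
  have "(\<lambda>z. cls U z) = (+>\<^bsub>BS\<^esub>) (null_sequences U mat_alg)" by (simp add: cls_def fun_eq_iff)
  then show ?thesis using ideal.rcos_ring_hom[OF null_ideal[of U]] by simp
qed

lemma cls_closed: "z \<in> carrier BS \<Longrightarrow> cls U z \<in> carrier (QQ U)"
  using ring_hom_closed[OF cls_hom] by (simp add: QQ_ops)

lemma carrier_QQ: "q \<in> carrier (QQ U) \<Longrightarrow> \<exists>z\<in>carrier BS. q = cls U z"
  unfolding QQ_ops FactRing_def A_RCOSETS_def' cls_def by auto

lemma cls_add: "z \<in> carrier BS \<Longrightarrow> w \<in> carrier BS \<Longrightarrow> cls U z \<oplus>\<^bsub>QQ U\<^esub> cls U w = cls U (\<lambda>n. z n + w n)"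
  using ring_hom_add[OF cls_hom, of z w U] by (simp add: QQ_ops)

lemma cls_mult: "z \<in> carrier BS \<Longrightarrow> w \<in> carrier BS \<Longrightarrow> cls U z \<otimes>\<^bsub>QQ U\<^esub> cls U w = cls U (\<lambda>n. z n * w n)"
  using ring_hom_mult[OF cls_hom, of z w U] by (simp add: QQ_ops)

lemma cls_one: "\<one>\<^bsub>QQ U\<^esub> = cls U (\<lambda>n. 1\<^sub>m n)"
  using ring_hom_one[OF cls_hom, of U] by (simp add: QQ_ops)

lemma cls_self: "z \<in> carrier BS \<Longrightarrow> z \<in> cls U z"
  using mem_cls_iff cls_eq_iff by blast

text \<open>Scalar multiplication and involution of the ultraproduct are unions over all
  representatives. By the continuity assumption \<open>n\<close> every representative contributes
  the same coset, so the union is that coset.\<close>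

lemma Union_cls:
  assumes z: "z \<in> carrier BS" and f: "\<And>x. x \<in> carrier BS \<Longrightarrow> f x \<in> carrier BS"
    and n: "\<And>x. x \<in> carrier BS \<Longrightarrow> ((\<lambda>n. mn2 n (x n - z n)) \<longlongrightarrow> 0) U \<Longrightarrow> ((\<lambda>n. mn2 n (f x n - f z n)) \<longlongrightarrow> 0) U"
  shows "(\<Union>x\<in>cls U z. null_sequences U mat_alg +>\<^bsub>BS\<^esub> f x) = cls U (f z)"
proof -
  have "null_sequences U mat_alg +>\<^bsub>BS\<^esub> f x = cls U (f z)" if "x \<in> cls U z" for x
    unfolding cls_def[symmetric] using that n f z by (subst cls_eq_iff) (auto simp: mem_cls_iff)
  then show ?thesis using cls_self[OF z] by blast
qed

lemma cls_star:
  assumes z: "z \<in> carrier BS"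
  shows "star (QQ U) (cls U z) = cls U (\<lambda>n. mat_adjoint (z n))"
proof -
  have "star (QQ U) (cls U z) = (\<Union>x\<in>cls U z. null_sequences U mat_alg +>\<^bsub>BS\<^esub> (\<lambda>n. mat_adjoint (x n)))"
    by (simp add: ultraproduct_def Let_def)
  also have "\<dots> = cls U (\<lambda>n. mat_adjoint (z n))"
  proof (rule Union_cls[OF z BS_adjoint])
    fix x assume x: "x \<in> carrier BS" "((\<lambda>n. mn2 n (x n - z n)) \<longlongrightarrow> 0) U"
    have "mn2 n (mat_adjoint (x n) - mat_adjoint (z n)) = mn2 n (x n - z n)" for n
    proof -
      note c = BS_carrierD(1)[OF x(1), of n] BS_carrierD(1)[OF z, of n]
      have "mat_adjoint (x n) - mat_adjoint (z n) = mat_adjoint (x n - z n)" using c by (intro eq_matI) auto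
      then show ?thesis using mn2_adjoint[of "x n - z n" n] minus_carrier_mat[OF c(2)] by simp
    qed
    then show "((\<lambda>n. mn2 n (mat_adjoint (x n) - mat_adjoint (z n))) \<longlongrightarrow> 0) U" using x by simp
  qed
  finally show ?thesis .
qed

lemma cls_smult:
  assumes z: "z \<in> carrier BS"
  shows "c \<odot>\<^bsub>QQ U\<^esub> cls U z = cls U (\<lambda>n. c \<cdot>\<^sub>m z n)"
proof -
  have "c \<odot>\<^bsub>QQ U\<^esub> cls U z = (\<Union>x\<in>cls U z. null_sequences U mat_alg +>\<^bsub>BS\<^esub> (\<lambda>n. c \<cdot>\<^sub>m x n))"
    by (simp add: ultraproduct_def Let_def)
  also have "\<dots> = cls U (\<lambda>n. c \<cdot>\<^sub>m z n)"
  proof (rule Union_cls[OF z BS_smult])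
    fix x assume x: "x \<in> carrier BS" "((\<lambda>n. mn2 n (x n - z n)) \<longlongrightarrow> 0) U"
    have "mn2 n (c \<cdot>\<^sub>m x n - c \<cdot>\<^sub>m z n) = cmod c * mn2 n (x n - z n)" for n
    proof -
      note d = BS_carrierD(1)[OF x(1), of n] BS_carrierD(1)[OF z, of n]
      have "c \<cdot>\<^sub>m x n - c \<cdot>\<^sub>m z n = c \<cdot>\<^sub>m (x n - z n)" using d by (intro eq_matI) (auto simp: right_diff_distrib)
      then show ?thesis using mn2_smult[of "x n - z n" n c] minus_carrier_mat[OF d(2)] by simp
    qed
    then show "((\<lambda>n. mn2 n (c \<cdot>\<^sub>m x n - c \<cdot>\<^sub>m z n)) \<longlongrightarrow> 0) U" using tendsto_mult_left[OF x(2), of "cmod c"] by simp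
  qed
  finally show ?thesis .
qed

lemma tr_close:
  assumes c: "\<And>n. x n \<in> carrier_mat n n" "\<And>n. z n \<in> carrier_mat n n"
    and n: "((\<lambda>n. mn2 n (x n - z n)) \<longlongrightarrow> 0) U" and t: "((\<lambda>n. tr (mat_alg n) (z n)) \<longlongrightarrow> t) U"
  shows "((\<lambda>n. tr (mat_alg n) (x n)) \<longlongrightarrow> t) U"
proof -
  have "((\<lambda>n. cmod (tr (mat_alg n) (x n) - tr (mat_alg n) (z n))) \<longlongrightarrow> 0) U"
    by (rule tendsto_null_le[OF n], simp only: norm_ge_zero, subst tr_mat_minus[OF c, symmetric],
        rule tr_mat_le[OF minus_carrier_mat[OF c(2)]])
  then have "((\<lambda>n. tr (mat_alg n) (x n) - tr (mat_alg n) (z n)) \<longlongrightarrow> 0) U" by (rule tendsto_norm_zero_cancel)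
  from tendsto_add[OF this t] show ?thesis by simp
qed

lemma cls_tr:
  assumes U: "U \<noteq> bot" and z: "z \<in> carrier BS" and t: "((\<lambda>n. tr (mat_alg n) (z n)) \<longlongrightarrow> t) U"
  shows "tr (QQ U) (cls U z) = t"
proof -
  have "tr (QQ U) (cls U z) = (THE t. \<forall>x\<in>cls U z. ((\<lambda>n. tr (mat_alg n) (x n)) \<longlongrightarrow> t) U)"
    by (simp add: ultraproduct_def Let_def del: mat_alg_sel(9))
  also have "\<dots> = t"
  proof (rule the_equality)
    show "\<forall>x\<in>cls U z. ((\<lambda>n. tr (mat_alg n) (x n)) \<longlongrightarrow> t) U"
      using mem_cls_iff[OF z] BS_carrierD(1) z t by (blast intro: tr_close)
    fix s assume "\<forall>x\<in>cls U z. ((\<lambda>n. tr (mat_alg n) (x n)) \<longlongrightarrow> s) U"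
    then show "s = t" using cls_self[OF z] tendsto_unique[OF U] t by blast
  qed
  finally show ?thesis .
qed

lemma tr_limit_exists:
  assumes U: "free_ultrafilter U" and z: "z \<in> carrier BS"
  obtains t where "((\<lambda>n. tr (mat_alg n) (z n)) \<longlongrightarrow> t) U"
proof -
  obtain C where C: "\<And>n. operator_norm (z n) \<le> C" using BS_carrierD(2)[OF z] by blast
  have "cmod (tr (mat_alg n) (z n)) \<le> C" for n
    using tr_mat_bounded[OF BS_carrierD(1)[OF z, of n]] C[of n] by linarith
  then show ?thesis using ultrafilter_bounded_limit[OF U, of "\<lambda>n. tr (mat_alg n) (z n)" C] that by blast
qed

section \<open>Embeddings from microstates\<close>

context pre_tracial
begin

lemma tr_zero [simp]: "tr M \<zero> = 0"
  using tr_smult[of \<zero> 0] by simp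

lemma tr_finsum:
  "finite S \<Longrightarrow> (\<And>s. s \<in> S \<Longrightarrow> f s \<in> carrier M) \<Longrightarrow> tr M (finsum M f S) = (\<Sum>s\<in>S. tr M (f s))"
proof (induction S rule: finite_induct)
  case (insert s S)
  have "finsum M f (insert s S) = f s \<oplus> finsum M f S"
    using insert by (intro finsum_insert) auto
  then show ?case using insert by (simp add: tr_add finsum_closed Pi_def)
qed simp

lemma tr_eval_poly:
  assumes Z: "\<And>k. Z k \<in> carrier M"
  shows "tr M (eval_poly M Z p) = (\<Sum>w\<in>Poly_Mapping.keys p. Poly_Mapping.lookup p w * tr M (eval_word M Z w))"
proof -
  have w: "eval_word M Z w \<in> carrier M" for w using Z by (rule eval_word_closed)
  have "tr M (eval_poly M Z p) = (\<Sum>u\<in>Poly_Mapping.keys p. tr M (Poly_Mapping.lookup p u \<odot>\<^bsub>M\<^esub> eval_word M Z u))"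
    unfolding eval_poly_def by (rule tr_finsum) (use w in auto)
  then show ?thesis using w by (simp add: tr_smult)
qed

lemma norm2_mult_diff:
  assumes "x \<in> carrier M" "y \<in> carrier M" "p \<in> carrier M" "q \<in> carrier M"
  shows "norm2 M (x \<otimes> y \<ominus> p \<otimes> q) \<le> norm2 M (x \<ominus> p) * nrm M y + nrm M p * norm2 M (y \<ominus> q)"
proof -
  have e: "lv x * lv y - lv p * lv q = (lv x - lv p) * lv y + lv p * (lv y - lv q)"
    by (simp add: algebra_simps)
  have "F.n2 (lv x * lv y - lv p * lv q) \<le> F.n2 ((lv x - lv p) * lv y) + F.n2 (lv p * (lv y - lv q))"
    unfolding e by (rule F.n2_add)
  also have "\<dots> \<le> F.n2 (lv x - lv p) * nrm M (ev (lv y)) + nrm M (ev (lv p)) * F.n2 (lv y - lv q)"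
    by (intro add_mono F.n2_mult_left F.n2_mult_right)
  finally show ?thesis using assms by (simp add: n2_ev)
qed

lemma norm2_add_diff:
  assumes "x \<in> carrier M" "y \<in> carrier M" "p \<in> carrier M" "q \<in> carrier M"
  shows "norm2 M ((x \<oplus> y) \<ominus> (p \<oplus> q)) \<le> norm2 M (x \<ominus> p) + norm2 M (y \<ominus> q)"
proof -
  have e: "(lv x + lv y) - (lv p + lv q) = (lv x - lv p) + (lv y - lv q)" by simp
  have "F.n2 ((lv x + lv y) - (lv p + lv q)) \<le> F.n2 (lv x - lv p) + F.n2 (lv y - lv q)"
    unfolding e by (rule F.n2_add)
  then show ?thesis using assms by (simp add: n2_ev)
qed

lemma norm2_star_diff:
  "x \<in> carrier M \<Longrightarrow> p \<in> carrier M \<Longrightarrow> norm2 M (star M x \<ominus> star M p) = norm2 M (x \<ominus> p)"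
  using F.n2_st[of "lv x - lv p"] unfolding F.st_diff by (simp add: n2_ev)

lemma norm2_smult_diff:
  "x \<in> carrier M \<Longrightarrow> p \<in> carrier M \<Longrightarrow> norm2 M (c \<odot>\<^bsub>M\<^esub> x \<ominus> c \<odot>\<^bsub>M\<^esub> p) = cmod c * norm2 M (x \<ominus> p)"
  using F.n2_sc[of c "lv x - lv p"] unfolding right_diff_distrib by (simp add: n2_ev)

text \<open>For self-adjoint \<open>x\<close> of norm at most \<open>R\<close>, pairing
  \<open>x\<close> with \<open>s1 * s1\<close> or with \<open>- (s2 * s2)\<close> gives at most
  \<open>R\<close> times the trace of the square; replacing \<open>x\<close> by \<open>p\<close>
  costs one application of Cauchy-Schwarz. In the application the squares approximate the excess of
  \<open>p\<close> above \<open>R\<close> and below \<open>- R\<close>. They are written as squares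
  because \<open>t_conj_le\<close> is the available form of positivity.\<close>

lemma trace_cut_estimate:
  assumes c: "x \<in> carrier M" "p \<in> carrier M" "s1 \<in> carrier M" "s2 \<in> carrier M"
    and sa: "star M x = x" "star M s1 = s1" "star M s2 = s2" and R: "nrm M x \<le> R"
  shows "Re (tr M (p \<otimes> (s1 \<otimes> s1 \<ominus> s2 \<otimes> s2))) - R * Re (tr M (s1 \<otimes> s1 \<oplus> s2 \<otimes> s2))
    \<le> norm2 M (x \<ominus> p) * norm2 M (s1 \<otimes> s1 \<ominus> s2 \<otimes> s2)"
proof -
  define h where "h = F.n2 1"
  \<comment> \<open>A polynomial with value \<open>x\<close> that is fixed by
    \<open>poly_star\<close>, which the variable \<open>lv x\<close> is not.\<close>
  define y where "y = const_poly (1/2) * (lv x + poly_star (lv x))"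
  have ey: "ev y = x"
  proof -
    have "ev y = ev (const_poly (1/2) * lv x + const_poly (1/2) * lv x)" using c sa by (simp add: y_def sm_add_right)
    then show ?thesis using c by (simp only: F.sc_half ev_lv)
  qed
  have sy: "poly_star y = y" by (simp add: y_def F.st_scm F.st_add poly_star_star add.commute)
  have b: "Re (tr M (s \<otimes> x \<otimes> s)) \<le> R * Re (tr M (s \<otimes> s))" "- Re (tr M (s \<otimes> x \<otimes> s)) \<le> R * Re (tr M (s \<otimes> s))"
    if s: "s \<in> carrier M" "star M s = s" for s
  proof -
    have n: "(F.n2 (lv s))\<^sup>2 = Re (tr M (s \<otimes> s))" using s by (simp add: F.n2_sq)
    have n0: "0 \<le> Re (tr M (s \<otimes> s))" unfolding n[symmetric] by simp
    have le: "nrm M x * Re (tr M (s \<otimes> s)) \<le> R * Re (tr M (s \<otimes> s))" using n0 R by (rule mult_right_mono[rotated])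
    show "Re (tr M (s \<otimes> x \<otimes> s)) \<le> R * Re (tr M (s \<otimes> s))"
      using F.t_conj_le[OF sy, of "lv s"] s ey n le by simp
    have "poly_star (- y) = - y" by (simp add: F.st_minus sy)
    from F.t_conj_le[OF this, of "lv s"]
    have "Re (tr M (ev (poly_star (lv s) * (- y) * lv s))) \<le> nrm M (ev (- y)) * (F.n2 (lv s))\<^sup>2" .
    also have "poly_star (lv s) * (- y) * lv s = - (poly_star (lv s) * y * lv s)" by simp
    also have "Re (tr M (ev (- (poly_star (lv s) * y * lv s)))) = - Re (tr M (s \<otimes> x \<otimes> s))"
      using F.t_minus[of "poly_star (lv s) * y * lv s"] s ey by simp
    also have "nrm M (ev (- y)) = nrm M x" using F.nr_minus[of y] ey by simp
    finally show "- Re (tr M (s \<otimes> x \<otimes> s)) \<le> R * Re (tr M (s \<otimes> s))" unfolding n using le by simp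
  qed
  have tc: "tr M (x \<otimes> (s \<otimes> s)) = tr M (s \<otimes> x \<otimes> s)" if "s \<in> carrier M" for s
    using tr_comm[of s "x \<otimes> s"] tr_comm[of "x \<otimes> s" s] c that by (simp add: m_assoc)
  let ?u = "s1 \<otimes> s1 \<ominus> s2 \<otimes> s2"
  have u: "?u \<in> carrier M" using c by simp
  have e1: "tr M (p \<otimes> ?u) = tr M (x \<otimes> ?u) - tr M ((x \<ominus> p) \<otimes> ?u)"
  proof -
    have "lv p * lv ?u = lv x * lv ?u - (lv x - lv p) * lv ?u" by (simp add: algebra_simps)
    then have "tr M (ev (lv p * lv ?u)) = tr M (ev (lv x * lv ?u)) - tr M (ev ((lv x - lv p) * lv ?u))"
      by (metis F.t_diff)
    then show ?thesis using c u by simp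
  qed
  have e2: "tr M (x \<otimes> ?u) = tr M (s1 \<otimes> x \<otimes> s1) - tr M (s2 \<otimes> x \<otimes> s2)"
  proof -
    have "lv x * (lv s1 * lv s1 - lv s2 * lv s2) = lv x * (lv s1 * lv s1) - lv x * (lv s2 * lv s2)" by (simp add: algebra_simps)
    then have "tr M (ev (lv x * (lv s1 * lv s1 - lv s2 * lv s2))) = tr M (ev (lv x * (lv s1 * lv s1))) - tr M (ev (lv x * (lv s2 * lv s2)))"
      by (metis F.t_diff)
    then show ?thesis using c tc by simp
  qed
  have "- Re (tr M ((x \<ominus> p) \<otimes> ?u)) \<le> norm2 M (x \<ominus> p) * norm2 M ?u"
    using tr_mult_le[of "x \<ominus> p" ?u] abs_Re_le_cmod[of "tr M ((x \<ominus> p) \<otimes> ?u)"] c u by simp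
  moreover have "Re (tr M (s1 \<otimes> s1 \<oplus> s2 \<otimes> s2)) = Re (tr M (s1 \<otimes> s1)) + Re (tr M (s2 \<otimes> s2))"
    using c by (simp add: tr_add)
  ultimately show ?thesis unfolding e1 e2 using b(1)[OF c(3) sa(2)] b(2)[OF c(4) sa(3)] by (simp add: distrib_left)
qed

end

text \<open>\<open>dense\<close> is all that is retained of the tuple being generating.
  \<open>X\<close> and \<open>Z\<close> are total and bounded at every index, so that evaluations
  carry no membership conditions, while \<open>dense\<close> and \<open>law_limit\<close> speak only
  of the letters in \<open>K\<close>.\<close>

locale microstate_sequence = tracial_wstar_alg A for A :: "('a, 'm) tracial_alg_scheme" (structure) +
  fixes U :: "nat filter" and K :: "'k set" and X :: "'k \<Rightarrow> 'a" and R :: "'k \<Rightarrow> real"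
    and Z :: "nat \<Rightarrow> 'k \<Rightarrow> complex mat"
  assumes U: "free_ultrafilter U"
    and X_closed: "X k \<in> carrier A"
    and Z_carrier: "Z n k \<in> carrier_mat n n"
    and Z_norm: "operator_norm (Z n k) \<le> R k"
    and dense: "x \<in> carrier A \<Longrightarrow> e > 0 \<Longrightarrow> \<exists>p\<in>ncpolys K. norm2 A (x \<ominus> eval_poly A X p) < e"
    and law_limit: "fst ` set w \<subseteq> K \<Longrightarrow>
      ((\<lambda>n. tr (mat_alg n) (eval_word (mat_alg n) (Z n) w)) \<longlongrightarrow> tr A (eval_word A X w)) U"
begin

abbreviation pe :: "'k ncpoly \<Rightarrow> 'a" where "pe \<equiv> eval_poly A X"

abbreviation pz :: "nat \<Rightarrow> 'k ncpoly \<Rightarrow> complex mat" where "pz n \<equiv> eval_poly (mat_alg n) (Z n)"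

lemma Ub: "U \<noteq> bot" by (rule free_ultrafilter_bot[OF U])

lemma pe_closed [simp]: "pe p \<in> carrier A" by (rule eval_poly_closed) (rule X_closed)

lemma Zc: "Z n k \<in> carrier (mat_alg n)" using Z_carrier by simp

lemma pz_closed: "pz n p \<in> carrier_mat n n"
  using MA.eval_poly_closed[of "Z n" n p] Zc by simp

lemma pz_hom:
  "pz n (p + q) = pz n p + pz n q" "pz n (p * q) = pz n p * pz n q" "pz n (poly_star p) = mat_adjoint (pz n p)"
  "pz n 1 = 1\<^sub>m n" "pz n (const_poly c * p) = c \<cdot>\<^sub>m pz n p" "pz n (p - q) = pz n p - pz n q"
  using MA.eval_poly_add[where Z = "Z n", OF Zc] MA.eval_poly_mult[where Z = "Z n", OF Zc]
    MA.eval_poly_star[where Z = "Z n", OF Zc] MA.eval_poly_one[where Z = "Z n", OF Zc]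
    MA.eval_poly_scale[where Z = "Z n", OF Zc] MA.eval_poly_minus[where Z = "Z n", OF Zc]
  by (simp_all add: mat_alg_minus[OF pz_closed pz_closed])

lemma pe_hom:
  "pe (p + q) = pe p \<oplus> pe q" "pe (p * q) = pe p \<otimes> pe q" "pe (poly_star p) = star A (pe p)"
  "pe 1 = \<one>" "pe (const_poly c * p) = c \<odot>\<^bsub>A\<^esub> pe p" "pe (p - q) = pe p \<ominus> pe q"
  using eval_poly_add[where Z = X, OF X_closed] eval_poly_mult[where Z = X, OF X_closed]
    eval_poly_star[where Z = X, OF X_closed] eval_poly_one[where Z = X, OF X_closed]
    eval_poly_scale[where Z = X, OF X_closed] eval_poly_minus[where Z = X, OF X_closed]
  by simp_all

lemma tr_pz: "p \<in> ncpolys K \<Longrightarrow> ((\<lambda>n. tr (mat_alg n) (pz n p)) \<longlongrightarrow> tr A (pe p)) U"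
  unfolding MA.tr_eval_poly[where Z = "Z _", OF Zc] tr_eval_poly[where Z = X, OF X_closed]
  by (intro tendsto_sum tendsto_mult_left law_limit) (auto simp: ncpolys_def)

lemma norm2_pz:
  assumes p: "p \<in> ncpolys K"
  shows "((\<lambda>n. mn2 n (pz n p)) \<longlongrightarrow> norm2 A (pe p)) U"
proof -
  have "((\<lambda>n. sqrt (Re (tr (mat_alg n) (pz n (poly_star p * p))))) \<longlongrightarrow> sqrt (Re (tr A (pe (poly_star p * p))))) U"
    by (intro tendsto_intros tr_pz ncpolys_mult ncpolys_star p)
  then show ?thesis by (simp add: norm2_def pz_hom pe_hom del: mat_alg_sel(9))
qed

lemma word_BS: "(\<lambda>n. eval_word (mat_alg n) (Z n) w) \<in> carrier BS"
proof (induction w)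
  case Nil
  show ?case using BS_one by (simp add: eval_word_def)
next
  case (Cons a w)
  have z: "(\<lambda>n. Z n (fst a)) \<in> carrier BS" by (rule BS_carrierI[OF Z_carrier Z_norm])
  have "(\<lambda>n. if snd a then mat_adjoint (Z n (fst a)) else Z n (fst a)) \<in> carrier BS"
    using z BS_adjoint[OF z] by (cases "snd a") auto
  moreover have "eval_word (mat_alg n) (Z n) (a # w) =
      (if snd a then mat_adjoint (Z n (fst a)) else Z n (fst a)) * eval_word (mat_alg n) (Z n) w" for n
    by (simp add: eval_word_def case_prod_beta)
  ultimately show ?case using BS_mult Cons by (simp only:)
qed

lemma pz_BS: "(\<lambda>n. pz n p) \<in> carrier BS"
proof (induction p rule: poly_mapping_add_induct)
  case zero
  show ?case using BS_zero by simp
next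
  case (single w c)
  have "pz n (Poly_Mapping.single w c) = c \<cdot>\<^sub>m eval_word (mat_alg n) (Z n) w" for n
    using MA.eval_poly_single[where Z = "Z n", OF Zc] by simp
  then show ?case using BS_smult[OF word_BS] by simp
next
  case (add p q)
  then show ?case using BS_add by (simp add: pz_hom)
qed

text \<open>The graph of the embedding: \<open>z\<close> represents \<open>x\<close> if one and the
  same polynomial approximates both in the 2-norm. The sequence \<open>z\<close> is bounded in
  operator norm, although the approximating polynomials have no bound in common.\<close>

definition apx :: "(nat \<Rightarrow> complex mat) \<Rightarrow> 'a \<Rightarrow> bool" where
  "apx z x \<longleftrightarrow> z \<in> carrier BS \<and> x \<in> carrier A \<and>
    (\<forall>e>0. \<exists>p\<in>ncpolys K. norm2 A (x \<ominus> pe p) < e \<and> (\<forall>\<^sub>F n in U. mn2 n (z n - pz n p) < e))"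

lemma apxD:
  assumes "apx z x"
  shows "z \<in> carrier BS" "x \<in> carrier A" "z n \<in> carrier_mat n n"
    "e > 0 \<Longrightarrow> \<exists>p\<in>ncpolys K. norm2 A (x \<ominus> pe p) < e \<and> (\<forall>\<^sub>F n in U. mn2 n (z n - pz n p) < e)"
  using assms BS_carrierD(1) by (auto simp: apx_def)

lemma apx_poly:
  assumes "p \<in> ncpolys K"
  shows "apx (\<lambda>n. pz n p) (pe p)"
proof -
  have "pz n p - pz n p = 0\<^sub>m n n" for n using pz_closed[of n p] by (intro eq_matI) auto
  then have "mn2 n (pz n p - pz n p) = 0" for n by (simp add: norm2_frob frob_def)
  moreover have "norm2 A (pe p \<ominus> pe p) = 0" by (simp add: norm2_eq_0 minus_eq_zero_iff)
  ultimately show ?thesis using pz_BS unfolding apx_def by (auto intro!: bexI[OF _ assms])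
qed

text \<open>Two polynomials close to \<open>x\<close> are close to each other in \<open>A\<close>,
  and \<open>norm2_pz\<close> transfers this to the matrices.\<close>

lemma apx_unique:
  assumes z: "apx z x" and w: "apx w x"
  shows "cls U z = cls U w"
proof -
  have "((\<lambda>n. mn2 n (z n - w n)) \<longlongrightarrow> 0) U"
  proof (rule order_tendstoI)
    fix a :: real assume "a < 0"
    then show "\<forall>\<^sub>F n in U. a < mn2 n (z n - w n)"
      using mn2_nonneg[OF minus_carrier_mat[OF apxD(3)[OF w]]] by (intro always_eventually allI) (rule less_le_trans)
  next
    fix a :: real assume a: "0 < a"
    then have a5: "a / 5 > 0" by simp
    obtain p where p: "p \<in> ncpolys K" "norm2 A (x \<ominus> pe p) < a / 5" "\<forall>\<^sub>F n in U. mn2 n (z n - pz n p) < a / 5"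
      using apxD(4)[OF z a5] by blast
    obtain q where q: "q \<in> ncpolys K" "norm2 A (x \<ominus> pe q) < a / 5" "\<forall>\<^sub>F n in U. mn2 n (w n - pz n q) < a / 5"
      using apxD(4)[OF w a5] by blast
    have "norm2 A (pe (p - q)) \<le> norm2 A (pe p \<ominus> x) + norm2 A (x \<ominus> pe q)"
      unfolding pe_hom using apxD(2)[OF z] by (intro norm2_triangle) auto
    also have "\<dots> < 2 * (a / 5)" using p q norm2_minus_commute[of x "pe p"] apxD(2)[OF z] by simp
    finally have "\<forall>\<^sub>F n in U. mn2 n (pz n (p - q)) < 2 * (a / 5)"
      using norm2_pz[OF ncpolys_diff[OF p(1) q(1)]] by (intro order_tendstoD) auto
    with p(3) q(3) show "\<forall>\<^sub>F n in U. mn2 n (z n - w n) < a"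
    proof eventually_elim
      case (elim n)
      note c = apxD(3)[OF z, of n] apxD(3)[OF w, of n] pz_closed[of n p] pz_closed[of n q]
      have "mn2 n (z n - w n) \<le> mn2 n (z n - pz n p) + (mn2 n (pz n p - pz n q) + mn2 n (pz n q - w n))"
        using mn2_triangle[OF c(1,3,2)] mn2_triangle[OF c(3,4,2)] by simp
      then show ?case using elim mn2_minus_commute[OF c(2,4)] a by (simp add: pz_hom)
    qed
  qed
  then show ?thesis using cls_eq_iff[OF apxD(1)[OF w] apxD(1)[OF z]] by simp
qed

lemma mn2_mult_diff:
  assumes "x \<in> carrier_mat n n" "y \<in> carrier_mat n n" "p \<in> carrier_mat n n" "q \<in> carrier_mat n n"
  shows "mn2 n (x * y - p * q) \<le> mn2 n (x - p) * operator_norm y + operator_norm p * mn2 n (y - q)"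
  using MA.norm2_mult_diff[of x n y p q] assms by (simp add: mat_alg_minus mult_carrier_mat[of _ n n _ n])

lemma half_cancel: "0 < D \<Longrightarrow> e / (2 * D) * D = e / 2" for D e :: real
  by simp

lemma apx_mult:
  assumes z: "apx z x" and w: "apx w y"
  shows "apx (\<lambda>n. z n * w n) (x \<otimes> y)"
  unfolding apx_def
proof (intro conjI allI impI)
  show "(\<lambda>n. z n * w n) \<in> carrier BS" by (rule BS_mult[OF apxD(1)[OF z] apxD(1)[OF w]])
  note xy = apxD(2)[OF z] apxD(2)[OF w]
  then show "x \<otimes> y \<in> carrier A" by simp
  fix e :: real assume e: "e > 0"
  obtain C where C: "C \<ge> 0" "\<And>n. operator_norm (w n) \<le> C" using BS_carrierD(2)[OF apxD(1)[OF w]] by blast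
  define e1 where "e1 = e / (2 * (C + nrm A y + 1))"
  have d1: "C + nrm A y + 1 > 0" using C nrm_nonneg[OF xy(2)] by simp
  then have e1: "e1 > 0" using e by (simp add: e1_def)
  have e1b: "e1 * (C + nrm A y + 1) = e / 2" unfolding e1_def using d1 by (rule half_cancel)
  obtain p where p: "p \<in> ncpolys K" "norm2 A (x \<ominus> pe p) < e1" "\<forall>\<^sub>F n in U. mn2 n (z n - pz n p) < e1"
    using apxD(4)[OF z e1] by blast
  obtain D where D: "D \<ge> 0" "\<And>n. operator_norm (pz n p) \<le> D" using BS_carrierD(2)[OF pz_BS] by blast
  \<comment> \<open>The norms of \<open>p\<close> become large as \<open>p\<close> improves, so the
    tolerance for \<open>q\<close> is fixed only after \<open>p\<close>.\<close>
  define e2 where "e2 = e / (2 * (D + nrm A (pe p) + 1))"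
  have np: "0 \<le> nrm A (pe p)" by (rule nrm_nonneg) simp
  have d2: "D + nrm A (pe p) + 1 > 0" using D np by simp
  then have e2: "e2 > 0" using e by (simp add: e2_def)
  have e2b: "e2 * (D + nrm A (pe p) + 1) = e / 2" unfolding e2_def using d2 by (rule half_cancel)
  obtain q where q: "q \<in> ncpolys K" "norm2 A (y \<ominus> pe q) < e2" "\<forall>\<^sub>F n in U. mn2 n (w n - pz n q) < e2"
    using apxD(4)[OF w e2] by blast
  have b1: "e1 * N < e / 2" if "0 \<le> N" "N \<le> C + nrm A y" for N
  proof -
    have "e1 * N < e1 * (C + nrm A y + 1)" using that e1 by (intro mult_strict_left_mono) auto
    then show ?thesis by (simp only: e1b)
  qed
  have b2: "N * e2 < e / 2" if "0 \<le> N" "N \<le> D + nrm A (pe p)" for N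
  proof -
    have "e2 * N < e2 * (D + nrm A (pe p) + 1)" using that e2 by (intro mult_strict_left_mono) auto
    then show ?thesis by (simp only: e2b mult.commute)
  qed
  have "norm2 A (x \<otimes> y \<ominus> pe (p * q)) \<le> norm2 A (x \<ominus> pe p) * nrm A y + nrm A (pe p) * norm2 A (y \<ominus> pe q)"
    unfolding pe_hom using xy by (intro norm2_mult_diff) auto
  also have "\<dots> \<le> e1 * nrm A y + nrm A (pe p) * e2"
    using p q np nrm_nonneg[OF xy(2)] by (intro add_mono mult_right_mono mult_left_mono) auto
  also have "\<dots> < e" using b1[of "nrm A y"] b2[of "nrm A (pe p)"] C D np nrm_nonneg[OF xy(2)] by simp
  finally have 1: "norm2 A (x \<otimes> y \<ominus> pe (p * q)) < e" .
  have "\<forall>\<^sub>F n in U. mn2 n (z n * w n - pz n (p * q)) < e"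
    using p(3) q(3)
  proof eventually_elim
    case (elim n)
    note c = apxD(3)[OF z, of n] apxD(3)[OF w, of n] pz_closed[of n p] pz_closed[of n q]
    have "mn2 n (z n * w n - pz n (p * q)) \<le> mn2 n (z n - pz n p) * operator_norm (w n) + operator_norm (pz n p) * mn2 n (w n - pz n q)"
      unfolding pz_hom by (rule mn2_mult_diff[OF c])
    also have "\<dots> \<le> e1 * C + D * e2"
      using elim C D e1 mn2_nonneg[OF minus_carrier_mat[OF c(4)]] operator_norm_nonneg[OF c(2)]
      by (intro add_mono mult_mono) auto
    also have "\<dots> < e" using b1[of C] b2[of D] C D np nrm_nonneg[OF xy(2)] by simp
    finally show ?case .
  qed
  with 1 ncpolys_mult[OF p(1) q(1)]
  show "\<exists>p\<in>ncpolys K. norm2 A (x \<otimes> y \<ominus> pe p) < e \<and> (\<forall>\<^sub>F n in U. mn2 n (z n * w n - pz n p) < e)" by blast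
qed

lemma apx_add:
  assumes z: "apx z x" and w: "apx w y"
  shows "apx (\<lambda>n. z n + w n) (x \<oplus> y)"
  unfolding apx_def
proof (intro conjI allI impI)
  show "(\<lambda>n. z n + w n) \<in> carrier BS" by (rule BS_add[OF apxD(1)[OF z] apxD(1)[OF w]])
  note xy = apxD(2)[OF z] apxD(2)[OF w]
  then show "x \<oplus> y \<in> carrier A" by simp
  fix e :: real assume "e > 0"
  then have e: "e / 2 > 0" by simp
  obtain p where p: "p \<in> ncpolys K" "norm2 A (x \<ominus> pe p) < e / 2" "\<forall>\<^sub>F n in U. mn2 n (z n - pz n p) < e / 2"
    using apxD(4)[OF z e] by blast
  obtain q where q: "q \<in> ncpolys K" "norm2 A (y \<ominus> pe q) < e / 2" "\<forall>\<^sub>F n in U. mn2 n (w n - pz n q) < e / 2"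
    using apxD(4)[OF w e] by blast
  have "norm2 A ((x \<oplus> y) \<ominus> pe (p + q)) < e"
    unfolding pe_hom using norm2_add_diff[of x y "pe p" "pe q"] xy p q by simp
  moreover have "\<forall>\<^sub>F n in U. mn2 n (z n + w n - pz n (p + q)) < e"
    using p(3) q(3)
  proof eventually_elim
    case (elim n)
    note c = apxD(3)[OF z, of n] apxD(3)[OF w, of n] pz_closed[of n p] pz_closed[of n q]
    have "mn2 n (z n + w n - (pz n p + pz n q)) \<le> mn2 n (z n - pz n p) + mn2 n (w n - pz n q)"
      using MA.norm2_add_diff[of "z n" n "w n" "pz n p" "pz n q"] c by (simp add: mat_alg_minus)
    then show ?case using elim by (simp add: pz_hom)
  qed
  ultimately show "\<exists>p\<in>ncpolys K. norm2 A (x \<oplus> y \<ominus> pe p) < e \<and> (\<forall>\<^sub>F n in U. mn2 n (z n + w n - pz n p) < e)"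
    using ncpolys_add[OF p(1) q(1)] by blast
qed

lemma apx_star:
  assumes z: "apx z x"
  shows "apx (\<lambda>n. mat_adjoint (z n)) (star A x)"
  unfolding apx_def
proof (intro conjI allI impI)
  show "(\<lambda>n. mat_adjoint (z n)) \<in> carrier BS" by (rule BS_adjoint[OF apxD(1)[OF z]])
  note x = apxD(2)[OF z]
  then show "star A x \<in> carrier A" by simp
  fix e :: real assume e: "e > 0"
  obtain p where p: "p \<in> ncpolys K" "norm2 A (x \<ominus> pe p) < e" "\<forall>\<^sub>F n in U. mn2 n (z n - pz n p) < e"
    using apxD(4)[OF z e] by blast
  have "norm2 A (star A x \<ominus> pe (poly_star p)) < e"
    unfolding pe_hom using norm2_star_diff[of x "pe p"] x p by simp
  moreover have "\<forall>\<^sub>F n in U. mn2 n (mat_adjoint (z n) - pz n (poly_star p)) < e"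
    using p(3)
  proof eventually_elim
    case (elim n)
    note c = apxD(3)[OF z, of n] pz_closed[of n p]
    show ?case using MA.norm2_star_diff[of "z n" n "pz n p"] c elim by (simp add: mat_alg_minus pz_hom)
  qed
  ultimately show "\<exists>p\<in>ncpolys K. norm2 A (star A x \<ominus> pe p) < e \<and> (\<forall>\<^sub>F n in U. mn2 n (mat_adjoint (z n) - pz n p) < e)"
    using ncpolys_star[OF p(1)] by blast
qed

lemma apx_smult:
  assumes z: "apx z x"
  shows "apx (\<lambda>n. c \<cdot>\<^sub>m z n) (c \<odot>\<^bsub>A\<^esub> x)"
proof -
  have "apx (\<lambda>n. pz n (const_poly c * 1)) (pe (const_poly c * 1))"
    by (rule apx_poly) (rule ncpolys_mult[OF ncpolys_const ncpolys_one])
  from apx_mult[OF this z] have 1: "apx (\<lambda>n. pz n (const_poly c * 1) * z n) (pe (const_poly c * 1) \<otimes> x)" .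
  have "pz n (const_poly c * 1) * z n = c \<cdot>\<^sub>m z n" for n
    unfolding pz_hom(5)[of n c 1] pz_hom(4) using mult_smult_assoc_mat[OF one_carrier_mat apxD(3)[OF z, of n], of c] apxD(3)[OF z, of n] by simp
  moreover have "pe (const_poly c * 1) \<otimes> x = c \<odot>\<^bsub>A\<^esub> x"
    unfolding pe_hom(5)[of c 1] pe_hom(4) using apxD(2)[OF z] by simp
  ultimately show ?thesis using 1 by (simp only:)
qed

lemma apx_tr:
  assumes z: "apx z x"
  shows "((\<lambda>n. tr (mat_alg n) (z n)) \<longlongrightarrow> tr A x) U"
proof (rule tendstoI)
  fix e :: real assume e: "e > 0"
  define e' where "e' = e / (3 + norm2 A \<one>)"
  have d: "3 + norm2 A \<one> > 0" using norm2_nonneg[of \<one>] one_closed by (intro add_pos_nonneg) auto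
  have e': "e' > 0" using e d by (simp add: e'_def)
  have eb: "e' * (3 + norm2 A \<one>) = e" unfolding e'_def using d by (metis less_irrefl nonzero_eq_divide_eq)
  note x = apxD(2)[OF z]
  obtain p where p: "p \<in> ncpolys K" "norm2 A (x \<ominus> pe p) < e'" "\<forall>\<^sub>F n in U. mn2 n (z n - pz n p) < e'"
    using apxD(4)[OF z e'] by blast
  have t: "\<forall>\<^sub>F n in U. dist (tr (mat_alg n) (pz n p)) (tr A (pe p)) < e'"
    using tr_pz[OF p(1)] e' by (rule tendstoD)
  have "cmod (tr A x - tr A (pe p)) \<le> norm2 A \<one> * norm2 A (x \<ominus> pe p)"
    using tr_le_norm2[of "x \<ominus> pe p"] x by (simp add: tr_minus)
  also have "\<dots> \<le> norm2 A \<one> * e'" using p by (intro mult_left_mono) auto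
  finally have 1: "cmod (tr A (pe p) - tr A x) \<le> norm2 A \<one> * e'" by (simp add: norm_minus_commute)
  show "\<forall>\<^sub>F n in U. dist (tr (mat_alg n) (z n)) (tr A x) < e"
    using p(3) t
  proof eventually_elim
    case (elim n)
    note c = apxD(3)[OF z, of n] pz_closed[of n p]
    have 2: "cmod (tr (mat_alg n) (z n) - tr (mat_alg n) (pz n p)) < e'"
      using tr_mat_le[OF minus_carrier_mat[OF c(2)], of "z n"] elim tr_mat_minus[OF c] by simp
    have "dist (tr (mat_alg n) (z n)) (tr A x) \<le> dist (tr (mat_alg n) (z n)) (tr (mat_alg n) (pz n p))
        + (dist (tr (mat_alg n) (pz n p)) (tr A (pe p)) + dist (tr A (pe p)) (tr A x))"
      by (meson add_left_mono dist_triangle order_trans)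
    also have "\<dots> < e' + (e' + norm2 A \<one> * e')"
      using 1 2 elim by (simp add: dist_norm del: mat_alg_sel(9))
    also have "\<dots> \<le> e" using eb e' by (simp add: algebra_simps)
    finally show ?case .
  qed
qed

end

section \<open>Truncation of self-adjoint microstates and existence of the limit embedding\<close>

lemma poly_star_const_mult: "poly_star (const_poly c * p) = const_poly (cnj c) * poly_star p"
  unfolding poly_star_mult poly_star_single by (simp add: zero_list_def word_star_def const_poly_commute[unfolded zero_list_def])

lemma poly_star_power: "poly_star p = p \<Longrightarrow> poly_star (p ^ k) = p ^ k"
  by (induction k) (simp_all add: poly_star_mult power_commutes poly_star_single word_star_def zero_list_def
      flip: single_one)

lemma clip_identities:
  fixes t R :: real
  assumes "0 \<le> R"
  shows "t - max (- R) (min R t) = max (t - R) 0 - max (- t - R) 0"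
    "(max (t - R) 0 - max (- t - R) 0)\<^sup>2 = t * (max (t - R) 0 - max (- t - R) 0) - R * (max (t - R) 0 + max (- t - R) 0)"
proof -
  consider "t > R" | "t < - R" | "\<bar>t\<bar> \<le> R" by linarith
  note c = this
  show "t - max (- R) (min R t) = max (t - R) 0 - max (- t - R) 0" using assms by (auto simp: max_def min_def)
  from c show "(max (t - R) 0 - max (- t - R) 0)\<^sup>2 = t * (max (t - R) 0 - max (- t - R) 0) - R * (max (t - R) 0 + max (- t - R) 0)"
  proof cases
    case 1
    then have "max (t - R) 0 = t - R" "max (- t - R) 0 = 0" using assms by auto
    then show ?thesis by (simp add: power2_eq_square algebra_simps)
  next
    case 2
    then have "max (t - R) 0 = 0" "max (- t - R) 0 = - t - R" using assms by auto
    then show ?thesis by (simp add: power2_eq_square algebra_simps)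
  next
    case 3
    then have "max (t - R) 0 = 0" "max (- t - R) 0 = 0" by auto
    then show ?thesis by simp
  qed
qed

text \<open>Weierstrass approximation is applied to the square root of \<open>f\<close>, so that the
  approximant is the square of a polynomial and remains visibly positive when evaluated in
  \<open>A\<close>. If the root is bounded by \<open>B\<close> and approximated within
  \<open>h \<le> 1\<close>, its square is approximated within
  \<open>h * (2 * B + 1)\<close>.\<close>

lemma polynomial_square_approx:
  fixes f :: "real \<Rightarrow> real"
  assumes f: "continuous_on UNIV f" "\<And>t. 0 \<le> f t" "\<And>t. \<bar>t\<bar> \<le> C \<Longrightarrow> f t \<le> B\<^sup>2" and B: "0 \<le> B" and e: "0 < e"
  obtains a m where "\<And>t. \<bar>t\<bar> \<le> C \<Longrightarrow> \<bar>(\<Sum>i\<le>(m::nat). a i * t ^ i)\<^sup>2 - f t\<bar> \<le> e"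
proof -
  define h where "h = min 1 (e / (2 * B + 1))"
  have h: "0 < h" "h \<le> 1" using B e by (auto simp: h_def)
  have "h * (2 * B + 1) \<le> e / (2 * B + 1) * (2 * B + 1)" using B by (intro mult_right_mono) (auto simp: h_def)
  also have "\<dots> = e" using B by simp
  finally have hB: "h * (2 * B + 1) \<le> e" .
  have "continuous_on {-C..C} (\<lambda>t. sqrt (f t))" using f(1) by (intro continuous_on_real_sqrt) (rule continuous_on_subset, auto)
  from Stone_Weierstrass_real_polynomial_function[OF compact_Icc this h(1)]
  obtain g where g: "real_polynomial_function g" "\<And>t. t \<in> {-C..C} \<Longrightarrow> \<bar>sqrt (f t) - g t\<bar> < h" by blast
  obtain a m where am: "g = (\<lambda>x. \<Sum>i\<le>(m::nat). a i * x ^ i)" using g(1) by (auto simp: real_polynomial_function_iff_sum)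
  show ?thesis
  proof
    fix t :: real assume t: "\<bar>t\<bar> \<le> C"
    have s: "0 \<le> sqrt (f t)" "sqrt (f t) \<le> B" using f(2)[of t] f(3)[OF t] B by (auto intro: real_le_lsqrt)
    have d: "\<bar>g t - sqrt (f t)\<bar> \<le> h" using g(2)[of t] t by (simp add: abs_le_iff abs_less_iff)
    have "(g t)\<^sup>2 - (sqrt (f t))\<^sup>2 = (g t - sqrt (f t)) * (g t + sqrt (f t))"
      unfolding power2_eq_square by (rule square_diff_square_factored[THEN trans]) (rule mult.commute)
    then have "(g t)\<^sup>2 - f t = (g t - sqrt (f t)) * (g t + sqrt (f t))" unfolding real_sqrt_pow2[OF f(2)[of t]] .
    then have "\<bar>(g t)\<^sup>2 - f t\<bar> = \<bar>g t - sqrt (f t)\<bar> * \<bar>g t + sqrt (f t)\<bar>" by (simp add: abs_mult)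
    also have "\<bar>g t + sqrt (f t)\<bar> \<le> 2 * B + 1" using d s h by linarith
    then have "\<bar>g t - sqrt (f t)\<bar> * \<bar>g t + sqrt (f t)\<bar> \<le> h * (2 * B + 1)" using d h by (intro mult_mono) auto
    finally show "\<bar>(\<Sum>i\<le>m. a i * t ^ i)\<^sup>2 - f t\<bar> \<le> e" using hB by (simp add: am)
  qed
qed

lemma fcal_minus:
  assumes V: "unitary_mat n V"
  shows "fcal n V d f - fcal n V d g = fcal n V d (\<lambda>x. f x - g x)"
proof -
  have e: "fcal n V d f = fcal n V d (\<lambda>x. f x - g x) + fcal n V d g" unfolding fcal_add[OF V] by simp
  show ?thesis unfolding e using fcal_carrier[OF V, of d "\<lambda>x. f x - g x"] fcal_carrier[OF V, of d g] by (intro eq_matI) auto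
qed

lemma mean_mono:
  fixes f g :: "nat \<Rightarrow> real"
  assumes "n > 0" "\<And>i. i < n \<Longrightarrow> f i - h \<le> g i"
  shows "(\<Sum>i<n. f i) / real n - h \<le> (\<Sum>i<n. g i) / real n"
proof -
  have "(\<Sum>i<n. f i) - real n * h = (\<Sum>i<n. f i - h)" by (simp add: sum_subtractf)
  also have "\<dots> \<le> (\<Sum>i<n. g i)" using assms by (intro sum_mono) auto
  finally have "((\<Sum>i<n. f i) - real n * h) / real n \<le> (\<Sum>i<n. g i) / real n" by (rule divide_right_mono) simp
  then show ?thesis using assms(1) by (simp add: diff_divide_distrib)
qed

context microstate_sequence
begin

text \<open>One *-polynomial \<open>P\<close> works for all \<open>n\<close> and all
  diagonalisations, so that traces of polynomial functions of the microstates converge to traces in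
  \<open>A\<close>.\<close>

lemma poly_calculus:
  fixes a :: "nat \<Rightarrow> real"
  assumes p: "p \<in> ncpolys K" "poly_star p = p"
  shows "\<exists>P\<in>ncpolys K. poly_star P = P \<and>
     (\<forall>n V d. unitary_mat n V \<longrightarrow> pz n p = fcal n V d (\<lambda>t. t) \<longrightarrow> pz n P = fcal n V d (\<lambda>t. \<Sum>i\<le>m. a i * t ^ i))"
proof (induction m)
  case 0
  let ?P = "const_poly (complex_of_real (a 0)) * (1 :: 'k ncpoly)"
  have "pz n ?P = fcal n V d (\<lambda>t. \<Sum>i\<le>0. a i * t ^ i)" if V: "unitary_mat n V" for n V d
    unfolding pz_hom(5)[of n _ 1] pz_hom(4) fcal_one[OF V, of d, symmetric] fcal_smult[OF V] by simp
  moreover have "poly_star ?P = ?P" unfolding poly_star_const_mult using poly_star_power[OF p(2), of 0] by simp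
  ultimately show ?case by (intro bexI[of _ ?P] conjI allI impI ncpolys_mult ncpolys_const ncpolys_one)
next
  case (Suc m)
  then obtain P where P: "P \<in> ncpolys K" "poly_star P = P"
    "\<And>n V d. unitary_mat n V \<Longrightarrow> pz n p = fcal n V d (\<lambda>t. t) \<Longrightarrow> pz n P = fcal n V d (\<lambda>t. \<Sum>i\<le>m. a i * t ^ i)" by blast
  let ?P = "P + const_poly (complex_of_real (a (Suc m))) * p ^ Suc m"
  have "pz n ?P = fcal n V d (\<lambda>t. \<Sum>i\<le>Suc m. a i * t ^ i)" if V: "unitary_mat n V" "pz n p = fcal n V d (\<lambda>t. t)" for n V d
  proof -
    have k: "pz n (p ^ k) = fcal n V d (\<lambda>t. t ^ k)" for k
    proof (induction k)
      case 0
      show ?case using pz_hom(4) fcal_one[OF V(1)] by simp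
    next
      case (Suc k)
      show ?case unfolding power_Suc pz_hom(2) Suc V(2) fcal_mult[OF V(1)] ..
    qed
    show ?thesis unfolding pz_hom(1) pz_hom(5) k P(3)[OF V] fcal_smult[OF V(1)] fcal_add[OF V(1)] by simp
  qed
  moreover have "poly_star ?P = ?P" unfolding poly_star_add poly_star_const_mult P poly_star_power[OF p(2)] by simp
  ultimately show ?case by (intro bexI[of _ ?P] conjI allI impI ncpolys_add ncpolys_mult ncpolys_const ncpolys_power P p)
qed

text \<open>For a self-adjoint microstate the distance to its spectral truncation at \<open>R0\<close> is at most the
  distance from \<open>pe p\<close> to the ball of radius \<open>R0\<close>: with \<open>w\<close> the excess of a real number over the
  truncation interval, \<open>w\<^sup>2 = t * w - R0 * \<bar>w\<bar>\<close>, and pairing the right-hand side with \<open>x\<close> in place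
  of \<open>t\<close> gives something nonpositive.\<close>

lemma clip_estimate:
  assumes x: "x \<in> carrier A" "star A x = x" "nrm A x \<le> R0" and R0: "0 < R0"
    and p: "p \<in> ncpolys K" "poly_star p = p" and e: "0 < e"
    and V: "\<And>n. unitary_mat n (V n)" and pV: "\<And>n. pz n p = fcal n (V n) (d n) (\<lambda>t. t)"
  shows "\<forall>\<^sub>F n in U. mn2 n (fcal n (V n) (d n) (\<lambda>t. max (- R0) (min R0 t)) - pz n p) < norm2 A (x \<ominus> pe p) + e"
proof -
  define \<delta> where "\<delta> = norm2 A (x \<ominus> pe p)"
  have \<delta>: "0 \<le> \<delta>" using x by (simp add: \<delta>_def)
  obtain C where C: "C \<ge> 0" "\<And>n. operator_norm (pz n p) \<le> C" using BS_carrierD(2)[OF pz_BS] by blast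
  have dC: "\<bar>d n i\<bar> \<le> C" if "i < n" for n i
    using fcal_eigenvalue_le[OF V that, where f = "\<lambda>t. t" and d = "d n"] C(2)[of n] by (simp add: pV)
  \<comment> \<open>\<open>D\<close> collects the errors of the final comparison, in units of
    \<open>\<eta>\<close>; their sum \<open>\<eta> * D\<close> is made equal to
    \<open>e\<^sup>2 / 2\<close>.\<close>
  define D where "D = 2 * (C + R0) + 3 * \<delta> + 1"
  have D: "0 < D" using C R0 \<delta> by (simp add: D_def)
  define \<eta> where "\<eta> = e\<^sup>2 / (2 * D)"
  have \<eta>: "0 < \<eta>" using e D by (simp add: \<eta>_def)
  have \<eta>D: "\<eta> * D = e\<^sup>2 / 2" unfolding \<eta>_def using D by (rule half_cancel)
  define f1 f2 :: "real \<Rightarrow> real" where "f1 = (\<lambda>t. max (t - R0) 0)" and "f2 = (\<lambda>t. max (- t - R0) 0)"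
  have CB: "C \<le> (C + 1)\<^sup>2" using C(1) by (simp add: power2_eq_square algebra_simps)
  obtain a1 m1 where g1: "\<And>t. \<bar>t\<bar> \<le> C \<Longrightarrow> \<bar>(\<Sum>i\<le>(m1::nat). a1 i * t ^ i)\<^sup>2 - f1 t\<bar> \<le> \<eta>"
  proof (rule polynomial_square_approx[of f1 C "C + 1" \<eta>])
    show "continuous_on UNIV f1" unfolding f1_def by (intro continuous_intros)
    show "f1 t \<le> (C + 1)\<^sup>2" if "\<bar>t\<bar> \<le> C" for t using that R0 CB C(1) unfolding f1_def by (intro max.boundedI) auto
  qed (use C \<eta> in \<open>auto simp: f1_def\<close>)
  obtain a2 m2 where g2: "\<And>t. \<bar>t\<bar> \<le> C \<Longrightarrow> \<bar>(\<Sum>i\<le>(m2::nat). a2 i * t ^ i)\<^sup>2 - f2 t\<bar> \<le> \<eta>"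
  proof (rule polynomial_square_approx[of f2 C "C + 1" \<eta>])
    show "continuous_on UNIV f2" unfolding f2_def by (intro continuous_intros)
    show "f2 t \<le> (C + 1)\<^sup>2" if "\<bar>t\<bar> \<le> C" for t using that R0 CB C(1) unfolding f2_def by (intro max.boundedI) auto
  qed (use C \<eta> in \<open>auto simp: f2_def\<close>)
  define h1 h2 where "h1 = (\<lambda>t::real. \<Sum>i\<le>m1. a1 i * t ^ i)" and "h2 = (\<lambda>t::real. \<Sum>i\<le>m2. a2 i * t ^ i)"
  obtain P1 where P1: "P1 \<in> ncpolys K" "poly_star P1 = P1" "\<And>n. pz n P1 = fcal n (V n) (d n) h1"
    using poly_calculus[OF p, of a1 m1] V pV unfolding h1_def by blast
  obtain P2 where P2: "P2 \<in> ncpolys K" "poly_star P2 = P2" "\<And>n. pz n P2 = fcal n (V n) (d n) h2"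
    using poly_calculus[OF p, of a2 m2] V pV unfolding h2_def by blast
  \<comment> \<open>\<open>u\<close> approximates the signed excess \<open>f1 - f2\<close> over the
    truncation interval, and \<open>s\<close> its modulus \<open>f1 + f2\<close>.\<close>
  define u s where "u = P1 * P1 - P2 * P2" and "s = P1 * P1 + P2 * P2"
  have us: "u \<in> ncpolys K" "p * u \<in> ncpolys K" "s \<in> ncpolys K"
    unfolding u_def s_def by (intro ncpolys_mult ncpolys_add ncpolys_diff P1 P2 p)+
  have pzu: "pz n u = fcal n (V n) (d n) (\<lambda>t. h1 t * h1 t - h2 t * h2 t)" for n
    unfolding u_def pz_hom P1 P2 fcal_mult[OF V] fcal_minus[OF V] ..
  have pzs: "pz n s = fcal n (V n) (d n) (\<lambda>t. h1 t * h1 t + h2 t * h2 t)" for n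
    unfolding s_def pz_hom P1 P2 fcal_mult[OF V] fcal_add[OF V] ..
  have pzpu: "pz n (p * u) = fcal n (V n) (d n) (\<lambda>t. t * (h1 t * h1 t - h2 t * h2 t))" for n
    unfolding pz_hom pzu pV fcal_mult[OF V] ..
  define T where "T = (\<lambda>n. Re (tr (mat_alg n) (pz n (p * u))) - R0 * Re (tr (mat_alg n) (pz n s)))"
  define \<tau> where "\<tau> = Re (tr A (pe (p * u))) - R0 * Re (tr A (pe s))"
  define N where "N = norm2 A (pe u)"
  have Tl: "(T \<longlongrightarrow> \<tau>) U" unfolding T_def \<tau>_def by (intro tendsto_intros tr_pz us)
  have Nl: "((\<lambda>n. mn2 n (pz n u)) \<longlongrightarrow> N) U" unfolding N_def by (intro norm2_pz us)
  have star: "star A (pe P1) = pe P1" "star A (pe P2) = pe P2" using pe_hom(3)[of P1] pe_hom(3)[of P2] P1 P2 by auto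
  have \<tau>: "\<tau> \<le> \<delta> * N"
    using trace_cut_estimate[OF x(1) pe_closed pe_closed pe_closed x(2) star x(3), of p]
    by (simp add: \<tau>_def \<delta>_def N_def u_def s_def pe_hom)
  have "\<forall>\<^sub>F n in U. T n < \<tau> + \<eta>" using Tl by (rule order_tendstoD) (use \<eta> in simp)
  moreover have "\<forall>\<^sub>F n in U. N - \<eta> < mn2 n (pz n u)" using Nl by (rule order_tendstoD) (use \<eta> in simp)
  moreover have "\<forall>\<^sub>F n in U. n \<ge> 1" by (rule free_ultrafilter_ge[OF U])
  ultimately show ?thesis
  proof eventually_elim
    case (elim n)
    define w where "w = (\<lambda>t. f1 t - f2 t)"
    have w: "t - max (- R0) (min R0 t) = w t" "(w t)\<^sup>2 = t * w t - R0 * (f1 t + f2 t)" for t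
      using clip_identities[of R0 t] R0 by (auto simp: w_def f1_def f2_def)
    define B where "B = mn2 n (fcal n (V n) (d n) w)"
    have fc: "fcal n (V n) (d n) f \<in> carrier_mat n n" for f by (rule fcal_carrier[OF V])
    have B0: "0 \<le> B" unfolding B_def by (rule mn2_nonneg[OF fc])
    have B2: "B\<^sup>2 = (\<Sum>i<n. (w (d n i))\<^sup>2) / real n"
      unfolding B_def norm2_fcal[OF V] by (intro real_sqrt_pow2 divide_nonneg_nonneg sum_nonneg) auto
    have goalB: "mn2 n (fcal n (V n) (d n) (\<lambda>t. max (- R0) (min R0 t)) - pz n p) = B"
    proof -
      have "(max (- R0) (min R0 t) - t)\<^sup>2 = (w t)\<^sup>2" for t unfolding w(1)[symmetric] by (rule power2_commute)
      then show ?thesis unfolding pV fcal_minus[OF V] B_def norm2_fcal[OF V] by simp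
    qed
    have hw: "\<bar>(h1 t * h1 t - h2 t * h2 t) - w t\<bar> \<le> 2 * \<eta>" "h1 t * h1 t + h2 t * h2 t \<le> f1 t + f2 t + 2 * \<eta>" if "\<bar>t\<bar> \<le> C" for t
      using g1[OF that] g2[OF that] by (auto simp: h1_def h2_def w_def power2_eq_square)
    have T: "B\<^sup>2 - 2 * (C + R0) * \<eta> \<le> T n"
    proof -
      have "(w (d n i))\<^sup>2 - 2 * (C + R0) * \<eta> \<le> d n i * (h1 (d n i) * h1 (d n i) - h2 (d n i) * h2 (d n i))
          - R0 * (h1 (d n i) * h1 (d n i) + h2 (d n i) * h2 (d n i))" if "i < n" for i
      proof -
        define t where "t = d n i"
        have t: "\<bar>t\<bar> \<le> C" using dC[OF that] by (simp add: t_def)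
        have "\<bar>t * ((h1 t * h1 t - h2 t * h2 t) - w t)\<bar> \<le> C * (2 * \<eta>)"
          unfolding abs_mult using t hw(1)[OF t] C by (intro mult_mono) auto
        then have "t * w t - t * (h1 t * h1 t - h2 t * h2 t) \<le> 2 * C * \<eta>" by (simp add: right_diff_distrib abs_le_iff)
        moreover have "R0 * (h1 t * h1 t + h2 t * h2 t) \<le> R0 * (f1 t + f2 t + 2 * \<eta>)" using hw(2)[OF t] R0 by (intro mult_left_mono) auto
        ultimately show ?thesis unfolding w(2) t_def[symmetric] by (simp add: algebra_simps)
      qed
      from mean_mono[OF _ this] elim(3)
      show ?thesis unfolding T_def pzpu pzs tr_fcal[OF V] B2 Re_complex_of_real
        by (simp only: sum_subtractf sum_distrib_left[symmetric] diff_divide_distrib times_divide_eq_right)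
    qed
    have Nn: "mn2 n (pz n u) \<le> B + 2 * \<eta>"
    proof -
      let ?r = "\<lambda>t. (h1 t * h1 t - h2 t * h2 t) - w t"
      have "pz n u = fcal n (V n) (d n) w + fcal n (V n) (d n) ?r" unfolding pzu fcal_add[OF V] by simp
      then have "mn2 n (pz n u) \<le> B + mn2 n (fcal n (V n) (d n) ?r)" unfolding B_def using mn2_add[OF fc fc] by simp
      also have "mn2 n (fcal n (V n) (d n) ?r) \<le> operator_norm (fcal n (V n) (d n) ?r)" by (rule norm2_le_operator_norm[OF fc])
      also have "\<dots> \<le> 2 * \<eta>" using hw(1)[OF dC] \<eta> by (intro operator_norm_fcal[OF V]) auto
      finally show ?thesis by simp
    qed
    show ?case
    proof (rule ccontr)
      assume "\<not> ?case"
      \<comment> \<open>Up to multiples of \<open>\<eta>\<close> the trace estimate says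
        \<open>B\<^sup>2 \<le> \<delta> * B\<close>, where \<open>B\<close> is the distance to the
        truncation. A \<open>B\<close> of at least \<open>\<delta> + e\<close> violates this by
        \<open>e\<^sup>2\<close>.\<close>
      then have BI: "\<delta> + e \<le> B" unfolding goalB \<delta>_def by simp
      have "e * e \<le> (B - \<delta>) * B" using BI e \<delta> by (intro mult_mono) auto
      also have "\<dots> = B\<^sup>2 - \<delta> * B" by (simp add: power2_eq_square algebra_simps)
      also have "B\<^sup>2 \<le> 2 * (C + R0) * \<eta> + \<delta> * N + \<eta>" using T elim(1) \<tau> by linarith
      also have "\<delta> * N \<le> \<delta> * (B + 3 * \<eta>)" using elim(2) Nn \<delta> by (intro mult_left_mono) auto
      finally have "e * e \<le> \<eta> * D" by (simp add: D_def algebra_simps)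
      then show False unfolding \<eta>D using e by (simp add: power2_eq_square)
    qed
  qed
qed


text \<open>Polynomials \<open>p k\<close> approximating \<open>x\<close> have no common
  operator-norm bound, so their evaluations cannot simply be diagonalised over \<open>k\<close>. The
  truncation of \<open>pz n (p t)\<close> at \<open>R0\<close> is bounded and, by
  \<open>clip_estimate\<close>, still close to \<open>pz n (p t)\<close>, hence to all
  \<open>pz n (p l)\<close> with \<open>l \<le> t\<close>. A diagonal choice along \<open>U\<close>
  then yields one bounded sequence.\<close>

lemma apx_exists_sa:
  assumes x: "x \<in> carrier A" "star A x = x"
  shows "\<exists>z. apx z x"
proof -
  define R0 where "R0 = nrm A x + 1"
  have R0: "0 < R0" "nrm A x \<le> R0" using nrm_nonneg[OF x(1)] by (auto simp: R0_def)
  define \<iota> where "\<iota> k = 1 / real (Suc k)" for k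
  have \<iota>: "0 < \<iota> k" for k by (simp add: \<iota>_def)
  have \<iota>_mono: "\<iota> l \<le> \<iota> k" if "k \<le> l" for k l using that by (simp add: \<iota>_def frac_le)
  have "\<exists>p\<in>ncpolys K. poly_star p = p \<and> norm2 A (x \<ominus> pe p) < \<iota> k" for k
  proof -
    obtain q where q: "q \<in> ncpolys K" "norm2 A (x \<ominus> pe q) < \<iota> k" using dense[OF x(1) \<iota>] by blast
    let ?p = "const_poly (1/2) * (q + poly_star q)"
    have 1: "(1/2) \<odot>\<^bsub>A\<^esub> (x \<oplus> x) = x"
    proof -
      have "ev (const_poly (1/2) * lv x + const_poly (1/2) * lv x) = ev (lv x)" by (simp only: F.sc_half)
      then show ?thesis using x by (simp add: sm_add_right)
    qed
    have "norm2 A ((1/2) \<odot>\<^bsub>A\<^esub> (x \<oplus> x) \<ominus> pe ?p) = 1/2 * norm2 A ((x \<oplus> x) \<ominus> (pe q \<oplus> star A (pe q)))"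
      unfolding pe_hom(5) pe_hom(1) pe_hom(3) using x by (subst norm2_smult_diff) auto
    also have "\<dots> \<le> 1/2 * (norm2 A (x \<ominus> pe q) + norm2 A (star A x \<ominus> star A (pe q)))"
      using norm2_add_diff[of x x "pe q" "star A (pe q)"] x by simp
    also have "\<dots> = norm2 A (x \<ominus> pe q)" using norm2_star_diff[of x "pe q"] x(1) by simp
    finally have "norm2 A (x \<ominus> pe ?p) < \<iota> k" using q(2) unfolding 1 by simp
    moreover have "poly_star ?p = ?p" unfolding poly_star_const_mult poly_star_add poly_star_star by (simp add: add.commute)
    moreover have "?p \<in> ncpolys K" by (intro ncpolys_mult ncpolys_const ncpolys_add ncpolys_star q)
    ultimately show ?thesis by blast
  qed
  then obtain p where p: "\<And>k. p k \<in> ncpolys K" "\<And>k. poly_star (p k) = p k" "\<And>k. norm2 A (x \<ominus> pe (p k)) < \<iota> k"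
    by metis
  \<comment> \<open>The factor 4 allows \<open>2 * \<iota> t\<close> for the truncation and
    \<open>2 * \<iota> l\<close> for \<open>p t - p l\<close>.\<close>
  define G where "G = (\<lambda>t n z. z \<in> carrier_mat n n \<and> operator_norm z \<le> R0 \<and> (\<forall>l\<in>{..t}. mn2 n (z - pz n (p l)) < 4 * \<iota> l))"
  have "eventually (\<lambda>n. \<exists>z. G t n z) U" for t
  proof -
    have "\<forall>n. \<exists>V d. unitary_mat n V \<and> pz n (p t) = fcal n V d (\<lambda>t. t)"
      using hermitian_diagonalization[OF pz_closed[of _ "p t"]] pz_hom(3)[of _ "p t"] p(2) unfolding fcal_def by simp
    then obtain V d where V: "\<And>n. unitary_mat n (V n)" "\<And>n. pz n (p t) = fcal n (V n) (d n) (\<lambda>t. t)" by metis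
    define y where "y n = fcal n (V n) (d n) (\<lambda>t. max (- R0) (min R0 t))" for n
    have yc: "y n \<in> carrier_mat n n" for n unfolding y_def by (rule fcal_carrier[OF V(1)])
    have yn: "operator_norm (y n) \<le> R0" for n
      unfolding y_def by (rule operator_norm_fcal[OF V(1)]) (use R0 in auto)
    have "\<forall>\<^sub>F n in U. mn2 n (y n - pz n (p t)) < norm2 A (x \<ominus> pe (p t)) + \<iota> t"
      unfolding y_def by (rule clip_estimate[OF x R0(2,1) p(1,2) \<iota> V])
    moreover have "\<forall>\<^sub>F n in U. \<forall>l\<in>{..t}. mn2 n (pz n (p t - p l)) < 2 * \<iota> l"
    proof (rule eventually_ball_finite[OF finite_atMost], rule ballI)
      fix l assume "l \<in> {..t}"
      then have l: "\<iota> t \<le> \<iota> l" by (intro \<iota>_mono) auto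
      have "norm2 A (pe (p t - p l)) \<le> norm2 A (pe (p t) \<ominus> x) + norm2 A (x \<ominus> pe (p l))"
        unfolding pe_hom using x by (intro norm2_triangle) auto
      also have "\<dots> < 2 * \<iota> l" using p(3)[of t] p(3)[of l] l norm2_minus_commute[of x "pe (p t)"] x by simp
      finally show "\<forall>\<^sub>F n in U. mn2 n (pz n (p t - p l)) < 2 * \<iota> l"
        using norm2_pz[OF ncpolys_diff[OF p(1)[of t] p(1)[of l]]] by (intro order_tendstoD) auto
    qed
    ultimately show ?thesis
    proof eventually_elim
      case (elim n)
      have "mn2 n (y n - pz n (p l)) < 4 * \<iota> l" if l: "l \<in> {..t}" for l
      proof -
        have "mn2 n (y n - pz n (p l)) \<le> mn2 n (y n - pz n (p t)) + mn2 n (pz n (p t) - pz n (p l))"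
          by (rule mn2_triangle[OF yc pz_closed pz_closed])
        also have "mn2 n (pz n (p t) - pz n (p l)) < 2 * \<iota> l" using elim(2) l by (simp add: pz_hom)
        finally show ?thesis using elim(1) p(3)[of t] \<iota>_mono[of l t] l by simp
      qed
      then have "G t n (y n)" unfolding G_def using yc yn by blast
      then show ?case by blast
    qed
  qed
  note Gex = this
  have Gmono: "G t n z" if "t \<le> t'" "G t' n z" for t t' n z using that by (simp add: G_def)
  obtain z where z: "\<And>t. \<forall>\<^sub>F n in U. G t n (z n)"
  proof (rule ultrafilter_diagonal[where G = G, OF U Gex])
    fix t t' n z assume "t \<le> t'" "G t' n z"
    then show "G t n z" by (rule Gmono)
  qed (rule that)
  obtain C0 where C0: "C0 \<ge> 0" "\<And>n. operator_norm (0\<^sub>m n n :: complex mat) \<le> C0" using BS_carrierD(2)[OF BS_zero] by blast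
  \<comment> \<open>The bound holds on a set in \<open>U\<close>; zeros elsewhere make the sequence
    bounded at every coordinate without changing its class.\<close>
  define z' where "z' n = (if z n \<in> carrier_mat n n \<and> operator_norm (z n) \<le> R0 then z n else 0\<^sub>m n n)" for n
  have "operator_norm (z' n) \<le> max C0 R0" for n using C0(2)[of n] by (auto simp: z'_def)
  moreover have "z' n \<in> carrier_mat n n" for n by (simp add: z'_def)
  ultimately have BS: "z' \<in> carrier BS" by (rule BS_carrierI[rotated])
  have "apx z' x"
    unfolding apx_def
  proof (intro conjI allI impI BS x)
    fix e :: real assume "e > 0"
    then obtain l where l: "\<iota> l < e / 4" using nat_approx_posE[of "e / 4"] unfolding \<iota>_def by auto
    have "\<forall>\<^sub>F n in U. mn2 n (z' n - pz n (p l)) < e"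
      using z[of l]
    proof eventually_elim
      case (elim n)
      then have "z' n = z n" "mn2 n (z n - pz n (p l)) < 4 * \<iota> l" by (auto simp: G_def z'_def)
      then show ?case using l by simp
    qed
    moreover have "norm2 A (x \<ominus> pe (p l)) < e" using p(3)[of l] l \<open>e > 0\<close> \<iota>[of l] by linarith
    ultimately show "\<exists>p\<in>ncpolys K. norm2 A (x \<ominus> pe p) < e \<and> (\<forall>\<^sub>F n in U. mn2 n (z' n - pz n p) < e)"
      using p(1) by blast
  qed
  then show ?thesis by blast
qed

lemma apx_exists:
  assumes x: "x \<in> carrier A"
  shows "\<exists>z. apx z x"
proof -
  obtain a b where ab: "lv x = a + const_poly \<i> * b" "poly_star a = a" "poly_star b = b"
    using F.real_imaginary_parts[of "lv x"] by metis
  have s: "star A (ev a) = ev a" "star A (ev b) = ev b" using ev_star[of a] ev_star[of b] ab by auto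
  have xe: "x = ev a \<oplus> \<i> \<odot>\<^bsub>A\<^esub> ev b" using x ev_lv[of x] unfolding ab(1) by simp
  obtain z w where "apx z (ev a)" "apx w (ev b)" using apx_exists_sa s by (metis ev_closed)
  from apx_add[OF this(1) apx_smult[OF this(2), of \<i>]] show ?thesis unfolding xe by blast
qed

definition limit_embedding :: "'a \<Rightarrow> (nat \<Rightarrow> complex mat) set" where
  "limit_embedding x = cls U (SOME z. apx z x)"

lemma limit_embedding_eq: "apx z x \<Longrightarrow> limit_embedding x = cls U z"
  unfolding limit_embedding_def using apx_unique[OF someI[of "\<lambda>z. apx z x"]] by blast

lemma limit_embedding_cases:
  assumes "x \<in> carrier A"
  obtains z where "apx z x" "limit_embedding x = cls U z" "z \<in> carrier BS"
  using apx_exists[OF assms] limit_embedding_eq apxD(1) by blast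

lemma apx_one: "apx (\<lambda>n. 1\<^sub>m n) \<one>"
  using apx_poly[OF ncpolys_one] unfolding pz_hom pe_hom .

lemma limit_embedding: "embedding A (QQ U) limit_embedding"
  unfolding embedding_def
proof (intro conjI allI ballI ring_hom_memI)
  fix x y assume "x \<in> carrier A" "y \<in> carrier A"
  then obtain z w where z: "apx z x" "limit_embedding x = cls U z" "z \<in> carrier BS"
    and w: "apx w y" "limit_embedding y = cls U w" "w \<in> carrier BS" by (metis limit_embedding_cases)
  show "limit_embedding (x \<otimes> y) = limit_embedding x \<otimes>\<^bsub>QQ U\<^esub> limit_embedding y"
    unfolding z(2) w(2) cls_mult[OF z(3) w(3)] by (rule limit_embedding_eq[OF apx_mult[OF z(1) w(1)]])
  show "limit_embedding (x \<oplus> y) = limit_embedding x \<oplus>\<^bsub>QQ U\<^esub> limit_embedding y"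
    unfolding z(2) w(2) cls_add[OF z(3) w(3)] by (rule limit_embedding_eq[OF apx_add[OF z(1) w(1)]])
next
  fix x assume "x \<in> carrier A"
  then obtain z where z: "apx z x" "limit_embedding x = cls U z" "z \<in> carrier BS" by (rule limit_embedding_cases)
  show "limit_embedding x \<in> carrier (QQ U)" unfolding z(2) by (rule cls_closed[OF z(3)])
  show "limit_embedding (c \<odot>\<^bsub>A\<^esub> x) = c \<odot>\<^bsub>QQ U\<^esub> limit_embedding x" for c
    unfolding z(2) cls_smult[OF z(3)] by (rule limit_embedding_eq[OF apx_smult[OF z(1)]])
  show "limit_embedding (star A x) = star (QQ U) (limit_embedding x)"
    unfolding z(2) cls_star[OF z(3)] by (rule limit_embedding_eq[OF apx_star[OF z(1)]])
  show "tr (QQ U) (limit_embedding x) = tr A x"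
    unfolding z(2) by (rule cls_tr[OF Ub z(3) apx_tr[OF z(1)]])
next
  show "limit_embedding \<one> = \<one>\<^bsub>QQ U\<^esub>" unfolding cls_one by (rule limit_embedding_eq[OF apx_one])
qed

lemma limit_embedding_var:
  assumes "k \<in> K"
  shows "limit_embedding (X k) = cls U (\<lambda>n. Z n k)"
proof -
  have "apx (\<lambda>n. pz n (var_poly k)) (pe (var_poly k))" by (rule apx_poly) (use assms in simp)
  then show ?thesis using limit_embedding_eq
    by (simp add: eval_poly_var[where Z = X, OF X_closed] MA.eval_poly_var[where Z = "Z _", OF Zc])
qed

end

section \<open>Amplification\<close>

lemma sum_blocks: "(\<Sum>a<q * m. f a) = (\<Sum>p<q. \<Sum>e<(m::nat). f (p * m + e))"
proof (induction q)
  case (Suc q)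
  have "(\<Sum>a<Suc q * m. f a) = (\<Sum>a<q * m. f a) + (\<Sum>a=q * m..<q * m + m. f a)"
    by (simp add: add.commute sum.atLeastLessThan_concat lessThan_atLeast0)
  also have "(\<Sum>a=q * m..<q * m + m. f a) = (\<Sum>e<m. f (q * m + e))"
    using sum.shift_bounds_nat_ivl[of f 0 "q * m" m] by (simp add: lessThan_atLeast0 add.commute)
  finally show ?case using Suc by simp
qed simp

lemma sum_blocks_remainder:
  assumes "m > 0" "\<And>a. q * m \<le> a \<Longrightarrow> a < n \<Longrightarrow> f a = 0" "q * m \<le> n"
  shows "(\<Sum>a<n. f a) = (\<Sum>p<q. \<Sum>e<(m::nat). f (p * m + e))"
proof -
  have "(\<Sum>a<n. f a) = (\<Sum>a<q * m. f a)" using assms by (intro sum.mono_neutral_right) auto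
  then show ?thesis by (simp add: sum_blocks)
qed

text \<open>\<open>n div m\<close> diagonal copies of an \<open>m \<times> m\<close> matrix, followed by zeros.\<close>

definition amp :: "nat \<Rightarrow> nat \<Rightarrow> complex mat \<Rightarrow> complex mat" where
  "amp n m W = mat n n (\<lambda>(a, b). if a div m = b div m \<and> a div m < n div m then W $$ (a mod m, b mod m) else 0)"

lemma amp_carrier [simp, intro]: "amp n m W \<in> carrier_mat n n"
  by (simp add: amp_def)

lemma amp_dim [simp]: "dim_row (amp n m W) = n" "dim_col (amp n m W) = n"
  by (simp_all add: amp_def)

lemma index_amp: "a < n \<Longrightarrow> b < n \<Longrightarrow>
    amp n m W $$ (a, b) = (if a div m = b div m \<and> a div m < n div m then W $$ (a mod m, b mod m) else 0)"
  by (simp add: amp_def)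

lemma div_less_blocks: "0 < m \<Longrightarrow> a div m < q \<longleftrightarrow> a < q * (m::nat)"
  by (simp add: div_less_iff_less_mult)

lemma block_less: "p < n div m \<Longrightarrow> e < m \<Longrightarrow> p * m + e < (n::nat)"
proof -
  assume "p < n div m" "e < m"
  then have "p * m + e < Suc p * m" "Suc p * m \<le> n div m * m" by (simp, intro mult_right_mono) auto
  then show ?thesis using div_times_less_eq_dividend[of n m] by linarith
qed

lemma amp_mult:
  assumes m: "0 < m" and W: "W \<in> carrier_mat m m" "W' \<in> carrier_mat m m"
  shows "amp n m (W * W') = amp n m W * amp n m W'"
proof (intro eq_matI)
  fix a b assume ab: "a < dim_row (amp n m W * amp n m W')" "b < dim_col (amp n m W * amp n m W')"
  then have ab: "a < n" "b < n" by auto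
  let ?q = "n div m"
  have mm: "a mod m < m" "b mod m < m" using m by auto
  have "(amp n m W * amp n m W') $$ (a, b) = (\<Sum>c<n. amp n m W $$ (a, c) * amp n m W' $$ (c, b))"
    using ab by (simp add: scalar_prod_def lessThan_atLeast0)
  also have "\<dots> = (\<Sum>p<?q. \<Sum>e<m. amp n m W $$ (a, p * m + e) * amp n m W' $$ (p * m + e, b))"
  proof (rule sum_blocks_remainder[OF m])
    fix c assume "?q * m \<le> c" "c < n"
    then have "\<not> c div m < ?q" by (simp add: div_less_blocks[OF m])
    then show "amp n m W $$ (a, c) * amp n m W' $$ (c, b) = 0" using ab \<open>c < n\<close> by (simp add: index_amp)
  qed simp
  also have "\<dots> = (\<Sum>p<?q. if a div m = p then if a div m = b div m then (W * W') $$ (a mod m, b mod m) else 0 else 0)"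
  proof (intro sum.cong refl)
    fix p assume p: "p \<in> {..<?q}"
    have "amp n m W $$ (a, p * m + e) * amp n m W' $$ (p * m + e, b)
      = (if a div m = p \<and> p = b div m then W $$ (a mod m, e) * W' $$ (e, b mod m) else 0)" if "e < m" for e
      using that p ab block_less[of p n m e] by (simp add: index_amp)
    then have "(\<Sum>e<m. amp n m W $$ (a, p * m + e) * amp n m W' $$ (p * m + e, b))
      = (\<Sum>e<m. if a div m = p \<and> p = b div m then W $$ (a mod m, e) * W' $$ (e, b mod m) else 0)" by simp
    also have "\<dots> = (if a div m = p then if a div m = b div m then (W * W') $$ (a mod m, b mod m) else 0 else 0)"
      using W mm by (auto simp: scalar_prod_def lessThan_atLeast0)
    finally show "(\<Sum>e<m. amp n m W $$ (a, p * m + e) * amp n m W' $$ (p * m + e, b))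
      = (if a div m = p then if a div m = b div m then (W * W') $$ (a mod m, b mod m) else 0 else 0)" .
  qed
  also have "\<dots> = amp n m (W * W') $$ (a, b)" using ab by (simp add: index_amp)
  finally show "amp n m (W * W') $$ (a, b) = (amp n m W * amp n m W') $$ (a, b)" by simp
qed (use W in auto)

lemma amp_adjoint:
  assumes m: "0 < m" and W: "W \<in> carrier_mat m m"
  shows "amp n m (mat_adjoint W) = mat_adjoint (amp n m W)"
proof (intro eq_matI)
  fix a b assume "a < dim_row (mat_adjoint (amp n m W))" "b < dim_col (mat_adjoint (amp n m W))"
  then have ab: "a < n" "b < n" by auto
  have "a mod m < m" "b mod m < m" using m by auto
  then show "amp n m (mat_adjoint W) $$ (a, b) = mat_adjoint (amp n m W) $$ (a, b)"
    using ab W by (auto simp: index_amp)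
qed auto

lemma vec_norm2_square: "(vec_norm2 v)\<^sup>2 = (\<Sum>i<dim_vec v. (cmod (vec_index v i))\<^sup>2)"
  unfolding vec_norm2_L2 L2_set_def lessThan_atLeast0 by (intro real_sqrt_pow2 sum_nonneg) auto

text \<open>The matrix acts by \<open>W\<close> on each consecutive segment \<open>vb p\<close> of
  length \<open>m\<close> and annihilates the remaining coordinates, so squared norms add up over
  the segments.\<close>

lemma operator_norm_amp:
  assumes m: "0 < m" and W: "W \<in> carrier_mat m m"
  shows "operator_norm (amp n m W) \<le> operator_norm W"
proof (rule operator_norm_le[OF amp_carrier operator_norm_nonneg[OF W]])
  fix v :: "complex vec" assume v: "v \<in> carrier_vec n"
  let ?q = "n div m"
  define vb where "vb p = vec m (\<lambda>e. vec_index v (p * m + e))" for p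
  have vb: "vb p \<in> carrier_vec m" for p by (simp add: vb_def)
  have ent: "vec_index (amp n m W *\<^sub>v v) (p * m + e) = vec_index (W *\<^sub>v vb p) e" if p: "p < ?q" "e < m" for p e
  proof -
    have "vec_index (amp n m W *\<^sub>v v) (p * m + e) = (\<Sum>c<n. amp n m W $$ (p * m + e, c) * vec_index v c)"
      using v block_less[OF p] by (simp add: scalar_prod_def lessThan_atLeast0)
    also have "\<dots> = (\<Sum>p'<?q. \<Sum>e'<m. amp n m W $$ (p * m + e, p' * m + e') * vec_index v (p' * m + e'))"
    proof (rule sum_blocks_remainder[OF m])
      fix c assume "?q * m \<le> c" "c < n"
      then have "\<not> c div m < ?q" by (simp add: div_less_blocks[OF m])
      then show "amp n m W $$ (p * m + e, c) * vec_index v c = 0" using p block_less[OF p] \<open>c < n\<close> by (auto simp: index_amp)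
    qed simp
    also have "\<dots> = (\<Sum>p'<?q. if p = p' then \<Sum>e'<m. W $$ (e, e') * vec_index (vb p) e' else 0)"
    proof (intro sum.cong refl)
      fix p' assume p': "p' \<in> {..<?q}"
      have "amp n m W $$ (p * m + e, p' * m + e') = (if p = p' then W $$ (e, e') else 0)" if "e' < m" for e'
        using that p p' block_less[OF p] block_less[of p' n m e'] by (simp add: index_amp)
      then show "(\<Sum>e'<m. amp n m W $$ (p * m + e, p' * m + e') * vec_index v (p' * m + e'))
        = (if p = p' then \<Sum>e'<m. W $$ (e, e') * vec_index (vb p) e' else 0)" by (simp add: vb_def)
    qed
    also have "\<dots> = vec_index (W *\<^sub>v vb p) e" using p W by (simp add: scalar_prod_def lessThan_atLeast0 vb_def)
    finally show ?thesis .
  qed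
  have "(vec_norm2 (amp n m W *\<^sub>v v))\<^sup>2 = (\<Sum>c<n. (cmod (vec_index (amp n m W *\<^sub>v v) c))\<^sup>2)"
    by (simp add: vec_norm2_square)
  also have "\<dots> = (\<Sum>p<?q. \<Sum>e<m. (cmod (vec_index (amp n m W *\<^sub>v v) (p * m + e)))\<^sup>2)"
  proof (rule sum_blocks_remainder[OF m])
    fix c assume "?q * m \<le> c" "c < n"
    then have "\<not> c div m < ?q" by (simp add: div_less_blocks[OF m])
    then have "amp n m W $$ (c, b) = 0" if "b < n" for b using that \<open>c < n\<close> by (simp add: index_amp)
    then have "vec_index (amp n m W *\<^sub>v v) c = 0" using v \<open>c < n\<close> by (simp add: scalar_prod_def)
    then show "(cmod (vec_index (amp n m W *\<^sub>v v) c))\<^sup>2 = 0" by simp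
  qed simp
  also have "\<dots> = (\<Sum>p<?q. (vec_norm2 (W *\<^sub>v vb p))\<^sup>2)"
    using W by (simp add: ent vec_norm2_square)
  also have "\<dots> \<le> (\<Sum>p<?q. (operator_norm W * vec_norm2 (vb p))\<^sup>2)"
    by (intro sum_mono power_mono operator_norm_bound[OF W vb] vec_norm2_nonneg)
  also have "\<dots> = (operator_norm W)\<^sup>2 * (\<Sum>p<?q. \<Sum>e<m. (cmod (vec_index v (p * m + e)))\<^sup>2)"
    by (simp add: power_mult_distrib sum_distrib_left vec_norm2_square vb_def)
  also have "\<dots> = (operator_norm W)\<^sup>2 * (\<Sum>c<?q * m. (cmod (vec_index v c))\<^sup>2)"
    by (simp add: sum_blocks)
  also have "\<dots> \<le> (operator_norm W)\<^sup>2 * (\<Sum>c<n. (cmod (vec_index v c))\<^sup>2)"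
    by (intro mult_left_mono sum_mono2) (auto intro: order.strict_trans2[OF _ div_times_less_eq_dividend])
  also have "\<dots> = (operator_norm W * vec_norm2 v)\<^sup>2" using v by (simp add: power_mult_distrib vec_norm2_square)
  finally show "vec_norm2 (amp n m W *\<^sub>v v) \<le> operator_norm W * vec_norm2 v"
    by (rule power2_le_imp_le) (intro mult_nonneg_nonneg operator_norm_nonneg[OF W] vec_norm2_nonneg)
qed

lemma tr_amp:
  assumes m: "0 < m" and W: "W \<in> carrier_mat m m"
  shows "tr (mat_alg n) (amp n m W) = complex_of_real (real (n div m * m) / real n) * tr (mat_alg m) W"
proof -
  let ?q = "n div m"
  have "(\<Sum>a<n. amp n m W $$ (a, a)) = (\<Sum>p<?q. \<Sum>e<m. amp n m W $$ (p * m + e, p * m + e))"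
  proof (rule sum_blocks_remainder[OF m])
    fix c assume "?q * m \<le> c" "c < n"
    then have "\<not> c div m < ?q" by (simp add: div_less_blocks[OF m])
    then show "amp n m W $$ (c, c) = 0" using \<open>c < n\<close> by (simp add: index_amp)
  qed simp
  also have "\<dots> = (\<Sum>p<?q. \<Sum>e<m. W $$ (e, e))"
    using block_less[of _ n m] by (intro sum.cong refl) (simp add: index_amp)
  finally show ?thesis using m by (simp add: field_simps)
qed

text \<open>The empty word is excluded because amplification with a zero tail is multiplicative but
  not unital.\<close>

lemma eval_word_amp:
  assumes m: "0 < m" and Z: "\<And>k. Z k \<in> carrier_mat m m" and w: "w \<noteq> []"
  shows "eval_word (mat_alg n) (\<lambda>k. amp n m (Z k)) w = amp n m (eval_word (mat_alg m) Z w)"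
  using w
proof (induction w)
  case (Cons a w)
  define B where "B = (if snd a then mat_adjoint (Z (fst a)) else Z (fst a))"
  have B: "B \<in> carrier_mat m m" using Z by (simp add: B_def)
  have aB: "(if snd a then mat_adjoint (amp n m (Z (fst a))) else amp n m (Z (fst a))) = amp n m B"
    by (simp add: B_def amp_adjoint[OF m Z])
  have ew: "eval_word (mat_alg m) Z w \<in> carrier_mat m m" using MA.eval_word_closed[of Z m w] Z by simp
  have c: "eval_word (mat_alg l) Y (a # w) = (if snd a then mat_adjoint (Y (fst a)) else Y (fst a)) * eval_word (mat_alg l) Y w" for l Y
    by (simp add: eval_word_def case_prod_beta)
  show ?case
  proof (cases "w = []")
    case True
    then show ?thesis unfolding c aB B_def[symmetric] using B by (simp add: eval_word_def)
  next
    case False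
    show ?thesis unfolding c aB B_def[symmetric] Cons.IH[OF False] amp_mult[OF m B ew] ..
  qed
qed simp

lemma amp_commutes_block_diagonal:
  fixes f :: "nat \<Rightarrow> real"
  shows "amp n m W * diag_real n (\<lambda>a. f (a div m)) = diag_real n (\<lambda>a. f (a div m)) * amp n m W"
proof (intro eq_matI)
  fix a b assume "a < dim_row (diag_real n (\<lambda>a. f (a div m)) * amp n m W)" "b < dim_col (diag_real n (\<lambda>a. f (a div m)) * amp n m W)"
  then have ab: "a < n" "b < n" by (auto simp: diag_real_def)
  show "(amp n m W * diag_real n (\<lambda>a. f (a div m))) $$ (a, b) = (diag_real n (\<lambda>a. f (a div m)) * amp n m W) $$ (a, b)"
    unfolding index_diag_mult_left[OF amp_carrier ab] index_diag_mult_right[OF amp_carrier ab] using ab by (auto simp: index_amp)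
qed (auto simp: diag_real_def)

text \<open>Complete periods have exactly the mean of one period. The incomplete last period, and
  the share of the mean it ought to have, are each at most \<open>P * H\<close>.\<close>

lemma periodic_sum:
  fixes f :: "nat \<Rightarrow> real"
  assumes P: "0 < P" and per: "\<And>a. f (a mod P) = f a" and H: "\<And>a. \<bar>f a\<bar> \<le> H"
  shows "\<bar>(\<Sum>a<n. f a) - real n * ((\<Sum>a<P. f a) / real P)\<bar> \<le> 2 * real P * H"
proof -
  define q s S where "q = n div P" and "s = n mod P" and "S = (\<Sum>a<P. f a)"
  have n: "n = q * P + s" and s: "s < P" using P by (auto simp: q_def s_def)
  have fp: "f (p * P + e) = f e" for p e using per[of "p * P + e"] per[of e] by simp
  have split: "(\<Sum>a<l + s. g a) = (\<Sum>a<l. g a) + (\<Sum>a<s. g (l + a))" for l and g :: "nat \<Rightarrow> real"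
    by (induction s) auto
  have e: "(\<Sum>a<n. f a) = real q * S + (\<Sum>a<s. f a)"
    unfolding n split sum_blocks by (simp add: fp S_def)
  have S: "\<bar>S\<bar> \<le> real P * H" unfolding S_def using sum_norm_bound[of "{..<P}" f H] H by simp
  have H0: "0 \<le> H" using H[of 0] by linarith
  have "\<bar>\<Sum>a<s. f a\<bar> \<le> real s * H" using sum_norm_bound[of "{..<s}" f H] H by simp
  also have "\<dots> \<le> real P * H" using s H0 by (intro mult_right_mono) auto
  finally have 1: "\<bar>\<Sum>a<s. f a\<bar> \<le> real P * H" .
  have "\<bar>real s * (S / real P)\<bar> = real s / real P * \<bar>S\<bar>" by (simp add: abs_mult)
  also have "\<dots> \<le> 1 * \<bar>S\<bar>" using s by (intro mult_right_mono) auto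
  finally have 2: "\<bar>real s * (S / real P)\<bar> \<le> real P * H" using S by simp
  have "real n * (S / real P) = real q * S + real s * (S / real P)" using P unfolding n by (simp add: distrib_right field_simps)
  then have "(\<Sum>a<n. f a) - real n * (S / real P) = (\<Sum>a<s. f a) - real s * (S / real P)" unfolding e by simp
  then have "\<bar>(\<Sum>a<n. f a) - real n * (S / real P)\<bar> \<le> \<bar>\<Sum>a<s. f a\<bar> + \<bar>real s * (S / real P)\<bar>"
    by (simp only: abs_triangle_ineq4)
  also have "\<dots> \<le> real P * H + real P * H" using 1 2 by (rule add_mono)
  also have "\<dots> = 2 * real P * H" by simp
  finally show ?thesis unfolding S_def .
qed

text \<open>Block numbers modulo \<open>k\<close> are equidistributed up to an error of order
  \<open>m / n\<close>. For \<open>h c = c ^ j\<close> the means are the moments of the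
  block-constant operator that commutes with the amplification.\<close>

lemma block_mean:
  fixes h :: "nat \<Rightarrow> real"
  assumes m: "0 < m" and k: "0 < k" and n: "0 < n" and H: "\<And>c. c < k \<Longrightarrow> \<bar>h c\<bar> \<le> H"
  shows "\<bar>(\<Sum>a<n. h ((a div m) mod k)) / real n - (\<Sum>c<k. h c) / real k\<bar> \<le> 2 * real k * H * (real m / real n)"
proof -
  let ?f = "\<lambda>a. h ((a div m) mod k)"
  have per: "?f (a mod (k * m)) = ?f a" for a
  proof -
    have "a mod (k * m) div m = a div m mod k" using m by (simp add: mult.commute[of k] mod_mult2_eq)
    then show ?thesis by simp
  qed
  have f: "\<bar>?f a\<bar> \<le> H" for a using H k by simp
  have "(\<Sum>a<k * m. ?f a) = (\<Sum>p<k. \<Sum>e<m. h p)" unfolding sum_blocks by (intro sum.cong refl) simp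
  then have "(\<Sum>a<k * m. ?f a) / real (k * m) = (\<Sum>c<k. h c) / real k" using m by (simp add: sum_distrib_left[symmetric])
  then have b: "\<bar>(\<Sum>a<n. ?f a) - real n * ((\<Sum>c<k. h c) / real k)\<bar> \<le> 2 * real (k * m) * H"
    using periodic_sum[where P = "k * m" and f = ?f and H = H and n = n, OF _ per f] m k by simp
  have "(\<Sum>a<n. ?f a) / real n - (\<Sum>c<k. h c) / real k = ((\<Sum>a<n. ?f a) - real n * ((\<Sum>c<k. h c) / real k)) / real n"
    using n by (simp add: diff_divide_distrib)
  then have "\<bar>(\<Sum>a<n. ?f a) / real n - (\<Sum>c<k. h c) / real k\<bar> = \<bar>(\<Sum>a<n. ?f a) - real n * ((\<Sum>c<k. h c) / real k)\<bar> / real n"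
    by (simp only: abs_divide abs_of_nat)
  also have "\<dots> \<le> 2 * real (k * m) * H / real n" using b by (rule divide_right_mono) simp
  finally show ?thesis by (simp add: mult_ac)
qed

section \<open>Sparsity from an almost commuting operator\<close>

text \<open>Binomial expansion of \<open>g (x - y)\<close> turns the average over pairs into a
  polynomial in the moments. The expansion holds for any finite list of reals, so it serves both the
  eigenvalues and the points \<open>0, ..., k - 1\<close>.\<close>

lemma tendsto_eigenvalue_differences:
  fixes d :: "nat \<Rightarrow> nat \<Rightarrow> real"
  assumes g: "real_polynomial_function g"
    and mom: "\<And>j. ((\<lambda>n. (\<Sum>i<n. d n i ^ j) / real n) \<longlongrightarrow> (\<Sum>c<k. real c ^ j) / real k) U"
  shows "((\<lambda>n. (\<Sum>a<n. \<Sum>b<n. g (d n a - d n b)) / (real n)\<^sup>2)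
    \<longlongrightarrow> (\<Sum>a<k. \<Sum>b<k. g (real a - real b)) / (real k)\<^sup>2) U"
proof -
  obtain a N where g: "g = (\<lambda>x. \<Sum>i\<le>(N::nat). a i * x ^ i)" using g by (auto simp: real_polynomial_function_iff_sum)
  have expand: "(\<Sum>x<l. \<Sum>y<l. g (e x - e y)) / (real l)\<^sup>2
    = (\<Sum>i\<le>N. a i * (\<Sum>j\<le>i. (of_nat (i choose j) * (- 1) ^ (i - j)) * (((\<Sum>x<l. e x ^ j) / real l) * ((\<Sum>y<l. e y ^ (i - j)) / real l))))"
    for l and e :: "nat \<Rightarrow> real"
  proof -
    have "g (x - y) = (\<Sum>i\<le>N. a i * (\<Sum>j\<le>i. (of_nat (i choose j) * (- 1) ^ (i - j)) * (x ^ j * y ^ (i - j))))" for x y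
      unfolding g diff_conv_add_uminus binomial_ring
      by (simp add: power_minus[of y] mult_ac)
    then have "(\<Sum>x<l. \<Sum>y<l. g (e x - e y)) = (\<Sum>x<l. \<Sum>y<l. \<Sum>i\<le>N. \<Sum>j\<le>i. a i * (of_nat (i choose j) * (- 1) ^ (i - j)) * (e x ^ j * e y ^ (i - j)))"
      by (simp only: sum_distrib_left mult.assoc)
    also have "\<dots> = (\<Sum>i\<le>N. \<Sum>j\<le>i. \<Sum>x<l. \<Sum>y<l. a i * (of_nat (i choose j) * (- 1) ^ (i - j)) * (e x ^ j * e y ^ (i - j)))"
    proof -
      have "(\<Sum>x<l. \<Sum>y<l. \<Sum>i\<le>N. \<Sum>j\<le>i. H x y i j) = (\<Sum>i\<le>N. \<Sum>j\<le>i. \<Sum>x<l. \<Sum>y<l. H x y i j)" for H :: "nat \<Rightarrow> nat \<Rightarrow> nat \<Rightarrow> nat \<Rightarrow> real"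
      proof -
        have "(\<Sum>x<l. \<Sum>y<l. \<Sum>i\<le>N. \<Sum>j\<le>i. H x y i j) = (\<Sum>x<l. \<Sum>i\<le>N. \<Sum>y<l. \<Sum>j\<le>i. H x y i j)"
          by (intro sum.cong refl sum.swap)
        also have "\<dots> = (\<Sum>i\<le>N. \<Sum>x<l. \<Sum>y<l. \<Sum>j\<le>i. H x y i j)" by (rule sum.swap)
        also have "\<dots> = (\<Sum>i\<le>N. \<Sum>x<l. \<Sum>j\<le>i. \<Sum>y<l. H x y i j)" by (intro sum.cong refl sum.swap)
        also have "\<dots> = (\<Sum>i\<le>N. \<Sum>j\<le>i. \<Sum>x<l. \<Sum>y<l. H x y i j)" by (intro sum.cong refl sum.swap)
        finally show ?thesis .
      qed
      then show ?thesis .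
    qed
    also have "\<dots> = (\<Sum>i\<le>N. a i * (\<Sum>j\<le>i. (of_nat (i choose j) * (- 1) ^ (i - j)) * ((\<Sum>x<l. e x ^ j) * (\<Sum>y<l. e y ^ (i - j)))))"
      unfolding sum_product by (simp only: sum_distrib_left mult.assoc)
    finally have "(\<Sum>x<l. \<Sum>y<l. g (e x - e y)) / (real l)\<^sup>2 = \<dots> / (real l)\<^sup>2" by simp
    also have "\<dots> = (\<Sum>i\<le>N. a i * (\<Sum>j\<le>i. (of_nat (i choose j) * (- 1) ^ (i - j)) * (((\<Sum>x<l. e x ^ j) * (\<Sum>y<l. e y ^ (i - j))) / (real l)\<^sup>2)))"
      by (simp only: sum_divide_distrib times_divide_eq_right[symmetric])
    also have "\<dots> = (\<Sum>i\<le>N. a i * (\<Sum>j\<le>i. (of_nat (i choose j) * (- 1) ^ (i - j)) * (((\<Sum>x<l. e x ^ j) / real l) * ((\<Sum>y<l. e y ^ (i - j)) / real l))))"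
      by (simp only: power2_eq_square times_divide_times_eq)
    finally show ?thesis .
  qed
  show ?thesis unfolding expand
    by (intro tendsto_sum tendsto_mult tendsto_const mom)
qed

lemma one_half_le: "1 / 2 \<le> (1 :: real)"
  by simp

text \<open>Vanishes at the nonzero differences of the points \<open>0, \<dots>, k - 1\<close>.\<close>

definition diff_poly :: "nat \<Rightarrow> real \<Rightarrow> real" where
  "diff_poly k t = (\<Prod>j\<in>{1..<k}. (1 - (1 / real j)\<^sup>2 * t\<^sup>2)\<^sup>2)"

text \<open>At a difference of distinct points the factor with index the distance vanishes, so of
  the \<open>k\<^sup>2\<close> pairs only the \<open>k\<close> diagonal ones contribute, each with
  value 1. Squaring the factors makes the polynomial nonnegative, as a Markov type count of nearly
  equal eigenvalues requires; continuity at 0 gives the lower bound 1/2.\<close>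

lemma diff_poly:
  "real_polynomial_function (diff_poly k)" "0 \<le> diff_poly k t"
  "0 < k \<Longrightarrow> (\<Sum>a<k. \<Sum>b<k. diff_poly k (real a - real b)) / (real k)\<^sup>2 = 1 / real k"
  "\<exists>\<eta>>0. \<forall>t. \<bar>t\<bar> < \<eta> \<longrightarrow> 1 / 2 \<le> diff_poly k t"
proof -
  define g where "g = diff_poly k"
  have g_def: "g = (\<lambda>t. \<Prod>j\<in>{1..<k}. (1 - (1 / real j)\<^sup>2 * t\<^sup>2)\<^sup>2)" unfolding g_def by (rule ext) (rule diff_poly_def)
  have dp: "diff_poly k = g" unfolding g_def by (rule ext) (rule diff_poly_def)
  have lin: "real_polynomial_function (\<lambda>t::real. t)" by (rule real_polynomial_function.intros(1)) (rule bounded_linear_ident)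
  show "real_polynomial_function (diff_poly k)" unfolding dp g_def diff_conv_add_uminus power2_eq_square mult_minus_left[symmetric]
    by (intro real_polynomial_function_prod real_polynomial_function.intros(2-4) lin finite_atLeastLessThan)
  show "0 \<le> diff_poly k t" unfolding dp g_def by (intro prod_nonneg) auto
  have g0: "g 0 = 1" by (simp add: g_def)
  have gz: "g (real a - real b) = (if a = b then 1 else 0)" if ab: "a < k" "b < k" for a b
  proof (cases "a = b")
    case False
    define j where "j = (if a < b then b - a else a - b)"
    have j: "j \<in> {1..<k}" using False ab by (auto simp: j_def)
    have "(real a - real b)\<^sup>2 = (real j)\<^sup>2"
      by (cases "a < b") (auto simp: j_def of_nat_diff power2_commute)
    then have "(1 - (1 / real j)\<^sup>2 * (real a - real b)\<^sup>2)\<^sup>2 = 0" using j by (simp add: power_divide)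
    then have "\<exists>j\<in>{1..<k}. (1 - (1 / real j)\<^sup>2 * (real a - real b)\<^sup>2)\<^sup>2 = 0" using j by blast
    then have "g (real a - real b) = 0" unfolding g_def by (intro iffD2[OF prod_zero_iff]) auto
    then show ?thesis using False by simp
  qed (simp add: g0)
  show "(\<Sum>a<k. \<Sum>b<k. diff_poly k (real a - real b)) / (real k)\<^sup>2 = 1 / real k" if "0 < k"
    unfolding dp using that by (simp add: gz power2_eq_square)
  have "isCont g 0" unfolding g_def by (intro continuous_intros)
  then have "eventually (\<lambda>t. 1 / 2 < g t) (at 0)" unfolding isCont_def g0 by (rule order_tendstoD) simp
  then obtain \<eta> where "\<eta> > 0" "\<And>t. t \<noteq> 0 \<Longrightarrow> dist t 0 < \<eta> \<Longrightarrow> 1 / 2 < g t" unfolding eventually_at by auto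
  then have "\<forall>t. \<bar>t\<bar> < \<eta> \<longrightarrow> 1 / 2 \<le> g t"     using g0 by (metis (no_types, opaque_lifting) dist_norm diff_zero less_imp_le real_norm_def one_half_le)
  with \<open>\<eta> > 0\<close> show "\<exists>\<eta>>0. \<forall>t. \<bar>t\<bar> < \<eta> \<longrightarrow> 1 / 2 \<le> diff_poly k t" unfolding dp by blast
qed

text \<open>An almost commuting self-adjoint operator whose spectral measure is spread evenly over \<open>k\<close>
  points makes the entries of \<open>Z\<close> in its eigenbasis negligible away from the \<open>n\<^sup>2 / k\<close> positions
  joining nearly equal eigenvalues.\<close>

lemma eventually_sparse:
  assumes U: "free_ultrafilter U" and F: "finite F" and \<epsilon>: "0 < \<epsilon>" and c: "0 < c" "4 / c \<le> real k"
    and V: "\<And>n. unitary_mat n (V n)"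
    and Z: "\<And>n i. Z n i \<in> carrier_mat n n"
    and mom: "\<And>j. ((\<lambda>n. (\<Sum>i<n. d n i ^ j) / real n) \<longlongrightarrow> (\<Sum>c<k. real c ^ j) / real k) U"
    and comm: "\<And>i. i \<in> F \<Longrightarrow> ((\<lambda>n. mn2 n (fcal n (V n) (d n) (\<lambda>t. t) * Z n i - Z n i * fcal n (V n) (d n) (\<lambda>t. t))) \<longlongrightarrow> 0) U"
  shows "\<forall>\<^sub>F n in U. sparse_tuple n F c \<epsilon> (Z n)"
proof -
  have "0 < 4 / c" using c by simp
  then have "0 < real k" using c(2) by linarith
  then have k: "0 < k" by simp
  define g where "g = diff_poly k"
  note g = diff_poly[of k, folded g_def]
  obtain \<eta> where \<eta>: "\<eta> > 0" "\<And>t. \<bar>t\<bar> < \<eta> \<Longrightarrow> 1 / 2 \<le> g t" using g(4) by blast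
  have lim: "((\<lambda>n. (\<Sum>a<n. \<Sum>b<n. g (d n a - d n b)) / (real n)\<^sup>2) \<longlongrightarrow> 1 / real k) U"
    using tendsto_eigenvalue_differences[OF g(1) mom] unfolding g(3)[OF k] .
  have "4 \<le> real k * c" using c by (simp add: divide_le_eq)
  \<comment> \<open>Pairs with difference below \<open>\<eta>\<close> have
    \<open>g \<ge> 1/2\<close>, so their proportion is at most twice the mean of \<open>g\<close>.
    To keep it below \<open>c\<close> the mean must be below \<open>c / 2\<close>, and its limit is
    \<open>1 / k \<le> c / 4\<close>.\<close>
  then have "1 / real k < c / 2" using k by (simp add: divide_less_eq mult.commute)
  then have "\<forall>\<^sub>F n in U. (\<Sum>a<n. \<Sum>b<n. g (d n a - d n b)) / (real n)\<^sup>2 < c / 2"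
    using lim by (intro order_tendstoD) auto
  \<comment> \<open>Away from nearly equal eigenvalues the commutator is at least
    \<open>\<eta>\<close> times the entry, whence this tolerance for a tail of size
    \<open>\<epsilon>\<close>.\<close>
  moreover have "\<forall>\<^sub>F n in U. \<forall>i\<in>F. mn2 n (fcal n (V n) (d n) (\<lambda>t. t) * Z n i - Z n i * fcal n (V n) (d n) (\<lambda>t. t)) < \<eta> * \<epsilon>"
    using F by (rule eventually_ball_finite) (use comm \<eta> \<epsilon> in \<open>auto intro!: order_tendstoD\<close>)
  moreover have "\<forall>\<^sub>F n in U. n \<ge> 1" by (rule free_ultrafilter_ge[OF U])
  ultimately show ?thesis
  proof eventually_elim
    case (elim n)
    then have n: "0 < n" by simp
    define S where "S = {p \<in> {..<n} \<times> {..<n}. \<bar>d n (fst p) - d n (snd p)\<bar> < \<eta>}"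
    have fS: "finite S" "S \<subseteq> {..<n} \<times> {..<n}" unfolding S_def by (rule finite_subset[of _ "{..<n} \<times> {..<n}"]) auto
    have "real (card S) * (1 / 2) = (\<Sum>p\<in>S. 1 / 2)" by simp
    also have "\<dots> \<le> (\<Sum>p\<in>S. g (d n (fst p) - d n (snd p)))" 
    proof (rule sum_mono)
      fix p assume "p \<in> S"
      then show "1 / 2 \<le> g (d n (fst p) - d n (snd p))" by (intro \<eta>(2)) (simp add: S_def)
    qed
    also have "\<dots> \<le> (\<Sum>p\<in>{..<n} \<times> {..<n}. g (d n (fst p) - d n (snd p)))" using fS g(2) by (intro sum_mono2) auto
    also have "\<dots> = (\<Sum>a<n. \<Sum>b<n. g (d n a - d n b))" by (simp add: sum.cartesian_product case_prod_beta)
    also have "\<dots> \<le> c / 2 * (real n)\<^sup>2" using elim(1) n by (simp add: divide_less_eq)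
    finally have card: "real (card S) \<le> c * (real n)\<^sup>2" by simp
    have "(\<Sum>p\<in>{..<n} \<times> {..<n} - S. (cmod ((mat_adjoint (V n) * Z n i * V n) $$ p))\<^sup>2) \<le> \<epsilon>\<^sup>2 * real n" if i: "i \<in> F" for i
    proof -
      let ?E = "\<lambda>p. (cmod ((mat_adjoint (V n) * Z n i * V n) $$ p))\<^sup>2"
      let ?W = "\<Sum>p\<in>{..<n} \<times> {..<n}. (d n (fst p) - d n (snd p))\<^sup>2 * ?E p"
      have "\<eta>\<^sup>2 * (\<Sum>p\<in>{..<n} \<times> {..<n} - S. ?E p) = (\<Sum>p\<in>{..<n} \<times> {..<n} - S. \<eta>\<^sup>2 * ?E p)" by (rule sum_distrib_left)
      also have "\<dots> \<le> (\<Sum>p\<in>{..<n} \<times> {..<n} - S. (d n (fst p) - d n (snd p))\<^sup>2 * ?E p)"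
      proof (intro sum_mono mult_right_mono)
        fix p assume "p \<in> {..<n} \<times> {..<n} - S"
        then have "\<eta> \<le> \<bar>d n (fst p) - d n (snd p)\<bar>" by (auto simp: S_def)
        then have "\<eta>\<^sup>2 \<le> \<bar>d n (fst p) - d n (snd p)\<bar>\<^sup>2" using \<eta>(1) by (intro power_mono) auto
        then show "\<eta>\<^sup>2 \<le> (d n (fst p) - d n (snd p))\<^sup>2" by simp
      qed simp
      also have "\<dots> \<le> ?W" by (rule sum_mono2) auto
      finally have 1: "\<eta>\<^sup>2 * (\<Sum>p\<in>{..<n} \<times> {..<n} - S. ?E p) \<le> ?W" .
      have "sqrt (?W / real n) < \<eta> * \<epsilon>" using elim(2) i unfolding commutator_norm2[OF V Z] by blast
      then have "?W / real n < (\<eta> * \<epsilon>)\<^sup>2" using \<eta>(1) \<epsilon> by (simp only: real_sqrt_less_iff[symmetric, of _ "(\<eta> * \<epsilon>)\<^sup>2"] real_sqrt_abs abs_of_nonneg mult_nonneg_nonneg less_imp_le)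
      then have "?W < \<eta>\<^sup>2 * (\<epsilon>\<^sup>2 * real n)" using n by (simp add: divide_less_eq power_mult_distrib mult_ac)
      with 1 have "\<eta>\<^sup>2 * (\<Sum>p\<in>{..<n} \<times> {..<n} - S. ?E p) \<le> \<eta>\<^sup>2 * (\<epsilon>\<^sup>2 * real n)" by linarith
      then show ?thesis by (rule mult_left_le_imp_le) (use \<eta> in simp)
    qed
    with card fS(2) V[of n] show ?case unfolding sparse_tuple_def by blast
  qed
qed

lemma tendsto_cls_tr:
  assumes U: "free_ultrafilter U" and z: "z \<in> carrier BS"
  shows "((\<lambda>n. tr (mat_alg n) (z n)) \<longlongrightarrow> tr (QQ U) (cls U z)) U"
proof -
  obtain t where t: "((\<lambda>n. tr (mat_alg n) (z n)) \<longlongrightarrow> t) U" by (rule tr_limit_exists[OF U z])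
  with cls_tr[OF free_ultrafilter_bot[OF U] z t] show ?thesis by simp
qed

text \<open>The image of a self-adjoint class has a representative that is self-adjoint modulo null
  sequences; its real part is an exact one, which can be diagonalised at every coordinate.\<close>

lemma automorphism_selfadjoint_lift:
  assumes \<theta>: "automorphism (QQ U) \<theta>" and T: "T \<in> carrier BS" "\<And>n. mat_adjoint (T n) = T n"
  obtains S where "S \<in> carrier BS" "\<And>n. mat_adjoint (S n) = S n" "\<theta> (cls U T) = cls U S"
proof -
  have e: "embedding (QQ U) (QQ U) \<theta>" using \<theta> by (simp add: automorphism_def)
  then have "\<theta> (cls U T) \<in> carrier (QQ U)" using cls_closed[OF T(1), of U] ring_hom_closed[of \<theta> "QQ U" "QQ U" "cls U T"]
    by (simp add: embedding_def)
  then obtain S' where S': "S' \<in> carrier BS" "\<theta> (cls U T) = cls U S'" using carrier_QQ by blast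
  have "star (QQ U) (cls U T) = cls U T" unfolding cls_star[OF T(1)] T(2) by simp
  then have "cls U (\<lambda>n. mat_adjoint (S' n)) = cls U S'"
    using e cls_closed[OF T(1)] unfolding cls_star[OF S'(1), symmetric] S'(2)[symmetric] by (metis embedding_def)
  then have null: "((\<lambda>n. mn2 n (mat_adjoint (S' n) - S' n)) \<longlongrightarrow> 0) U"
    using cls_eq_iff[OF S'(1) BS_adjoint[OF S'(1)]] by simp
  define S where "S n = (1/2) \<cdot>\<^sub>m (S' n + mat_adjoint (S' n))" for n
  have S: "S \<in> carrier BS" unfolding S_def by (rule BS_smult[OF BS_add[OF S'(1) BS_adjoint[OF S'(1)]]])
  note c = BS_carrierD(1)[OF S'(1)]
  have "S n - S' n = (1/2) \<cdot>\<^sub>m (mat_adjoint (S' n) - S' n)" for n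
    unfolding S_def using c[of n] by (intro eq_matI) (auto simp: field_simps)
  then have half: "mn2 n (S n - S' n) = 1/2 * mn2 n (mat_adjoint (S' n) - S' n)" for n
    using mn2_smult[OF minus_carrier_mat[OF c], of n] by simp
  have "((\<lambda>n. mn2 n (S n - S' n)) \<longlongrightarrow> 0) U"
    using tendsto_mult_left[OF null, of "1/2"] unfolding half mult_zero_right .
  then have "cls U S = cls U S'" using cls_eq_iff[OF S'(1) S] by simp
  moreover have "mat_adjoint (S n) = S n" for n
    unfolding S_def using c[of n] by (simp add: mat_adjoint_smult mat_adjoint_add[of _ n n] comm_add_mat[of _ n n])
  ultimately show ?thesis using that S S'(2) by metis
qed

text \<open>The automorphism carries the diagonal operator to a class with the same moments that
  commutes with the class of \<open>Z\<close>. For a self-adjoint lift \<open>S\<close> this means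
  that its eigenvalues have the prescribed limiting moments and that its commutators with
  \<open>Z\<close> tend to 0 in the 2-norm, which is the input of \<open>eventually_sparse\<close>.
  The induction over powers transfers the moments one multiplication at a time.\<close>

lemma sparse_of_conjugate_commutant:
  assumes U: "free_ultrafilter U" and F: "finite F" and \<epsilon>: "0 < \<epsilon>" and c: "0 < c" "4 / c \<le> real k"
    and \<theta>: "automorphism (QQ U) \<theta>"
    and Z: "\<And>i. i \<in> F \<Longrightarrow> (\<lambda>n. Z n i) \<in> carrier BS" "\<And>n i. Z n i \<in> carrier_mat n n"
    and W: "\<And>i. i \<in> F \<Longrightarrow> (\<lambda>n. W n i) \<in> carrier BS"
    and conj: "\<And>i. i \<in> F \<Longrightarrow> \<theta> (cls U (\<lambda>n. W n i)) = cls U (\<lambda>n. Z n i)"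
    and D: "(\<lambda>n. diag_real n (D n)) \<in> carrier BS"
    and comm: "\<And>n i. i \<in> F \<Longrightarrow> W n i * diag_real n (D n) = diag_real n (D n) * W n i"
    and mom: "\<And>j. ((\<lambda>n. (\<Sum>i<n. D n i ^ j) / real n) \<longlongrightarrow> (\<Sum>c<k. real c ^ j) / real k) U"
  shows "\<forall>\<^sub>F n in U. sparse_tuple n F c \<epsilon> (Z n)"
proof -
  define T where "T = (\<lambda>n. diag_real n (D n))"
  have T: "T \<in> carrier BS" "\<And>n. mat_adjoint (T n) = T n" using D by (simp_all add: T_def diag_real_adjoint)
  obtain S where S: "S \<in> carrier BS" "\<And>n. mat_adjoint (S n) = S n" "\<theta> (cls U T) = cls U S"
    using automorphism_selfadjoint_lift[OF \<theta> T] by blast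
  have e: "embedding (QQ U) (QQ U) \<theta>" using \<theta> by (simp add: automorphism_def)
  have hom: "\<theta> (x \<otimes>\<^bsub>QQ U\<^esub> y) = \<theta> x \<otimes>\<^bsub>QQ U\<^esub> \<theta> y" "\<theta> \<one>\<^bsub>QQ U\<^esub> = \<one>\<^bsub>QQ U\<^esub>" "tr (QQ U) (\<theta> x) = tr (QQ U) x"
    if "x \<in> carrier (QQ U)" "y \<in> carrier (QQ U)" for x y
    using e ring_hom_mult[of \<theta> "QQ U" "QQ U" x y] ring_hom_one[of \<theta> "QQ U" "QQ U"] that by (simp_all add: embedding_def)
  have "\<forall>n. \<exists>V d. unitary_mat n V \<and> S n = fcal n V d (\<lambda>t. t)"
    using hermitian_diagonalization[OF BS_carrierD(1)[OF S(1)] S(2)] unfolding fcal_def by simp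
  then obtain V d where V: "\<And>n. unitary_mat n (V n)" and SV: "\<And>n. S n = fcal n (V n) (d n) (\<lambda>t. t)" by metis
  have SVe: "S = (\<lambda>n. fcal n (V n) (d n) (\<lambda>t. t))" using SV by auto
  have pow: "(\<lambda>n. diag_real n (\<lambda>i. D n i ^ j)) \<in> carrier BS \<and> (\<lambda>n. fcal n (V n) (d n) (\<lambda>t. t ^ j)) \<in> carrier BS \<and>
    \<theta> (cls U (\<lambda>n. diag_real n (\<lambda>i. D n i ^ j))) = cls U (\<lambda>n. fcal n (V n) (d n) (\<lambda>t. t ^ j))" for j
  proof (induction j)
    case 0
    have "\<theta> (cls U (\<lambda>n. 1\<^sub>m n)) = cls U (\<lambda>n. 1\<^sub>m n)" using hom(2) cls_closed[OF BS_one] unfolding cls_one by blast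
    then show ?case using BS_one by (simp add: diag_real_one fcal_one[OF V])
  next
    case (Suc j)
    have 1: "diag_real n (\<lambda>i. D n i ^ Suc j) = T n * diag_real n (\<lambda>i. D n i ^ j)" for n
      by (simp add: T_def diag_real_mult)
    have 2: "fcal n (V n) (d n) (\<lambda>t. t ^ Suc j) = S n * fcal n (V n) (d n) (\<lambda>t. t ^ j)" for n
      unfolding SV fcal_mult[OF V] by simp
    note ih = conjunct1[OF Suc.IH] conjunct1[OF conjunct2[OF Suc.IH]] conjunct2[OF conjunct2[OF Suc.IH]]
    have "\<theta> (cls U (\<lambda>n. T n * diag_real n (\<lambda>i. D n i ^ j))) = cls U (\<lambda>n. S n * fcal n (V n) (d n) (\<lambda>t. t ^ j))"
      unfolding cls_mult[OF T(1) ih(1), symmetric] cls_mult[OF S(1) ih(2), symmetric]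
      unfolding hom(1)[OF cls_closed[OF T(1)] cls_closed[OF ih(1)]] S(3) ih(3) ..
    then show ?case unfolding 1 2 using BS_mult[OF T(1) ih(1)] BS_mult[OF S(1) ih(2)] by blast
  qed
  have mom': "((\<lambda>n. (\<Sum>i<n. d n i ^ j) / real n) \<longlongrightarrow> (\<Sum>c<k. real c ^ j) / real k) U" for j
  proof -
    have "((\<lambda>n. tr (mat_alg n) (diag_real n (\<lambda>i. D n i ^ j))) \<longlongrightarrow> complex_of_real ((\<Sum>c<k. real c ^ j) / real k)) U"
      unfolding tr_diag_real by (rule tendsto_of_real[OF mom])
    then have "tr (QQ U) (cls U (\<lambda>n. diag_real n (\<lambda>i. D n i ^ j))) = complex_of_real ((\<Sum>c<k. real c ^ j) / real k)"
      by (rule cls_tr[OF free_ultrafilter_bot[OF U] conjunct1[OF pow[of j]]])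
    moreover have "tr (QQ U) (cls U (\<lambda>n. fcal n (V n) (d n) (\<lambda>t. t ^ j))) = tr (QQ U) (cls U (\<lambda>n. diag_real n (\<lambda>i. D n i ^ j)))"
      unfolding conjunct2[OF conjunct2[OF pow[of j]], symmetric]
      by (rule hom(3)[OF cls_closed[OF conjunct1[OF pow[of j]]] cls_closed[OF conjunct1[OF pow[of j]]]])
    ultimately have trS: "tr (QQ U) (cls U (\<lambda>n. fcal n (V n) (d n) (\<lambda>t. t ^ j))) = complex_of_real ((\<Sum>c<k. real c ^ j) / real k)"
      by (rule trans[rotated])
    have "((\<lambda>n. tr (mat_alg n) (fcal n (V n) (d n) (\<lambda>t. t ^ j))) \<longlongrightarrow> complex_of_real ((\<Sum>c<k. real c ^ j) / real k)) U"
      using tendsto_cls_tr[OF U conjunct1[OF conjunct2[OF pow[of j]]]] unfolding trS .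
    from tendsto_Re[OF this] show ?thesis unfolding tr_fcal[OF V] Re_complex_of_real .
  qed
  have comm': "((\<lambda>n. mn2 n (S n * Z n i - Z n i * S n)) \<longlongrightarrow> 0) U" if i: "i \<in> F" for i
  proof -
    have "cls U (\<lambda>n. W n i) \<otimes>\<^bsub>QQ U\<^esub> cls U T = cls U T \<otimes>\<^bsub>QQ U\<^esub> cls U (\<lambda>n. W n i)"
      unfolding cls_mult[OF W[OF i] T(1)] cls_mult[OF T(1) W[OF i]] by (simp add: T_def comm[OF i])
    from arg_cong[OF this, of \<theta>]
    have "cls U (\<lambda>n. Z n i) \<otimes>\<^bsub>QQ U\<^esub> cls U S = cls U S \<otimes>\<^bsub>QQ U\<^esub> cls U (\<lambda>n. Z n i)"
      unfolding hom(1)[OF cls_closed[OF W[OF i]] cls_closed[OF T(1)]] hom(1)[OF cls_closed[OF T(1)] cls_closed[OF W[OF i]]]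
        conj[OF i] S(3) .
    then have "cls U (\<lambda>n. S n * Z n i) = cls U (\<lambda>n. Z n i * S n)"
      unfolding cls_mult[OF Z(1)[OF i] S(1)] cls_mult[OF S(1) Z(1)[OF i]] by simp
    then show ?thesis using cls_eq_iff[OF BS_mult[OF Z(1)[OF i] S(1)] BS_mult[OF S(1) Z(1)[OF i]]] by simp
  qed
  show ?thesis by (rule eventually_sparse[OF U F \<epsilon> c V Z(2) mom' comm'[unfolded SV]])
qed

section \<open>The entropy bound\<close>

lemma operator_norm_zero: "operator_norm (0\<^sub>m n n) = 0"
  using operator_norm_smult[of "0\<^sub>m n n :: complex mat" n n 0] by simp

lemma tendsto_of_rate:
  fixes f :: "nat \<Rightarrow> 'b::real_normed_vector"
  assumes "\<And>t. j \<le> t \<Longrightarrow> \<forall>\<^sub>F n in U. dist (f n) L \<le> C * (1 / real (Suc t))" and C: "0 \<le> C"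
  shows "(f \<longlongrightarrow> L) U"
proof (rule tendstoI)
  fix e :: real assume e: "0 < e"
  obtain N where N: "1 / real (Suc N) < e / (C + 1)" using nat_approx_posE[of "e / (C + 1)"] e C by auto
  define t where "t = max j N"
  have "1 / real (Suc t) \<le> 1 / real (Suc N)" by (simp add: t_def frac_le)
  then have "1 / real (Suc t) < e / (C + 1)" using N by linarith
  then have "(C + 1) * (1 / real (Suc t)) < e" using C by (simp add: pos_less_divide_eq mult.commute)
  moreover have "C * (1 / real (Suc t)) \<le> (C + 1) * (1 / real (Suc t))" by (rule mult_right_mono) auto
  ultimately have "C * (1 / real (Suc t)) < e" by linarith
  moreover have "\<forall>\<^sub>F n in U. dist (f n) L \<le> C * (1 / real (Suc t))" by (rule assms(1)) (simp add: t_def)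
  ultimately show "\<forall>\<^sub>F n in U. dist (f n) L < e" by (auto elim: eventually_mono)
qed

lemma sparse_tuple_cong: "(\<And>i. i \<in> F \<Longrightarrow> Z i = Z' i) \<Longrightarrow> sparse_tuple n F c \<epsilon> Z = sparse_tuple n F c \<epsilon> Z'"
  unfolding sparse_tuple_def by simp

text \<open>Finitely many words suffice to describe the neighbourhoods used below, as the trace of
  an evaluated polynomial is linear in the traces of its words.\<close>

lemma law_neighbourhood_words:
  fixes w :: "nat \<Rightarrow> ('k \<times> bool) list"
  assumes \<mu>: "\<mu> \<in> topspace (law_topology K)" and w: "\<And>j. fst ` set (w j) \<subseteq> K" and e: "0 < e"
  shows "{\<nu> \<in> topspace (law_topology K). \<forall>j\<in>{..t}. dist (\<nu> (Poly_Mapping.single (w j) 1)) (\<mu> (Poly_Mapping.single (w j) 1)) < e}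
    \<in> law_neighbourhoods K \<mu>" (is "?O \<in> _")
proof -
  let ?s = "\<lambda>j. Poly_Mapping.single (w j) (1::complex)"
  let ?B = "\<lambda>j. {\<nu> \<in> topspace (law_topology K). \<nu> (?s j) \<in> ball (\<mu> (?s j)) e}"
  have "openin (law_topology K) (?B j)" for j
  proof (rule openin_continuous_map_preimage[where Y = euclidean])
    show "continuous_map (law_topology K) euclidean (\<lambda>\<nu>. \<nu> (?s j))"
      unfolding law_topology_def by (rule continuous_map_product_projection) (rule ncpolys_single[OF w])
  qed simp
  then have "openin (law_topology K) ((\<Inter>j\<in>{..t}. ?B j) \<inter> topspace (law_topology K))" by (intro openin_INT) auto
  moreover have "(\<Inter>j\<in>{..t}. ?B j) \<inter> topspace (law_topology K) = ?O" by (auto simp: dist_commute)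
  ultimately have "openin (law_topology K) ?O" by simp
  then show ?thesis unfolding law_neighbourhoods_def using \<mu> e by auto
qed

context tracial_wstar_alg
begin

text \<open>The diagonal argument can meet only countably many conditions, while the index set may
  be uncountable. Separability supplies countably many polynomials that approximate a dense set;
  each has finitely many variables, and these together with \<open>F\<close> form
  \<open>K0\<close>.\<close>

lemma countable_generating_indices:
  fixes X :: "'k \<Rightarrow> 'a"
  assumes U: "free_ultrafilter U" and sep: "separable_tracial M" and X: "\<And>k. X k \<in> carrier M"
    and gen: "wstar_generated M (X ` K) = carrier M" and F: "finite F" "F \<subseteq> K"
  shows "\<exists>K0\<subseteq>K. countable K0 \<and> F \<subseteq> K0 \<and>
    (\<forall>x\<in>carrier M. \<forall>e>0. \<exists>p\<in>ncpolys K0. norm2 M (x \<ominus> eval_poly M X p) < e)"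
proof -
  obtain D where D: "countable D" "D \<subseteq> carrier M" "\<And>x e. x \<in> carrier M \<Longrightarrow> e > 0 \<Longrightarrow> \<exists>d\<in>D. norm2 M (x \<ominus> d) < e"
    using sep by (auto simp: separable_tracial_def)
  define S where "S = eval_poly M X ` ncpolys K"
  have closed: "eval_poly M X p \<in> carrier M" for p by (rule eval_poly_closed) (rule X)
  have "carrier_star_subalgebra S"
    unfolding carrier_star_subalgebra_def
  proof (intro conjI allI ballI)
    show "S \<subseteq> carrier M" using closed by (auto simp: S_def)
    have "eval_poly M X 1 = \<one>" by (rule eval_poly_one[where Z = X, OF X])
    then show "\<one> \<in> S" unfolding S_def using ncpolys_one by (metis imageI)
    fix x assume "x \<in> S"
    then obtain p where p: "p \<in> ncpolys K" "x = eval_poly M X p" by (auto simp: S_def)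
    show "c \<odot>\<^bsub>M\<^esub> x \<in> S" for c
      unfolding p(2) eval_poly_scale[where Z = X, OF X, symmetric] S_def
      by (intro imageI ncpolys_mult ncpolys_const p)
    show "star M x \<in> S" unfolding p(2) eval_poly_star[where Z = X, OF X, symmetric] S_def by (intro imageI ncpolys_star p)
    fix y assume "y \<in> S"
    then obtain q where q: "q \<in> ncpolys K" "y = eval_poly M X q" by (auto simp: S_def)
    show "x \<oplus> y \<in> S" unfolding p(2) q(2) eval_poly_add[where Z = X, OF X, symmetric] S_def by (intro imageI ncpolys_add p q)
    show "x \<otimes> y \<in> S" unfolding p(2) q(2) eval_poly_mult[where Z = X, OF X, symmetric] S_def by (intro imageI ncpolys_mult p q)
  qed
  moreover have "X ` K \<subseteq> S"
  proof
    fix x assume "x \<in> X ` K"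
    then obtain k where k: "k \<in> K" "x = X k" by blast
    have "x = eval_poly M X (var_poly k)" unfolding k(2) by (rule eval_poly_var[where Z = X, OF X, symmetric])
    then show "x \<in> S" unfolding S_def using k(1) by (auto intro!: imageI ncpolys_single)
  qed
  ultimately have dense: "\<exists>p\<in>ncpolys K. norm2 M (x \<ominus> eval_poly M X p) < e" if "x \<in> carrier M" "e > 0" for x e
    using norm2_density[OF U _ gen _ that, of S] unfolding S_def by blast
  have "\<forall>d n. \<exists>p. d \<in> D \<longrightarrow> p \<in> ncpolys K \<and> norm2 M (d \<ominus> eval_poly M X p) < 1 / real (Suc n)"
  proof (intro allI)
    fix d n show "\<exists>p. d \<in> D \<longrightarrow> p \<in> ncpolys K \<and> norm2 M (d \<ominus> eval_poly M X p) < 1 / real (Suc n)"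
      using dense[of d "1 / real (Suc n)"] D(2) by (cases "d \<in> D") auto
  qed
  then obtain p where p: "\<And>d n. d \<in> D \<Longrightarrow> p d n \<in> ncpolys K" "\<And>d n. d \<in> D \<Longrightarrow> norm2 M (d \<ominus> eval_poly M X (p d n)) < 1 / real (Suc n)"
    by metis
  define vars :: "'k ncpoly \<Rightarrow> 'k set" where "vars q = (\<Union>w\<in>Poly_Mapping.keys q. fst ` set w)" for q
  define K0 where "K0 = F \<union> (\<Union>d\<in>D. \<Union>n. vars (p d n))"
  have fin: "finite (vars q)" for q by (simp add: vars_def)
  have "countable (\<Union>d\<in>D. \<Union>n. vars (p d n))"
    by (intro countable_UN D(1) countableI_type countable_finite[OF fin])
  then have cK: "countable K0" unfolding K0_def using F(1) by (simp add: countable_finite)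
  have sub: "K0 \<subseteq> K" unfolding K0_def using F(2) p(1) by (fastforce simp: vars_def ncpolys_def)
  have pK: "p d n \<in> ncpolys K0" if "d \<in> D" for d n unfolding ncpolys_def K0_def vars_def using that by blast
  have "\<exists>q\<in>ncpolys K0. norm2 M (x \<ominus> eval_poly M X q) < e" if x: "x \<in> carrier M" and e: "e > 0" for x e
  proof -
    obtain d where d: "d \<in> D" "norm2 M (x \<ominus> d) < e / 2" using D(3)[OF x, of "e / 2"] e by auto
    obtain n where n: "1 / real (Suc n) < e / 2" using nat_approx_posE[of "e / 2"] e by auto
    have "norm2 M (x \<ominus> eval_poly M X (p d n)) \<le> norm2 M (x \<ominus> d) + norm2 M (d \<ominus> eval_poly M X (p d n))"
      using x d(1) D(2) closed by (intro norm2_triangle) auto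
    also have "\<dots> < e" using d(2) p(2)[OF d(1), of n] n by linarith
    finally show ?thesis using pK[OF d(1)] by blast
  qed
  moreover have "F \<subseteq> K0" by (simp add: K0_def)
  ultimately show ?thesis by (intro exI[of _ K0] conjI ballI allI impI cK sub)
qed

text \<open>If non-sparse microstates survived every neighbourhood of the law, they would give one
  embedding, and block-diagonal amplifications of microstates another one whose relative commutant
  contains operators with evenly spread spectrum; conjugacy transports such an operator
  to the first embedding, which forces sparsity.\<close>

lemma sparse_neighbourhood:
  fixes X :: "'i + 'j \<Rightarrow> 'a" and R :: "'i + 'j \<Rightarrow> real"
  assumes U: "free_ultrafilter U" and sep: "separable_tracial M"
    and conj: "\<And>\<alpha> \<beta>. embedding M (QQ U) \<alpha> \<Longrightarrow> embedding M (QQ U) \<beta> \<Longrightarrow> conjugate_embeddings M (QQ U) \<alpha> \<beta>"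
    and X: "\<And>k. k \<in> K \<Longrightarrow> X k \<in> carrier M" and R: "\<And>k. k \<in> K \<Longrightarrow> 0 < R k"
    and gen: "wstar_generated M (X ` K) = carrier M"
    and F: "finite F" "Inl ` F \<subseteq> K" and c: "0 < c" and \<epsilon>: "0 < \<epsilon>"
  shows "\<exists>\<O>\<in>law_neighbourhoods K (nc_law M K X). \<forall>\<^sub>F n in U. \<forall>Z\<in>microstates n K R \<O>. sparse_tuple n F c \<epsilon> (\<lambda>i. Z (Inl i))"
proof (rule ccontr)
  assume contr: "\<not> ?thesis"
  \<comment> \<open>Zero outside \<open>K\<close>, with radius 1 in \<open>Rt\<close>, makes the
    tuple total, as \<open>microstate_sequence\<close> demands.\<close>
  define Xt where "Xt k = (if k \<in> K then X k else \<zero>)" for k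
  have Xt: "Xt k \<in> carrier M" for k using X by (simp add: Xt_def)
  define Rt where "Rt k = (if k \<in> K then R k else 1)" for k
  have Rt: "0 \<le> Rt k" for k using R[of k] by (cases "k \<in> K") (simp_all add: Rt_def)
  have "Xt ` K = X ` K" by (auto simp: Xt_def)
  then obtain K0 where K0: "K0 \<subseteq> K" "countable K0" "Inl ` F \<subseteq> K0"
    and dense: "\<And>x e. x \<in> carrier M \<Longrightarrow> e > 0 \<Longrightarrow> \<exists>p\<in>ncpolys K0. norm2 M (x \<ominus> eval_poly M Xt p) < e"
    using countable_generating_indices[where X = Xt and K = K and F = "Inl ` F", OF U sep Xt] gen F by auto
  define w where "w = from_nat_into (lists (K0 \<times> (UNIV :: bool set)))"
  have wr: "range w = lists (K0 \<times> UNIV)"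
    unfolding w_def using K0(2) by (intro range_from_nat_into) auto
  have wK0: "fst ` set (w j) \<subseteq> K0" for j using rangeI[of w j] unfolding wr by (auto simp: lists_eq_set)
  then have wK: "fst ` set (w j) \<subseteq> K" for j using K0(1) by blast
  have w_surj: "\<exists>j. v = w j" if "fst ` set v \<subseteq> K0" for v
  proof -
    have "v \<in> range w" unfolding wr lists_eq_set using that by force
    then show ?thesis by blast
  qed
  define \<tau> where "\<tau> v = tr M (eval_word M Xt v)" for v
  define ok where "ok n z \<longleftrightarrow> (\<forall>k. z k \<in> carrier_mat n n \<and> operator_norm (z k) \<le> Rt k)" for n and z :: "'i + 'j \<Rightarrow> complex mat"
  define close where "close t n z \<longleftrightarrow> ok n z \<and> (\<forall>j\<in>{..t}. dist (tr (mat_alg n) (eval_word (mat_alg n) z (w j))) (\<tau> (w j)) < 1 / real (Suc t))"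
    for t n and z :: "'i + 'j \<Rightarrow> complex mat"
  have close_mono: "close t n z" if "t \<le> t'" "close t' n z" for t t' n z
  proof -
    have "1 / real (Suc t') \<le> 1 / real (Suc t)" using that(1) by (simp add: frac_le)
    then show ?thesis using that unfolding close_def by (force intro: less_le_trans)
  qed
  define G where "G t n z \<longleftrightarrow> close t n z \<and> \<not> sparse_tuple n F c \<epsilon> (\<lambda>i. z (Inl i))" for t n and z :: "'i + 'j \<Rightarrow> complex mat"
  have Gex: "\<forall>\<^sub>F n in U. \<exists>z. G t n z" for t
  proof -
    let ?\<mu> = "nc_law M K X"
    let ?s = "\<lambda>j. Poly_Mapping.single (w j) (1::complex)"
    let ?O = "{\<nu> \<in> topspace (law_topology K). \<forall>j\<in>{..t}. dist (\<nu> (?s j)) (?\<mu> (?s j)) < 1 / real (Suc t)}"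
    have "?O \<in> law_neighbourhoods K ?\<mu>"
      by (rule law_neighbourhood_words[OF _ wK]) (auto simp: law_topology_def nc_law_def PiE_def extensional_def)
    then have "\<not> (\<forall>\<^sub>F n in U. \<forall>Z\<in>microstates n K R ?O. sparse_tuple n F c \<epsilon> (\<lambda>i. Z (Inl i)))" using contr by blast
    then have "\<forall>\<^sub>F n in U. \<not> (\<forall>Z\<in>microstates n K R ?O. sparse_tuple n F c \<epsilon> (\<lambda>i. Z (Inl i)))"
      using U unfolding free_ultrafilter_def by blast
    then show ?thesis
    proof eventually_elim
      case (elim n)
      then obtain Z where Z: "Z \<in> microstates n K R ?O" "\<not> sparse_tuple n F c \<epsilon> (\<lambda>i. Z (Inl i))" by blast
      define z where "z k = (if k \<in> K then Z k else 0\<^sub>m n n)" for k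
      have ZE: "Z \<in> (\<Pi>\<^sub>E k\<in>K. {A \<in> carrier_mat n n. operator_norm A \<le> R k})" "nc_law (mat_alg n) K Z \<in> ?O"
        using Z(1) unfolding microstates_def by blast+
      have zk: "z k \<in> carrier_mat n n \<and> operator_norm (z k) \<le> Rt k" for k
        using PiE_mem[OF ZE(1), of k] by (auto simp: z_def Rt_def operator_norm_zero)
      have zc: "z k \<in> carrier (mat_alg n)" for k using zk by simp
      have "nc_law (mat_alg n) K Z (?s j) = tr (mat_alg n) (eval_word (mat_alg n) z (w j))" for j
      proof -
        have s: "?s j \<in> ncpolys K" by (rule ncpolys_single[OF wK])
        have "eval_poly (mat_alg n) Z (?s j) = eval_poly (mat_alg n) z (?s j)"
          by (rule MA.eval_poly_cong[OF _ s]) (use zc in \<open>auto simp: z_def\<close>)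
        also have "\<dots> = 1 \<cdot>\<^sub>m eval_word (mat_alg n) z (w j)"
          using MA.eval_poly_single[where Z = z, OF zc] by simp
        also have "\<dots> = eval_word (mat_alg n) z (w j)" by (intro eq_matI) auto
        finally show ?thesis using s unfolding nc_law_def by simp
      qed
      moreover have "?\<mu> (?s j) = \<tau> (w j)" for j
      proof -
        have s: "?s j \<in> ncpolys K" by (rule ncpolys_single[OF wK])
        have "eval_poly M X (?s j) = eval_poly M Xt (?s j)"
          by (rule eval_poly_cong[OF _ s]) (use Xt in \<open>auto simp: Xt_def\<close>)
        also have "\<dots> = 1 \<odot>\<^bsub>M\<^esub> eval_word M Xt (w j)"
          by (rule eval_poly_single[where Z = Xt, OF Xt])
        also have "\<dots> = eval_word M Xt (w j)" using eval_word_closed[where Z = Xt, OF Xt] by simp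
        finally show ?thesis using s unfolding nc_law_def \<tau>_def by simp
      qed
      ultimately have "close t n z" using ZE(2) zk unfolding close_def ok_def by simp
      moreover have "sparse_tuple n F c \<epsilon> (\<lambda>i. z (Inl i)) = sparse_tuple n F c \<epsilon> (\<lambda>i. Z (Inl i))"
        by (rule sparse_tuple_cong) (use F(2) in \<open>auto simp: z_def\<close>)
      ultimately have "G t n z" using Z(2) unfolding G_def by blast
      then show ?case by blast
    qed
  qed
  have Gmono: "G t n z" if "t \<le> t'" "G t' n z" for t t' n z using that close_mono unfolding G_def by blast
  obtain z where z: "\<And>t. \<forall>\<^sub>F n in U. G t n (z n)"
  proof (rule ultrafilter_diagonal[where G = G, OF U Gex])
    fix t t' n z assume "t \<le> t'" "G t' n z"
    then show "G t n z" by (rule Gmono)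
  qed (rule that)
  define Z1 where "Z1 n = (if ok n (z n) then z n else (\<lambda>k. 0\<^sub>m n n))" for n
  have Z1k: "Z1 n k \<in> carrier_mat n n" "operator_norm (Z1 n k) \<le> Rt k" for n k
    using Rt by (auto simp: Z1_def ok_def operator_norm_zero)
  have Z1z: "G t n (z n) \<Longrightarrow> Z1 n = z n" for t n by (auto simp: G_def close_def Z1_def)
  interpret E1: microstate_sequence M U K0 Xt Rt Z1
  proof
    fix v :: "(('i + 'j) \<times> bool) list" assume "fst ` set v \<subseteq> K0"
    then obtain j where j: "v = w j" using w_surj by blast
    show "((\<lambda>n. tr (mat_alg n) (eval_word (mat_alg n) (Z1 n) v)) \<longlongrightarrow> tr M (eval_word M Xt v)) U"
    proof (rule tendsto_of_rate[where j = j and C = 1])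
      fix t assume t: "j \<le> t"
      show "\<forall>\<^sub>F n in U. dist (tr (mat_alg n) (eval_word (mat_alg n) (Z1 n) v)) (tr M (eval_word M Xt v)) \<le> 1 * (1 / real (Suc t))"
        using z[of t]
      proof eventually_elim
        case (elim n)
        then have "dist (tr (mat_alg n) (eval_word (mat_alg n) (z n) (w j))) (\<tau> (w j)) < 1 / real (Suc t)"
          using t unfolding G_def close_def by blast
        then show ?case unfolding Z1z[OF elim] j \<tau>_def by simp
      qed
    qed simp
  qed (use U Xt Z1k dense in auto)
  \<comment> \<open>The number of spectral points depends on the sparsity level alone;
    \<open>4 / c\<close> is what \<open>eventually_sparse\<close> asks for.\<close>
  obtain k where k: "4 / c \<le> real k" using real_arch_simple by blast
  have "0 < 4 / c" using c by simp
  then have "0 < real k" using k by linarith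
  then have k0: "0 < k" by simp
  \<comment> \<open>A witness at \<open>n\<close> is a smaller size \<open>m\<close> with a
    microstate of that size. The condition \<open>m * Suc t \<le> n\<close> makes blocks of size
    \<open>m\<close>, and the remainder of \<open>n\<close> modulo \<open>m\<close>,
    negligible.\<close>
  define G2 where "G2 t n my \<longleftrightarrow> 0 < fst my \<and> fst my * Suc t \<le> n \<and> close t (fst my) (snd my)" for t n and my :: "nat \<times> ('i + 'j \<Rightarrow> complex mat)"
  have G2ex: "\<forall>\<^sub>F n in U. \<exists>my. G2 t n my" for t
  proof -
    \<comment> \<open>A single size \<open>m\<close> that admits a microstate of quality
      \<open>t\<close> serves every \<open>n \<ge> m * Suc t\<close>.\<close>
    have "\<forall>\<^sub>F n in U. n \<ge> 1 \<and> (\<exists>z. G t n z)" by (intro eventually_conj free_ultrafilter_ge[OF U] Gex)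
    then obtain m y where m: "1 \<le> m" "G t m y" using eventually_happens'[OF free_ultrafilter_bot[OF U]] by blast
    have "\<forall>\<^sub>F n in U. n \<ge> m * Suc t" by (rule free_ultrafilter_ge[OF U])
    then show ?thesis
    proof eventually_elim
      case (elim n)
      then have "G2 t n (m, y)" using m unfolding G2_def G_def by simp
      then show ?case by blast
    qed
  qed
  have G2mono: "G2 t n my" if "t \<le> t'" "G2 t' n my" for t t' n my
  proof -
    have "fst my * Suc t \<le> fst my * Suc t'" using that(1) by simp
    then show ?thesis using that close_mono unfolding G2_def by (meson le_trans)
  qed
  obtain my where my: "\<And>t. \<forall>\<^sub>F n in U. G2 t n (my n)"
  proof (rule ultrafilter_diagonal[where G = G2, OF U G2ex])
    fix t t' n z assume "t \<le> t'" "G2 t' n z"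
    then show "G2 t n z" by (rule G2mono)
  qed (rule that)
  define m where "m n = fst (my n)" for n
  define y where "y n = snd (my n)" for n
  have G2D: "0 < m n" "m n * Suc t \<le> n" "close t (m n) (y n)" "G2 0 n (my n)" if "G2 t n (my n)" for t n
    using that G2mono[of 0 t n "my n"] unfolding G2_def m_def y_def by auto
  have ratio: "0 < n \<and> real (m n) / real n \<le> 1 / real (Suc t)" if "G2 t n (my n)" for t n
  proof -
    have n: "0 < n" using G2D(1,2)[OF that] by (metis gr0I le_0_eq mult_is_0 nat.distinct(1) not_less_zero)
    have "real (m n) * real (Suc t) \<le> real n" using G2D(2)[OF that] by (metis of_nat_le_iff of_nat_mult)
    then show ?thesis using n by (simp add: divide_simps mult.commute)
  qed
  define Z2 where "Z2 n k = (if G2 0 n (my n) then amp n (m n) (y n k) else 0\<^sub>m n n)" for n k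
  \<comment> \<open>Constant on the blocks of the amplification, hence commuting with it, while
    reduction of the block number modulo \<open>k\<close> spreads the spectrum evenly over
    \<open>0, ..., k - 1\<close>.\<close>
  define D where "D n a = (if G2 0 n (my n) then real ((a div m n) mod k) else 0)" for n a
  have yc: "y n k \<in> carrier_mat (m n) (m n)" "operator_norm (y n k) \<le> Rt k" if "G2 t n (my n)" for t n k
    using G2D(3)[OF that] unfolding close_def ok_def by blast+
  have Z2k: "Z2 n k \<in> carrier_mat n n" "operator_norm (Z2 n k) \<le> Rt k" for n k
  proof -
    show "Z2 n k \<in> carrier_mat n n" by (simp add: Z2_def)
    show "operator_norm (Z2 n k) \<le> Rt k"
    proof (cases "G2 0 n (my n)")
      case True
      have "operator_norm (amp n (m n) (y n k)) \<le> operator_norm (y n k)"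
        by (rule operator_norm_amp[OF G2D(1)[OF True] yc(1)[OF True]])
      then show ?thesis using True yc(2)[OF True, of k] by (simp add: Z2_def)
    qed (simp add: Z2_def operator_norm_zero Rt)
  qed
  interpret E2: microstate_sequence M U K0 Xt Rt Z2
  proof
    fix v :: "(('i + 'j) \<times> bool) list" assume "fst ` set v \<subseteq> K0"
    then obtain j where j: "v = w j" using w_surj by blast
    show "((\<lambda>n. tr (mat_alg n) (eval_word (mat_alg n) (Z2 n) v)) \<longlongrightarrow> tr M (eval_word M Xt v)) U"
    proof (rule tendsto_of_rate[where j = j and C = "cmod (\<tau> v) + 2"])
      fix t assume t: "j \<le> t"
      show "\<forall>\<^sub>F n in U. dist (tr (mat_alg n) (eval_word (mat_alg n) (Z2 n) v)) (tr M (eval_word M Xt v)) \<le> (cmod (\<tau> v) + 2) * (1 / real (Suc t))"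
        using my[of t]
      proof eventually_elim
        case (elim n)
        note m0 = G2D(1)[OF elim] and n = ratio[OF elim]
        let ?x = "tr (mat_alg (m n)) (eval_word (mat_alg (m n)) (y n) v)"
        have x: "cmod (?x - \<tau> v) < 1 / real (Suc t)"
          using G2D(3)[OF elim] t unfolding close_def j dist_norm by blast
        show ?case
        \<comment> \<open>The empty word is evaluated to the full identity and not to its
          amplification; all other words lose the factor \<open>\<rho>\<close>, the proportion of
          coordinates covered by blocks.\<close>
        proof (cases "v = []")
          case True
          have one: "tr (mat_alg l) (eval_word (mat_alg l) Z v) = 1" if "0 < l" for l Z
            using that unfolding True eval_word_def by simp
          have "cmod (1 - \<tau> v) \<le> 1 / real (Suc t)" using x unfolding one[OF m0] by simp
          also have "\<dots> \<le> (cmod (\<tau> v) + 2) * (1 / real (Suc t))" using mult_right_mono[of 1 "cmod (\<tau> v) + 2" "1 / real (Suc t)"] by simp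
          finally show ?thesis unfolding one[OF conjunct1[OF n]] \<tau>_def[symmetric] dist_norm .
        next
          case False
          define \<rho> where "\<rho> = real (n div m n * m n) / real n"
          have Z2n: "Z2 n = (\<lambda>k. amp n (m n) (y n k))" using G2D(4)[OF elim] by (auto simp: Z2_def)
          have ew: "eval_word (mat_alg (m n)) (y n) v \<in> carrier_mat (m n) (m n)"
            using MA.eval_word_closed[of "y n" "m n" v] yc(1)[OF elim] by simp
          have e: "tr (mat_alg n) (eval_word (mat_alg n) (Z2 n) v) = complex_of_real \<rho> * ?x"
            unfolding Z2n eval_word_amp[OF m0 yc(1)[OF elim] False] tr_amp[OF m0 ew] \<rho>_def ..
          have "real n = real (n div m n * m n) + real (n mod m n)" by (metis div_mult_mod_eq of_nat_add)
          then have "1 - \<rho> = real (n mod m n) / real n" using n by (simp add: \<rho>_def field_simps)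
          moreover have "real (n mod m n) / real n \<le> real (m n) / real n" using m0 by (intro divide_right_mono) auto
          ultimately have \<rho>: "\<bar>\<rho> - 1\<bar> \<le> 1 / real (Suc t)" using n by (simp add: abs_le_iff) (smt (verit) divide_nonneg_nonneg of_nat_0_le_iff)
          have xb: "cmod ?x \<le> cmod (\<tau> v) + 1"
          proof -
            have "cmod ?x \<le> cmod (?x - \<tau> v) + cmod (\<tau> v)" by (metis norm_triangle_sub add.commute)
            moreover have "1 / real (Suc t) \<le> 1" by simp
            ultimately show ?thesis using x by linarith
          qed
          have "complex_of_real \<rho> * ?x - \<tau> v = complex_of_real (\<rho> - 1) * ?x + (?x - \<tau> v)" by (simp add: left_diff_distrib del: mat_alg_sel(9))
          then have "cmod (complex_of_real \<rho> * ?x - \<tau> v) \<le> cmod (complex_of_real (\<rho> - 1) * ?x) + cmod (?x - \<tau> v)" by (simp only: norm_triangle_ineq)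
          also have "cmod (complex_of_real (\<rho> - 1) * ?x) \<le> 1 / real (Suc t) * (cmod (\<tau> v) + 1)"
            unfolding norm_mult norm_of_real using \<rho> xb by (intro mult_mono) auto
          finally have "cmod (complex_of_real \<rho> * ?x - \<tau> v) \<le> 1 / real (Suc t) * (cmod (\<tau> v) + 1) + 1 / real (Suc t)" using x by linarith
          also have "\<dots> = (cmod (\<tau> v) + 2) * (1 / real (Suc t))" by (simp add: add_divide_distrib)
          finally show ?thesis unfolding e \<tau>_def[symmetric] dist_norm .
        qed
      qed
    qed simp
  qed (use U Xt Z2k dense in auto)
  have "conjugate_embeddings M (QQ U) E2.limit_embedding E1.limit_embedding"
    by (rule conj[OF E2.limit_embedding E1.limit_embedding])
  then obtain \<theta> where \<theta>: "automorphism (QQ U) \<theta>" "\<And>x. x \<in> carrier M \<Longrightarrow> E1.limit_embedding x = \<theta> (E2.limit_embedding x)"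
    unfolding conjugate_embeddings_def by blast
  have "\<forall>\<^sub>F n in U. sparse_tuple n F c \<epsilon> ((\<lambda>n i. Z1 n (Inl i)) n)"
  proof (rule sparse_of_conjugate_commutant[OF U F(1) \<epsilon> c k \<theta>(1), where W = "\<lambda>n i. Z2 n (Inl i)" and D = D])
    fix i assume i: "i \<in> F"
    then have iK: "Inl i \<in> K0" using K0(3) by blast
    show "(\<lambda>n. Z1 n (Inl i)) \<in> carrier BS" by (rule BS_carrierI[OF Z1k])
    show "(\<lambda>n. Z2 n (Inl i)) \<in> carrier BS" by (rule BS_carrierI[OF Z2k])
    show "\<theta> (cls U (\<lambda>n. Z2 n (Inl i))) = cls U (\<lambda>n. Z1 n (Inl i))"
      unfolding E1.limit_embedding_var[OF iK, symmetric] E2.limit_embedding_var[OF iK, symmetric] by (rule \<theta>(2)[OF Xt, symmetric])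
    show "Z2 n (Inl i) * diag_real n (D n) = diag_real n (D n) * Z2 n (Inl i)" for n
    proof (cases "G2 0 n (my n)")
      case True
      have "D n = (\<lambda>a. real ((a div m n) mod k))" using True by (auto simp: D_def)
      then show ?thesis using True amp_commutes_block_diagonal[of n "m n" "y n (Inl i)" "\<lambda>p. real (p mod k)"] by (simp add: Z2_def)
    next
      case False
      have dc: "diag_real n (D n) \<in> carrier_mat n n" by (simp add: diag_real_def)
      show ?thesis using False by (simp add: Z2_def left_mult_zero_mat[OF dc] right_mult_zero_mat[OF dc])
    qed
  next
    show "Z1 n i \<in> carrier_mat n n" for n i by (rule Z1k)
    show "(\<lambda>n. diag_real n (D n)) \<in> carrier BS"
    proof (rule BS_carrierI)
      show "diag_real n (D n) \<in> carrier_mat n n" for n by (simp add: diag_real_def)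
      have "(a mod k) \<le> k" for a using k0 by (simp add: less_imp_le)
      then show "operator_norm (diag_real n (D n)) \<le> real k" for n
        by (intro operator_norm_diag_real) (auto simp: D_def)
    qed
    fix j
    show "((\<lambda>n. (\<Sum>i<n. D n i ^ j) / real n) \<longlongrightarrow> (\<Sum>c<k. real c ^ j) / real k) U"
    proof (rule tendsto_of_rate[where j = 0 and C = "2 * real k * real k ^ j"])
      fix t :: nat
      show "\<forall>\<^sub>F n in U. dist ((\<Sum>i<n. D n i ^ j) / real n) ((\<Sum>c<k. real c ^ j) / real k) \<le> 2 * real k * real k ^ j * (1 / real (Suc t))"
        using my[of t]
      proof eventually_elim
        case (elim n)
        have "\<bar>real c ^ j\<bar> \<le> real k ^ j" if "c < k" for c using that by (simp add: power_mono)
        from block_mean[OF G2D(1)[OF elim] k0 conjunct1[OF ratio[OF elim]] this]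
        have "\<bar>(\<Sum>i<n. D n i ^ j) / real n - (\<Sum>c<k. real c ^ j) / real k\<bar> \<le> 2 * real k * real k ^ j * (real (m n) / real n)"
          using G2D(4)[OF elim] by (simp add: D_def)
        also have "\<dots> \<le> 2 * real k * real k ^ j * (1 / real (Suc t))" using ratio[OF elim] by (intro mult_left_mono) auto
        finally show ?case by (simp only: dist_real_def)
      qed
    qed simp
  qed
  with z[of 0] have "\<forall>\<^sub>F n in U. False"
  proof eventually_elim
    case (elim n)
    then show ?case unfolding Z1z[OF elim(1)] by (simp add: G_def)
  qed
  then show False using free_ultrafilter_bot[OF U] by simp
qed

end

lemma log_enat_le:
  assumes "k \<le> enat l" "real l \<le> exp x"
  shows "log_enat k \<le> ereal x"
proof -
  obtain a where a: "k = enat a" "a \<le> l" using assms(1) by (cases k) auto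
  have "ln (real a) \<le> x" if "0 < a"
  proof -
    have "ln (real a) \<le> ln (exp x)" using that a(2) assms(2) by (subst ln_le_cancel_iff) auto
    then show ?thesis by simp
  qed
  then show ?thesis by (simp add: log_enat_def a(1))
qed

theorem corollary1p4:
  fixes U :: "nat filter"
    and A :: "'a tracial_alg"
    and I :: "'i set" and X :: "'i \<Rightarrow> 'a" and r :: "'i \<Rightarrow> real"
    and J :: "'j set" and Y :: "'j \<Rightarrow> 'a" and r' :: "'j \<Rightarrow> real"
  assumes "free_ultrafilter U"
    and "tracial_wstar A" and "separable_tracial A"
    and "\<And>\<alpha> \<beta>. embedding A (matrix_ultraproduct U) \<alpha> \<Longrightarrow>
           embedding A (matrix_ultraproduct U) \<beta> \<Longrightarrow>
           conjugate_embeddings A (matrix_ultraproduct U) \<alpha> \<beta>"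
    and "generating_tuples A (carrier A) I X r J Y r'"
  shows "one_bounded_entropy U A I X r J Y r' \<le> 0"
  unfolding one_bounded_entropy_def
proof (intro SUP_least)
  interpret tracial_wstar_alg A by unfold_locales (rule assms(2))
  fix \<epsilon> :: real and F assume "\<epsilon> \<in> {0<..}" "F \<in> {F. finite F \<and> F \<subseteq> I}"
  then have \<epsilon>: "0 < \<epsilon>" and F: "finite F" "F \<subseteq> I" by auto
  let ?K = "I <+> J" and ?X = "case_sum X Y" and ?R = "case_sum r r'"
  let ?f = "\<lambda>\<O> n. ereal (1 / (real n)\<^sup>2) * log_enat (orbital_covering_number n I F \<epsilon>
    ((\<lambda>Z. \<lambda>i\<in>I. Z (Inl i)) ` microstates n ?K ?R \<O>))"
  have XK: "k \<in> ?K \<Longrightarrow> ?X k \<in> carrier A" and RK: "k \<in> ?K \<Longrightarrow> 0 < ?R k" for k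
    using assms(5) by (auto simp: generating_tuples_def bounded_tuple_def)
  have "?X ` ?K = X ` I \<union> Y ` J" by (force simp: image_iff)
  then have gen: "wstar_generated A (?X ` ?K) = carrier A" using assms(5) by (simp add: generating_tuples_def)
  have FK: "Inl ` F \<subseteq> ?K" using F by auto
  show "(INF \<O>\<in>law_neighbourhoods ?K (nc_law A ?K ?X). Lim U (?f \<O>)) \<le> 0"
  proof (rule ereal_le_epsilon2)
    fix \<delta> :: real assume \<delta>: "0 < \<delta>"
    obtain c where c: "0 < c"
      and cover: "\<And>n \<Omega>. 0 < n \<Longrightarrow> (\<And>Z i. Z \<in> \<Omega> \<Longrightarrow> i \<in> F \<Longrightarrow> Z i \<in> carrier_mat n n \<and> operator_norm (Z i) \<le> r i) \<Longrightarrow>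
        (\<And>Z. Z \<in> \<Omega> \<Longrightarrow> sparse_tuple n F c (\<epsilon> / 2) Z) \<Longrightarrow>
        \<exists>\<Omega>'. \<Omega>' \<subseteq> (\<Pi>\<^sub>E i\<in>I. carrier_mat n n) \<and> finite \<Omega>' \<and> orbital_cover n F \<epsilon> \<Omega> \<Omega>' \<and>
          real (card \<Omega>') \<le> exp (\<delta> * (real n)\<^sup>2)"
      using sparse_covering[OF F \<epsilon> \<delta>, of r] by blast
    \<comment> \<open>Half of the radius is granted to the entries outside the supports; the rest is
      left for the rounding in the cover.\<close>
    have \<epsilon>2: "0 < \<epsilon> / 2" using \<epsilon> by simp
    have "\<exists>\<O>\<in>law_neighbourhoods ?K (nc_law A ?K ?X).
        \<forall>\<^sub>F n in U. \<forall>Z\<in>microstates n ?K ?R \<O>. sparse_tuple n F c (\<epsilon> / 2) (\<lambda>i. Z (Inl i))"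
    proof (rule sparse_neighbourhood[OF assms(1,3) _ _ _ gen F(1) FK c \<epsilon>2])
      show "conjugate_embeddings A (QQ U) \<alpha> \<beta>" if "embedding A (QQ U) \<alpha>" "embedding A (QQ U) \<beta>" for \<alpha> \<beta>
        using that by (rule assms(4))
    qed (use XK RK in blast)+
    then obtain \<O> where \<O>: "\<O> \<in> law_neighbourhoods ?K (nc_law A ?K ?X)"
      and sparse: "\<forall>\<^sub>F n in U. \<forall>Z\<in>microstates n ?K ?R \<O>. sparse_tuple n F c (\<epsilon> / 2) (\<lambda>i. Z (Inl i))"
      by blast
    have "\<forall>\<^sub>F n in U. n \<ge> 1" by (rule free_ultrafilter_ge[OF assms(1)])
    with sparse have le: "\<forall>\<^sub>F n in U. ?f \<O> n \<le> ereal \<delta>"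
    proof eventually_elim
      case (elim n)
      then have n: "0 < n" by simp
      let ?\<Omega> = "(\<lambda>Z. \<lambda>i\<in>I. Z (Inl i)) ` microstates n ?K ?R \<O>"
      have "\<exists>\<Omega>'. \<Omega>' \<subseteq> (\<Pi>\<^sub>E i\<in>I. carrier_mat n n) \<and> finite \<Omega>' \<and> orbital_cover n F \<epsilon> ?\<Omega> \<Omega>' \<and>
          real (card \<Omega>') \<le> exp (\<delta> * (real n)\<^sup>2)"
      proof (rule cover[OF n])
        fix W assume "W \<in> ?\<Omega>"
        then obtain Z where Z: "Z \<in> microstates n ?K ?R \<O>" "W = (\<lambda>i\<in>I. Z (Inl i))" by blast
        have "sparse_tuple n F c (\<epsilon> / 2) W = sparse_tuple n F c (\<epsilon> / 2) (\<lambda>i. Z (Inl i))"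
          by (rule sparse_tuple_cong) (use F(2) in \<open>auto simp: Z(2)\<close>)
        then show "sparse_tuple n F c (\<epsilon> / 2) W" using elim(1) Z(1) by blast
        fix i assume "i \<in> F"
        then have i: "i \<in> I" "Inl i \<in> ?K" using F(2) by auto
        have "Z (Inl i) \<in> {B \<in> carrier_mat n n. operator_norm B \<le> ?R (Inl i)}"
          using Z(1) i(2) unfolding microstates_def by (intro PiE_mem[where S = ?K and T = "\<lambda>k. {B \<in> carrier_mat n n. operator_norm B \<le> ?R k}"]) auto
        then show "W i \<in> carrier_mat n n \<and> operator_norm (W i) \<le> r i" using i(1) by (simp add: Z(2))
      qed
      then obtain \<Omega>' where \<Omega>': "\<Omega>' \<subseteq> (\<Pi>\<^sub>E i\<in>I. carrier_mat n n)" "finite \<Omega>'" "orbital_cover n F \<epsilon> ?\<Omega> \<Omega>'"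
        "real (card \<Omega>') \<le> exp (\<delta> * (real n)\<^sup>2)" by blast
      have "orbital_covering_number n I F \<epsilon> ?\<Omega> \<le> enat (card \<Omega>')"
        unfolding orbital_covering_number_def using \<Omega>'(1-3) by (intro INF_lower) blast
      then have "log_enat (orbital_covering_number n I F \<epsilon> ?\<Omega>) \<le> ereal (\<delta> * (real n)\<^sup>2)" using \<Omega>'(4) by (rule log_enat_le)
      then have "?f \<O> n \<le> ereal (1 / (real n)\<^sup>2) * ereal (\<delta> * (real n)\<^sup>2)" by (rule ereal_mult_left_mono) simp
      also have "\<dots> = ereal \<delta>" using n by simp
      finally show ?case .
    qed
    \<comment> \<open>\<open>Lim\<close> is a description, so its value is known only once
      convergence is: the extended reals are compact and \<open>U\<close> is an ultrafilter.\<close>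
    obtain l where l: "(?f \<O> \<longlongrightarrow> l) U"
      using ultrafilter_compact_limit[OF assms(1) compact_UNIV, of "?f \<O>"] by blast
    have "Lim U (?f \<O>) = l" by (rule tendsto_Lim[OF free_ultrafilter_bot[OF assms(1)] l])
    also have "l \<le> ereal \<delta>" by (rule tendsto_upperbound[OF l le free_ultrafilter_bot[OF assms(1)]])
    finally have "Lim U (?f \<O>) \<le> 0 + ereal \<delta>" by simp
    with \<O> show "(INF \<O>\<in>law_neighbourhoods ?K (nc_law A ?K ?X). Lim U (?f \<O>)) \<le> 0 + ereal \<delta>"
      by (rule INF_lower2)
  qed
qed

end
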